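(* Assume the setting and notation of the context, and let $\delta\in(0,1]$, $q>1$. Suppose: (i) $\sup_{s\in\mathcal X}G(s,s)=:\gamma^2<\infty$ (a.s. with respect to any probability measure on $\mathcal X$); (ii) $\sup_{m\in\mathcal P}K(m,m)=:\kappa^2<\infty$ ($\rho_\mu$-a.s.); (iii) for some $\alpha\in(0,1]$, $L>0$: $\|K_{m_1}-K_{m_2}\|_{\mathcal H_K}\le L\|m_1-m_2\|_{\mathcal H_G}^{\alpha}$ for all $m_1,m_2\in\mathcal P$; (iv) $f_\rho=L_K^r h_\rho$ with $h_\rho\in L^2(\mathcal P,\rho_\mu)$, $\|h_\rho\|_{L^2}\le R<\infty$, where $0<r\le\frac12$; (v) for some $\nu\in(0,1]$, $c_\nu<\infty$: $\mathcal N(\lambda)\le c_\nu\lambda^{-\nu}$, and $2r+\nu\le1$; (vi) with $\lambda=(\eta_nT_n)^{-1}$, $n\ge \frac{32\kappa^2\log(4/\delta)}{\lambda}\log\big(e\,\mathcal N(\lambda)(1+\frac{\lambda}{\|L_K\|})\big)$, and $\eta_n<\frac1{4\kappa^2}$. Let $\eta_0<\frac1{4\kappa^2}$ and choose the second-stage sample size $$N=N_n\ge \Big(\frac{R^2n}{M^2\log^q(n)}\Big)^{\frac{3-2r}{\alpha}}.$$ Then, for any $n$ sufficiently large, with probability at least $1-\delta$ with respect to the data $D$, $$\mathbb E_{\hat D|D}\big[\|S_K\bar{\hat h}_{T_n}-f_\rho\|_{L^2}\big]\le C\log(6/\delta)\,R\Big(\frac{M^2\log^q(n)}{R^2n}\Big)^{r},$$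 where $C<\infty$ is a constant not depending on $n$ or $N$, for tail-averaged mini-batch SGD with batch size $b_n$, step size $\eta_n$ and $T_n$ iterations given by each of the following choices: 1. $b_n=1$, $\eta_n=\big(\frac{M^2\log^q(n)}{R^2n}\big)^{2r+\nu}$, $T_n=\big(\frac{R^2n}{M^2\log^q(n)}\big)^{2r+\nu+1}$; 2. $b_n=\big(\frac{R^2n}{M^2\log^q(n)}\big)^{2r+\nu}$, $\eta_n=\eta_0$, $T_n=\frac{R^2n}{M^2\log^q(n)}$; 3. $b_n=\frac{R^2n}{M^2\log^q(n)}$, $\eta_n=\eta_0$, $T_n=\frac{R^2n}{M^2\log^q(n)}$.
   Context: Setting. $\mathcal X$ is a compact topological space, $\mathcal M^+(\mathcal X)$ the Borel probability measures on $\mathcal X$ (weak topology), $\mathcal Y\subseteq[-M,M]$ with $M>0$. $G$ is a Mercer kernel on $\mathcal X$ (symmetric, continuous, positive semidefinite) with reproducing kernel Hilbert space (RKHS) $\mathcal H_G$; the mean embedding of $x\in\mathcal M^+(\mathcal X)$ is $\mu_x=\int_{\mathcal X}G(s,\cdot)\,dx(s)\in\mathcal H_G$; $\mathcal P:=\{\mu_x:x\in\mathcal M^+(\mathcal X)\}\subset\mathcal H_G$. $K$ is a reproducing kernel on $\mathcal P$ with RKHS $\mathcal H_K$; $K_m:=K(m,\cdot)$. $\rho$ is a probability measure on $\mathcal P\times\mathcal Y$ with marginal $\rho_\mu$ on $\mathcal P$; $L^2=L^2(\mathcal P,\rho_\mu)$; $f_\rho(m)=\int_{\mathcal Y}y\,d\rho(y|m)$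 is the regression function. $S_K:\mathcal H_K\to L^2$ is the inclusion, $L_K=S_KS_K^*$ (the kernel integral operator on $L^2$; powers via spectral calculus), and $\mathcal N(\lambda)=\mathrm{trace}(L_K(L_K+\lambda)^{-1})$ for $\lambda>0$. Data. First stage: $(x_j,y_j)$, $j=1,\dots,n$, i.i.d. on $\mathcal M^+(\mathcal X)\times\mathcal Y$ such that $(\mu_{x_j},y_j)\sim\rho$; $D=\{(\mu_{x_j},y_j)\}_{j=1}^n$. Second stage: for each $j$, $x_{j,1},\dots,x_{j,N}$ are i.i.d. from $x_j$; $\mu_{\hat x_j}=\frac1N\sum_{i=1}^NG(x_{j,i},\cdot)$; $\hat D=\{(\mu_{\hat x_j},y_j)\}_{j=1}^n$. $\mathbb E_{\hat D|D}$ denotes the conditional expectation with respect to the sample $\hat D$ given $D$. Algorithm (second-stage tail-averaged SGD with batch size $b\in\{1,\dots,n\}$, step size $\eta>0$). With $j_1,\dots,j_{bT}$ i.i.d. uniform on $\{1,\dots,n\}$, starting with $\hat h_0\in\mathcal H_K$, $\hat h_{t+1}=\hat h_t-\eta\frac1b\sum_{i=bt+1}^{b(t+1)}(\hat h_t(\mu_{\hat x_{j_i}})-y_{j_i})K_{\mu_{\hat x_{j_i}}}$; $\ \bar{\hat h}_T=\frac2T\sum_{t=\lfloor T/2\rfloor+1}^T\hat h_t$. *)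

theory Defs
  imports "HOL-Probability.Probability"
begin

section \<open>Reproducing kernel Hilbert spaces\<close>

text \<open>
  The RKHS of \<open>K\<close> on \<open>A\<close> is carried by a Hilbert space type; \<open>val f x\<close> is the value at \<open>x\<close> of the
  function represented by \<open>f\<close>. The second clause says that a vector is determined by its values
  on \<open>A\<close>, so that the type is, through \<open>val\<close>, a Hilbert space of functions on \<open>A\<close>; the third
  says that \<open>K x\<close> belongs to it and reproduces the value at \<open>x\<close>. Values of \<open>val f\<close> and \<open>K\<close>
  outside \<open>A\<close> are irrelevant.
\<close>

definition rkhs_on ::
    "'a set \<Rightarrow> ('a \<Rightarrow> 'a \<Rightarrow> real) \<Rightarrow> ('h::{real_inner,banach} \<Rightarrow> 'a \<Rightarrow> real) \<Rightarrow> bool" where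
  "rkhs_on A K val \<longleftrightarrow>
     (\<forall>x\<in>A. linear (\<lambda>f. val f x)) \<and>
     (\<forall>f. (\<forall>x\<in>A. val f x = 0) \<longrightarrow> f = 0) \<and>
     (\<forall>x\<in>A. \<exists>k. (\<forall>y\<in>A. val k y = K x y) \<and> (\<forall>f. f \<bullet> k = val f x))"

definition kernel_section ::
    "'a set \<Rightarrow> ('a \<Rightarrow> 'a \<Rightarrow> real) \<Rightarrow> ('h::{real_inner,banach} \<Rightarrow> 'a \<Rightarrow> real) \<Rightarrow> 'a \<Rightarrow> 'h" where
  "kernel_section A K val x = (THE k. \<forall>y\<in>A. val k y = K x y)"

definition mercer_kernel :: "('x::topological_space \<Rightarrow> 'x \<Rightarrow> real) \<Rightarrow> bool" where
  "mercer_kernel G \<longleftrightarrow>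
     (\<forall>s t. G s t = G t s) \<and>
     continuous_on UNIV (\<lambda>(s, t). G s t) \<and>
     (\<forall>S c. finite S \<longrightarrow> 0 \<le> (\<Sum>s\<in>S. \<Sum>t\<in>S. c s * c t * G s t))"


section \<open>Probability measures and mean embeddings\<close>

definition borel_probs :: "'x::topological_space measure set" where
  "borel_probs = {x. sets x = sets borel \<and> prob_space x}"

definition weak_topology :: "'x::topological_space measure topology" where
  "weak_topology = topology_generated_by
     {{x \<in> borel_probs. (\<integral>s. f s \<partial>x) \<in> U} | (f :: 'x \<Rightarrow> real) U.
        continuous_on UNIV f \<and> bounded (range f) \<and> open U}"

definition weak_borel :: "'x::topological_space measure measure" where
  "weak_borel = sigma borel_probs {U. openin weak_topology U}"

text \<open>
  The mean embedding is a Bochner integral, whence the class \<^class>\<open>second_countable_topology\<close>.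
  This is no restriction: the RKHS of a continuous kernel on a compact space is separable.
\<close>

definition mean_embedding ::
    "('x::topological_space \<Rightarrow> 'x \<Rightarrow> real) \<Rightarrow>
     ('g::{real_inner,banach,second_countable_topology} \<Rightarrow> 'x \<Rightarrow> real) \<Rightarrow> 'x measure \<Rightarrow> 'g" where
  "mean_embedding G val x = (\<integral>s. kernel_section UNIV G val s \<partial>x)"

definition mean_embeddings ::
    "('x::topological_space \<Rightarrow> 'x \<Rightarrow> real) \<Rightarrow>
     ('g::{real_inner,banach,second_countable_topology} \<Rightarrow> 'x \<Rightarrow> real) \<Rightarrow> 'g set" where
  "mean_embeddings G val = mean_embedding G val ` borel_probs"

definition empirical_embedding ::
    "('x \<Rightarrow> 'x \<Rightarrow> real) \<Rightarrow> ('g::{real_inner,banach} \<Rightarrow> 'x \<Rightarrow> real) \<Rightarrow> nat \<Rightarrow> (nat \<Rightarrow> 'x) \<Rightarrow> 'g" where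
  "empirical_embedding G val N s = (1 / real N) *\<^sub>R (\<Sum>i=1..N. kernel_section UNIV G val (s i))"


section \<open>Square-integrable functions and operators on them\<close>

text \<open>
  Elements of \<open>L\<^sup>2(\<mu>)\<close> are represented by functions; all notions below are invariant under
  changes on null sets. Operators are maps on representatives.
\<close>

definition L2 :: "'a measure \<Rightarrow> ('a \<Rightarrow> real) set" where
  "L2 \<mu> = {f \<in> borel_measurable \<mu>. integrable \<mu> (\<lambda>m. (f m)\<^sup>2)}"

definition L2_inner :: "'a measure \<Rightarrow> ('a \<Rightarrow> real) \<Rightarrow> ('a \<Rightarrow> real) \<Rightarrow> real" where
  "L2_inner \<mu> f g = (\<integral>m. f m * g m \<partial>\<mu>)"

definition L2_norm :: "'a measure \<Rightarrow> ('a \<Rightarrow> real) \<Rightarrow> real" where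
  "L2_norm \<mu> f = sqrt (\<integral>m. (f m)\<^sup>2 \<partial>\<mu>)"

definition L2_op_norm :: "'a measure \<Rightarrow> (('a \<Rightarrow> real) \<Rightarrow> ('a \<Rightarrow> real)) \<Rightarrow> real" where
  "L2_op_norm \<mu> A = Sup {L2_norm \<mu> (A f) | f. f \<in> L2 \<mu> \<and> L2_norm \<mu> f \<le> 1}"

text \<open>
  The inclusion \<open>S\<^sub>K\<close> of the RKHS into \<open>L\<^sup>2(\<mu>)\<close> is \<open>val\<close>. Its adjoint is characterised by
  \<open>\<langle>S\<^sub>K\<^sup>* f, h\<rangle> = \<langle>f, S\<^sub>K h\<rangle>\<close>, and \<open>L\<^sub>K = S\<^sub>K S\<^sub>K\<^sup>*\<close>.
\<close>

definition inclusion_adj ::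
    "'a measure \<Rightarrow> ('h::{real_inner,banach} \<Rightarrow> 'a \<Rightarrow> real) \<Rightarrow> ('a \<Rightarrow> real) \<Rightarrow> 'h" where
  "inclusion_adj \<mu> val f = (THE g. \<forall>h. g \<bullet> h = L2_inner \<mu> f (val h))"

definition kernel_op ::
    "'a measure \<Rightarrow> ('h::{real_inner,banach} \<Rightarrow> 'a \<Rightarrow> real) \<Rightarrow> ('a \<Rightarrow> real) \<Rightarrow> ('a \<Rightarrow> real)" where
  "kernel_op \<mu> val f = val (inclusion_adj \<mu> val f)"

text \<open>
  Spectral decomposition \<open>A = \<Sum>\<^sub>i \<sigma>\<^sub>i \<langle>\<cdot>, e\<^sub>i\<rangle> e\<^sub>i\<close> of a compact positive self-adjoint operator
  (\<open>L\<^sub>K\<close> is one when the kernel is bounded). Indices with \<open>\<sigma> i = 0\<close> are padding, so that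
  operators of finite rank are covered.
\<close>

definition spectral_system ::
    "'a measure \<Rightarrow> (('a \<Rightarrow> real) \<Rightarrow> ('a \<Rightarrow> real)) \<Rightarrow> (nat \<Rightarrow> real) \<Rightarrow> (nat \<Rightarrow> 'a \<Rightarrow> real) \<Rightarrow> bool" where
  "spectral_system \<mu> A \<sigma> e \<longleftrightarrow>
     (\<forall>i. \<sigma> i \<ge> 0 \<and> e i \<in> L2 \<mu>) \<and>
     (\<forall>i j. \<sigma> i > 0 \<longrightarrow> \<sigma> j > 0 \<longrightarrow> L2_inner \<mu> (e i) (e j) = (if i = j then 1 else 0)) \<and>
     (\<forall>f\<in>L2 \<mu>. (\<lambda>k. L2_norm \<mu> (\<lambda>m. A f m - (\<Sum>i<k. \<sigma> i * L2_inner \<mu> f (e i) * e i m)))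
        \<longlonglongrightarrow> 0)"

text \<open>
  \<open>g = A\<^sup>r h\<close> in \<open>L\<^sup>2(\<mu>)\<close>, for an exponent \<open>r > 0\<close> (so that the kernel of \<open>A\<close> contributes nothing;
  recall \<open>0 powr r = 0\<close>). The value does not depend on the spectral system.
\<close>

definition is_op_power ::
    "'a measure \<Rightarrow> (('a \<Rightarrow> real) \<Rightarrow> ('a \<Rightarrow> real)) \<Rightarrow> real \<Rightarrow> ('a \<Rightarrow> real) \<Rightarrow> ('a \<Rightarrow> real) \<Rightarrow> bool" where
  "is_op_power \<mu> A r h g \<longleftrightarrow> g \<in> L2 \<mu> \<and>
     (\<exists>\<sigma> e. spectral_system \<mu> A \<sigma> e \<and>
        (\<lambda>k. L2_norm \<mu> (\<lambda>m. g m - (\<Sum>i<k. \<sigma> i powr r * L2_inner \<mu> h (e i) * e i m)))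
          \<longlonglongrightarrow> 0)"

text \<open>
  Orthonormal bases indexed by a set of natural numbers suffice below: \<open>L\<^sup>2\<close> of a finite Borel
  measure on a subset of a separable metric space is separable.
\<close>

definition L2_onb :: "'a measure \<Rightarrow> nat set \<Rightarrow> (nat \<Rightarrow> 'a \<Rightarrow> real) \<Rightarrow> bool" where
  "L2_onb \<mu> I e \<longleftrightarrow>
     (\<forall>i\<in>I. e i \<in> L2 \<mu>) \<and>
     (\<forall>i\<in>I. \<forall>j\<in>I. L2_inner \<mu> (e i) (e j) = (if i = j then 1 else 0)) \<and>
     (\<forall>f\<in>L2 \<mu>. (\<forall>i\<in>I. L2_inner \<mu> f (e i) = 0) \<longrightarrow> L2_norm \<mu> f = 0)"

definition L2_trace :: "'a measure \<Rightarrow> (('a \<Rightarrow> real) \<Rightarrow> ('a \<Rightarrow> real)) \<Rightarrow> real" where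
  "L2_trace \<mu> A =
     (THE t. \<forall>I e. L2_onb \<mu> I e \<longrightarrow> ((\<lambda>i. L2_inner \<mu> (A (e i)) (e i)) has_sum t) I)"

definition shifted_inverse ::
    "'a measure \<Rightarrow> (('a \<Rightarrow> real) \<Rightarrow> ('a \<Rightarrow> real)) \<Rightarrow> real \<Rightarrow> ('a \<Rightarrow> real) \<Rightarrow> ('a \<Rightarrow> real)" where
  "shifted_inverse \<mu> A l f = (SOME g. g \<in> L2 \<mu> \<and> (AE m in \<mu>. A g m + l * g m = f m))"

definition effective_dim ::
    "'a measure \<Rightarrow> ('h::{real_inner,banach} \<Rightarrow> 'a \<Rightarrow> real) \<Rightarrow> real \<Rightarrow> real" where
  "effective_dim \<mu> val l =
     L2_trace \<mu> (\<lambda>f. kernel_op \<mu> val (shifted_inverse \<mu> (kernel_op \<mu> val) l f))"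


section \<open>The regression problem\<close>

definition regular_conditional ::
    "('a \<times> real) measure \<Rightarrow> 'a measure \<Rightarrow> real measure \<Rightarrow> ('a \<Rightarrow> real measure) \<Rightarrow> bool" where
  "regular_conditional \<rho> \<rho>\<mu> Y c \<longleftrightarrow>
     c \<in> \<rho>\<mu> \<rightarrow>\<^sub>M prob_algebra Y \<and>
     (\<forall>A\<in>sets \<rho>\<mu>. \<forall>B\<in>sets Y. emeasure \<rho> (A \<times> B) = (\<integral>\<^sup>+m\<in>A. emeasure (c m) B \<partial>\<rho>\<mu>))"

definition regression_function :: "('a \<Rightarrow> real measure) \<Rightarrow> 'a \<Rightarrow> real" where
  "regression_function c m = (\<integral>y. y \<partial>c m)"


section \<open>Two-stage sampling\<close>

text \<open>
  \<open>x j\<close>, \<open>y j\<close> are the first-stage observations with common law \<open>Q\<close>, \<open>s j i\<close> the second-stage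
  ones, and \<open>J i\<close> (\<open>i = 1, \<dots>, k\<close>) the indices drawn by the algorithm. The fourth clause
  says that, given the first stage, the \<open>s j i\<close> are independent with respective laws \<open>x j\<close>. The
  indices are independent of both stages.
\<close>

definition two_stage_sample ::
    "'w measure \<Rightarrow> ('x::topological_space measure \<times> real) measure \<Rightarrow> nat \<Rightarrow> nat \<Rightarrow> nat \<Rightarrow>
     (nat \<Rightarrow> 'w \<Rightarrow> 'x measure) \<Rightarrow> (nat \<Rightarrow> 'w \<Rightarrow> real) \<Rightarrow> (nat \<Rightarrow> nat \<Rightarrow> 'w \<Rightarrow> 'x) \<Rightarrow>
     (nat \<Rightarrow> 'w \<Rightarrow> nat) \<Rightarrow> bool" where
  "two_stage_sample \<Omega> Q n N k x y s J \<longleftrightarrow>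
     prob_space \<Omega> \<and>
     prob_space.indep_vars \<Omega> (\<lambda>_. Q) (\<lambda>j \<omega>. (x j \<omega>, y j \<omega>)) {1..n} \<and>
     (\<forall>j\<in>{1..n}. distr \<Omega> Q (\<lambda>\<omega>. (x j \<omega>, y j \<omega>)) = Q \<and> (\<forall>i\<in>{1..N}. s j i \<in> \<Omega> \<rightarrow>\<^sub>M borel)) \<and>
     (\<forall>A. (\<forall>j i. A j i \<in> sets borel) \<longrightarrow>
        (AE \<omega> in \<Omega>.
           real_cond_exp \<Omega>
             (vimage_algebra (space \<Omega>) (\<lambda>\<omega>. \<lambda>j\<in>{1..n}. (x j \<omega>, y j \<omega>)) (\<Pi>\<^sub>M j\<in>{1..n}. Q))
             (indicator {\<omega> \<in> space \<Omega>. \<forall>j\<in>{1..n}. \<forall>i\<in>{1..N}. s j i \<omega> \<in> A j i}) \<omega>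
           = (\<Prod>j=1..n. \<Prod>i=1..N. measure (x j \<omega>) (A j i)))) \<and>
     prob_space.indep_vars \<Omega> (\<lambda>_. count_space {1..n}) J {1..k} \<and>
     (\<forall>i\<in>{1..k}. distr \<Omega> (count_space {1..n}) (J i) = uniform_count_measure {1..n}) \<and>
     prob_space.indep_set \<Omega>
       (sets (vimage_algebra (space \<Omega>)
          (\<lambda>\<omega>. (\<lambda>j\<in>{1..n}. (x j \<omega>, y j \<omega>), \<lambda>p\<in>{1..n} \<times> {1..N}. s (fst p) (snd p) \<omega>))
          ((\<Pi>\<^sub>M j\<in>{1..n}. Q) \<Otimes>\<^sub>M (\<Pi>\<^sub>M p\<in>{1..n} \<times> {1..N}. borel))))
       (sets (vimage_algebra (space \<Omega>) (\<lambda>\<omega>. \<lambda>i\<in>{1..k}. J i \<omega>) (\<Pi>\<^sub>M i\<in>{1..k}. count_space {1..n})))"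

text \<open>
  The \<open>\<sigma>\<close>-algebra generated by \<open>D = ((\<mu>\<^bsub>x\<^sub>j\<^esub>, y\<^sub>j))\<^sub>j\<close>; \<open>\<rho>\<close> supplies the measurable structure.
\<close>

definition data_algebra ::
    "'w measure \<Rightarrow> ('g \<times> real) measure \<Rightarrow> ('x measure \<Rightarrow> 'g) \<Rightarrow> nat \<Rightarrow>
     (nat \<Rightarrow> 'w \<Rightarrow> 'x measure) \<Rightarrow> (nat \<Rightarrow> 'w \<Rightarrow> real) \<Rightarrow> 'w measure" where
  "data_algebra \<Omega> \<rho> emb n x y =
     vimage_algebra (space \<Omega>) (\<lambda>\<omega>. \<lambda>j\<in>{1..n}. (emb (x j \<omega>), y j \<omega>)) (\<Pi>\<^sub>M j\<in>{1..n}. \<rho>)"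


section \<open>Tail-averaged mini-batch stochastic gradient descent\<close>

primrec sgd ::
    "'g set \<Rightarrow> ('g \<Rightarrow> 'g \<Rightarrow> real) \<Rightarrow> ('k::{real_inner,banach} \<Rightarrow> 'g \<Rightarrow> real) \<Rightarrow> nat \<Rightarrow> real \<Rightarrow>
     (nat \<Rightarrow> 'g) \<Rightarrow> (nat \<Rightarrow> real) \<Rightarrow> (nat \<Rightarrow> nat) \<Rightarrow> 'k \<Rightarrow> nat \<Rightarrow> 'k" where
  "sgd P K val b \<eta> m y J h\<^sub>0 0 = h\<^sub>0"
| "sgd P K val b \<eta> m y J h\<^sub>0 (Suc t) =
     sgd P K val b \<eta> m y J h\<^sub>0 t -
     (\<eta> * (1 / real b)) *\<^sub>R (\<Sum>i = b * t + 1 .. b * (t + 1).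
        (val (sgd P K val b \<eta> m y J h\<^sub>0 t) (m (J i)) - y (J i)) *\<^sub>R kernel_section P K val (m (J i)))"

definition tail_average :: "nat \<Rightarrow> (nat \<Rightarrow> 'k::real_vector) \<Rightarrow> 'k" where
  "tail_average T h = (2 / real T) *\<^sub>R (\<Sum>t = T div 2 + 1 .. T. h t)"

text \<open>
  Batch sizes and numbers of iterations prescribed by real expressions are understood up to
  rounding, in either direction.
\<close>

definition rounds :: "nat \<Rightarrow> real \<Rightarrow> bool" where
  "rounds k z \<longleftrightarrow> \<bar>real k - z\<bar> < 1"

definition scaled_size :: "real \<Rightarrow> real \<Rightarrow> real \<Rightarrow> nat \<Rightarrow> real" where
  "scaled_size R M q n = R\<^sup>2 * real n / (M\<^sup>2 * ln (real n) powr q)"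

definition inv_scaled_size :: "real \<Rightarrow> real \<Rightarrow> real \<Rightarrow> nat \<Rightarrow> real" where
  "inv_scaled_size R M q n = M\<^sup>2 * ln (real n) powr q / (R\<^sup>2 * real n)"

definition tuning ::
    "real \<Rightarrow> real \<Rightarrow> real \<Rightarrow> real \<Rightarrow> real \<Rightarrow> real \<Rightarrow> nat \<Rightarrow> nat \<Rightarrow> real \<Rightarrow> nat \<Rightarrow> bool" where
  "tuning R M q r \<nu> \<eta>\<^sub>0 n b \<eta> T \<longleftrightarrow>
     (b = 1 \<and> \<eta> = inv_scaled_size R M q n powr (2 * r + \<nu>) \<and>
        rounds T (scaled_size R M q n powr (2 * r + \<nu> + 1))) \<or>
     (rounds b (scaled_size R M q n powr (2 * r + \<nu>)) \<and> \<eta> = \<eta>\<^sub>0 \<and>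
        rounds T (scaled_size R M q n)) \<or>
     (rounds b (scaled_size R M q n) \<and> \<eta> = \<eta>\<^sub>0 \<and> rounds T (scaled_size R M q n))"

end

theory Submission
  imports Defs
begin

text \<open>
 Write \<open>u\<close> for the inverse scaled sample size and \<open>\<theta> = 1/(\<eta> T)\<close>, which is of order \<open>u\<close>. By Markov's
 inequality, applied to the conditional expectation given the data, it is enough to bound the
 unconditional expectation of the excess by \<open>\<delta> u\<^sup>r\<close>. As \<open>2r < 1\<close>, the source condition gives approximation
 error \<open>o(\<theta>\<^bsup>2r\<^esup>)\<close>, and the logarithm in \<open>u\<close> makes the variance \<open>o(u\<^bsup>2r\<^esup>)\<close>, so the constant absorbs \<open>\<delta>\<close>.

 The first-stage iterates split into a noise-free part, whose test error is compared with its
 training error by exchanging the test point with a sample point and using stability of SGD, and a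
 noise part, which is linear in the centred labels and is bounded through leverage scores; the mean
 leverage is at most the effective dimension because \<open>T \<mapsto> trace T(T + \<theta>)\<^sup>-\<^sup>1\<close> is concave. The second stage
 perturbs the features. Outside an event of probability exponentially small in \<open>N\<close> the perturbed
 features are still bounded by a multiple of \<open>\<kappa>\<close> and SGD is stable in mean square; on that event the
 iterates grow at most exponentially in \<open>1/\<theta>\<close>, which the choice of \<open>N\<close> compensates.
\<close>

section \<open>Averages over index sequences\<close>

text \<open>Markov's inequality costs a factor 1/\<delta>, while the constant is fixed before
  \<delta>; bounds of the right order are therefore not enough, and every term has to be made small
  compared with the target. The obstacle of the second stage is that K(m,m) \<le> \<kappa>^2 holds
  only almost everywhere, whereas empirical embeddings may lie in a null set. There only a cruder
  bound B on the features is at hand, for which a step of SGD need not be a contraction. The Hoelder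
  condition carries the bound \<kappa> over to empirical embeddings close to the true ones, up to a
  constant factor, for which the step size bound 1/(4 \<kappa>^2) leaves room. Concentration of the
  empirical operator is replaced by exchangeability of a test point and a sample point, which costs
  absolute constants as soon as \<kappa>^2 \<le> n \<theta>; first-stage quantities are then
  controlled in expectation only. The indices drawn by the algorithm enter as averages over finitely
  many index sequences, so that martingale arguments become statements about finite sums.\<close>

abbreviation avg :: "nat => (nat => real) => real" where
 "avg n F \<equiv> (1 / real n) * (\<Sum>l=1..n. F l)"

lemmas bochner_sum = Bochner_Integration.integral_sum
lemmas bochner_cong = Bochner_Integration.integral_cong

text \<open>Extensional functions keep this set finite, and the restriction of the random indices to
  \<open>{1..k}\<close> is an element of it.\<close>

definition seqs :: "nat => nat => (nat => nat) set" where
 "seqs n k = PiE {1..k} (%_. {1..n})"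

definition av :: "nat => nat => ((nat => nat) => real) => real" where
 "av n k F = (\<Sum>J\<in>seqs n k. F J) / real n ^ k"

lemma finite_seqs [simp]: "finite (seqs n k)"
 unfolding seqs_def by (intro finite_PiE) auto

lemma card_seqs: "card (seqs n k) = n ^ k"
 unfolding seqs_def by (subst card_PiE) auto

lemma mem_seqs_upd:
 "J \<in> seqs n k ==> i \<in> {1..k} ==> a \<in> {1..n} ==> J(i := a) \<in> seqs n k" unfolding seqs_def by (auto simp: PiE_iff extensional_def)

lemma seqs_in: "J \<in> seqs n k ==> i \<in> {1..k} ==> J i \<in> {1..n}"
 unfolding seqs_def by auto

lemma av_const: "n >= 1 ==> av n k (%_. c) = c"
 by (simp add: av_def card_seqs)

lemma av_add: "av n k (%J. F J + G J) = av n k F + av n k G"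
 by (simp add: av_def sum.distrib add_divide_distrib)

lemma av_diff: "av n k (%J. F J - G J) = av n k F - av n k G"
 by (simp add: av_def sum_subtractf diff_divide_distrib)

lemma av_cmult: "av n k (%J. c * F J) = c * av n k F"
 by (simp add: av_def sum_distrib_left)

lemma av_sum: "av n k (%J. \<Sum>i\<in>I. F i J) = (\<Sum>i\<in>I. av n k (F i))"
 by (simp add: av_def sum.swap[of _ I] sum_divide_distrib)

lemma av_mono:
 "(!!J. J \<in> seqs n k ==> F J <= G J) ==> av n k F <= av n k G" by (auto simp: av_def intro!: divide_right_mono sum_mono)

lemma av_cong:
 "(!!J. J \<in> seqs n k ==> F J = G J) ==> av n k F = av n k G" by (auto simp: av_def)

lemma av_nonneg:
 "(!!J. J \<in> seqs n k ==> 0 <= F J) ==> 0 <= av n k F" by (auto simp: av_def intro!: divide_nonneg_nonneg sum_nonneg)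

text \<open>The map (J, a) to (J(i := a), J i) is an involution of
  \<open>seqs n k \<times> {1..n}\<close>. It trades the i-th entry for a fresh index, and G does
  not notice because it ignores that entry.\<close>

lemma av_resample:
 assumes i: "i \<in> {1..k}"
  and inv: "!!J a l. J \<in> seqs n k ==> a \<in> {1..n} ==> G (J(i := a)) l = G J l"
 shows "av n k (%J. G J (J i)) = av n k (%J. avg n (%l. G J l))"
proof (cases "n = 0")
 case True
 thus ?thesis using i by (auto simp: av_def)
next
 case False
 let ?S = "seqs n k"
 have "(\<Sum>J\<in>?S. \<Sum>l=1..n. G J l) = (\<Sum>p\<in>?S \<times> {1..n}. G (fst p) (snd p))" by (simp add: sum.cartesian_product split_beta)
 also have "... = (\<Sum>p\<in>?S \<times> {1..n}. G (fst p) (fst p i))" by (rule sum.reindex_bij_witness[where i = "%p. ((fst p)(i := snd p), fst p i)"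
     and j = "%p. ((fst p)(i := snd p), fst p i)"])
   (use i in \<open>auto simp: inv fun_upd_idem mem_seqs_upd seqs_in[unfolded atLeastAtMost_iff] simp del: One_nat_def\<close>)
 also have "... = real n * (\<Sum>J\<in>?S. G J (J i))" by (subst sum.cartesian_product[where g = "%J _. G J (J i)", symmetric, unfolded split_beta])
   (simp add: sum_distrib_left)
 finally have "(\<Sum>J\<in>?S. G J (J i)) = (1 / real n) * (\<Sum>J\<in>?S. \<Sum>l=1..n. G J l)" using False by simp
 thus ?thesis by (simp add: av_def sum_distrib_left)
qed

lemma block_card: "card {b * t + 1..b * (t + 1)} = (b::nat)"
 by simp

lemma block_subset: "t < T ==> {b * t + 1..b * (t + 1)} \<subseteq> {1..b * T :: nat}"
 using mult_le_mono2[of "t + 1" T b] by auto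

text \<open>Plays the role of measurability with respect to the indices drawn before batch t.
  Iterate number t has this property, having read only the first b t indices.\<close>

definition block_free :: "nat => nat => nat => nat => ((nat => nat) => 'c) => bool" where
 "block_free n b T t G \<longleftrightarrow> (\<forall>J\<in>seqs n (b * T). \<forall>i\<in>{b * t + 1..b * (t + 1)}.
  \<forall>a\<in>{1..n}. G (J(i := a)) = G J)"

lemma block_freeI:
 assumes "!!J J'. (!!i. i \<in> {1..b * t} ==> J i = J' i) ==> G J = G J'"
 shows "block_free n b T t G"
 unfolding block_free_def
proof (intro ballI, goal_cases)
 case (1 J i a)
 hence "j \<noteq> i" if "j \<in> {1..b * t}" for j using that by simp
 thus ?case by (intro assms) simp
qed

lemma av_block:
 fixes G :: "(nat => nat) => nat => real"
 assumes "t < T" "b >= 1" and free: "block_free n b T t G"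
 shows "av n (b * T) (%J. (1 / real b) * (\<Sum>i = b * t + 1..b * (t + 1). G J (J i)))
  = av n (b * T) (%J. avg n (%l. G J l))" (is "_ = ?R")
proof -
 have "av n (b * T) (%J. G J (J i)) = ?R" if "i \<in> {b * t + 1..b * (t + 1)}" for i
  using block_subset[OF assms(1), of b] that free unfolding block_free_def by (intro av_resample) auto
 hence "(\<Sum>i = b * t + 1..b * (t + 1). av n (b * T) (%J. G J (J i)))
  = real b * av n (b * T) (%J. avg n (%l. G J l))"
  by (subst sum.cong[OF refl]) (assumption, simp only: sum_constant block_card)
 thus ?thesis using assms(2) by (simp only: av_cmult av_sum) simp
qed

lemma scaled_sum_square:
 fixes V :: "'i => 'k::real_inner"
 shows "(norm ((1 / c) *\<^sub>R (\<Sum>i\<in>B. V i)))^2 = (1 / c^2) * (\<Sum>i\<in>B. \<Sum>j\<in>B. V i \<bullet> V j)"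
proof -
 have "(norm (\<Sum>i\<in>B. V i))^2 = (\<Sum>i\<in>B. \<Sum>j\<in>B. V i \<bullet> V j)" unfolding power2_norm_eq_inner inner_sum_left inner_sum_right by (rule sum.swap)
 thus ?thesis by (simp add: power_mult_distrib power_divide)
qed

text \<open>The centred terms sum to zero over l, so resampling one of two different positions
  annihilates the cross terms. Of b^2 products only b remain, and centring does not raise the second
  moment.\<close>

lemma av_block_variance:
 fixes G :: "(nat => nat) => nat => 'k::real_inner"
 assumes "t < T" "b >= 1" "n >= 1" and free: "block_free n b T t G"
 defines "mean \<equiv> %J. (1 / real n) *\<^sub>R (\<Sum>l=1..n. G J l)"
 shows "av n (b * T) (%J. (norm ((1 / real b) *\<^sub>R (\<Sum>i = b * t + 1..b * (t + 1). G J (J i)) - mean J))^2)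
  <= (1 / real b) * av n (b * T) (%J. avg n (%l. (norm (G J l))^2))"
proof -
 let ?X = "%G. %J. avg n (%l. (norm (G J l))^2)"
 let ?U = "%V i. %J. V J (J i) \<bullet> V J (J i)"
 let ?V = "%V i j. %J. V J (J i) \<bullet> V J (J j)"
 let ?B = "{b * t + 1..b * (t + 1)}"
 let ?av = "av n (b * T)"
 define V where "V = (%J l. G J l - mean J)"
 have sub: "?B \<subseteq> {1..b * T}" by (rule block_subset[OF assms(1)])
 have inv: "G (J(i := a)) l = G J l" "mean (J(i := a)) = mean J" if "J \<in> seqs n (b * T)" "i \<in> ?B" "a \<in> {1..n}" for J i a l
  using free that unfolding block_free_def mean_def by auto
 have invV: "V (J(i := a)) l = V J l"  if "J \<in> seqs n (b * T)" "i \<in> ?B" "a \<in> {1..n}" for J i a l using inv[OF that] by (simp add: V_def)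
 have V0: "(\<Sum>l=1..n. V J l) = 0" for J using assms(3) by (simp add: V_def sum_subtractf mean_def sum_constant_scaleR)
 have cross: "?av (?V V i j) = 0" if "i \<in> ?B" "j \<in> ?B" "i \<noteq> j" for i j
 proof -
  have "?av (?V V i j)
   = ?av (%J. avg n (%l. V J l \<bullet> V J (J j)))"
   using that sub by (intro av_resample[where G = "%J l. V J l \<bullet> V J (J j)"]) (auto simp: invV)
  also have "... = ?av (%J. 0)" by (intro av_cong) (simp add: inner_sum_left[symmetric] V0 del: One_nat_def)
  finally show ?thesis using av_const[OF assms(3)] by simp
 qed
 have diag: "?av (?U V i) <= ?av (?X G)" if "i \<in> ?B" for i
 proof -
  have "?av (?U V i) = ?av (%J. avg n (%l. V J l \<bullet> V J l))"
   using that sub by (intro av_resample[where G = "%J l. V J l \<bullet> V J l"]) (auto simp: invV)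
  also have "... <= ?av (?X G)"
  proof (intro av_mono mult_left_mono, goal_cases)
   case (1 J)
   have "(\<Sum>l=1..n. V J l \<bullet> V J l)
    = (\<Sum>l=1..n. (norm (G J l))^2) - 2 * ((\<Sum>l=1..n. G J l) \<bullet> mean J) + n * (mean J \<bullet> mean J)"
    by (simp add: V_def inner_diff_left inner_diff_right sum.distrib sum_subtractf
      power2_norm_eq_inner inner_sum_left inner_sum_right inner_commute algebra_simps
      sum_distrib_left)
   also have "(\<Sum>l=1..n. G J l) = real n *\<^sub>R mean J" using assms(3) by (simp add: mean_def)
   also have "(\<Sum>l=1..n. (norm (G J l))^2) - 2 * (real n *\<^sub>R mean J \<bullet> mean J) + n * (mean J \<bullet> mean J)
    <= (\<Sum>l=1..n. (norm (G J l))^2)" by simp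
   finally show ?case .
  qed simp
  finally show ?thesis .
 qed
 have "(1 / real b) *\<^sub>R (\<Sum>i\<in>?B. G J (J i)) - mean J = (1 / real b) *\<^sub>R (\<Sum>i\<in>?B. V J (J i))" for J using assms(2)
  by (simp only: V_def sum_subtractf sum_constant_scaleR block_card scaleR_diff_right scaleR_scaleR)
   simp
 hence "?av (%J. (norm ((1 / real b) *\<^sub>R (\<Sum>i\<in>?B. G J (J i)) - mean J))^2)
  = ?av (%J. (1 / (real b)^2) * (\<Sum>i\<in>?B. \<Sum>j\<in>?B. V J (J i) \<bullet> V J (J j)))"
  by (simp only: scaled_sum_square)
 also have "... = (1 / (real b)^2) * (\<Sum>i\<in>?B. \<Sum>j\<in>?B. ?av (?V V i j))" by (simp only: av_cmult av_sum)
 also have "(\<Sum>i\<in>?B. \<Sum>j\<in>?B. ?av (?V V i j))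
  = (\<Sum>i\<in>?B. \<Sum>j\<in>?B. if i = j then ?av (?U V i) else 0)"
  by (intro sum.cong refl) (use cross in auto)
 also have "... = (\<Sum>i\<in>?B. ?av (?U V i))" by simp
 also have "... <= (\<Sum>i\<in>?B. ?av (?X G))" by (intro sum_mono diag)
 also have "... = real b * ?av (?X G)" by simp
 finally show ?thesis using assms(2) by (simp add: power2_eq_square divide_right_mono)
qed

section \<open>Stability of stochastic gradient descent\<close>

text \<open>\<open>sgd\<close> with a feature vector F l in place of the kernel section at the l-th
  input, evaluation being an inner product. Features and labels become free parameters that can be
  exchanged, perturbed or split.\<close>

primrec fsgd :: "nat => real => (nat => 'k::real_inner) => (nat => real) => (nat => nat) => 'k => nat => 'k"
 where
 "fsgd b \<eta> F c J h 0 = h"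
| "fsgd b \<eta> F c J h (Suc t) = fsgd b \<eta> F c J h t - (\<eta> * (1 / real b)) *\<^sub>R
  (\<Sum>i = b * t + 1..b * (t + 1). (fsgd b \<eta> F c J h t \<bullet> F (J i) - c (J i)) *\<^sub>R F (J i))"

lemma fsgd_cong:
 "(!!i. i \<in> {1..b * t} ==> J i = J' i) ==> fsgd b \<eta> F c J h t = fsgd b \<eta> F c J' h t"
proof (induction t)
 case (Suc t)
 have "fsgd b \<eta> F c J h t = fsgd b \<eta> F c J' h t" by (rule Suc.IH) (use Suc.prems in auto)
 moreover have "J i = J' i" if "i \<in> {b * t + 1..b * (t + 1)}" for i using that by (intro Suc.prems) auto
 hence "(\<Sum>i = b * t + 1..b * (t + 1). (v \<bullet> F (J i) - c (J i)) *\<^sub>R F (J i))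
  = (\<Sum>i = b * t + 1..b * (t + 1). (v \<bullet> F (J' i) - c (J' i)) *\<^sub>R F (J' i))" for v
  by (intro sum.cong) (simp_all only:)
 ultimately show ?case by (simp only: fsgd.simps)
qed simp

lemma block_free_fsgd: "block_free n b T t (%J. H (fsgd b \<eta> F c J h t))"
 by (intro block_freeI arg_cong[where f = H] fsgd_cong)

lemma block_free_fsgd2:
 "block_free n b T t (%J. H (fsgd b \<eta> F c J h t) (fsgd b \<eta> F' c' J h' t))" by (rule block_freeI) (metis fsgd_cong)

lemma fsgd_add:
 "fsgd b \<eta> F (%l. c l + c' l) J (h + h') t = fsgd b \<eta> F c J h t + fsgd b \<eta> F c' J h' t"
proof (induction t)
 case (Suc t)
 have *: "((x + y) \<bullet> v - (a + a')) *\<^sub>R v = (x \<bullet> v - a) *\<^sub>R v + (y \<bullet> v - a') *\<^sub>R v" for x y v :: 'a and a a'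
  by (simp add: inner_add_left algebra_simps)
 show ?case by (simp only: fsgd.simps Suc * sum.distrib scaleR_add_right) simp
qed simp

lemma fsgd_scale:
 "fsgd b \<eta> F (%l. a * c l) J (a *\<^sub>R h) t = a *\<^sub>R fsgd b \<eta> F c J h t"
proof (induction t)
 case (Suc t)
 have *: "(a * x - a * y) *\<^sub>R v = a *\<^sub>R ((x - y) *\<^sub>R v)" for x y and v :: 'a by (simp add: algebra_simps)
 show ?case by (simp only: fsgd.simps Suc inner_scaleR_left * scaleR_sum_right[symmetric]) (simp add: algebra_simps)
qed simp

text \<open>The recursion is linear in the pair of labels and initial vector. The noise iterate is
  thus a combination of iterates driven by unit labels, with the noise values as
  coefficients.\<close>

lemma fsgd_sum:
 assumes "finite I"
 shows "fsgd b \<eta> F (%l. \<Sum>j\<in>I. e j * c j l) J 0 t = (\<Sum>j\<in>I. e j *\<^sub>R fsgd b \<eta> F (c j) J 0 t)"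
 using assms
proof (induction I)
 case empty
 show ?case by (simp, induction t) simp_all
next
 case (insert j I)
 have "fsgd b \<eta> F (%l. \<Sum>j\<in>insert j I. e j * c j l) J 0 t
  = fsgd b \<eta> F (%l. e j * c j l) J (e j *\<^sub>R 0) t + fsgd b \<eta> F (%l. \<Sum>j\<in>I. e j * c j l) J 0 t"
  using insert by (simp add: fsgd_add[where h = 0 and h' = 0, simplified])
 thus ?case using insert by (simp only: fsgd_scale) simp
qed

lemma fsgd_label_cong:
 assumes "!!i. i \<in> {1..b * t} ==> J i \<in> {1..n}"
  and "!!l. l \<in> {1..n} ==> F l = F' l" and "!!l. l \<in> {1..n} ==> c l = c' l"
 shows "fsgd b \<eta> F c J h t = fsgd b \<eta> F' c' J h t"
 using assms(1)
proof (induction t)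
 case (Suc t)
 have "fsgd b \<eta> F c J h t = fsgd b \<eta> F' c' J h t" by (rule Suc.IH) (use Suc.prems in auto)
 moreover have "J i \<in> {1..n}" if "i \<in> {b * t + 1..b * (t + 1)}" for i using that by (intro Suc.prems) auto
 hence "F (J i) = F' (J i)" "c (J i) = c' (J i)" if "i \<in> {b * t + 1..b * (t + 1)}" for i using assms(2,3) that by blast+
 hence "(\<Sum>i = b * t + 1..b * (t + 1). (v \<bullet> F (J i) - c (J i)) *\<^sub>R F (J i))
  = (\<Sum>i = b * t + 1..b * (t + 1). (v \<bullet> F' (J i) - c' (J i)) *\<^sub>R F' (J i))" for v
  by (intro sum.cong) (simp_all only:)
 ultimately show ?case by (simp only: fsgd.simps)
qed simp

lemma norm_mean_square_le:
 fixes V :: "'i => 'k::real_inner"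
 assumes "finite B" "card B = b" "b >= 1"
 shows "(norm ((1 / real b) *\<^sub>R (\<Sum>i\<in>B. V i)))^2 <= (1 / real b) * (\<Sum>i\<in>B. (norm (V i))^2)"
proof -
 have "(norm (\<Sum>i\<in>B. V i))^2 <= (\<Sum>i\<in>B. norm (V i))^2" by (intro power_mono norm_sum) auto
 also have "... <= real b * (\<Sum>i\<in>B. (norm (V i))^2)" using sum_squared_le_sum_of_squares[of "%i. norm (V i)" B] assms by (simp add: mult.commute)
 finally have "(norm (\<Sum>i\<in>B. V i))^2 / (real b)^2 <= real b * (\<Sum>i\<in>B. (norm (V i))^2) / (real b)^2" by (rule divide_right_mono) simp
 thus ?thesis using assms(3) by (simp add: power_divide power2_eq_square)
qed

text \<open>Convexity of the squared norm: a batch step is the mean over its indices of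
  single-sample steps, so in mean square a batch does no worse than one sample.\<close>

lemma av_batch_step:
 fixes p :: "(nat => nat) => 'k::real_inner"
 assumes "t < T" "b >= 1" "block_free n b T t p" "block_free n b T t G"
 shows "av n (b * T) (%J. (norm (p J - (\<eta> * (1 / real b)) *\<^sub>R (\<Sum>i = b * t + 1..b * (t + 1). G J (J i))))^2)
  <= av n (b * T) (%J. avg n (%l. (norm (p J - \<eta> *\<^sub>R G J l))^2))" (is "_ <= ?R")
proof -
 let ?B = "{b * t + 1..b * (t + 1)}"
 have "(norm (p J - (\<eta> * (1 / real b)) *\<^sub>R (\<Sum>i\<in>?B. G J (J i))))^2
  <= (1 / real b) * (\<Sum>i\<in>?B. (norm (p J - \<eta> *\<^sub>R G J (J i)))^2)" for J
 proof -
  have "p J - (\<eta> * (1 / real b)) *\<^sub>R (\<Sum>i\<in>?B. G J (J i))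
   = (1 / real b) *\<^sub>R (\<Sum>i\<in>?B. p J - \<eta> *\<^sub>R G J (J i))"
   using assms(2) by (simp only: sum_subtractf sum_constant_scaleR block_card scaleR_diff_right scaleR_scaleR
     scaleR_sum_right[symmetric]) simp
  thus ?thesis using norm_mean_square_le[of ?B b] assms(2) by (simp only:) simp
 qed
 hence "av n (b * T) (%J. (norm (p J - (\<eta> * (1 / real b)) *\<^sub>R (\<Sum>i\<in>?B. G J (J i))))^2)
  <= av n (b * T) (%J. (1 / real b) * (\<Sum>i\<in>?B. (norm (p J - \<eta> *\<^sub>R G J (J i)))^2))"
  by (rule av_mono)
 also have "... = ?R" using assms by (intro av_block) (auto simp: block_free_def)
 finally show ?thesis .
qed

lemma mean_le:
 "n >= 1 ==> (!!l. l \<in> {1..n} ==> f l <= (c::real)) ==> avg n (%l. f l) <= c"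
 using sum_bounded_above[of "{1..n}" f c] by (simp add: divide_le_eq mult.commute)

text \<open>Here p is the displacement from a comparison vector, r the residual of the iterate and u
  that of the comparison vector. Of the gain 2 \<eta> r^2, one quarter pays for the quadratic term,
  as \<eta> \<kappa>^2 \<le> 1/2, and one quarter for the cross term.\<close>

lemma residual_step:
 fixes p f :: "'k::real_inner"
 assumes "0 <= \<eta>" "(norm f)^2 <= \<kappa>^2" "\<eta> * \<kappa>^2 <= 1 / 2" "p \<bullet> f = r + u"
 shows "(norm (p - \<eta> *\<^sub>R (r *\<^sub>R f)))^2 <= (norm p)^2 - \<eta> * r^2 + 2 * \<eta> * u^2" (is "?L <= _")
proof -
 have 1: "?L = (norm p)^2 - 2 * \<eta> * r * (r + u) + \<eta>^2 * r^2 * (norm f)^2" unfolding power2_norm_eq_inner assms(4)[symmetric]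
  by (simp add: algebra_simps inner_diff_left inner_diff_right inner_commute power2_eq_square)
 have "\<eta> * (norm f)^2 <= 1 / 2" using mult_left_mono[OF assms(2,1)] assms(3) by simp
 from mult_right_mono[OF mult_left_mono[OF this assms(1)], of "r^2"]
 have 2: "\<eta>^2 * r^2 * (norm f)^2 <= \<eta> * r^2 / 2" by (simp add: power2_eq_square mult_ac)
 have "0 <= (r + 2 * u)^2" by simp
 hence "- 2 * (r * u) <= r^2 / 2 + 2 * u^2" by (simp add: power2_eq_square algebra_simps)
 from mult_left_mono[OF this assms(1)]
 have "- 2 * \<eta> * r * u <= \<eta> * r^2 / 2 + 2 * \<eta> * u^2" by (simp add: algebra_simps)
 with 1 2 show ?thesis by (simp add: algebra_simps power2_eq_square)
qed

lemma mean_residual_step: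
 assumes "n >= 1" "0 <= \<eta>" "\<eta> * \<kappa>^2 <= 1 / 2" and F: "!!l. l \<in> {1..n} ==> (norm (F l))^2 <= \<kappa>^2"
 shows "av n k (%J. avg n (%l. (norm ((h J - w) - \<eta> *\<^sub>R ((h J \<bullet> F l - c l) *\<^sub>R F l)))^2))
  <= av n k (%J. (norm (h J - w))^2) - \<eta> * av n k (%J. avg n (%l. (h J \<bullet> F l - c l)^2))
   + 2 * \<eta> * (avg n (%l. (c l - w \<bullet> F l)^2))" (is "?L <= _")
proof -
 have "?L <= av n k (%J. avg n (%l. (norm (h J - w))^2 - \<eta> * (h J \<bullet> F l - c l)^2 + 2 * \<eta> * (c l - w \<bullet> F l)^2))"
  by (intro av_mono mult_left_mono sum_mono residual_step[OF assms(2) F assms(3)]) (auto simp: inner_diff_left)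
 also have "... = av n k (%J. (norm (h J - w))^2 - \<eta> * (avg n (%l. (h J \<bullet> F l - c l)^2))
   + 2 * \<eta> * (avg n (%l. (c l - w \<bullet> F l)^2)))"
  using assms(1) by (intro av_cong) (simp add: sum.distrib sum_subtractf sum_distrib_left[symmetric] field_simps)
 finally show ?thesis by (simp only: av_add av_diff av_cmult av_const[OF assms(1)])
qed

lemma fsgd_energy_step:
 assumes "b >= 1" "n >= 1" "0 <= \<eta>" "\<eta> * \<kappa>^2 <= 1 / 2" "t < T"
  and F: "!!l. l \<in> {1..n} ==> (norm (F l))^2 <= \<kappa>^2"
 shows "av n (b * T) (%J. (norm (fsgd b \<eta> F c J h (Suc t) - w))^2)
  <= av n (b * T) (%J. (norm (fsgd b \<eta> F c J h t - w))^2)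
   - \<eta> * av n (b * T) (%J. avg n (%l. (fsgd b \<eta> F c J h t \<bullet> F l - c l)^2))
   + 2 * \<eta> * (avg n (%l. (c l - w \<bullet> F l)^2))" (is "?L <= _")
proof -
 let ?h = "%J. fsgd b \<eta> F c J h t"
 let ?G = "%J l. (?h J \<bullet> F l - c l) *\<^sub>R F l"
 have "?L = av n (b * T) (%J. (norm ((?h J - w) - (\<eta> * (1 / real b)) *\<^sub>R (\<Sum>i = b * t + 1..b * (t + 1). ?G J (J i))))^2)" unfolding fsgd.simps
  by (intro av_cong arg_cong[where f = "%x. (norm x)^2"]) (simp only: diff_diff_eq add.commute)
 also have "... <= av n (b * T) (%J. avg n (%l. (norm ((?h J - w) - \<eta> *\<^sub>R ?G J l))^2))"
  by (rule av_batch_step[OF assms(5,1) block_free_fsgd block_free_fsgd])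
 finally show ?thesis using mean_residual_step[OF assms(2-4) F] by (rule order_trans)
qed

lemma fsgd_energy:
 assumes "b >= 1" "n >= 1" "0 <= \<eta>" "\<eta> * \<kappa>^2 <= 1 / 2" "t <= T"
  and F: "!!l. l \<in> {1..n} ==> (norm (F l))^2 <= \<kappa>^2"
 shows "av n (b * T) (%J. (norm (fsgd b \<eta> F c J h t - w))^2)
   + \<eta> * (\<Sum>s<t. av n (b * T) (%J. avg n (%l. (fsgd b \<eta> F c J h s \<bullet> F l - c l)^2)))
  <= (norm (h - w))^2 + 2 * \<eta> * real t * (avg n (%l. (c l - w \<bullet> F l)^2))"
 using assms(5)
proof (induction t)
 case 0
 thus ?case using av_const[OF assms(2)] by simp
next
 case (Suc t)
 have *: "e' + \<eta> * (S + r) <= A + 2 * \<eta> * (x + 1) * u" if "e' <= e - \<eta> * r + 2 * \<eta> * u" "e + \<eta> * S <= A + 2 * \<eta> * x * u" for e e' r S A x u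
  using that by (simp add: algebra_simps)
 show ?case unfolding sum.lessThan_Suc of_nat_Suc add.commute[of 1] by (rule *[OF fsgd_energy_step[OF assms(1-4)]]) (use Suc F in auto)
qed

text \<open>The tail average uses the last iterate too, whose residual is missing from
  \<open>fsgd_energy\<close>. One further step pays for it, since the squared distance after that
  step is nonnegative.\<close>

lemma fsgd_residuals:
 assumes "b >= 1" "n >= 1" "0 <= \<eta>" "\<eta> * \<kappa>^2 <= 1 / 2"
  and F: "!!l. l \<in> {1..n} ==> (norm (F l))^2 <= \<kappa>^2"
 shows "\<eta> * (\<Sum>s\<le>T. av n (b * T) (%J. avg n (%l. (fsgd b \<eta> F c J h s \<bullet> F l - c l)^2)))
  <= (norm (h - w))^2 + 2 * \<eta> * real (T + 1) * (avg n (%l. (c l - w \<bullet> F l)^2))"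
proof -
 have "0 <= av n (b * T) (%J. avg n (%l. (norm ((fsgd b \<eta> F c J h T - w) - \<eta> *\<^sub>R ((fsgd b \<eta> F c J h T \<bullet> F l - c l) *\<^sub>R F l)))^2))"
  by (intro av_nonneg mult_nonneg_nonneg sum_nonneg) auto
 note 1 = order_trans[OF this mean_residual_step[OF assms(2-4) F]]
 have *: "\<eta> * (S + r) <= A + 2 * \<eta> * (x + 1) * u" if "0 <= e - \<eta> * r + 2 * \<eta> * u" "e + \<eta> * S <= A + 2 * \<eta> * x * u" for e r S A x u
  using that by (simp add: algebra_simps)
 show ?thesis unfolding lessThan_Suc_atMost[symmetric] sum.lessThan_Suc of_nat_add of_nat_1
  by (rule *[OF 1 fsgd_energy[OF assms(1-4) order_refl]]) (use F in auto)
qed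

text \<open>The constant 3 majorises e, hence (1 + 1/T)^T. The terms p are a dissipation that is
  carried along on the left.\<close>

lemma discrete_gronwall:
 fixes e g p :: "nat => real"
 assumes "T >= 1" "t <= T" "!!s. 0 <= g s" "!!s. 0 <= p s" "e 0 = 0"
  and step: "!!s. s < T ==> e (Suc s) + p s <= (1 + 1 / real T) * e s + g s"
 shows "e t + (\<Sum>s<t. p s) <= 3 * (\<Sum>s<t. g s)"
proof -
 let ?q = "1 + 1 / real T"
 have "e t + (\<Sum>s<t. p s) <= ?q ^ t * (\<Sum>s<t. g s)" using assms(2)
 proof (induction t)
  case 0
  thus ?case by (simp add: assms(5))
 next
  case (Suc t)
  have "e (Suc t) + (\<Sum>s<Suc t. p s) <= ?q * e t + g t + (\<Sum>s<t. p s)" using step[of t] Suc by simp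
  also have "... <= ?q * (e t + (\<Sum>s<t. p s)) + g t" using assms(4) by (simp add: algebra_simps sum_nonneg)
  also have "... <= ?q * (?q ^ t * (\<Sum>s<t. g s)) + g t" using Suc by (intro add_right_mono mult_left_mono) auto
  also have "... <= ?q * (?q ^ t * (\<Sum>s<t. g s)) + ?q ^ Suc t * g t"
   using mult_right_mono[OF one_le_power[of ?q "Suc t"] assms(3)[of t]] assms(1) by simp
  also have "... = ?q ^ Suc t * (\<Sum>s<Suc t. g s)" by (simp only: sum.lessThan_Suc power_Suc distrib_left mult.assoc)
  finally show ?case .
 qed
 also have "... <= 3 * (\<Sum>s<t. g s)"
 proof (intro mult_right_mono sum_nonneg assms(3))
  have "?q ^ t <= ?q ^ T" by (rule power_increasing[OF assms(2)]) simp
  also have "... <= exp (1 / real T) ^ T" by (intro power_mono exp_ge_add_one_self) simp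
  also have "... = exp 1" using assms(1) by (simp add: exp_of_nat_mult[symmetric])
  also have "... <= 3" by (rule exp_le)
  finally show "?q ^ t <= 3" .
 qed
 finally show ?thesis .
qed

lemma young_square:
 fixes x y :: real
 assumes "T > 0"
 shows "(x + y)^2 <= (1 + 1 / T) * x^2 + (1 + T) * y^2"
proof -
 have "0 <= (x / sqrt T - sqrt T * y)^2" by simp
 also have "... = x^2 / T + T * y^2 - 2 * x * y" using assms by (simp add: power2_diff power_divide power_mult_distrib)
 finally show ?thesis by (simp add: power2_sum algebra_simps)
qed

lemma contraction_rank_one:
 fixes p f :: "'k::real_inner"
 assumes "0 <= \<eta>" "(norm f)^2 <= \<kappa>^2" "\<eta> * \<kappa>^2 <= 1 / 2"
 shows "(norm (p - \<eta> *\<^sub>R ((p \<bullet> f) *\<^sub>R f)))^2 <= (norm p)^2 - \<eta> * (p \<bullet> f)^2"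
 using residual_step[OF assms, where p = p and u = 0 and r = "p \<bullet> f"] by simp

text \<open>Both samples are run with the same indices. Only the replaced point breaks the
  contraction, and it is drawn with frequency 1/n. The bound is in terms of the residuals at the
  replaced points instead of worst-case values, because the energy inequality controls their sum
  later.\<close>

lemma fsgd_stability:
 assumes "b >= 1" "n >= 1" "0 <= \<eta>" "\<eta> * \<kappa>^2 <= 1 / 2" "T >= 1" "t <= T" "0 <= \<kappa>"
  and F: "!!l. l \<in> {1..n} ==> (norm (F l))^2 <= \<kappa>^2"
  and F': "!!l. l \<in> {1..n} ==> (norm (F' l))^2 <= \<kappa>^2"
  and i: "i \<in> {1..n}"
  and eq: "!!l. l \<in> {1..n} ==> l \<noteq> i ==> F' l = F l \<and> c' l = c l"
 shows "av n (b * T) (%J. (norm (fsgd b \<eta> F c J h t - fsgd b \<eta> F' c' J h t))^2)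
  <= 6 * (real T / (real n)^2 + 1 / real n) * \<eta>^2 * \<kappa>^2 *
   (\<Sum>s<t. av n (b * T) (%J. (fsgd b \<eta> F c J h s \<bullet> F i - c i)^2 + (fsgd b \<eta> F' c' J h s \<bullet> F' i - c' i)^2))"
proof -
 let ?av = "av n (b * T)"
 let ?h = "fsgd b \<eta> F c" and ?k = "fsgd b \<eta> F' c'"
 define K where "K = 2 * (real T / (real n)^2 + 1 / real n) * \<eta>^2 * \<kappa>^2"
 define e where "e = (%t. ?av (%J. (norm (?h J h t - ?k J h t))^2))"
 define g where "g = (%t. K * ?av (%J. (?h J h t \<bullet> F i - c i)^2 + (?k J h t \<bullet> F' i - c' i)^2))"
 have g0: "0 <= g s" for s unfolding g_def K_def by (intro mult_nonneg_nonneg av_nonneg) auto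
 have step: "e (Suc s) <= (1 + 1 / real T) * e s + g s" if "s < T" for s
 proof -
  let ?p = "%J. ?h J h s - ?k J h s"
  let ?x = "%J. ?h J h s \<bullet> F i - c i" and ?y = "%J. ?k J h s \<bullet> F' i - c' i"
  let ?G = "%J l. (?h J h s \<bullet> F l - c l) *\<^sub>R F l - (?k J h s \<bullet> F' l - c' l) *\<^sub>R F' l"
  let ?a = "%J. \<bar>?x J\<bar> + \<bar>?y J\<bar>"
  let ?q = "%J. 2 * norm (?p J) * (\<eta> * \<kappa> * ?a J) + (\<eta> * \<kappa> * ?a J)^2"
  have "e (Suc s) = ?av (%J. (norm (?p J - (\<eta> * (1 / real b)) *\<^sub>R (\<Sum>i = b * s + 1..b * (s + 1). ?G J (J i))))^2)"
   unfolding e_def by (intro av_cong arg_cong[where f = "%x. (norm x)^2"]) (simp only: fsgd.simps sum_subtractf, simp add: algebra_simps)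
  also have "... <= ?av (%J. avg n (%l. (norm (?p J - \<eta> *\<^sub>R ?G J l))^2))"
   by (rule av_batch_step[OF that assms(1) block_free_fsgd2 block_free_fsgd2])
  also have "... <= ?av (%J. avg n (%l. (norm (?p J))^2 + (if l = i then
    ?q J else 0)))"
  proof (intro av_mono mult_left_mono sum_mono)
   fix J l assume l: "l \<in> {1..n}"
   show "(norm (?p J - \<eta> *\<^sub>R ?G J l))^2 <= (norm (?p J))^2 + (if l = i then
    ?q J else 0)" (is "?L <= _")
   proof (cases "l = i")
    case True
    have nF: "norm (F i) <= \<kappa>" "norm (F' i) <= \<kappa>" using F[OF i] F'[OF i] assms(7) by (auto intro: power2_le_imp_le)
    have "norm (?p J - \<eta> *\<^sub>R ?G J i) <= norm (?p J) + norm (\<eta> *\<^sub>R ?G J i)" by (rule norm_triangle_ineq4)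
    also have "norm (\<eta> *\<^sub>R ?G J i) <= \<eta> * (\<bar>?x J\<bar> * norm (F i) + \<bar>?y J\<bar> * norm (F' i))"
     using norm_triangle_ineq4[of "(?x J) *\<^sub>R F i" "(?y J) *\<^sub>R F' i"] by (simp add: assms(3) mult_left_mono)
    also have "... <= \<eta> * (\<bar>?x J\<bar> * \<kappa> + \<bar>?y J\<bar> * \<kappa>)" using nF assms(3) by (intro mult_left_mono add_mono) auto
    finally have "norm (?p J - \<eta> *\<^sub>R ?G J i) <= norm (?p J) + \<eta> * \<kappa> * ?a J" by (simp add: algebra_simps)
    from power_mono[OF this, of 2] True show ?thesis by (simp add: power2_sum algebra_simps)
   next
    case False
    with eq l have "F' l = F l" "c' l = c l" by auto
    hence G: "?G J l = (?p J \<bullet> F l) *\<^sub>R F l" by (simp add: inner_diff_left algebra_simps)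
    have "?L <= (norm (?p J))^2" unfolding G using contraction_rank_one[OF assms(3) F[OF l] assms(4), of "?p J"]
      mult_nonneg_nonneg[OF assms(3) zero_le_power2[of "?p J \<bullet> F l"]] by linarith
    with False show ?thesis by simp
   qed
  qed simp
  also have "... = ?av (%J. (norm (?p J))^2 + (1 / real n) *
    (?q J))"
  proof (intro av_cong)
   fix J
   have *: "(\<Sum>l=1..n. x + (if l = i then y else 0)) = real n * x + y" for x y :: real using i by (simp add: sum.distrib)
   show "avg n (%l. (norm (?p J))^2 + (if l = i then
    ?q J else 0)) = (norm (?p J))^2 + (1 / real n) * (?q J)"
    unfolding * using assms(2) by (simp add: field_simps)
  qed
  also have "... <= ?av (%J. (1 + 1 / real T) * (norm (?p J))^2 +
    K * ((?x J)^2 + (?y J)^2))"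
  proof (intro av_mono)
   fix J
   define x where "x = norm (?p J)"
   define y where "y = \<eta> * \<kappa> * ?a J"
   \<comment> \<open>Young's inequality with weights 1/T and T/n^2: the first is the growth per step
     that \<open>discrete_gronwall\<close> tolerates over T steps.\<close>
   have "0 <= (x / sqrt T - sqrt T * (y / real n))^2" by simp
   also have "... = x^2 / T + T * y^2 / (real n)^2 - (1 / real n) * (2 * x * y)"
    using assms(5,2) by (simp add: power2_diff power_divide power_mult_distrib)
   finally have 1: "(1 / real n) * (2 * x * y + y^2) <= x^2 / T + (T / (real n)^2 + 1 / n) * y^2" by (simp add: algebra_simps)
   have "(?a J)^2 <= 2 * ((?x J)^2 + (?y J)^2)" using sum_squares_bound[of "\<bar>?x J\<bar>" "\<bar>?y J\<bar>"] by (simp add: power2_sum)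
   hence "y^2 <= \<eta>^2 * \<kappa>^2 * (2 * ((?x J)^2 + (?y J)^2))" unfolding y_def power_mult_distrib by (intro mult_left_mono) auto
   hence "(T / (real n)^2 + 1 / n) * y^2 <= (T / (real n)^2 + 1 / n) *
    (\<eta>^2 * \<kappa>^2 * (2 * ((?x J)^2 + (?y J)^2)))"
    by (intro mult_left_mono) auto
   also have "... = K * ((?x J)^2 + (?y J)^2)" by (simp add: K_def algebra_simps)
   finally show "(norm (?p J))^2 + (1 / real n) *
    (?q J) <= (1 + 1 / real T) * (norm (?p J))^2 +
    K * ((?x J)^2 + (?y J)^2)"
    using 1 unfolding x_def[symmetric] y_def[symmetric] by (simp add: algebra_simps)
  qed
  also have "... = (1 + 1 / real T) * e s + g s" unfolding e_def g_def by (simp only: av_add av_cmult)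
  finally show ?thesis .
 qed
 have "e t + (\<Sum>s<t. 0) <= 3 * (\<Sum>s<t. g s)" by (rule discrete_gronwall[OF assms(5,6) g0, where p = "%_. 0"])
   (use step in \<open>auto simp: e_def av_const[OF assms(2)]\<close>)
 thus ?thesis unfolding e_def g_def K_def by (simp add: sum_distrib_left algebra_simps)
qed

text \<open>The steps for F' contract the difference, and the change of features acts as a forcing
  along the unperturbed run, so the right-hand side involves norms of unperturbed iterates alone.
  The dissipation in the directions F' l is kept because it later controls the empirical norm of the
  difference.\<close>

lemma fsgd_perturbation:
 assumes "b >= 1" "n >= 1" "0 <= \<eta>" "\<eta> * \<kappa>^2 <= 1 / 2" "T >= 1" "t <= T" "0 <= \<kappa>"
  and F: "!!l. l \<in> {1..n} ==> (norm (F l))^2 <= \<kappa>^2"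
  and F': "!!l. l \<in> {1..n} ==> (norm (F' l))^2 <= \<kappa>^2"
  and c: "!!l. l \<in> {1..n} ==> \<bar>c l\<bar> <= M"
 shows "av n (b * T) (%J. (norm (fsgd b \<eta> F' c J h t - fsgd b \<eta> F c J h t))^2)
  + \<eta> * (\<Sum>s<t. av n (b * T) (%J. avg n (%l. ((fsgd b \<eta> F' c J h s - fsgd b \<eta> F c J h s) \<bullet> F' l)^2)))
  <= 3 * (1 + real T) * \<eta>^2 * (avg n (%l. (norm (F' l - F l))^2)) *
   (\<Sum>s<t. 8 * \<kappa>^2 * av n (b * T) (%J. (norm (fsgd b \<eta> F c J h s))^2) + 2 * M^2)"
proof -
 let ?av = "av n (b * T)"
 let ?h = "fsgd b \<eta> F c" and ?k = "fsgd b \<eta> F' c"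
 define \<rho> where "\<rho> = avg n (%l. (norm (F' l - F l))^2)"
 have \<rho>0: "0 <= \<rho>" unfolding \<rho>_def by (intro mult_nonneg_nonneg sum_nonneg) auto
 define e where "e = (%t. ?av (%J. (norm (?k J h t - ?h J h t))^2))"
 define p where "p = (%s. \<eta> * ?av (%J. avg n (%l. ((?k J h s - ?h J h s) \<bullet> F' l)^2)))"
 define g where "g = (%s. (1 + real T) * \<eta>^2 * \<rho> * (8 * \<kappa>^2 * ?av (%J. (norm (?h J h s))^2) + 2 * M^2))"
 have g0: "0 <= g s" for s unfolding g_def by (intro mult_nonneg_nonneg add_nonneg_nonneg av_nonneg) (auto simp: \<rho>0)
 have p0: "0 <= p s" for s unfolding p_def by (intro mult_nonneg_nonneg av_nonneg sum_nonneg) (auto simp: assms(3))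
 have step: "e (Suc s) + p s <= (1 + 1 / real T) * e s + g s" if "s < T" for s
 proof -
  let ?p = "%J. ?k J h s - ?h J h s"
  let ?G = "%J l. (?k J h s \<bullet> F' l - c l) *\<^sub>R F' l - (?h J h s \<bullet> F l - c l) *\<^sub>R F l"
  have "e (Suc s) = ?av (%J. (norm (?p J - (\<eta> * (1 / real b)) *\<^sub>R (\<Sum>i = b * s + 1..b * (s + 1). ?G J (J i))))^2)"
   unfolding e_def by (intro av_cong arg_cong[where f = "%x. (norm x)^2"]) (simp only: fsgd.simps sum_subtractf, simp add: algebra_simps)
  also have "... <= ?av (%J. avg n (%l. (norm (?p J - \<eta> *\<^sub>R ?G J l))^2))"
   by (rule av_batch_step[OF that assms(1) block_free_fsgd2 block_free_fsgd2])
  also have "... <= ?av (%J. avg n (%l. (1 + 1 / real T) * (norm (?p J))^2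
    - \<eta> * (?p J \<bullet> F' l)^2 + (1 + real T) * \<eta>^2 * ((norm (F' l - F l))^2 * (8 * \<kappa>^2 * (norm (?h J h s))^2 + 2 * M^2))))"
  proof (intro av_mono mult_left_mono sum_mono)
   fix J l assume l: "l \<in> {1..n}"
   have nF: "norm (F l) <= \<kappa>" "norm (F' l) <= \<kappa>" using F[OF l] F'[OF l] assms(7) by (auto intro: power2_le_imp_le)
   let ?hh = "?h J h s" and ?r = "norm (F' l - F l)"
   let ?Z = "8 * \<kappa>^2 * (norm ?hh)^2 + 2 * M^2"
   \<comment> \<open>The forcing: the difference of the two gradients at the same unperturbed
     iterate.\<close>
   define \<xi> where "\<xi> = (?hh \<bullet> F' l - c l) *\<^sub>R F' l - (?hh \<bullet> F l - c l) *\<^sub>R F l"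
   have "\<xi> = (?hh \<bullet> (F' l - F l)) *\<^sub>R F' l + (?hh \<bullet> F l) *\<^sub>R (F' l - F l) - c l *\<^sub>R (F' l - F l)" by (simp add: \<xi>_def inner_diff_right algebra_simps)
   also have "norm \<dots> <= norm ((?hh \<bullet> (F' l - F l)) *\<^sub>R F' l) + norm ((?hh \<bullet> F l) *\<^sub>R (F' l - F l))
     + norm (c l *\<^sub>R (F' l - F l))"
    by (intro order_trans[OF norm_triangle_ineq4] add_mono norm_triangle_ineq order_refl)
   also have "... <= (norm ?hh * ?r) * \<kappa> + (norm ?hh * \<kappa>) * ?r + M * ?r"
   proof (intro add_mono, goal_cases)
    case 1 have "\<bar>?hh \<bullet> (F' l - F l)\<bar> <= norm ?hh * ?r" by (rule Cauchy_Schwarz_ineq2)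
    thus ?case using nF by (simp add: mult_mono)
    case 2 have "\<bar>?hh \<bullet> F l\<bar> <= norm ?hh * norm (F l)" by (rule Cauchy_Schwarz_ineq2)
    also have "... <= norm ?hh * \<kappa>" using nF by (intro mult_left_mono) auto
    finally show ?case by (simp add: mult_right_mono)
    case 3 show ?case using c[OF l] by (simp add: mult_right_mono)
   qed
   finally have "norm \<xi> <= ?r * (2 * \<kappa> * norm ?hh + M)" by (simp add: algebra_simps)
   hence "(norm \<xi>)^2 <= (?r * (2 * \<kappa> * norm ?hh + M))^2" by (intro power_mono) auto
   also have "... = ?r^2 * (2 * \<kappa> * norm ?hh + M)^2" by (rule power_mult_distrib)
   also have "... <= ?r^2 * ?Z" using sum_squares_bound[of "2 * \<kappa> * norm ?hh" M] by (intro mult_left_mono) (auto simp: power2_sum power_mult_distrib)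
   finally have \<xi>: "(norm \<xi>)^2 <= ?r^2 * ?Z" .
   let ?v = "?p J - \<eta> *\<^sub>R ((?p J \<bullet> F' l) *\<^sub>R F' l)"
   have "?p J - \<eta> *\<^sub>R ?G J l = ?v - \<eta> *\<^sub>R \<xi>" by (simp add: \<xi>_def inner_diff_left algebra_simps)
   moreover have "norm (?v - \<eta> *\<^sub>R \<xi>) <= norm ?v + \<eta> * norm \<xi>" using norm_triangle_ineq4[of ?v "\<eta> *\<^sub>R \<xi>"] assms(3) by simp
   ultimately have "(norm (?p J - \<eta> *\<^sub>R ?G J l))^2 <= (norm ?v + \<eta> * norm \<xi>)^2" by (intro power_mono) (simp_all only: norm_ge_zero)
   also have "... <= (1 + 1 / real T) * (norm ?v)^2 + (1 + real T) * (\<eta> * norm \<xi>)^2" using assms(5) by (intro young_square) simp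
   also have "... <= (1 + 1 / real T) * ((norm (?p J))^2 - \<eta> * (?p J \<bullet> F' l)^2)
     + (1 + real T) * (\<eta>^2 * (?r^2 * ?Z))"
    unfolding power_mult_distrib by (intro add_mono mult_left_mono contraction_rank_one[OF assms(3) F'[OF l] assms(4)] \<xi>) auto
   also have "... <= (1 + 1 / real T) * (norm (?p J))^2 - \<eta> * (?p J \<bullet> F' l)^2
     + (1 + real T) * \<eta>^2 * (?r^2 * ?Z)"
    using assms(3) by (simp add: algebra_simps)
   finally show "(norm (?p J - \<eta> *\<^sub>R ?G J l))^2 <= (1 + 1 / real T) * (norm (?p J))^2
    - \<eta> * (?p J \<bullet> F' l)^2 + (1 + real T) * \<eta>^2 * (?r^2 * ?Z)" .
  qed simp
  also have "... = ?av (%J. (1 + 1 / real T) * (norm (?p J))^2 - \<eta> * (avg n (%l. (?p J \<bullet> F' l)^2))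
    + (1 + real T) * \<eta>^2 * \<rho> * (8 * \<kappa>^2 * (norm (?h J h s))^2 + 2 * M^2))"
  proof (intro av_cong)
   fix J
   show "avg n (%l. (1 + 1 / real T) * (norm (?p J))^2
    - \<eta> * (?p J \<bullet> F' l)^2 + (1 + real T) * \<eta>^2 * ((norm (F' l - F l))^2 * (8 * \<kappa>^2 * (norm (?h J h s))^2 + 2 * M^2)))
    = (1 + 1 / real T) * (norm (?p J))^2 - \<eta> * (avg n (%l. (?p J \<bullet> F' l)^2))
    + (1 + real T) * \<eta>^2 * \<rho> * (8 * \<kappa>^2 * (norm (?h J h s))^2 + 2 * M^2)"
   proof -
    have *: "avg n (%l. x - \<eta> * y l + z * (u l * v)) = x - \<eta> * (avg n (%l. y l))
      + z * (avg n (%l. u l)) * v" for x z v :: real and y u :: "nat => real"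
     unfolding sum.distrib sum_subtractf sum_distrib_left[symmetric] sum_distrib_right[symmetric] using assms(2) by (simp add: field_simps)
    show ?thesis unfolding \<rho>_def by (rule *)
   qed
  qed
  also have "... = (1 + 1 / real T) * e s - p s + g s" unfolding e_def p_def g_def by (simp only: av_add av_diff av_cmult av_const[OF assms(2)])
  finally show ?thesis by simp
 qed
 have "e t + (\<Sum>s<t. p s) <= 3 * (\<Sum>s<t. g s)" by (rule discrete_gronwall[OF assms(5,6) g0 p0]) (use step in \<open>auto simp: e_def av_const[OF assms(2)]\<close>)
 thus ?thesis unfolding e_def g_def p_def sum_distrib_left[symmetric] \<rho>_def by (simp only: mult.assoc)
qed

section \<open>The empirical covariance operator, and gradient descent as the mean of SGD\<close>

definition emp_op :: "nat => (nat => 'k::real_inner) => 'k => 'k" where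
 "emp_op n F p = (1 / real n) *\<^sub>R (\<Sum>l=1..n. (p \<bullet> F l) *\<^sub>R F l)"

lemma emp_op_add: "emp_op n F (p + q) = emp_op n F p + emp_op n F q"
 by (simp add: emp_op_def inner_add_left scaleR_add_left sum.distrib scaleR_add_right)

lemma emp_op_scale: "emp_op n F (a *\<^sub>R p) = a *\<^sub>R emp_op n F p"
 by (simp add: emp_op_def scaleR_sum_right mult_ac)

lemma emp_op_diff: "emp_op n F (p - q) = emp_op n F p - emp_op n F q"
 by (simp add: emp_op_def inner_diff_left scaleR_diff_left sum_subtractf scaleR_diff_right)

lemma emp_op_zero [simp]: "emp_op n F 0 = 0"
 by (simp add: emp_op_def)

lemma inner_emp_op: "q \<bullet> emp_op n F p = avg n (%l. (p \<bullet> F l) * (q \<bullet> F l))"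
 by (simp add: emp_op_def inner_sum_right)

lemma emp_op_sym: "emp_op n F p \<bullet> q = p \<bullet> emp_op n F q"
 by (simp add: inner_emp_op inner_commute[of "emp_op n F p"] mult.commute)

lemma emp_op_quadratic: "p \<bullet> emp_op n F p = avg n (%l. (p \<bullet> F l)^2)"
 by (simp add: inner_emp_op power2_eq_square)

lemma emp_op_nonneg: "0 <= p \<bullet> emp_op n F p"
 unfolding emp_op_quadratic by (intro mult_nonneg_nonneg sum_nonneg) auto

lemma norm_emp_op_le:
 assumes "n >= 1" and F: "!!l. l \<in> {1..n} ==> (norm (F l))^2 <= \<kappa>^2"
 shows "(norm (emp_op n F p))^2 <= \<kappa>^2 * (p \<bullet> emp_op n F p)" (is "?L <= ?R")
proof -
 have "?L <= avg n (%l. (norm ((p \<bullet> F l) *\<^sub>R F l))^2)" unfolding emp_op_def using assms(1) by (intro norm_mean_square_le) auto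
 also have "... <= avg n (%l. \<kappa>^2 * (p \<bullet> F l)^2)" by (intro mult_left_mono sum_mono)
   (auto simp: power_mult_distrib mult.commute intro!: mult_right_mono F)
 also have "... = ?R" by (simp add: emp_op_quadratic sum_distrib_left[symmetric])
 finally show ?thesis .
qed

lemma bounded_linear_emp_op: "bounded_linear (emp_op n F)"
proof (rule bounded_linear_intro[OF emp_op_add emp_op_scale])
 let ?X = "avg n (%l. norm (F l) * norm (F l))"
 fix p
 have "norm (emp_op n F p) <= avg n (%l. norm p * norm (F l) * norm (F l))" unfolding emp_op_def norm_scaleR
  by (intro mult_mono order_trans[OF norm_sum] sum_mono) (auto intro!: mult_right_mono Cauchy_Schwarz_ineq2 sum_nonneg)
 also have "... = norm p * ?X" by (simp add: sum_distrib_left mult_ac)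
 finally show "norm (emp_op n F p) <= norm p * ?X" .
qed

definition gd_map :: "nat => (nat => 'k::real_inner) => real => 'k => 'k" where
 "gd_map n F \<eta> p = p - \<eta> *\<^sub>R emp_op n F p"

lemma gd_map_linear:
 "gd_map n F \<eta> (p + q) = gd_map n F \<eta> p + gd_map n F \<eta> q"
 "gd_map n F \<eta> (p - q) = gd_map n F \<eta> p - gd_map n F \<eta> q"
 "gd_map n F \<eta> (a *\<^sub>R p) = a *\<^sub>R gd_map n F \<eta> p"
 "gd_map n F \<eta> 0 = 0" by (simp_all add: gd_map_def emp_op_add emp_op_diff emp_op_scale algebra_simps)

lemma gd_map_sym: "gd_map n F \<eta> p \<bullet> q = p \<bullet> gd_map n F \<eta> q"
 by (simp add: gd_map_def inner_diff_left inner_diff_right emp_op_sym)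

lemma norm_gd_map_le:
 assumes "n >= 1" "0 <= \<eta>" "\<eta> * \<kappa>^2 <= 1 / 2" and F: "!!l. l \<in> {1..n} ==> (norm (F l))^2 <= \<kappa>^2"
 shows "(norm (gd_map n F \<eta> p))^2 <= (norm p)^2 - 3 / 2 * \<eta> * (p \<bullet> emp_op n F p)"
proof -
 let ?X = "p \<bullet> emp_op n F p"
 have "(norm (gd_map n F \<eta> p))^2 = (norm p)^2 - 2 * \<eta> * ?X + \<eta>^2 * (norm (emp_op n F p))^2" unfolding gd_map_def power2_norm_eq_inner
  by (simp add: inner_diff_left inner_diff_right inner_commute power2_eq_square algebra_simps)
 moreover have "\<eta>^2 * (norm (emp_op n F p))^2 <= \<eta>^2 * (\<kappa>^2 * ?X)" using norm_emp_op_le[where F = F, OF assms(1) F] by (intro mult_left_mono) auto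
 moreover have "\<eta> * ?X * (\<eta> * \<kappa>^2) <= \<eta> * ?X * (1 / 2)" by (intro mult_left_mono assms mult_nonneg_nonneg emp_op_nonneg)
 ultimately show ?thesis by (simp add: power2_eq_square algebra_simps)
qed

lemma norm_gd_map_contraction:
 assumes "n >= 1" "0 <= \<eta>" "\<eta> * \<kappa>^2 <= 1 / 2" and F: "!!l. l \<in> {1..n} ==> (norm (F l))^2 <= \<kappa>^2"
 shows "norm (gd_map n F \<eta> p) <= norm p"
proof -
 have "0 <= \<eta> * (p \<bullet> emp_op n F p)" by (intro mult_nonneg_nonneg assms emp_op_nonneg)
 with norm_gd_map_le[where F = F, OF assms(1-3) F, where p = p] have "(norm (gd_map n F \<eta> p))^2 <= (norm p)^2" by linarith
 thus ?thesis by (rule power2_le_imp_le) simp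
qed

text \<open>Equals sqrt n times the norm of T^(1/2) p for the empirical operator T. As a Euclidean
  norm of values it has the triangle inequality without any square root of T.\<close>

definition emp_norm :: "nat => (nat => 'k::real_inner) => 'k => real" where
 "emp_norm n F p = L2_set (%l. p \<bullet> F l) {1..n}"

lemma emp_norm_triangle: "emp_norm n F (p + q) <= emp_norm n F p + emp_norm n F q"
 unfolding emp_norm_def inner_add_left by (rule L2_set_triangle_ineq)

lemma emp_norm_scale: "0 <= a ==> emp_norm n F (a *\<^sub>R p) = a * emp_norm n F p"
 unfolding emp_norm_def by (simp add: L2_set_right_distrib)

lemma emp_norm_nonneg [simp]: "0 <= emp_norm n F p"
 unfolding emp_norm_def by simp

lemma emp_norm_square: "n >= 1 ==> (emp_norm n F p)^2 = real n * (p \<bullet> emp_op n F p)"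
 unfolding emp_norm_def L2_set_def emp_op_quadratic by (simp add: sum_nonneg)

text \<open>I - \<eta> T commutes with T and is a contraction, hence contracts the seminorm of
  T^(1/2) as well; the expansion checks this without forming T^(1/2).\<close>

lemma emp_norm_gd_map:
 assumes "n >= 1" "0 <= \<eta>" "\<eta> * \<kappa>^2 <= 1 / 2" and F: "!!l. l \<in> {1..n} ==> (norm (F l))^2 <= \<kappa>^2"
 shows "emp_norm n F (gd_map n F \<eta> p) <= emp_norm n F p" (is "?L <= _")
proof -
 let ?T = "emp_op n F"
 have "gd_map n F \<eta> p \<bullet> ?T (gd_map n F \<eta> p)
  = p \<bullet> ?T p - 2 * \<eta> * (norm (?T p))^2 + \<eta>^2 * (?T p \<bullet> ?T (?T p))"
  unfolding gd_map_def emp_op_diff emp_op_scale power2_norm_eq_inner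
  by (simp add: inner_diff_left inner_diff_right emp_op_sym[of n F p "?T p", symmetric] power2_eq_square algebra_simps)
 moreover have "?T p \<bullet> ?T (?T p) <= \<kappa>^2 * (norm (?T p))^2"
 proof -
  have "(?T p \<bullet> F l)^2 <= \<kappa>^2 * (norm (?T p))^2" if "l \<in> {1..n}" for l
  proof -
   have "(?T p \<bullet> F l)^2 <= (norm (?T p))^2 * (norm (F l))^2"
    using power_mono[OF Cauchy_Schwarz_ineq2[of "?T p" "F l"], of 2] by (simp add: power_mult_distrib)
   also have "... <= (norm (?T p))^2 * \<kappa>^2" using F[OF that] by (intro mult_left_mono) auto
   finally show ?thesis by (simp add: mult.commute)
  qed
  thus ?thesis unfolding emp_op_quadratic by (intro mean_le assms(1))
 qed
 hence "\<eta>^2 * (?T p \<bullet> ?T (?T p)) <= \<eta>^2 * (\<kappa>^2 * (norm (?T p))^2)" by (intro mult_left_mono) auto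
 moreover have "\<eta> * (norm (?T p))^2 * (\<eta> * \<kappa>^2) <= \<eta> * (norm (?T p))^2 * (1 / 2)" by (intro mult_left_mono assms mult_nonneg_nonneg) auto
 moreover have "0 <= \<eta> * (norm (?T p))^2" using assms(2) by simp
 ultimately have "gd_map n F \<eta> p \<bullet> ?T (gd_map n F \<eta> p) <= p \<bullet> ?T p" by (simp add: power2_eq_square algebra_simps)
 hence "?L^2 <= (emp_norm n F p)^2" by (simp add: emp_norm_square[OF assms(1)] mult_left_mono)
 thus ?thesis by (rule power2_le_imp_le) simp
qed

primrec fgd :: "nat => real => (nat => 'k::real_inner) => (nat => real) => 'k => nat => 'k" where
 "fgd n \<eta> F c h 0 = h"
| "fgd n \<eta> F c h (Suc t) = fgd n \<eta> F c h t - \<eta> *\<^sub>R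
  ((1 / real n) *\<^sub>R (\<Sum>l=1..n. (fgd n \<eta> F c h t \<bullet> F l - c l) *\<^sub>R F l))"

lemma fgd_Suc:
 "fgd n \<eta> F c h (Suc t) = gd_map n F \<eta> (fgd n \<eta> F c h t) + \<eta> *\<^sub>R ((1 / real n) *\<^sub>R (\<Sum>l=1..n. c l *\<^sub>R F l))"
 by (simp add: gd_map_def emp_op_def scaleR_diff_left sum_subtractf algebra_simps)

text \<open>Every batch is fresh and the update is affine in the iterate, so averaging over the
  indices turns SGD into full gradient descent. Testing against all \<phi> keeps the induction
  scalar.\<close>

lemma av_fsgd:
 assumes "b >= 1" "n >= 1" "t <= T"
 shows "av n (b * T) (%J. fsgd b \<eta> F c J h t \<bullet> \<phi>) = fgd n \<eta> F c h t \<bullet> \<phi>"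
 using assms(3)
proof (induction t arbitrary: \<phi>)
 case 0
 show ?case using av_const[OF assms(2)] by simp
next
 case (Suc t)
 let ?av = "av n (b * T)"
 let ?h = "%J. fsgd b \<eta> F c J h t"
 have t: "t < T" "t <= T" using Suc.prems by auto
 have "?av (%J. fsgd b \<eta> F c J h (Suc t) \<bullet> \<phi>) = ?av (%J. ?h J \<bullet> \<phi> - \<eta> *
   ((1 / real b) * (\<Sum>i = b * t + 1..b * (t + 1). (?h J \<bullet> F (J i) - c (J i)) * (F (J i) \<bullet> \<phi>))))"
  by (intro av_cong) (simp only: fsgd.simps inner_diff_left inner_scaleR_left inner_sum_left mult.assoc)
 also have "... = ?av (%J. ?h J \<bullet> \<phi>) - \<eta> * ?av (%J. avg n (%l. (?h J \<bullet> F l - c l) * (F l \<bullet> \<phi>)))"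
  by (simp only: av_diff av_cmult[of _ _ \<eta>]
    av_block[OF t(1) assms(1) block_free_fsgd[where H = "%x l. (x \<bullet> F l - c l) * (F l \<bullet> \<phi>)"]])
 also have "?av (%J. avg n (%l. (?h J \<bullet> F l - c l) * (F l \<bullet> \<phi>)))
  = avg n (%l. (?av (%J. ?h J \<bullet> F l) - c l) * (F l \<bullet> \<phi>))"
  unfolding av_cmult av_sum mult.commute[of _ "F _ \<bullet> \<phi>"] av_diff av_const[OF assms(2)] by (rule refl)
 also have "... = avg n (%l. (fgd n \<eta> F c h t \<bullet> F l - c l) * (F l \<bullet> \<phi>))" by (simp only: Suc.IH[OF t(2)])
 finally show ?case by (simp only: Suc.IH[OF t(2)] fgd.simps inner_diff_left inner_scaleR_left inner_sum_left)
qed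

lemma av_square_decomp:
 assumes "b >= 1" "n >= 1" "t <= T"
 shows "av n (b * T) (%J. (fsgd b \<eta> F c J h t \<bullet> \<phi> - a)^2)
  = (fgd n \<eta> F c h t \<bullet> \<phi> - a)^2 + av n (b * T) (%J. ((fsgd b \<eta> F c J h t - fgd n \<eta> F c h t) \<bullet> \<phi>)^2)"
proof -
 let ?av = "av n (b * T)"
 let ?g = "fgd n \<eta> F c h t \<bullet> \<phi>"
 have *: "?av (%J. (fsgd b \<eta> F c J h t \<bullet> \<phi> - a)^2) = ?av (%J. (fsgd b \<eta> F c J h t \<bullet> \<phi>)^2) - 2 * a * ?g + a^2" (is "?L = _") for a
 proof -
  have "?L
   = ?av (%J. (fsgd b \<eta> F c J h t \<bullet> \<phi>)^2 - 2 * a * (fsgd b \<eta> F c J h t \<bullet> \<phi>) + a^2)"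
   by (intro av_cong) (simp add: power2_diff)
  thus ?thesis by (simp only: av_add av_diff av_cmult av_const[OF assms(2)] av_fsgd[OF assms])
 qed
 show ?thesis unfolding inner_diff_left * by (simp add: power2_eq_square algebra_simps)
qed

lemma av_norm_decomp:
 assumes "b >= 1" "n >= 1" "t <= T"
 shows "av n (b * T) (%J. (norm (fsgd b \<eta> F c J h t))^2)
  = (norm (fgd n \<eta> F c h t))^2 + av n (b * T) (%J. (norm (fsgd b \<eta> F c J h t - fgd n \<eta> F c h t))^2)"
proof -
 let ?av = "av n (b * T)"
 let ?g = "fgd n \<eta> F c h t"
 have "?av (%J. (norm (fsgd b \<eta> F c J h t - ?g))^2)
  = ?av (%J. (norm (fsgd b \<eta> F c J h t))^2 - 2 * (fsgd b \<eta> F c J h t \<bullet> ?g) + (norm ?g)^2)"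
  by (intro av_cong) (simp add: power2_norm_eq_inner inner_diff_left inner_diff_right inner_commute)
 thus ?thesis by (simp only: av_add av_diff av_cmult av_const[OF assms(2)] av_fsgd[OF assms]) (simp add: power2_norm_eq_inner)
qed

text \<open>
 The fluctuation of SGD around gradient descent is driven by martingale differences, so its
 second moments obey a linear recursion.
\<close>

lemma fluctuation_step:
 fixes F :: "nat => 'k::real_inner" and V :: "'k => 'v::real_inner" and c :: "nat => real" and h :: 'k and \<eta> :: real
 assumes "b >= 1" "n >= 1" "t < T" and V: "linear V"
 defines "d \<equiv> %t J. fsgd b \<eta> F c J h t - fgd n \<eta> F c h t"
 shows "av n (b * T) (%J. (norm (V (d (Suc t) J)))^2)
  <= av n (b * T) (%J. (norm (V (gd_map n F \<eta> (d t J))))^2)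
   + \<eta>^2 / real b * (avg n (%l. (norm (V (F l)))^2 *
     av n (b * T) (%J. (fsgd b \<eta> F c J h t \<bullet> F l - c l)^2)))"
proof -
 let ?av = "av n (b * T)"
 let ?h = "%J. fsgd b \<eta> F c J h t"
 let ?B = "{b * t + 1..b * (t + 1)}"
 define G where "G = (%J l. (?h J \<bullet> F l - c l) *\<^sub>R V (F l))"
 define x where "x = (%J. V (gd_map n F \<eta> (d t J)))"
 define \<zeta> where "\<zeta> = (%J. (1 / real b) *\<^sub>R (\<Sum>i\<in>?B. G J (J i)) - (1 / real n) *\<^sub>R (\<Sum>l=1..n. G J l))"
 have dstep: "d (Suc t) J = gd_map n F \<eta> (d t J) - \<eta> *\<^sub>R ((1 / real b) *\<^sub>R
   (\<Sum>i\<in>?B. (?h J \<bullet> F (J i) - c (J i)) *\<^sub>R F (J i)) - (1 / real n) *\<^sub>R (\<Sum>l=1..n. (?h J \<bullet> F l - c l) *\<^sub>R F l))" for J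
 proof -
  have "(1 / real n) *\<^sub>R (\<Sum>l=1..n. (?h J \<bullet> F l - c l) *\<^sub>R F l)
   = emp_op n F (d t J) + (1 / real n) *\<^sub>R (\<Sum>l=1..n. (fgd n \<eta> F c h t \<bullet> F l - c l) *\<^sub>R F l)"
   unfolding emp_op_def scaleR_add_right[symmetric] sum.distrib[symmetric] d_def by (simp add: inner_diff_left algebra_simps)
  thus ?thesis unfolding gd_map_def d_def fsgd.simps fgd.simps by (simp add: algebra_simps)
 qed
 have Vd: "V (d (Suc t) J) = x J - \<eta> *\<^sub>R \<zeta> J" for J
  unfolding dstep x_def \<zeta>_def G_def linear_diff[OF V] linear_scale[OF V] linear_sum[OF V] by (rule refl)
 have freeG: "block_free n b T t G" unfolding G_def by (rule block_free_fsgd)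
 have freex: "block_free n b T t x" unfolding x_def d_def by (rule block_free_fsgd)
 have free: "block_free n b T t (%J l. x J \<bullet> G J l)" using freex freeG unfolding block_free_def by auto
 have cross: "?av (%J. x J \<bullet> \<zeta> J) = 0" (is "?L = _")
 proof -
  have "?L = ?av (%J. (1 / real b) * (\<Sum>i\<in>?B. x J \<bullet> G J (J i)))
    - ?av (%J. avg n (%l. x J \<bullet> G J l))"
   unfolding av_diff[symmetric] \<zeta>_def by (simp only: inner_diff_right inner_scaleR_right inner_sum_right)
  thus ?thesis using av_block[OF assms(3,1) free] by simp
 qed
 have "?av (%J. (norm (V (d (Suc t) J)))^2) = ?av (%J. (norm (x J))^2 - 2 * \<eta> * (x J \<bullet> \<zeta> J) + \<eta>^2 * (norm (\<zeta> J))^2)"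
  unfolding Vd power2_norm_eq_inner by (intro av_cong) (simp add: inner_diff_left inner_diff_right inner_commute power2_eq_square algebra_simps)
 also have "... = ?av (%J. (norm (x J))^2) + \<eta>^2 * ?av (%J. (norm (\<zeta> J))^2)" by (simp add: av_add av_diff av_cmult cross)
 also have "?av (%J. (norm (\<zeta> J))^2) <= (1 / real b) * ?av (%J. avg n (%l. (norm (G J l))^2))"
  unfolding \<zeta>_def by (rule av_block_variance[OF assms(3,1,2) freeG])
 also have "?av (%J. avg n (%l. (norm (G J l))^2))
  = avg n (%l. (norm (V (F l)))^2 * ?av (%J. (?h J \<bullet> F l - c l)^2))"
  unfolding G_def norm_scaleR power_mult_distrib power2_abs mult.commute[of "(_ - c _)^2"] by (simp only: av_cmult av_sum)
 finally show ?thesis by (simp add: x_def mult_left_mono)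
qed

text \<open>The directional bound is stationary under the recursion: the noise injected in a step,
  (3/2) \<Gamma> \<eta>^2/b times the quadratic form of \<phi>, is what the contraction of \<phi>
  under \<open>gd_map\<close> releases. So \<phi> has to vary in the induction, which also uses the
  bound at \<phi> = F l. The sum over j stays inside because for a family of labels only the sum of
  the squared residuals is bounded well.\<close>

lemma fluctuation_bounds:
 fixes F :: "nat => 'k::real_inner" and c :: "'j => nat => real" and h :: 'k and \<eta> :: real
 assumes "b >= 1" "n >= 1" "0 <= \<eta>" "\<eta> * \<kappa>^2 <= 1 / 2" "t <= T"
  and F: "!!l. l \<in> {1..n} ==> (norm (F l))^2 <= \<kappa>^2"
  and \<Gamma>: "!!s l. s <= T ==> l \<in> {1..n} ==> (\<Sum>j\<in>I. (fgd n \<eta> F (c j) h s \<bullet> F l - c j l)^2) <= \<Gamma>"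
 defines "d \<equiv> %j t J. fsgd b \<eta> F (c j) J h t - fgd n \<eta> F (c j) h t"
 shows "(\<Sum>j\<in>I. av n (b * T) (%J. (d j t J \<bullet> \<phi>)^2)) <= \<eta> / real b * \<Gamma> * (norm \<phi>)^2"
  and "(\<Sum>j\<in>I. av n (b * T) (%J. (norm (d j t J))^2)) <= 3 / 2 * real t * (\<eta>^2 / real b) * \<kappa>^2 * \<Gamma>"
proof goal_cases
 let ?X = "%b \<phi>. \<eta> / real b * \<Gamma> * (norm \<phi>)^2"
 case 1 let ?av = "av n (b * T)"
 have \<Gamma>0: "0 <= \<Gamma>" by (rule order_trans[OF sum_nonneg \<Gamma>[of 0 1]]) (use assms(2) in auto)
 have d0: "d j 0 J = 0" for j J by (simp add: d_def)
 have swap: "(\<Sum>j\<in>I. x j + a * (b * (\<Sum>l=1..n. y l * z j l)))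
  = (\<Sum>j\<in>I. x j) + a * (b * (\<Sum>l=1..n. y l * (\<Sum>j\<in>I. z j l)))" for x y z and a b :: real
  unfolding sum.distrib sum_distrib_left[symmetric] by (subst sum.swap) (simp only: sum_distrib_left)
 have res: "(\<Sum>j\<in>I. ?av (%J. (fsgd b \<eta> F (c j) J h t \<bullet> F l - c j l)^2)) <= 3 / 2 * \<Gamma>"
  if l: "l \<in> {1..n}" and t: "t < T" and IH: "!!\<phi>. (\<Sum>j\<in>I. ?av (%J. (d j t J \<bullet> \<phi>)^2)) <= ?X b \<phi>" for l t
 proof -
  have "(\<Sum>j\<in>I. ?av (%J. (fsgd b \<eta> F (c j) J h t \<bullet> F l - c j l)^2))
   = (\<Sum>j\<in>I. (fgd n \<eta> F (c j) h t \<bullet> F l - c j l)^2) + (\<Sum>j\<in>I. ?av (%J. (d j t J \<bullet> F l)^2))"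
   unfolding d_def sum.distrib[symmetric] using t by (intro sum.cong refl av_square_decomp[OF assms(1,2)]) auto
  also have "... <= \<Gamma> + \<eta> / real b * \<Gamma> * (norm (F l))^2" using t l by (intro add_mono \<Gamma> IH) auto
  also have "\<eta> / real b * \<Gamma> * (norm (F l))^2 <= 1 / 2 * \<Gamma>"
  proof -
   have "\<eta> / real b * (norm (F l))^2 <= \<eta> / 1 * \<kappa>^2" using assms(1,3) F[OF l] by (intro mult_mono divide_left_mono) auto
   hence "\<eta> / real b * (norm (F l))^2 <= 1 / 2" using assms(4) by (metis div_by_1 order_trans)
   from mult_right_mono[OF this \<Gamma>0] show ?thesis by (simp add: mult_ac)
  qed
  finally show ?thesis by simp
 qed
 have main: "(\<Sum>j\<in>I. ?av (%J. (d j t J \<bullet> \<phi>)^2)) <= ?X b \<phi>" if "t <= T" for t \<phi> using that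
 proof (induction t arbitrary: \<phi>)
  case 0
  thus ?case by (simp add: d0 av_const[OF assms(2)] assms(3) \<Gamma>0)
 next
  case (Suc t)
  hence t: "t < T" "t <= T" by auto
  have IH: "(\<Sum>j\<in>I. ?av (%J. (d j t J \<bullet> \<phi>)^2)) <= ?X b \<phi>" for \<phi> using Suc.IH t by blast
  let ?q = "\<phi> \<bullet> emp_op n F \<phi>"
  have "(\<Sum>j\<in>I. ?av (%J. (d j (Suc t) J \<bullet> \<phi>)^2))
   <= (\<Sum>j\<in>I. ?av (%J. (gd_map n F \<eta> (d j t J) \<bullet> \<phi>)^2)
    + \<eta>^2 / real b * (avg n (%l. (F l \<bullet> \<phi>)^2 * ?av (%J. (fsgd b \<eta> F (c j) J h t \<bullet> F l - c j l)^2))))"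
   using fluctuation_step[OF assms(1,2) t(1), where V = "%x. x \<bullet> \<phi>"]
   by (intro sum_mono) (simp add: d_def bounded_linear.linear[OF bounded_linear_inner_left])
  also have "... = (\<Sum>j\<in>I. ?av (%J. (d j t J \<bullet> gd_map n F \<eta> \<phi>)^2))
    + \<eta>^2 / real b * (avg n (%l. (F l \<bullet> \<phi>)^2 * (\<Sum>j\<in>I. ?av (%J. (fsgd b \<eta> F (c j) J h t \<bullet> F l - c j l)^2))))"
   unfolding gd_map_sym by (rule swap)
  also have "... <= \<eta> / real b * \<Gamma> * (norm (gd_map n F \<eta> \<phi>))^2
    + \<eta>^2 / real b * (avg n (%l. (F l \<bullet> \<phi>)^2 * (3 / 2 * \<Gamma>)))"
   using res[OF _ t(1) IH] assms(1) by (intro add_mono IH mult_left_mono sum_mono) auto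
  also have "avg n (%l. (F l \<bullet> \<phi>)^2 * (3 / 2 * \<Gamma>)) = ?q * (3 / 2 * \<Gamma>)"
   unfolding emp_op_quadratic sum_distrib_right[symmetric] by (simp add: inner_commute)
  also have "\<eta> / real b * \<Gamma> * (norm (gd_map n F \<eta> \<phi>))^2 + \<eta>^2 / real b * (?q * (3 / 2 * \<Gamma>))
   <= \<eta> / real b * \<Gamma> * ((norm \<phi>)^2 - 3 / 2 * \<eta> * ?q) + \<eta>^2 / real b * (?q * (3 / 2 * \<Gamma>))"
   using norm_gd_map_le[where F = F, OF assms(2-4) F] assms(3) \<Gamma>0 by (intro add_mono mult_left_mono order_refl) auto
  also have "... = ?X b \<phi>" by (simp add: power2_eq_square algebra_simps)
  finally show ?case .
 qed
 show ?case by (rule main[OF assms(5)])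
 case 2 show ?case using assms(5)
 proof (induction t)
  case 0
  thus ?case by (simp add: d0 av_const[OF assms(2)])
 next
  case (Suc t)
  hence t: "t < T" "t <= T" by auto
  have "(\<Sum>j\<in>I. ?av (%J. (norm (d j (Suc t) J))^2))
   <= (\<Sum>j\<in>I. ?av (%J. (norm (gd_map n F \<eta> (d j t J)))^2)
    + \<eta>^2 / real b * (avg n (%l. (norm (F l))^2 * ?av (%J. (fsgd b \<eta> F (c j) J h t \<bullet> F l - c j l)^2))))"
   using fluctuation_step[OF assms(1,2) t(1), where V = "%x. x"] by (intro sum_mono) (simp add: d_def linear_id[unfolded id_def])
  also have "... = (\<Sum>j\<in>I. ?av (%J. (norm (gd_map n F \<eta> (d j t J)))^2))
    + \<eta>^2 / real b * (avg n (%l. (norm (F l))^2 * (\<Sum>j\<in>I. ?av (%J. (fsgd b \<eta> F (c j) J h t \<bullet> F l - c j l)^2))))"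
   by (rule swap)
  also have "... <= (\<Sum>j\<in>I. ?av (%J. (norm (d j t J))^2))
    + \<eta>^2 / real b * (\<kappa>^2 * (3 / 2 * \<Gamma>))"
   using res[OF _ t(1) main[OF t(2)]] assms(1) F \<Gamma>0 power_mono[OF norm_gd_map_contraction[where F = F, OF assms(2-4) F] norm_ge_zero, where n = 2]
   by (intro add_mono mult_left_mono sum_mono mean_le assms(2) av_mono mult_mono) (auto intro!: sum_nonneg av_nonneg)
  also have "... <= 3 / 2 * real t * (\<eta>^2 / real b) * \<kappa>^2 * \<Gamma> + \<eta>^2 / real b * (\<kappa>^2 * (3 / 2 * \<Gamma>))" using Suc t by (intro add_mono) auto
  also have "... = 3 / 2 * real (Suc t) * (\<eta>^2 / real b) * \<kappa>^2 * \<Gamma>" by (simp add: algebra_simps)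
  finally show ?case .
 qed
qed

section \<open>Resolvents and leverage scores\<close>

lemma lax_milgram:
 fixes A :: "'k::{real_inner,banach} => 'k"
 assumes A: "bounded_linear A" and pos: "!!x. 0 <= x \<bullet> A x" and "\<theta> > 0"
 shows "\<exists>!c. A c + \<theta> *\<^sub>R c = \<phi>"
proof -
 interpret A: bounded_linear A by (rule A)
 obtain K where K: "K > 0" "!!x. norm (A x) <= norm x * K" using A.pos_bounded by blast
 define m where "m = K + \<theta>"
 have m: "m > 0" "\<theta> < m" using K assms(3) by (auto simp: m_def)
 \<comment> \<open>Step size of a Richardson iteration. It minimises 1 - 2 \<tau> \<theta> +
   \<tau>^2 m^2, where m bounds the norm of A + \<theta>, and the minimum is q.\<close>
 define \<tau> where "\<tau> = \<theta> / m^2"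
 have \<tau>: "\<tau> > 0" using m assms(3) by (simp add: \<tau>_def)
 define q where "q = 1 - \<theta>^2 / m^2"
 have q: "0 <= q" "q < 1" using m assms(3) by (auto simp: q_def power_mono)
 define f where "f = (%c. c - \<tau> *\<^sub>R (A c + \<theta> *\<^sub>R c - \<phi>))"
 have "dist (f x) (f y) <= sqrt q * dist x y" for x y
 proof -
  define d where "d = x - y"
  define B where "B = A d + \<theta> *\<^sub>R d"
  have fd: "f x - f y = d - \<tau> *\<^sub>R B" by (simp add: f_def d_def B_def A.diff algebra_simps)
  have "norm B <= norm d * m" using norm_triangle_ineq[of "A d" "\<theta> *\<^sub>R d"] K(2)[of d] assms(3) by (simp add: B_def m_def algebra_simps)
  hence "(norm B)^2 <= (norm d)^2 * m^2" using power_mono[of "norm B" "norm d * m" 2] by (simp add: power_mult_distrib)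
  from mult_left_mono[OF this, of "\<tau>^2"]
  have 1: "\<tau>^2 * (norm B)^2 <= \<theta>^2 / m^2 * (norm d)^2" using m by (simp add: \<tau>_def power2_eq_square field_simps)
  have "\<theta> * (norm d)^2 <= d \<bullet> B" using pos[of d] by (simp add: B_def inner_add_right power2_norm_eq_inner)
  from mult_left_mono[OF this, of \<tau>] \<tau>
  have 2: "\<theta>^2 / m^2 * (norm d)^2 <= \<tau> * (d \<bullet> B)" by (simp add: \<tau>_def power2_eq_square field_simps)
  have "(norm (f x - f y))^2 = (norm d)^2 - 2 * (\<tau> * (d \<bullet> B)) + \<tau>^2 * (norm B)^2" unfolding fd power2_norm_eq_inner
   by (simp add: inner_diff_left inner_diff_right inner_commute power2_eq_square algebra_simps)
  also have "... <= q * (norm d)^2" using 1 2 by (simp add: q_def left_diff_distrib)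
  finally have "norm (f x - f y) <= sqrt (q * (norm d)^2)" by (rule real_le_rsqrt)
  thus ?thesis by (simp add: dist_norm d_def real_sqrt_mult)
 qed
 hence "\<exists>!x. f x = x" using q by (intro banach_fix_type[of "sqrt q"]) auto
 moreover have "f x = x \<longleftrightarrow> A x + \<theta> *\<^sub>R x = \<phi>" for x using \<tau> by (auto simp: f_def)
 ultimately show ?thesis by simp
qed

definition resolvent :: "('k::{real_inner,banach} => 'k) => real => 'k => 'k" where
 "resolvent A \<theta> \<phi> = (THE c. A c + \<theta> *\<^sub>R c = \<phi>)"

locale psd_op =
 fixes A :: "'k::{real_inner,banach} => 'k" and \<theta> :: real
 assumes bounded_linear: "bounded_linear A"
  and pos: "!!x. 0 <= x \<bullet> A x"
  and sym: "!!x y. A x \<bullet> y = x \<bullet> A y"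
  and lam: "\<theta> > 0"
begin

lemma resolvent_eq: "A (resolvent A \<theta> \<phi>) + \<theta> *\<^sub>R resolvent A \<theta> \<phi> = \<phi>"
 unfolding resolvent_def by (rule theI'[OF lax_milgram[OF bounded_linear pos lam]])

lemma resolvent_unique: "A c + \<theta> *\<^sub>R c = \<phi> ==> resolvent A \<theta> \<phi> = c"
 using lax_milgram[OF bounded_linear pos lam, of \<phi>] resolvent_eq[of \<phi>] by blast

lemma op_resolvent: "A (resolvent A \<theta> \<phi>) = \<phi> - \<theta> *\<^sub>R resolvent A \<theta> \<phi>"
 using resolvent_eq[of \<phi>] by (simp add: eq_diff_eq)

lemma resolvent_sym: "resolvent A \<theta> x \<bullet> y = x \<bullet> resolvent A \<theta> y"
proof -
 let ?x = "resolvent A \<theta> x" and ?y = "resolvent A \<theta> y"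
 have "?x \<bullet> y = ?x \<bullet> (A ?y + \<theta> *\<^sub>R ?y)" by (simp only: resolvent_eq)
 also have "... = (A ?x + \<theta> *\<^sub>R ?x) \<bullet> ?y" by (simp add: inner_add_left inner_add_right sym)
 finally show ?thesis by (simp only: resolvent_eq)
qed

lemma resolvent_lower: "\<theta> * (norm (resolvent A \<theta> \<phi>))^2 <= \<phi> \<bullet> resolvent A \<theta> \<phi>"
proof -
 let ?c = "resolvent A \<theta> \<phi>"
 have "\<phi> \<bullet> ?c = (A ?c + \<theta> *\<^sub>R ?c) \<bullet> ?c" by (simp only: resolvent_eq)
 also have "... = ?c \<bullet> A ?c + \<theta> * (norm ?c)^2" by (simp only: inner_add_left inner_scaleR_left power2_norm_eq_inner inner_commute[of "A ?c"])
 finally show ?thesis using pos[of ?c] by simp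
qed

lemma resolvent_nonneg: "0 <= \<phi> \<bullet> resolvent A \<theta> \<phi>"
 using resolvent_lower[of \<phi>] lam by (meson mult_nonneg_nonneg less_imp_le order_trans zero_le_power2)

lemma norm_resolvent_le: "norm (resolvent A \<theta> \<phi>) <= norm \<phi> / \<theta>"
proof -
 let ?c = "resolvent A \<theta> \<phi>"
 have "\<theta> * (norm ?c)^2 <= norm \<phi> * norm ?c" using resolvent_lower[of \<phi>] Cauchy_Schwarz_ineq2[of \<phi> ?c] by linarith
 hence "norm ?c = 0 \<or> \<theta> * norm ?c <= norm \<phi>" using mult_le_cancel_right_pos[of "norm ?c" "\<theta> * norm ?c" "norm \<phi>"]
  by (simp only: power2_eq_square mult.assoc) (metis less_eq_real_def norm_ge_zero)
 thus ?thesis using lam by (auto simp: field_simps)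
qed

lemma resolvent_le: "\<phi> \<bullet> resolvent A \<theta> \<phi> <= (norm \<phi>)^2 / \<theta>"
proof -
 have "\<phi> \<bullet> resolvent A \<theta> \<phi> <= norm \<phi> * norm (resolvent A \<theta> \<phi>)" using Cauchy_Schwarz_ineq2[of \<phi> "resolvent A \<theta> \<phi>"] by linarith
 also have "... <= norm \<phi> * (norm \<phi> / \<theta>)" by (intro mult_left_mono norm_resolvent_le) simp
 finally show ?thesis by (simp add: power2_eq_square)
qed

text \<open>The resolvent's quadratic form is the Legendre transform of the shifted operator's.\<close>

lemma resolvent_variational:
 "2 * (\<phi> \<bullet> d) - (d \<bullet> A d + \<theta> * (norm d)^2) <= \<phi> \<bullet> resolvent A \<theta> \<phi>"
proof -
 interpret A: bounded_linear A by (rule bounded_linear)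
 let ?c = "resolvent A \<theta> \<phi>"
 have "0 <= (?c - d) \<bullet> A (?c - d) + \<theta> * ((?c - d) \<bullet> (?c - d))" using pos[of "?c - d"] lam by (intro add_nonneg_nonneg mult_nonneg_nonneg) auto
 also have "... = (A ?c + \<theta> *\<^sub>R ?c) \<bullet> ?c - 2 * ((A ?c + \<theta> *\<^sub>R ?c) \<bullet> d) + (d \<bullet> A d + \<theta> * (norm d)^2)"
  by (simp add: A.diff inner_diff_left inner_diff_right inner_add_left sym power2_norm_eq_inner
    inner_commute[of d ?c] algebra_simps) (simp add: sym[symmetric] inner_commute)
 finally show ?thesis unfolding resolvent_eq by simp
qed

text \<open>The variational inequality with d scaled optimally.\<close>

lemma resolvent_cauchy_schwarz:
 "(\<phi> \<bullet> d)^2 <= (\<phi> \<bullet> resolvent A \<theta> \<phi>) * (d \<bullet> A d + \<theta> * (norm d)^2)"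
proof (cases "d = 0")
 case False
 interpret A: bounded_linear A by (rule bounded_linear)
 define D where "D = d \<bullet> A d + \<theta> * (norm d)^2"
 have D: "D > 0" using pos[of d] lam False by (simp add: D_def add_nonneg_pos)
 define s where "s = (\<phi> \<bullet> d) / D"
 have "2 * (\<phi> \<bullet> (s *\<^sub>R d)) - s^2 * D <= \<phi> \<bullet> resolvent A \<theta> \<phi>" using resolvent_variational[of \<phi> "s *\<^sub>R d"] lam
  by (simp add: A.scale D_def power2_eq_square algebra_simps)
 hence "(\<phi> \<bullet> d)^2 / D <= \<phi> \<bullet> resolvent A \<theta> \<phi>" using D by (simp add: s_def power2_eq_square field_simps)
 thus ?thesis using D by (simp add: D_def[symmetric] field_simps)
qed simp

end

lemma psd_op_emp: "\<theta> > 0 ==> psd_op (emp_op n F) \<theta>"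
 by unfold_locales (auto simp: bounded_linear_emp_op[THEN bounded_linear.bounded]
   emp_op_nonneg emp_op_sym emp_op_add emp_op_scale intro: bounded_linear_emp_op[THEN bounded_linear.bounded])

text \<open>The ridge leverage score of \<phi>. Its mean over the sample points is the empirical
  effective dimension, the trace of T(T + \<theta>)^(-1).\<close>

definition leverage :: "nat => (nat => 'k::{real_inner,banach}) => real => 'k => real" where
 "leverage n F \<theta> \<phi> = \<phi> \<bullet> resolvent (emp_op n F) \<theta> \<phi>"

lemma leverage_nonneg: "\<theta> > 0 ==> 0 <= leverage n F \<theta> \<phi>"
 unfolding leverage_def by (rule psd_op.resolvent_nonneg[OF psd_op_emp])

lemma leverage_le: "\<theta> > 0 ==> leverage n F \<theta> \<phi> <= (norm \<phi>)^2 / \<theta>"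
 unfolding leverage_def by (rule psd_op.resolvent_le[OF psd_op_emp])

text \<open>Let c be the resolvent of \<phi> and p its leverage for F. Putting \<phi> into the
  sample raises the quadratic form at c by at most p^2/n. The variational bound tested at c/x with x
  = 1 + p/n then yields p/x, and p/n is at most \<kappa>^2/(n \<theta>).\<close>

lemma leverage_replace_one:
 assumes "n >= 1" "\<theta> > 0" "i \<in> {1..n}" "(norm \<phi>)^2 <= \<kappa>^2"
  and eq: "!!l. l \<in> {1..n} ==> l \<noteq> i ==> F' l = F l" and "F' i = \<phi>"
 shows "leverage n F \<theta> \<phi> <= (1 + \<kappa>^2 / (real n * \<theta>)) * leverage n F' \<theta> \<phi>"
proof -
 let ?X = "leverage n F' \<theta> \<phi>"
 let ?U = "%c. c \<bullet> emp_op n F' c + \<theta> * (norm c)^2"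
 interpret E: psd_op "emp_op n F" \<theta> by (rule psd_op_emp[OF assms(2)])
 interpret E': psd_op "emp_op n F'" \<theta> by (rule psd_op_emp[OF assms(2)])
 define c where "c = resolvent (emp_op n F) \<theta> \<phi>"
 define p where "p = leverage n F \<theta> \<phi>"
 have p0: "0 <= p" unfolding p_def by (rule leverage_nonneg[OF assms(2)])
 have p: "p = \<phi> \<bullet> c" by (simp add: p_def c_def leverage_def)
 have "p <= (norm \<phi>)^2 / \<theta>" unfolding p_def by (rule leverage_le[OF assms(2)])
 also have "... <= \<kappa>^2 / \<theta>" using assms(2,4) by (simp add: divide_right_mono)
 finally have pn: "p / real n <= \<kappa>^2 / (real n * \<theta>)" using assms(1) by (simp add: field_simps)
 define x where "x = 1 + p / real n"
 have x: "x >= 1" using p0 by (simp add: x_def)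
 have "(\<Sum>l=1..n. (c \<bullet> F' l)^2) = (c \<bullet> F' i)^2 + (\<Sum>l\<in>{1..n} - {i}. (c \<bullet> F' l)^2)" using assms(3) by (intro sum.remove) auto
 also have "(\<Sum>l\<in>{1..n} - {i}. (c \<bullet> F' l)^2) = (\<Sum>l\<in>{1..n} - {i}. (c \<bullet> F l)^2)" by (intro sum.cong) (auto simp: eq)
 also have "... <= (\<Sum>l=1..n. (c \<bullet> F l)^2)" by (intro sum_mono2) auto
 finally have "avg n (%l. (c \<bullet> F' l)^2) <= (1 / real n) * ((c \<bullet> F' i)^2 + (\<Sum>l=1..n. (c \<bullet> F l)^2))" by (intro mult_left_mono) auto
 hence "c \<bullet> emp_op n F' c <= c \<bullet> emp_op n F c + p^2 / real n" unfolding emp_op_quadratic assms(6) p by (simp add: inner_commute algebra_simps)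
 moreover have "c \<bullet> emp_op n F c + \<theta> * (norm c)^2 = p"
  unfolding p c_def E.op_resolvent by (simp add: inner_diff_right power2_norm_eq_inner inner_commute)
 ultimately have "?U c <= p * x" by (simp add: x_def power2_eq_square algebra_simps)
 hence "(1 / x^2) * (?U c) <= (1 / x^2) * (p * x)" by (intro mult_left_mono) auto
 moreover have "2 * (\<phi> \<bullet> ((1 / x) *\<^sub>R c)) - (1 / x^2) * (?U c) <= ?X" using E'.resolvent_variational[of \<phi> "(1 / x) *\<^sub>R c"]
  by (simp add: leverage_def emp_op_scale power2_eq_square algebra_simps)
 ultimately have "p / x <= ?X" using x by (simp add: p[symmetric] power2_eq_square)
 hence "p <= x * ?X" using x by (simp add: field_simps)
 also have "... <= (1 + \<kappa>^2 / (real n * \<theta>)) * ?X" using pn by (intro mult_right_mono leverage_nonneg assms(2)) (simp add: x_def)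
 finally show ?thesis by (simp add: p_def)
qed

text \<open>
 Gradient descent with the unit label vectors computes the transpose of the label-to-iterate map;
 the sequence \<open>a\<close> below is gradient ascent for a single linear functional.
\<close>

context
 fixes n :: nat and F :: "nat => 'k::{real_inner,banach}" and \<kappa> \<eta> \<theta> :: real
 assumes n: "n >= 1" and eta: "0 <= \<eta>" "\<eta> * \<kappa>^2 <= 1 / 2" and lam: "\<theta> > 0"
  and F: "!!l. l \<in> {1..n} ==> (norm (F l))^2 <= \<kappa>^2"
begin

interpretation E: psd_op "emp_op n F" \<theta> by (rule psd_op_emp[OF lam])

primrec ascent :: "'k => nat => 'k" where
 "ascent \<phi> 0 = 0"
| "ascent \<phi> (Suc s) = gd_map n F \<eta> (ascent \<phi> s) + \<eta> *\<^sub>R \<phi>"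

lemma ascent_gd_map: "ascent (gd_map n F \<eta> \<phi>) s = gd_map n F \<eta> (ascent \<phi> s)"
 by (induction s) (simp_all add: gd_map_linear)

abbreviation (input) unit_label :: "nat => nat => real" where
 "unit_label j l \<equiv> (if l = j then 1 else 0)"

lemma fgd_unit: "j \<in> {1..n} ==> fgd n \<eta> F (unit_label j) 0 s = (1 / real n) *\<^sub>R ascent (F j) s"
proof (induction s)
 case (Suc s)
 have "(\<Sum>l=1..n. unit_label j l *\<^sub>R F l) = F j" using Suc.prems by (subst sum.remove[of _ j]) (auto intro!: sum.neutral)
 thus ?case unfolding fgd_Suc using Suc by (simp add: gd_map_linear scaleR_add_right mult.commute)
qed simp

lemma ascent_sym: "ascent \<phi> s \<bullet> \<psi> = \<phi> \<bullet> ascent \<psi> s"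
proof (induction s arbitrary: \<phi> \<psi>)
 case (Suc s)
 show ?case by (simp add: inner_add_left inner_add_right gd_map_sym Suc ascent_gd_map)
qed simp

lemma ascent_diff:
 "ascent \<phi> (Suc s) - resolvent (emp_op n F) \<theta> \<phi>
  = gd_map n F \<eta> (ascent \<phi> s - resolvent (emp_op n F) \<theta> \<phi>) + (\<eta> * \<theta>) *\<^sub>R resolvent (emp_op n F) \<theta> \<phi>"
 by (simp add: gd_map_linear gd_map_def[of n F \<eta> "resolvent (emp_op n F) \<theta> \<phi>"] E.op_resolvent algebra_simps)

text \<open>The resolvent c solves (T + \<theta>) c = \<phi>, so unregularised ascent drifts away
  from it by \<eta> \<theta> c per step, at most c in total while s \<eta> \<theta> \<le> 1. The
  start contributes -c, and adding c back gives the factor 3.\<close>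

lemma emp_norm_ascent:
 assumes "real s * \<eta> * \<theta> <= 1"
 shows "emp_norm n F (ascent \<phi> s) <= 3 * emp_norm n F (resolvent (emp_op n F) \<theta> \<phi>)"
proof -
 let ?c = "resolvent (emp_op n F) \<theta> \<phi>"
 let ?N = "emp_norm n F"
 have "?N (ascent \<phi> s - ?c) <= (1 + real s * (\<eta> * \<theta>)) * ?N ?c" for s
 proof (induction s)
  case 0
  have "?N (- ?c) = ?N ?c" unfolding emp_norm_def L2_set_def by simp
  thus ?case by simp
 next
  case (Suc s)
  have "?N (ascent \<phi> (Suc s) - ?c) <= ?N (gd_map n F \<eta> (ascent \<phi> s - ?c)) + (\<eta> * \<theta>) * ?N ?c"
   unfolding ascent_diff using eta lam by (intro order_trans[OF emp_norm_triangle]) (simp add: emp_norm_scale)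
  also have "?N (gd_map n F \<eta> (ascent \<phi> s - ?c)) <= ?N (ascent \<phi> s - ?c)" by (rule emp_norm_gd_map[OF n eta F])
  finally show ?case using Suc by (simp add: algebra_simps)
 qed
 from this[of s] have "?N (ascent \<phi> s - ?c) <= (1 + real s * (\<eta> * \<theta>)) * ?N ?c" .
 also have "... <= 2 * ?N ?c" using assms by (intro mult_right_mono) (auto simp: mult.assoc)
 finally show ?thesis using emp_norm_triangle[of n F "ascent \<phi> s - ?c" ?c] by simp
qed

lemma norm_ascent:
 assumes "real s * \<eta> * \<theta> <= 1"
 shows "norm (ascent \<phi> s) <= 3 * norm (resolvent (emp_op n F) \<theta> \<phi>)"
proof -
 let ?c = "resolvent (emp_op n F) \<theta> \<phi>"
 have "norm (ascent \<phi> s - ?c) <= (1 + real s * (\<eta> * \<theta>)) * norm ?c" for s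
 proof (induction s)
  case (Suc s)
  have "norm (ascent \<phi> (Suc s) - ?c) <= norm (gd_map n F \<eta> (ascent \<phi> s - ?c)) + (\<eta> * \<theta>) * norm ?c"
   unfolding ascent_diff using eta lam by (intro order_trans[OF norm_triangle_ineq]) simp
  also have "norm (gd_map n F \<eta> (ascent \<phi> s - ?c)) <= norm (ascent \<phi> s - ?c)" by (rule norm_gd_map_contraction[OF n eta F])
  finally show ?case using Suc by (simp add: algebra_simps)
 qed simp
 from this[of s] have "norm (ascent \<phi> s - ?c) <= (1 + real s * (\<eta> * \<theta>)) * norm ?c" .
 also have "... <= 2 * norm ?c" using assms by (intro mult_right_mono) (auto simp: mult.assoc)
 finally show ?thesis using norm_triangle_ineq[of "ascent \<phi> s - ?c" ?c] by simp
qed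

text \<open>By symmetry of the ascent map the sum over j is the squared empirical norm of a single
  ascent vector. The 9 is the square of the 3 in \<open>emp_norm_ascent\<close>.\<close>

lemma sum_fgd_unit:
 assumes "real s * \<eta> * \<theta> <= 1"
 shows "(\<Sum>j=1..n. (fgd n \<eta> F (unit_label j) 0 s \<bullet> \<phi>)^2) <= 9 / real n * leverage n F \<theta> \<phi>" (is "?L <= ?R")
proof -
 let ?c = "resolvent (emp_op n F) \<theta> \<phi>"
 have "?L = (\<Sum>j=1..n. (1 / (real n)^2) * (ascent \<phi> s \<bullet> F j)^2)"
 proof (intro sum.cong refl, goal_cases)
  case (1 j)
  thus ?case by (subst fgd_unit) (auto simp: ascent_sym inner_commute[of "F j"] power_mult_distrib power_divide)
 qed
 also have "... = (1 / (real n)^2) * (emp_norm n F (ascent \<phi> s))^2"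
  unfolding sum_distrib_left[symmetric] by (simp add: emp_norm_def L2_set_def sum_nonneg)
 also have "... <= (1 / (real n)^2) * (3 * emp_norm n F ?c)^2" by (intro mult_left_mono power_mono emp_norm_ascent assms) auto
 also have "... = 9 / real n * (?c \<bullet> emp_op n F ?c)" using n unfolding power_mult_distrib emp_norm_square[OF n] by (simp add: power2_eq_square)
 also have "... <= ?R" using lam by (intro mult_left_mono) (auto simp: E.op_resolvent leverage_def inner_diff_right inner_commute)
 finally show ?thesis .
qed

lemma sum_norm_fgd_unit:
 assumes "real s * \<eta> * \<theta> <= 1"
 shows "(\<Sum>j=1..n. (norm (fgd n \<eta> F (unit_label j) 0 s))^2)
  <= 9 / (real n * \<theta>) * (avg n (%j. leverage n F \<theta> (F j)))"
proof -
 let ?X = "%j. 9 / ((real n)^2 * \<theta>) * leverage n F \<theta> (F j)"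
 let ?U = "%j. (norm (fgd n \<eta> F (unit_label j) 0 s))^2"
 have "(?U j) <= ?X j" if "j \<in> {1..n}" for j
 proof -
  have "(?U j) = (1 / (real n)^2) * (norm (ascent (F j) s))^2" using that by (subst fgd_unit) (auto simp: power_mult_distrib power_divide)
  also have "... <= (1 / (real n)^2) * (3 * norm (resolvent (emp_op n F) \<theta> (F j)))^2" by (intro mult_left_mono power_mono norm_ascent assms) auto
  also have "... = 9 / ((real n)^2 * \<theta>) * (\<theta> * (norm (resolvent (emp_op n F) \<theta> (F j)))^2)" using lam by (simp add: power_mult_distrib)
  also have "... <= ?X j" unfolding leverage_def using lam by (intro mult_left_mono E.resolvent_lower) auto
  finally show ?thesis .
 qed
 hence "(\<Sum>j=1..n. (?U j)) <= (\<Sum>j=1..n. ?X j)" by (intro sum_mono)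
 thus ?thesis unfolding sum_distrib_left[symmetric] by (simp add: power2_eq_square[of "real n"] mult_ac)
qed

text \<open>Leverages of sample points are at most \<kappa>^2/\<theta> \<le> n, so by
  \<open>sum_fgd_unit\<close> the squared residuals of gradient descent, summed over all unit
  labels, stay below 2 * 9 + 2 = 20. This is the \<Gamma> for
  \<open>fluctuation_bounds\<close>.\<close>

lemma noise_bounds:
 assumes "b >= 1" "t <= T" "real T * \<eta> * \<theta> <= 1" "\<kappa>^2 <= real n * \<theta>"
 shows "(\<Sum>j=1..n. av n (b * T) (%J. (fsgd b \<eta> F (unit_label j) J 0 t \<bullet> \<phi>)^2))
   <= 9 / real n * leverage n F \<theta> \<phi> + 20 * (\<eta> / real b) * (norm \<phi>)^2"
  and "(\<Sum>j=1..n. av n (b * T) (%J. (norm (fsgd b \<eta> F (unit_label j) J 0 t))^2))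
   <= 9 / (real n * \<theta>) * (avg n (%j. leverage n F \<theta> (F j)))
    + 30 * real t * (\<eta>^2 / real b) * \<kappa>^2"
proof -
 let ?X = "%j s l. fgd n \<eta> F (unit_label j) 0 s \<bullet> F l"
 let ?U = "%j s l. fgd n \<eta> F (unit_label j) 0 s \<bullet> F l - unit_label j l"
 let ?V = "avg n (%j. leverage n F \<theta> (F j))"
 let ?S = "%j. %J. (fsgd b \<eta> F (unit_label j) J 0 t \<bullet> \<phi>)^2"
 have s: "real s * \<eta> * \<theta> <= 1" if "s <= T" for s
 proof -
  have "real s * (\<eta> * \<theta>) <= real T * (\<eta> * \<theta>)" using that eta lam by (intro mult_right_mono) auto
  thus ?thesis using assms(3) by (simp add: mult.assoc)
 qed
 have G: "(\<Sum>j=1..n. (?U j s l)^2) <= 20" if "s <= T" "l \<in> {1..n}" for s l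
 proof -
  have "(\<Sum>j=1..n. (?U j s l)^2)
   <= (\<Sum>j=1..n. 2 * (?X j s l)^2 + 2 * (unit_label j l)^2)"
  proof (intro sum_mono)
   fix j
   have *: "(x - y)^2 <= 2 * x^2 + 2 * y^2" for x y :: real using zero_le_power2[of "x + y"] by (simp add: power2_eq_square algebra_simps)
   show "(?U j s l)^2
    <= 2 * (?X j s l)^2 + 2 * (unit_label j l)^2" by (rule *)
  qed
  also have "... = 2 * (\<Sum>j=1..n. (?X j s l)^2) + 2 * (\<Sum>j=1..n. (unit_label j l)^2)" by (simp only: sum.distrib sum_distrib_left)
  also have "(\<Sum>j=1..n. (unit_label j l)^2) = 1" using that(2) by (subst sum.remove[of _ l]) (auto intro!: sum.neutral)
  also have "(\<Sum>j=1..n. (?X j s l)^2) <= 9"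
  proof -
   have "leverage n F \<theta> (F l) <= \<kappa>^2 / \<theta>" using leverage_le[OF lam, of n F "F l"] F[OF that(2)] lam
    by (meson divide_right_mono less_imp_le order_trans)
   also have "... <= real n" using assms(4) lam by (simp add: field_simps)
   finally have "9 / real n * leverage n F \<theta> (F l) <= 9 / real n * real n" by (intro mult_left_mono) auto
   with sum_fgd_unit[OF s[OF that(1)], of "F l"] show ?thesis using n by simp
  qed
  finally show ?thesis by simp
 qed
 note fl = fluctuation_bounds[OF assms(1) n eta assms(2) F G]
 have "(\<Sum>j=1..n. av n (b * T) (?S j))
  = (\<Sum>j=1..n. (fgd n \<eta> F (unit_label j) 0 t \<bullet> \<phi>)^2)
   + (\<Sum>j=1..n. av n (b * T) (%J. ((fsgd b \<eta> F (unit_label j) J 0 t - fgd n \<eta> F (unit_label j) 0 t) \<bullet> \<phi>)^2))"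
  using av_square_decomp[OF assms(1) n assms(2), where a = 0 and F = F and h = 0 and \<phi> = \<phi> and \<eta> = \<eta>] by (simp add: sum.distrib)
 also have "... <= 9 / real n * leverage n F \<theta> \<phi> + \<eta> / real b * 20 * (norm \<phi>)^2" by (intro add_mono sum_fgd_unit s assms(2) fl(1))
 finally show "(\<Sum>j=1..n. av n (b * T) (?S j))
   <= 9 / real n * leverage n F \<theta> \<phi> + 20 * (\<eta> / real b) * (norm \<phi>)^2" by (simp add: mult_ac)
 have "(\<Sum>j=1..n. av n (b * T) (%J. (norm (fsgd b \<eta> F (unit_label j) J 0 t))^2))
  = (\<Sum>j=1..n. (norm (fgd n \<eta> F (unit_label j) 0 t))^2)
   + (\<Sum>j=1..n. av n (b * T) (%J. (norm (fsgd b \<eta> F (unit_label j) J 0 t - fgd n \<eta> F (unit_label j) 0 t))^2))"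
  unfolding sum.distrib[symmetric] by (intro sum.cong refl av_norm_decomp[OF assms(1) n assms(2)])
 also have "... <= 9 / (real n * \<theta>) * ?V
    + 3 / 2 * real t * (\<eta>^2 / real b) * \<kappa>^2 * 20"
  by (intro add_mono sum_norm_fgd_unit s assms(2) fl(2))
 finally show "(\<Sum>j=1..n. av n (b * T) (%J. (norm (fsgd b \<eta> F (unit_label j) J 0 t))^2))
   <= 9 / (real n * \<theta>) * ?V
    + 30 * real t * (\<eta>^2 / real b) * \<kappa>^2" by simp
qed

end

section \<open>Hilbert bases and weak measurability\<close>

context
 notes sum.cong [fundef_cong]
begin

fun gram_schmidt :: "(nat => 'k::real_inner) => nat => 'k" where
 "gram_schmidt d k = (let r = d k - (\<Sum>j<k. (d k \<bullet> gram_schmidt d j) *\<^sub>R gram_schmidt d j)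
  in (1 / norm r) *\<^sub>R r)"

end

declare gram_schmidt.simps [simp del]

definition orthonormal_seq :: "(nat => 'k::real_inner) => bool" where
 "orthonormal_seq v \<longleftrightarrow> (\<forall>i j. i \<noteq> j --> v i \<bullet> v j = 0) \<and> (\<forall>i. v i = 0 \<or> v i \<bullet> v i = 1)"

lemma gram_schmidt_orthonormal: "orthonormal_seq (gram_schmidt d)"
proof -
 let ?g = "gram_schmidt d"
 have unit: "?g i = 0 \<or> ?g i \<bullet> ?g i = 1" for i
  by (subst (1 2 3) gram_schmidt.simps) (auto simp: Let_def power2_norm_eq_inner[symmetric] power2_eq_square)
 have orth: "\<forall>j<i. ?g i \<bullet> ?g j = 0" for i
 proof (induction i rule: less_induct)
  case (less i)
  show ?case
  proof (intro allI impI, goal_cases)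
   case (1 j) note j = 1
   let ?r = "d i - (\<Sum>j<i. (d i \<bullet> ?g j) *\<^sub>R ?g j)"
   have "?g l \<bullet> ?g j = 0" if "l \<in> {..<i} - {j}" for l
    using less.IH[of l] less.IH[of j] that j by (cases "l < j") (auto simp: inner_commute not_less le_less)
   hence "(\<Sum>l<i. (d i \<bullet> ?g l) * (?g l \<bullet> ?g j)) = (d i \<bullet> ?g j) * (?g j \<bullet> ?g j)" using j by (subst sum.remove[of _ j]) (auto intro!: sum.neutral)
   also have "... = d i \<bullet> ?g j" using unit[of j] by auto
   finally have "?r \<bullet> ?g j = 0" by (simp add: inner_diff_left inner_sum_left)
   thus ?case by (subst gram_schmidt.simps) (simp add: Let_def)
  qed
 qed
 have "?g i \<bullet> ?g j = 0" if "i \<noteq> j" for i j using orth[of i] orth[of j] that by (cases "i < j") (auto simp: inner_commute not_less le_less)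
 thus ?thesis using unit by (auto simp: orthonormal_seq_def)
qed

lemma gram_schmidt_total:
 assumes "!!k. x \<bullet> gram_schmidt d k = 0"
 shows "x \<bullet> d k = 0"
proof -
 let ?r = "d k - (\<Sum>j<k. (d k \<bullet> gram_schmidt d j) *\<^sub>R gram_schmidt d j)"
 have "?r = norm ?r *\<^sub>R gram_schmidt d k" by (subst (5) gram_schmidt.simps) (simp add: Let_def)
 hence "x \<bullet> ?r = 0" by (metis assms inner_scaleR_right mult_zero_right)
 thus ?thesis by (simp add: inner_diff_right inner_sum_right assms)
qed

locale hilbert_basis =
 fixes v :: "nat => 'k::{real_inner,banach}"
 assumes orthonormal: "orthonormal_seq v"
  and total: "!!x. (!!i. x \<bullet> v i = 0) ==> x = 0"
begin

lemma inner_partial_sum: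
 "(\<Sum>i<m. a i *\<^sub>R v i) \<bullet> v j = (if j < m then a j * (v j \<bullet> v j) else 0)"
proof -
 have "(\<Sum>i<m. a i *\<^sub>R v i) \<bullet> v j = (\<Sum>i<m. if i = j then a j * (v j \<bullet> v j) else 0)"
  unfolding inner_sum_left using orthonormal by (intro sum.cong) (auto simp: orthonormal_seq_def)
 thus ?thesis by simp
qed

lemma norm_partial_sum:
 assumes "finite I"
 shows "(norm (\<Sum>i\<in>I. a i *\<^sub>R v i))^2 = (\<Sum>i\<in>I. (a i)^2 * (v i \<bullet> v i))"
proof -
 have "(\<Sum>j\<in>I. (a i *\<^sub>R v i) \<bullet> (a j *\<^sub>R v j)) = (a i)^2 * (v i \<bullet> v i)" (is "?L = _") if "i \<in> I" for i
 proof -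
  have "?L = (\<Sum>j\<in>I. if i = j then (a i)^2 * (v i \<bullet> v i) else 0)"
   using orthonormal by (intro sum.cong) (auto simp: orthonormal_seq_def power2_eq_square)
  thus ?thesis using that assms by simp
 qed
 thus ?thesis unfolding power2_norm_eq_inner inner_sum_left inner_sum_right by (subst sum.swap) simp
qed

lemma convergent_series:
 assumes "!!m. (\<Sum>i<m. (a i)^2 * (v i \<bullet> v i)) <= C"
 shows "\<exists>x. (%m. \<Sum>i<m. a i *\<^sub>R v i) \<longlonglongrightarrow> x"
proof -
 have "(\<Sum>i\<le>m. (a i)^2 * (v i \<bullet> v i)) <= C" for m using assms[of "Suc m"] unfolding lessThan_Suc_atMost .
 hence "summable (%i. (a i)^2 * (v i \<bullet> v i))" by (intro bounded_imp_summable[where B = C]) auto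
 hence cauchy: "\<exists>N. \<forall>m\<ge>N. \<forall>n. norm (\<Sum>i=m..<n. (a i)^2 * (v i \<bullet> v i)) < e" if "e > 0" for e using that by (auto simp: summable_Cauchy)
 have "summable (%i. a i *\<^sub>R v i)" unfolding summable_Cauchy
 proof (intro allI impI, goal_cases)
  case (1 e)
  then obtain N where N: "norm (\<Sum>i=m..<n. (a i)^2 * (v i \<bullet> v i)) < e^2" if "m >= N" for m n using cauchy[of "e^2"] by auto
  have "norm (\<Sum>i=m..<n. a i *\<^sub>R v i) < e" (is "?L < _") if "m >= N" for m n
  proof (rule power_less_imp_less_base)
   show "?L^2 < e^2" using N[OF that, of n] by (subst norm_partial_sum) auto
  qed (use \<open>e > 0\<close> in simp)
  thus ?case by blast
 qed
 thus ?thesis using summable_LIMSEQ by blast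
qed

lemma expansion: "(%m. \<Sum>i<m. (x \<bullet> v i) *\<^sub>R v i) \<longlonglongrightarrow> x"
proof -
 have idem: "(x \<bullet> v i) * (v i \<bullet> v i) = x \<bullet> v i" for x i using orthonormal by (cases "v i = 0") (auto simp: orthonormal_seq_def)
 have "(\<Sum>i<m. (x \<bullet> v i)^2 * (v i \<bullet> v i)) <= (norm x)^2" for m
 proof -
  let ?s = "\<Sum>i<m. (x \<bullet> v i) *\<^sub>R v i"
  have 1: "(norm ?s)^2 = x \<bullet> ?s" by (subst norm_partial_sum) (auto simp: inner_sum_right power2_eq_square mult.assoc idem)
  have "0 <= (norm (x - ?s))^2" by simp
  also have "... = (norm x)^2 - 2 * (x \<bullet> ?s) + (norm ?s)^2"
   unfolding power2_norm_eq_inner by (simp add: inner_diff_left inner_diff_right inner_commute)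
  finally have "(norm ?s)^2 <= (norm x)^2" using 1 by simp
  thus ?thesis by (subst (asm) norm_partial_sum) auto
 qed
 from convergent_series[OF this] obtain y where y: "(%m. \<Sum>i<m. (x \<bullet> v i) *\<^sub>R v i) \<longlonglongrightarrow> y" by blast
 have "(x - y) \<bullet> v j = 0" for j
 proof -
  have "(%m. (\<Sum>i<m. (x \<bullet> v i) *\<^sub>R v i) \<bullet> v j) \<longlonglongrightarrow> y \<bullet> v j" by (intro tendsto_intros y)
  moreover have "(%m. (\<Sum>i<m. (x \<bullet> v i) *\<^sub>R v i) \<bullet> v j) \<longlonglongrightarrow> x \<bullet> v j"
   by (rule tendsto_eventually) (auto simp: inner_partial_sum idem eventually_sequentially intro!: exI[of _ "Suc j"])
  ultimately show ?thesis using LIMSEQ_unique by (fastforce simp: inner_diff_left)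
 qed
 hence "x - y = 0" by (rule total)
 thus ?thesis using y by simp
qed

lemma parseval: "(%i. (x \<bullet> v i) * (y \<bullet> v i)) sums (x \<bullet> y)"
proof -
 have "(%m. (\<Sum>i<m. (x \<bullet> v i) *\<^sub>R v i) \<bullet> y) \<longlonglongrightarrow> x \<bullet> y" by (intro tendsto_intros expansion)
 thus ?thesis unfolding sums_def inner_sum_left inner_scaleR_left by (simp only: inner_commute[of _ y])
qed

text \<open>The candidate is the series with coefficients f (v i). Applying f to a partial sum s
  gives |s|^2 = f s \<le> K |s|, which is the bound that makes the series converge.\<close>

lemma riesz:
 fixes f :: "'k => real"
 assumes "bounded_linear f"
 shows "\<exists>!g. \<forall>h. g \<bullet> h = f h"
proof -
 interpret f: bounded_linear f by (rule assms)
 obtain K where K: "!!x. norm (f x) <= norm x * K" using f.bounded by blast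
 have fv: "f (v i) * (v i \<bullet> v i) = f (v i)" for i using orthonormal f.zero by (cases "v i = 0") (auto simp: orthonormal_seq_def)
 have "(\<Sum>i<m. (f (v i))^2 * (v i \<bullet> v i)) <= K^2" (is "?L <= _") for m
 proof -
  let ?s = "\<Sum>i<m. f (v i) *\<^sub>R v i"
  let ?q = "?L"
  have n: "(norm ?s)^2 = ?q" by (rule norm_partial_sum) simp
  have "?q = f ?s" by (simp add: f.sum f.scaleR power2_eq_square mult.assoc fv)
  also have "... <= norm ?s * K" using K[of ?s] by simp
  finally have "(norm ?s)^2 <= norm ?s * K" using n by simp
  hence "norm ?s = 0 \<or> norm ?s <= K" by (metis mult_le_cancel_left_pos norm_ge_zero order_le_less power2_eq_square)
  hence "(norm ?s)^2 <= K^2" by (auto intro: power_mono)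
  thus ?thesis using n by simp
 qed
 from convergent_series[OF this] obtain g where g: "(%m. \<Sum>i<m. f (v i) *\<^sub>R v i) \<longlonglongrightarrow> g" by blast
 have "g \<bullet> h = f h" for h
 proof (rule LIMSEQ_unique)
  show "(%m. (\<Sum>i<m. f (v i) *\<^sub>R v i) \<bullet> h) \<longlonglongrightarrow> g \<bullet> h" by (intro tendsto_intros g)
  have "(%m. f (\<Sum>i<m. (h \<bullet> v i) *\<^sub>R v i)) \<longlonglongrightarrow> f h" by (intro f.tendsto expansion)
  thus "(%m. (\<Sum>i<m. f (v i) *\<^sub>R v i) \<bullet> h) \<longlonglongrightarrow> f h" unfolding inner_sum_left inner_scaleR_left f.sum f.scaleR real_scaleR_def
   by (simp only: inner_commute[of h] mult.commute)
 qed
 thus ?thesis by (intro ex1I[of _ g]) (auto intro: vector_eq_rdot[THEN iffD1])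
qed

end

text \<open>
 The RKHS need not be a second countable type, so vector-valued measurability is
 replaced by measurability of all scalar products.
\<close>

definition weak_meas :: "'w measure => ('w => 'k::real_inner) => bool" where
 "weak_meas M \<Psi> \<longleftrightarrow> (\<forall>v. (%w. \<Psi> w \<bullet> v) \<in> borel_measurable M)"

named_theorems wm_intros

lemma wm_inner_const: "weak_meas M \<Psi> ==> (%w. \<Psi> w \<bullet> v) \<in> borel_measurable M"
 by (simp add: weak_meas_def)

lemma wm_const [wm_intros]: "weak_meas M (%_. x)"
 by (simp add: weak_meas_def)

lemma wm_add [wm_intros]:
 "weak_meas M f ==> weak_meas M g ==> weak_meas M (%w. f w + g w)" by (auto simp: weak_meas_def inner_add_left intro!: borel_measurable_add)

lemma wm_diff [wm_intros]:
 "weak_meas M f ==> weak_meas M g ==> weak_meas M (%w. f w - g w)" by (auto simp: weak_meas_def inner_diff_left intro!: borel_measurable_diff)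

lemma wm_scaleR [wm_intros]:
 "a \<in> borel_measurable M ==> weak_meas M f ==> weak_meas M (%w. a w *\<^sub>R f w)" by (auto simp: weak_meas_def intro!: borel_measurable_times)

lemma wm_sum [wm_intros]:
 "(!!i. i \<in> I ==> weak_meas M (f i)) ==> weak_meas M (%w. \<Sum>i\<in>I. f i w)" by (auto simp: weak_meas_def inner_sum_left intro!: borel_measurable_sum)

lemma wm_compose:
 "weak_meas N f ==> g \<in> measurable M N ==> weak_meas M (%w. f (g w))" unfolding weak_meas_def by (auto intro: measurable_compose)

lemma wm_LIMSEQ:
 assumes "!!k. weak_meas M (f k)" "!!w. w \<in> space M ==> (%k. f k w) \<longlonglongrightarrow> g w"
 shows "weak_meas M g"
 unfolding weak_meas_def
proof
 fix v
 show "(%w. g w \<bullet> v) \<in> borel_measurable M" by (rule borel_measurable_LIMSEQ_real[where u = "%k w. f k w \<bullet> v"])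
   (use assms in \<open>auto simp: weak_meas_def intro!: tendsto_intros\<close>)
qed

context hilbert_basis
begin

lemma wm_inner [wm_intros]:
 fixes f g :: "'w => 'k"
 assumes "weak_meas M f" "weak_meas M g"
 shows "(%w. f w \<bullet> g w) \<in> borel_measurable M"
proof (rule borel_measurable_LIMSEQ_real)
 show "(%k. \<Sum>i<k. (f w \<bullet> v i) * (g w \<bullet> v i)) \<longlonglongrightarrow> f w \<bullet> g w" for w using parseval by (simp add: sums_def)
 show "(%w. \<Sum>i<k. (f w \<bullet> v i) * (g w \<bullet> v i)) \<in> borel_measurable M" for k
  using assms by (intro borel_measurable_sum borel_measurable_times wm_inner_const)
qed

lemma wm_norm [wm_intros]:
 fixes f :: "'w => 'k"
 shows "weak_meas M f ==> (%w. norm (f w)) \<in> borel_measurable M"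
 unfolding norm_eq_sqrt_inner using wm_inner[of M f f] by simp

lemma wm_emp_op [wm_intros]:
 fixes F :: "'w => nat => 'k"
 assumes "!!l. l \<in> {1..n} ==> weak_meas M (%w. F w l)" "weak_meas M f"
 shows "weak_meas M (%w. emp_op n (F w) (f w))"
 unfolding emp_op_def by (intro wm_intros assms borel_measurable_const) auto

text \<open>The resolvent is the limit of a contractive iteration built from gradient descent steps.\<close>

lemma wm_resolvent [wm_intros]:
 fixes F :: "'w => nat => 'k"
 assumes "!!l. l \<in> {1..n} ==> weak_meas M (%w. F w l)" "weak_meas M f"
  and "n >= 1" "\<theta> > 0" "!!w l. w \<in> space M ==> l \<in> {1..n} ==> norm (F w l) <= \<kappa>"
 shows "weak_meas M (%w. resolvent (emp_op n (F w)) \<theta> (f w))"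
proof -
 define \<eta> where "\<eta> = 1 / (2 * (\<kappa>^2 + 1))"
 have \<eta>: "\<eta> > 0" "\<eta> * \<kappa>^2 <= 1 / 2" by (auto simp: \<eta>_def field_simps add_pos_nonneg)
 \<comment> \<open>For the resolvent c, \<open>gd_map\<close> of c plus \<eta> f is (1 + \<eta>
   \<theta>) c. Scaling by q therefore makes c the fixed point, and q is at the same time the
   contraction factor.\<close>
 define q where "q = 1 / (1 + \<eta> * \<theta>)"
 have q: "0 < q" "q < 1" "q * (1 + \<eta> * \<theta>) = 1" using mult_pos_pos[OF \<eta>(1) assms(4)] by (auto simp: q_def)
 define it where "it = (%k w. ((%c. q *\<^sub>R (gd_map n (F w) \<eta> c + \<eta> *\<^sub>R f w)) ^^ k) 0)"
 have wm: "weak_meas M (it k)" for k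
 proof (induction k)
  case 0
  show ?case by (simp add: it_def wm_const)
 next
  case (Suc k)
  have "it (Suc k) = (%w. q *\<^sub>R (it k w - \<eta> *\<^sub>R emp_op n (F w) (it k w) + \<eta> *\<^sub>R f w))" by (simp add: it_def gd_map_def)
  thus ?case using Suc by (auto intro!: wm_intros assms borel_measurable_const)
 qed
 show ?thesis
 proof (rule wm_LIMSEQ[OF wm])
  fix w assume w: "w \<in> space M"
  interpret E: psd_op "emp_op n (F w)" \<theta> by (rule psd_op_emp[OF assms(4)])
  define c where "c = resolvent (emp_op n (F w)) \<theta> (f w)"
  have F: "(norm (F w l))^2 <= \<kappa>^2" if "l \<in> {1..n}" for l using assms(5)[OF w that] by (intro power_mono) auto
  have fixpt: "c = q *\<^sub>R (gd_map n (F w) \<eta> c + \<eta> *\<^sub>R f w)"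
  proof -
   have "gd_map n (F w) \<eta> c + \<eta> *\<^sub>R f w = (1 + \<eta> * \<theta>) *\<^sub>R c" unfolding c_def gd_map_def E.op_resolvent by (simp add: algebra_simps)
   thus ?thesis using q by simp
  qed
  have "norm (it k w - c) <= q ^ k * norm c" for k
  proof (induction k)
   case 0
   show ?case by (simp add: it_def)
  next
   case (Suc k)
   have "it (Suc k) w - c = q *\<^sub>R gd_map n (F w) \<eta> (it k w - c)" by (subst fixpt) (simp add: it_def gd_map_linear algebra_simps)
   hence "norm (it (Suc k) w - c) <= q * norm (it k w - c)"
    using norm_gd_map_contraction[where F = "F w" and p = "it k w - c", OF assms(3) less_imp_le[OF \<eta>(1)] \<eta>(2) F] q(1) by (simp add: mult_left_mono)
   also have "... <= q * (q ^ k * norm c)" using Suc q by (intro mult_left_mono) auto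
   finally show ?case by simp
  qed
  note bound = this
  have lim: "(%k. q ^ k * norm c) \<longlonglongrightarrow> 0" using q by (auto intro!: tendsto_mult_left_zero LIMSEQ_realpow_zero)
  have "(%k. it k w - c) \<longlonglongrightarrow> 0" by (rule Lim_null_comparison[OF always_eventually[OF allI[OF bound]] lim])
  thus "(%k. it k w) \<longlonglongrightarrow> resolvent (emp_op n (F w)) \<theta> (f w)" by (simp add: c_def LIM_zero_iff)
 qed
qed

lemma measurable_leverage [wm_intros]:
 fixes F :: "'w => nat => 'k"
 assumes "!!l. l \<in> {1..n} ==> weak_meas M (%w. F w l)" "weak_meas M f"
  and "n >= 1" "\<theta> > 0" "!!w l. w \<in> space M ==> l \<in> {1..n} ==> norm (F w l) <= \<kappa>"
 shows "(%w. leverage n (F w) \<theta> (f w)) \<in> borel_measurable M"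
 unfolding leverage_def by (intro wm_inner wm_resolvent[OF assms] assms)

end

section \<open>Square integrable functions\<close>

lemma has_sum_cong_both:
 "(!!i. i \<in> I ==> f i = g i) ==> a = b ==> (f has_sum a) I \<longleftrightarrow> (g has_sum b) I" by (auto cong: has_sum_cong)

lemma discriminant_le:
 fixes a b c :: real
 assumes "!!s. 0 <= a - 2 * s * b + s^2 * c" "0 <= c"
 shows "b^2 <= a * c"
proof (cases "c = 0")
 case True
 have "b = 0"
 proof (rule ccontr)
  assume "b \<noteq> 0"
  thus False using assms(1)[of "(a + 1) / (2 * b)"] True by (simp add: field_simps)
 qed
 thus ?thesis using True by simp
next
 case False
 from assms(2) False have c: "c > 0" by simp
 have "0 <= a - 2 * (b / c) * b + (b / c)^2 * c" by (rule assms(1))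
 thus ?thesis using c by (simp add: power2_eq_square field_simps)
qed

context prob_space
begin

lemma L2_D: "f \<in> L2 M ==> f \<in> borel_measurable M" "f \<in> L2 M ==> integrable M (%m. (f m)^2)"
 by (auto simp: L2_def)

lemma L2_mult_integrable [intro]:
 assumes "f \<in> L2 M" "g \<in> L2 M"
 shows "integrable M (%m. f m * g m)"
proof (rule Bochner_Integration.integrable_bound)
 show "integrable M (%m. (f m)^2 + (g m)^2)" using assms by (auto simp: L2_def)
 show "(%m. f m * g m) \<in> borel_measurable M" using assms by (auto simp: L2_def)
 have *: "\<bar>x * y\<bar> <= x^2 + y^2" for x y :: real
 proof -
  have "2 * \<bar>x\<bar> * \<bar>y\<bar> <= x^2 + y^2" using sum_squares_bound[of "\<bar>x\<bar>" "\<bar>y\<bar>"] by simp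
  moreover have "0 <= \<bar>x\<bar> * \<bar>y\<bar>" by simp
  ultimately show ?thesis unfolding abs_mult by linarith
 qed
 show "AE m in M. norm (f m * g m) <= norm ((f m)^2 + (g m)^2)"
 proof (rule AE_I2, goal_cases)
  case (1 m)
  show ?case using *[of "f m" "g m"] by (simp only: real_norm_def)
 qed
qed

lemma bounded_L2:
 assumes "f \<in> borel_measurable M" "AE m in M. \<bar>f m\<bar> <= c"
 shows "f \<in> L2 M"
proof -
 have "AE m in M. norm ((f m)^2) <= c^2" using assms(2)
 proof eventually_elim
  case (elim m)
  hence "\<bar>f m\<bar>^2 <= c^2" by (intro power_mono) auto
  thus ?case by simp
 qed
 thus ?thesis using assms(1) by (auto simp: L2_def intro!: integrable_const_bound)
qed

lemma L2_const [intro]: "(%_. c) \<in> L2 M" by (auto simp: L2_def)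

lemma L2_integrable [intro]: "f \<in> L2 M ==> integrable M f"
 using L2_mult_integrable[of f "%_. 1"] by auto

lemma L2_scale [intro]: "f \<in> L2 M ==> (%m. a * f m) \<in> L2 M"
 by (auto simp: L2_def power_mult_distrib)

lemma L2_add [intro]:
 assumes "f \<in> L2 M" "g \<in> L2 M" shows "(%m. f m + g m) \<in> L2 M"
 using assms L2_mult_integrable[OF assms] by (auto simp: L2_def power2_sum mult.assoc)

lemma L2_diff [intro]:
 assumes "f \<in> L2 M" "g \<in> L2 M" shows "(%m. f m - g m) \<in> L2 M"
 using L2_add[OF assms(1) L2_scale[OF assms(2), of "-1"]] by simp

lemma L2_sum [intro]: "(!!i. i \<in> I ==> f i \<in> L2 M) ==> (%m. \<Sum>i\<in>I. f i m) \<in> L2 M"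
 by (induction I rule: infinite_finite_induct) auto

lemma L2_inner_add: "f \<in> L2 M ==> g \<in> L2 M ==> h \<in> L2 M ==>
 L2_inner M (%m. f m + g m) h = L2_inner M f h + L2_inner M g h"
 unfolding L2_inner_def by (simp add: distrib_right L2_mult_integrable)

lemma L2_inner_diff: "f \<in> L2 M ==> g \<in> L2 M ==> h \<in> L2 M ==>
 L2_inner M (%m. f m - g m) h = L2_inner M f h - L2_inner M g h"
 unfolding L2_inner_def by (simp add: left_diff_distrib L2_mult_integrable)

lemma L2_inner_scale: "L2_inner M (%m. a * f m) h = a * L2_inner M f h"
 unfolding L2_inner_def by (simp add: mult.assoc)

lemma L2_inner_commute: "L2_inner M f g = L2_inner M g f"
 unfolding L2_inner_def by (simp add: mult.commute)

lemma L2_inner_sum: "(!!i. i \<in> I ==> f i \<in> L2 M) ==> h \<in> L2 M ==>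
 L2_inner M (%m. \<Sum>i\<in>I. f i m) h = (\<Sum>i\<in>I. L2_inner M (f i) h)"
 unfolding L2_inner_def sum_distrib_right by (intro bochner_sum) auto

lemma L2_norm_square: "(L2_norm M f)^2 = L2_inner M f f"
 unfolding L2_norm_def L2_inner_def by (simp add: power2_eq_square)

lemma L2_norm_nonneg [simp]: "0 <= L2_norm M f"
 unfolding L2_norm_def by simp

lemma L2_inner_nonneg [simp]: "0 <= L2_inner M f f"
 unfolding L2_inner_def by (intro Bochner_Integration.integral_nonneg) auto

lemma L2_diff_square:
 assumes "f \<in> L2 M" "g \<in> L2 M"
 shows "L2_inner M (%m. f m - s * g m) (%m. f m - s * g m)
  = L2_inner M f f - 2 * s * L2_inner M f g + s^2 * L2_inner M g g"
proof -
 have "(f m - s * g m) * (f m - s * g m) = f m * f m - 2 * s * (f m * g m) + s^2 * (g m * g m)" for m by (simp add: power2_eq_square algebra_simps)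
 thus ?thesis unfolding L2_inner_def using assms by (simp add: L2_mult_integrable)
qed

lemma L2_cauchy_schwarz_square:
 assumes "f \<in> L2 M" "g \<in> L2 M"
 shows "(L2_inner M f g)^2 <= L2_inner M f f * L2_inner M g g"
 using L2_inner_nonneg[of "%m. f m - s * g m" for s] unfolding L2_diff_square[OF assms] by (rule discriminant_le) simp

lemma L2_cauchy_schwarz:
 assumes "f \<in> L2 M" "g \<in> L2 M"
 shows "\<bar>L2_inner M f g\<bar> <= L2_norm M f * L2_norm M g"
proof -
 have "\<bar>L2_inner M f g\<bar>^2 <= (L2_norm M f * L2_norm M g)^2" using L2_cauchy_schwarz_square[OF assms] by (simp add: power_mult_distrib L2_norm_square)
 thus ?thesis by (rule power2_le_imp_le) (simp add: L2_norm_nonneg)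
qed

lemma L2_norm_triangle:
 assumes "f \<in> L2 M" "g \<in> L2 M"
 shows "L2_norm M (%m. f m + g m) <= L2_norm M f + L2_norm M g" (is "?L <= ?R")
proof -
 have "?L^2 = (L2_norm M f)^2 + 2 * L2_inner M f g + (L2_norm M g)^2" using L2_diff_square[OF assms, of "-1"] by (simp add: L2_norm_square)
 also have "... <= ?R^2" using L2_cauchy_schwarz[OF assms] by (simp add: power2_sum abs_le_iff)
 finally show ?thesis by (rule power2_le_imp_le) (simp add: L2_norm_nonneg)
qed

lemma L2_norm_scale: "L2_norm M (%m. a * f m) = \<bar>a\<bar> * L2_norm M f"
 unfolding L2_norm_def by (simp add: power_mult_distrib real_sqrt_mult)

lemma L2_norm_zero_AE:
 assumes "f \<in> L2 M" "L2_norm M f = 0"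
 shows "AE m in M. f m = 0"
 using assms integral_nonneg_eq_0_iff_AE[of M "%m. (f m)^2"] by (simp add: L2_norm_def L2_def)

lemma integral_abs_le_L2_norm:
 assumes "f \<in> L2 M"
 shows "(LINT m|M. \<bar>f m\<bar>) <= L2_norm M f"
proof -
 have "(%m. \<bar>f m\<bar>) \<in> L2 M" using assms by (auto simp: L2_def)
 from L2_cauchy_schwarz[OF this L2_const[of 1]] show ?thesis by (simp add: L2_inner_def L2_norm_def prob_space abs_le_iff)
qed

text \<open>Riesz-Fischer: a Cauchy sequence in L2 is Cauchy in L1 and so has an almost everywhere
  convergent subsequence; Fatou's lemma gives the L2 distance to its limit.\<close>

lemma L2_complete:
 assumes s: "!!n. s n \<in> L2 M"
  and cauchy: "!!e. e > 0 ==> \<exists>N. \<forall>i\<ge>N. \<forall>j\<ge>N. L2_norm M (%m. s i m - s j m) < e"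
 obtains g where "g \<in> L2 M" "(%n. L2_norm M (%m. s n m - g m)) \<longlonglongrightarrow> 0"
proof -
 let ?X = "%s i j. %m. s i m - s j m"
 have meas [measurable]: "s n \<in> borel_measurable M" for n using s by (rule L2_D)
 have "\<exists>N. \<forall>i\<ge>N. \<forall>j\<ge>N. (LINT m|M. norm (s i m - s j m)) < e" if e: "e > 0" for e
 proof -
  obtain N where N: "L2_norm M (?X s i j) < e" if "i >= N" "j >= N" for i j using cauchy[OF e] by blast
  have "(LINT m|M. norm (s i m - s j m)) < e" if "i >= N" "j >= N" for i j using integral_abs_le_L2_norm[OF L2_diff[OF s s, of i j]] N[OF that] by simp
  thus ?thesis by blast
 qed
 then obtain r where r: "strict_mono r" "AE m in M. Cauchy (%i. s (r i) m)"
  using cauchy_L1_AE_cauchy_subseq[where s = s, OF L2_integrable[OF s]] by blast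
 define g where "g = (%m. lim (%i. s (r i) m))"
 have g [measurable]: "g \<in> borel_measurable M" unfolding g_def by measurable
 have lim: "AE m in M. (%i. s (r i) m) \<longlonglongrightarrow> g m" using r(2) by eventually_elim (simp add: g_def real_Cauchy_convergent convergent_LIMSEQ_iff[symmetric])
 have fatou: "(\<integral>\<^sup>+m. ennreal ((s n m - g m)^2) \<partial>M) <= ennreal (e^2)" (is "?L <= _")
  if e: "e > 0" and N: "!!i j. i >= N ==> j >= N ==> L2_norm M (?X s i j) < e" and n: "n >= N" for e N n
 proof -
  have "?L = (\<integral>\<^sup>+m. liminf (%i. ennreal ((s n m - s (r i) m)^2)) \<partial>M)"
  proof (rule nn_integral_cong_AE)
   show "AE m in M. ennreal ((s n m - g m)^2) = liminf (%i. ennreal ((s n m - s (r i) m)^2))" using lim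
   proof eventually_elim
    case (elim m)
    hence "(%i. ennreal ((s n m - s (r i) m)^2)) \<longlonglongrightarrow> ennreal ((s n m - g m)^2)" by (intro tendsto_intros)
    from lim_imp_Liminf[OF trivial_limit_sequentially this] show ?case by (rule sym)
   qed
  qed
  also have "... <= liminf (%i. \<integral>\<^sup>+m. ennreal ((s n m - s (r i) m)^2) \<partial>M)" by (intro nn_integral_liminf) measurable
  also have "... <= ennreal (e^2)"
  proof (rule Liminf_le)
   show "eventually (%i. (\<integral>\<^sup>+m. ennreal ((s n m - s (r i) m)^2) \<partial>M) <= ennreal (e^2)) sequentially" unfolding eventually_sequentially
   proof (intro exI allI impI)
    fix i assume i: "N <= i"
    hence "r i >= N" using seq_suble[OF r(1), of i] by simp
    from N[OF n this] have "(L2_norm M (%m. s n m - s (r i) m))^2 <= e^2" by (intro power_mono) auto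
    moreover have "(\<integral>\<^sup>+m. ennreal ((s n m - s (r i) m)^2) \<partial>M) = ennreal ((L2_norm M (%m. s n m - s (r i) m))^2)"
     using L2_D(2)[OF L2_diff[OF s s, of n "r i"]] by (subst nn_integral_eq_integral) (auto simp: L2_norm_def)
    ultimately show "(\<integral>\<^sup>+m. ennreal ((s n m - s (r i) m)^2) \<partial>M) <= ennreal (e^2)" by (simp add: ennreal_leI)
   qed
  qed simp
  finally show ?thesis .
 qed
 have sg: "(%m. s n m - g m) \<in> L2 M \<and> L2_norm M (%m. s n m - g m) <= e"
  if e: "e > 0" and N: "!!i j. i >= N ==> j >= N ==> L2_norm M (?X s i j) < e" and n: "n >= N" for e N n
 proof -
  note f = fatou[OF e N n]
  have int: "integrable M (%m. (s n m - g m)^2)" using f by (intro integrableI_bounded) (auto simp: le_less_trans[OF _ ennreal_less_top])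
  hence "ennreal (LINT m|M. (s n m - g m)^2) <= ennreal (e^2)" using f by (simp add: nn_integral_eq_integral)
  hence "(LINT m|M. (s n m - g m)^2) <= e^2" by (simp add: ennreal_le_iff)
  hence "L2_norm M (%m. s n m - g m) <= e" unfolding L2_norm_def using e by (intro real_le_lsqrt) auto
  thus ?thesis using int by (auto simp: L2_def)
 qed
 obtain N1 where N1: "!!i j. i >= N1 ==> j >= N1 ==> L2_norm M (?X s i j) < 1" using cauchy[of 1] by auto
 have "(%m. s N1 m - g m) \<in> L2 M" by (rule conjunct1[OF sg[of 1 N1 N1]]) (use N1 in auto)
 from L2_diff[OF s[of N1] this] have "g \<in> L2 M" by simp
 moreover have "(%n. L2_norm M (%m. s n m - g m)) \<longlonglongrightarrow> 0"
 proof (rule LIMSEQ_I, goal_cases)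
  case (1 e) note e = 1
  have "\<exists>N. \<forall>i\<ge>N. \<forall>j\<ge>N. L2_norm M (?X s i j) < e / 2" by (rule cauchy) (use e in simp)
  then obtain N where N: "!!i j. i >= N ==> j >= N ==> L2_norm M (?X s i j) < e / 2" by blast
  have "norm (L2_norm M (%m. s n m - g m) - 0) < e" if "n >= N" for n using conjunct2[OF sg[of "e / 2" N n, OF _ _ that]] N e by simp
  thus ?case by blast
 qed
 ultimately show ?thesis by (rule that)
qed

section \<open>Orthonormal systems in L2: Bessel's inequality and Parseval's identity\<close>

definition L2_orthonormal :: "nat set => (nat => 'a => real) => bool" where
 "L2_orthonormal I e \<longleftrightarrow> (\<forall>i\<in>I. e i \<in> L2 M) \<and>
  (\<forall>i\<in>I. \<forall>j\<in>I. L2_inner M (e i) (e j) = (if i = j then 1 else 0))"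

lemma L2_combination_inner:
 assumes o: "L2_orthonormal I e" and F: "finite F" "F \<subseteq> I" "j \<in> I"
 shows "L2_inner M (%m. \<Sum>i\<in>F. a i * e i m) (e j) = (if j \<in> F then a j else 0)" (is "?L = _")
proof -
 have "?L = (\<Sum>i\<in>F. L2_inner M (%m. a i * e i m) (e j))" using assms by (intro L2_inner_sum) (auto simp: L2_orthonormal_def)
 also have "... = (\<Sum>i\<in>F. if i = j then a j else 0)" using assms by (intro sum.cong) (auto simp: L2_inner_scale L2_orthonormal_def)
 finally show ?thesis using F(1) by simp
qed

lemma L2_combination_norm:
 assumes o: "L2_orthonormal I e" and F: "finite F" "F \<subseteq> I"
 shows "L2_inner M (%m. \<Sum>i\<in>F. a i * e i m) (%m. \<Sum>i\<in>F. a i * e i m) = (\<Sum>i\<in>F. (a i)^2)"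
proof -
 let ?s = "%m. \<Sum>i\<in>F. a i * e i m"
 have e: "e i \<in> L2 M" if "i \<in> F" for i using o F that by (auto simp: L2_orthonormal_def)
 hence "L2_inner M ?s ?s = (\<Sum>i\<in>F. L2_inner M (%m. a i * e i m) ?s)" by (intro L2_inner_sum L2_sum L2_scale) auto
 also have "... = (\<Sum>i\<in>F. a i * L2_inner M ?s (e i))" by (simp add: L2_inner_scale L2_inner_commute[of _ ?s])
 also have "... = (\<Sum>i\<in>F. (a i)^2)"
 proof (intro sum.cong refl, goal_cases)
  case (1 i)
  thus ?case using F by (subst L2_combination_inner[OF o]) (auto simp: power2_eq_square)
 qed
 finally show ?thesis .
qed

lemma L2_projection_norm:
 assumes o: "L2_orthonormal I e" and F: "finite F" "F \<subseteq> I" and f: "f \<in> L2 M"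
 shows "L2_inner M (%m. f m - (\<Sum>i\<in>F. L2_inner M f (e i) * e i m)) (%m. f m - (\<Sum>i\<in>F. L2_inner M f (e i) * e i m))
  = L2_inner M f f - (\<Sum>i\<in>F. (L2_inner M f (e i))^2)"
proof -
 let ?s = "%m. \<Sum>i\<in>F. L2_inner M f (e i) * e i m"
 have e: "e i \<in> L2 M" if "i \<in> F" for i using o F that by (auto simp: L2_orthonormal_def)
 have s: "?s \<in> L2 M" using e by (intro L2_sum L2_scale) auto
 have "L2_inner M f ?s = L2_inner M ?s f" by (rule L2_inner_commute)
 also have "... = (\<Sum>i\<in>F. L2_inner M (%m. L2_inner M f (e i) * e i m) f)" using e f by (intro L2_inner_sum) auto
 also have "... = (\<Sum>i\<in>F. (L2_inner M f (e i))^2)" by (simp add: L2_inner_scale L2_inner_commute[of _ f] power2_eq_square)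
 finally have fs: "L2_inner M f ?s = (\<Sum>i\<in>F. (L2_inner M f (e i))^2)" .
 show ?thesis using L2_diff_square[OF f s, of 1] by (simp add: fs L2_combination_norm[OF o F])
qed

lemma L2_bessel:
 assumes o: "L2_orthonormal I e" and F: "finite F" "F \<subseteq> I" and f: "f \<in> L2 M"
 shows "(\<Sum>i\<in>F. (L2_inner M f (e i))^2) <= L2_inner M f f"
 using L2_inner_nonneg[of "%m. f m - (\<Sum>i\<in>F. L2_inner M f (e i) * e i m)"] unfolding L2_projection_norm[OF assms] by simp

text \<open>The Fourier series is Cauchy by Bessel's inequality, its limit has the coefficients of
  f, and totality makes the difference null. Indices outside I carry zero terms, so that ordinary
  series over the naturals apply.\<close>

lemma L2_parseval_square:
 assumes onb: "L2_onb M I e" and f: "f \<in> L2 M"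
 shows "((%i. (L2_inner M f (e i))^2) has_sum L2_inner M f f) I"
proof -
 let ?X = "%s i j. L2_norm M (%m. s i m - s j m)"
 let ?U = "%s n g. %m. s n m - g m"
 have o: "L2_orthonormal I e" using onb by (auto simp: L2_onb_def L2_orthonormal_def)
 have e: "e i \<in> L2 M" if "i \<in> I" for i using o that by (auto simp: L2_orthonormal_def)
 define c where "c = (%i. if i \<in> I then (L2_inner M f (e i))^2 else 0)"
 define s where "s = (%k m. \<Sum>i\<in>{..<k} \<inter> I. L2_inner M f (e i) * e i m)"
 have s: "s k \<in> L2 M" for k unfolding s_def by (intro L2_sum L2_scale e) auto
 have csum: "sum c A = (\<Sum>i\<in>A \<inter> I. (L2_inner M f (e i))^2)" if "finite A" for A using that by (simp add: c_def sum.inter_restrict)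
 have "summable c"
 proof (rule bounded_imp_summable)
  show "sum c {..k} <= L2_inner M f f" for k unfolding csum[OF finite_atMost] by (intro L2_bessel[OF o _ _ f]) auto
 qed (auto simp: c_def)
 have diff: "?X s i j = sqrt (sum c {j..<i})" if "j <= i" for i j
 proof -
  have "s i m - s j m = (\<Sum>i\<in>{j..<i} \<inter> I. L2_inner M f (e i) * e i m)" for m
  proof -
   have "{..<i} \<inter> I = ({..<j} \<inter> I) \<union> ({j..<i} \<inter> I)" using that by auto
   thus ?thesis unfolding s_def by (simp add: sum.union_disjoint disjoint_iff)
  qed
  hence "?X s i j = sqrt (L2_inner M (%m. \<Sum>i\<in>{j..<i} \<inter> I. L2_inner M f (e i) * e i m) (%m. \<Sum>i\<in>{j..<i} \<inter> I. L2_inner M f (e i) * e i m))"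
   by (simp add: L2_norm_def L2_inner_def power2_eq_square)
  thus ?thesis by (subst (asm) L2_combination_norm[OF o]) (auto simp: csum)
 qed
 have cau: "\<exists>N. \<forall>i\<ge>N. \<forall>j\<ge>N. ?X s i j < \<epsilon>" if \<epsilon>: "\<epsilon> > 0" for \<epsilon>
 proof -
  obtain N where N: "norm (sum c {j..<i}) < \<epsilon>^2" if "j >= N" for i j using \<open>summable c\<close> \<epsilon> unfolding summable_Cauchy by (meson zero_less_power)
  have 1: "?X s i j < \<epsilon>" if "j >= N" "j <= i" for i j unfolding diff[OF that(2)] using N[OF that(1), of i] \<epsilon> by (intro real_less_lsqrt) auto
  have "?X s i j < \<epsilon>" if "i >= N" "j >= N" for i j
  proof (cases "j <= i")
   case False
   hence "L2_norm M (%m. s j m - s i m) < \<epsilon>" using 1[of i j] that by simp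
   thus ?thesis by (simp add: L2_norm_def power2_commute)
  qed (use 1 that in auto)
  thus ?thesis by blast
 qed
 obtain g where g: "g \<in> L2 M" "(%n. L2_norm M (?U s n g)) \<longlonglongrightarrow> 0" by (rule L2_complete[where s = s, OF s cau])
 have "L2_inner M (%m. f m - g m) (e i) = 0" if i: "i \<in> I" for i
 proof -
  have "(%n. L2_inner M (?U s n g) (e i)) \<longlonglongrightarrow> 0"
  proof (rule Lim_null_comparison[OF always_eventually])
   show "\<forall>n. norm (L2_inner M (?U s n g) (e i)) <= L2_norm M (?U s n g) * L2_norm M (e i)"
    using L2_cauchy_schwarz[OF L2_diff[OF s g(1)] e[OF i]] by simp
   show "(%n. L2_norm M (?U s n g) * L2_norm M (e i)) \<longlonglongrightarrow> 0" by (intro tendsto_mult_left_zero g)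
  qed
  moreover have "(%n. L2_inner M (?U s n g) (e i)) \<longlonglongrightarrow> L2_inner M f (e i) - L2_inner M g (e i)"
  proof (rule tendsto_eventually, goal_cases)
   case 1 show ?case unfolding eventually_sequentially
   proof (intro exI[of _ "Suc i"] allI impI, goal_cases)
    case (1 n)
    hence "L2_inner M (s n) (e i) = L2_inner M f (e i)" unfolding s_def using i by (subst L2_combination_inner[OF o]) auto
    thus ?case by (simp add: L2_inner_diff s g e i)
   qed
  qed
  ultimately have "L2_inner M f (e i) - L2_inner M g (e i) = 0" using LIMSEQ_unique by blast
  thus ?thesis by (simp add: L2_inner_diff f g e i)
 qed
 hence z: "L2_norm M (%m. f m - g m) = 0" using onb L2_diff[OF f g(1)] by (auto simp: L2_onb_def)
 have "(%n. L2_norm M (%m. f m - s n m)) \<longlonglongrightarrow> 0"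
 proof (rule Lim_null_comparison[OF always_eventually g(2)], intro allI, goal_cases)
  case (1 n)
  have "L2_norm M (%m. (f m - g m) + (-1) * (s n m - g m)) <= L2_norm M (%m. f m - g m) + L2_norm M (%m. (-1) * (s n m - g m))"
   using f g s by (intro L2_norm_triangle L2_scale) auto
  thus ?case unfolding z L2_norm_scale by simp
 qed
 hence "(%n. (L2_norm M (%m. f m - s n m))^2) \<longlonglongrightarrow> 0" using tendsto_power[of _ 0 _ 2] by fastforce
 moreover have "(L2_norm M (%m. f m - s n m))^2 = L2_inner M f f - sum c {..<n}" for n
  unfolding L2_norm_square s_def by (subst L2_projection_norm[OF o _ _ f]) (auto simp: csum)
 ultimately have "(%n. L2_inner M f f - sum c {..<n}) \<longlonglongrightarrow> 0" by simp
 from tendsto_diff[OF tendsto_const this, of "L2_inner M f f"] have "c sums L2_inner M f f" by (simp add: sums_def)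
 hence "(c has_sum L2_inner M f f) UNIV" by (rule sums_nonneg_imp_has_sum) (auto simp: c_def)
 moreover have "(c has_sum L2_inner M f f) UNIV \<longleftrightarrow> ((%i. (L2_inner M f (e i))^2) has_sum L2_inner M f f) I"
  by (rule has_sum_cong_neutral) (auto simp: c_def)
 ultimately show ?thesis by simp
qed

text \<open>Polarisation of the quadratic identity.\<close>

lemma L2_parseval:
 assumes onb: "L2_onb M I e" and f: "f \<in> L2 M" and g: "g \<in> L2 M"
 shows "((%i. L2_inner M f (e i) * L2_inner M g (e i)) has_sum L2_inner M f g) I"
proof -
 let ?X = "%i. (1 / 2) * ((L2_inner M (%m. f m + g m) (e i))^2 + (-1) * (L2_inner M f (e i))^2 + (-1) * (L2_inner M g (e i))^2)"
 let ?U = "L2_inner M (%m. f m + g m) (%m. f m + g m)"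
 have fg: "(%m. f m + g m) \<in> L2 M" using f g by auto
 have e: "e i \<in> L2 M" if "i \<in> I" for i using onb that by (auto simp: L2_onb_def)
 have pol: "?U = L2_inner M f f + 2 * L2_inner M f g + L2_inner M g g" using L2_diff_square[OF f g, of "-1"] by simp
 have "(?X
  has_sum (1 / 2) * (?U + (-1) * L2_inner M f f + (-1) * L2_inner M g g)) I"
  by (intro has_sum_cmult_right has_sum_add L2_parseval_square[OF onb] f g fg)
 also have "(?X
  has_sum (1 / 2) * (?U + (-1) * L2_inner M f f + (-1) * L2_inner M g g)) I
  \<longleftrightarrow> ?thesis"
  unfolding pol by (intro has_sum_cong_both) (auto simp: L2_inner_add f g e power2_sum)
 finally show ?thesis .
qed

end

section \<open>Existence of orthonormal bases of L2\<close>

context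
 notes sum.cong [fundef_cong]
begin

text \<open>Elements of L2 are functions with a seminorm and not vectors of a type, whence a second
  orthogonalisation. A null remainder is again sent to 0 by 1 / 0 = 0.\<close>

fun L2_gram_schmidt :: "'a measure => (nat => 'a => real) => nat => 'a => real" where
 "L2_gram_schmidt M d k = (let r = (%m. d k m - (\<Sum>j<k. L2_inner M (d k) (L2_gram_schmidt M d j) * L2_gram_schmidt M d j m))
  in (%m. (1 / L2_norm M r) * r m))"

end

declare L2_gram_schmidt.simps [simp del]

context prob_space
begin

lemma L2_inner_zero:
 assumes "f \<in> L2 M" "g \<in> L2 M" "L2_inner M g g = 0"
 shows "L2_inner M f g = 0"
 using L2_cauchy_schwarz_square[OF assms(1,2)] assms(3) by simp

lemma L2_gram_schmidt_L2:
 assumes d: "!!k. d k \<in> L2 M"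
 shows "L2_gram_schmidt M d k \<in> L2 M"
proof (induction k rule: less_induct)
 case (less k)
 show ?case by (subst L2_gram_schmidt.simps, unfold Let_def, intro L2_scale L2_diff L2_sum d less) simp
qed

lemma L2_gram_schmidt_unit:
 "L2_inner M (L2_gram_schmidt M d k) (L2_gram_schmidt M d k) \<in> {0, 1}"
proof -
 define r where "r = (%m. d k m - (\<Sum>j<k. L2_inner M (d k) (L2_gram_schmidt M d j) * L2_gram_schmidt M d j m))"
 have "L2_gram_schmidt M d k = (%m. (1 / L2_norm M r) * r m)" by (subst L2_gram_schmidt.simps) (simp add: Let_def r_def)
 hence "(L2_norm M (L2_gram_schmidt M d k))^2 = (\<bar>1 / L2_norm M r\<bar> * L2_norm M r)^2" by (simp only: L2_norm_scale)
 thus ?thesis unfolding L2_norm_square by (cases "L2_norm M r = 0") auto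
qed

lemma L2_gram_schmidt_orthogonal:
 assumes d: "!!k. d k \<in> L2 M"
 shows "i \<noteq> j ==> L2_inner M (L2_gram_schmidt M d i) (L2_gram_schmidt M d j) = 0"
proof -
 let ?g = "L2_gram_schmidt M d"
 have g: "?g k \<in> L2 M" for k by (rule L2_gram_schmidt_L2[OF d])
 have orth: "\<forall>j<i. L2_inner M (?g i) (?g j) = 0" for i
 proof (induction i rule: less_induct)
  case (less i)
  show ?case
  proof (intro allI impI, goal_cases)
   case (1 j) note j = 1
   let ?s = "%m. \<Sum>l<i. L2_inner M (d i) (?g l) * ?g l m"
   have s: "?s \<in> L2 M" by (intro L2_sum L2_scale g)
   have "L2_inner M ?s (?g j) = (\<Sum>l<i. L2_inner M (d i) (?g l) * L2_inner M (?g l) (?g j))"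
    by (subst L2_inner_sum) (auto simp: L2_inner_scale intro!: g)
   also have "L2_inner M (?g l) (?g j) = 0" if "l \<in> {..<i} - {j}" for l using less.IH[of l] less.IH[of j] that j
    by (cases "l < j") (auto simp: L2_inner_commute[of "?g l"] not_less le_less)
   hence "(\<Sum>l<i. L2_inner M (d i) (?g l) * L2_inner M (?g l) (?g j))
     = L2_inner M (d i) (?g j) * L2_inner M (?g j) (?g j)"
    using j by (subst sum.remove[of _ j]) (auto intro!: sum.neutral)
   also have "... = L2_inner M (d i) (?g j)" using L2_gram_schmidt_unit[of d j] L2_inner_zero[OF d g, of j i] by auto
   finally have "L2_inner M (%m. d i m - ?s m) (?g j) = 0" by (simp add: L2_inner_diff d s g)
   thus ?case by (subst L2_gram_schmidt.simps, unfold Let_def L2_inner_scale) simp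
  qed
 qed
 show "i \<noteq> j ==> L2_inner M (?g i) (?g j) = 0" using orth[of i] orth[of j] by (cases "i < j") (auto simp: L2_inner_commute[of "?g i"] not_less le_less)
qed

lemma L2_gram_schmidt_total:
 assumes d: "!!k. d k \<in> L2 M" and f: "f \<in> L2 M"
  and "!!k. L2_inner M f (L2_gram_schmidt M d k) = 0"
 shows "L2_inner M f (d k) = 0"
proof -
 let ?g = "L2_gram_schmidt M d"
 let ?s = "%m. \<Sum>l<k. L2_inner M (d k) (?g l) * ?g l m"
 have g: "?g k \<in> L2 M" for k by (rule L2_gram_schmidt_L2[OF d])
 have s: "?s \<in> L2 M" by (intro L2_sum L2_scale g)
 define r where "r = (%m. d k m - ?s m)"
 have r: "r \<in> L2 M" unfolding r_def by (intro L2_diff d s)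
 have gk: "?g k = (%m. (1 / L2_norm M r) * r m)" by (subst L2_gram_schmidt.simps) (simp add: Let_def r_def)
 have "L2_inner M r f = 0"
 proof (cases "L2_norm M r = 0")
  case True
  hence "L2_inner M r r = 0" using L2_norm_square[of r] by simp
  hence "L2_inner M f r = 0" by (rule L2_inner_zero[OF f r])
  thus ?thesis by (subst L2_inner_commute)
 next
  case False
  have "L2_inner M (?g k) f = 0" using assms(3)[of k] by (subst L2_inner_commute)
  thus ?thesis using False unfolding gk L2_inner_scale by simp
 qed
 moreover have "L2_inner M ?s f = 0"
 proof -
  have "L2_inner M (?g l) f = 0" for l using assms(3)[of l] by (subst L2_inner_commute)
  thus ?thesis by (subst L2_inner_sum) (auto simp: L2_inner_scale intro!: g f L2_scale)
 qed
 ultimately have "L2_inner M (d k) f = 0" by (simp add: r_def L2_inner_diff d s f)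
 thus ?thesis by (subst L2_inner_commute)
qed

text \<open>Dynkin's argument: the sets over which f integrates to zero contain an
  intersection-stable generator and are closed under complements and countable disjoint
  unions.\<close>

lemma AE_zero_if_orthogonal_to_generator:
 assumes G: "Int_stable G" "G \<subseteq> Pow (space M)" "sets M = sigma_sets (space M) G" "space M \<in> G"
  and f: "f \<in> L2 M" and 0: "!!A. A \<in> G ==> L2_inner M f (indicator A) = 0"
 shows "AE m in M. f m = 0"
proof -
 have int: "integrable M f" by (rule L2_integrable[OF f])
 have eq: "(\<integral>m\<in>A. f m \<partial>M) = L2_inner M f (indicator A)" for A unfolding L2_inner_def set_lebesgue_integral_def by (simp add: mult.commute)
 have si: "set_integrable M A f" if "A \<in> sets M" for A unfolding set_integrable_def using int that by (intro integrable_mult_indicator)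
 have all: "(\<integral>m\<in>A. f m \<partial>M) = 0" if "A \<in> sets M" for A
 proof -
  have "A \<in> sigma_sets (space M) G" using G that by simp
  from G(1,2) this show ?thesis
  proof (induction rule: sigma_sets_induct_disjoint)
   case (basic A)
   thus ?case using 0 by (simp add: eq)
  next
   case empty
   thus ?case by (simp add: set_lebesgue_integral_def)
  next
   case (compl A)
   hence A: "A \<in> sets M" using G by simp
   have "(\<integral>m\<in>space M. f m \<partial>M) = (\<integral>m\<in>A \<union> (space M - A). f m \<partial>M)" using sets.sets_into_space[OF A] by (simp add: Un_absorb1)
   also have "... = (\<integral>m\<in>A. f m \<partial>M) + (\<integral>m\<in>space M - A. f m \<partial>M)" using A by (intro set_integral_Un si) auto
   finally show ?case using 0[OF G(4)] compl eq[of "space M"] by simp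
  next
   case (union A)
   hence A: "A i \<in> sets M" for i using G by auto
   have "(\<integral>m\<in>(\<Union>i. A i). f m \<partial>M) = (\<Sum>i. (\<integral>m\<in>A i. f m \<partial>M))"
    using union(1) A by (intro lebesgue_integral_countable_add si) (auto simp: disjoint_family_on_def)
   thus ?case using union by simp
  qed
 qed
 show ?thesis by (rule density_unique_real[OF int]) (auto simp: all set_lebesgue_integral_def[of _ _ "%_. 0"])
qed

lemma ex_L2_onb:
 assumes G: "Int_stable G" "G \<subseteq> Pow (space M)" "sets M = sigma_sets (space M) G" "space M \<in> G" "countable G"
 shows "\<exists>I e. L2_onb M I e"
proof -
 define d where "d = (%k. indicator (from_nat_into G k) :: 'a => real)"
 have Gne: "G \<noteq> {}" using G(4) by auto
 have "from_nat_into G k \<in> sets M" for k using from_nat_into[OF Gne, of k] G(3) by (auto intro: sigma_sets.Basic)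
 hence d: "d k \<in> L2 M" for k unfolding d_def by (intro bounded_L2[where c = 1]) (auto simp: indicator_def)
 let ?g = "L2_gram_schmidt M d"
 define I where "I = {k. L2_inner M (?g k) (?g k) = 1}"
 have g: "?g k \<in> L2 M" for k by (rule L2_gram_schmidt_L2[OF d])
 have "L2_onb M I ?g" unfolding L2_onb_def
 proof (intro conjI ballI impI)
  show "L2_inner M (?g i) (?g j) = (if i = j then 1 else 0)" if "i \<in> I" "j \<in> I" for i j
   using that L2_gram_schmidt_orthogonal[OF d, of i j] by (auto simp: I_def)
  fix f assume f: "f \<in> L2 M" and 0: "\<forall>i\<in>I. L2_inner M f (?g i) = 0"
  have "L2_inner M f (?g k) = 0" for k
  proof (cases "k \<in> I")
   case False
   hence "L2_inner M (?g k) (?g k) = 0" using L2_gram_schmidt_unit[of d k] by (simp add: I_def)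
   thus ?thesis by (rule L2_inner_zero[OF f g])
  qed (use 0 in auto)
  hence fd: "L2_inner M f (d k) = 0" for k by (intro L2_gram_schmidt_total[OF d f])
  have "AE m in M. f m = 0"
  proof (rule AE_zero_if_orthogonal_to_generator[OF G(1-4) f], goal_cases)
   case (1 A)
   thus ?case using fd[of "to_nat_on G A"] G(5) by (simp add: d_def)
  qed
  hence "L2_inner M f f = (LINT m|M. 0)" unfolding L2_inner_def using f by (intro integral_cong_AE) (auto simp: L2_def)
  thus "L2_norm M f = 0" by (simp add: L2_norm_def L2_inner_def power2_eq_square)
 qed (rule g)
 thus ?thesis by blast
qed

end

text \<open>Finite intersections of a countable base generate the trace \<sigma>-algebra and are
  stable under intersection. Some basis must exist for \<open>effective_dim\<close> to have its
  meaning, since \<open>L2_trace\<close> characterises its value through all bases.\<close>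

lemma ex_L2_onb_borel:
 fixes P :: "'g::second_countable_topology set"
 assumes "prob_space \<mu>" "sets \<mu> = sets (restrict_space borel P)"
 shows "\<exists>I e. L2_onb \<mu> I e"
proof -
 interpret prob_space \<mu> by fact
 obtain B :: "'g set set" where B: "countable B" "topological_basis B" using ex_countable_basis by blast
 define C where "C = {X. \<exists>F. F \<subseteq> B \<and> finite F \<and> X = \<Inter>F}"
 define G where "G = (\<inter>) P ` C"
 have P: "space \<mu> = P" using sets_eq_imp_space_eq[OF assms(2)] by (simp add: space_restrict_space)
 have "C = Inter ` {F. finite F \<and> F \<subseteq> B}" by (auto simp: C_def)
 hence "countable C" using countable_Collect_finite_subset[OF B(1)] by simp
 have Cint: "X \<inter> Y \<in> C" if XY: "X \<in> C" "Y \<in> C" for X Y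
 proof -
  obtain F where F: "F \<subseteq> B" "finite F" "X = \<Inter>F" using XY(1) unfolding C_def by auto
  obtain F' where F': "F' \<subseteq> B" "finite F'" "Y = \<Inter>F'" using XY(2) unfolding C_def by auto
  have "X \<inter> Y = \<Inter>(F \<union> F')" using F F' by auto
  thus ?thesis unfolding C_def mem_Collect_eq using F F' by (intro exI[of _ "F \<union> F'"]) simp
 qed
 have UC: "UNIV \<in> C" unfolding C_def mem_Collect_eq by (rule exI[of _ "{}"]) simp
 have BC: "B \<subseteq> C"
 proof
  fix X assume "X \<in> B"
  thus "X \<in> C" unfolding C_def mem_Collect_eq by (intro exI[of _ "{X}"]) simp
 qed
 have Copen: "X \<in> sets borel" if X: "X \<in> C" for X
 proof -
  obtain F where F: "F \<subseteq> B" "finite F" "X = \<Inter>F" using X unfolding C_def by auto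
  have "open (\<Inter>F)" using F topological_basis_open[OF B(2)] by (intro open_Inter) auto
  hence "open X" using F by simp
  thus ?thesis by simp
 qed
 have sb: "sets (borel :: 'g measure) = sigma_sets UNIV B" by (subst borel_eq_countable_basis[OF B]) simp
 have "sigma_sets UNIV B = sigma_sets UNIV C"
 proof (rule sigma_sets_eqI)
  show "a \<in> sigma_sets UNIV C" if "a \<in> B" for a using that BC by auto
  show "a \<in> sigma_sets UNIV B" if "a \<in> C" for a using Copen[OF that] unfolding sb .
 qed
 hence borel: "sets (borel :: 'g measure) = sigma_sets UNIV C" unfolding sb .
 have "sets \<mu> = (\<inter>) P ` sigma_sets UNIV C" unfolding assms(2) sets_restrict_space borel ..
 also have "... = {id -` A \<inter> P |A. A \<in> sigma_sets UNIV C}" by (auto simp: image_iff)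
 also have "... = sigma_sets P {id -` A \<inter> P |A. A \<in> C}" by (rule sigma_sets_vimage_commute) auto
 also have "{id -` A \<inter> P |A. A \<in> C} = G" by (auto simp: G_def image_iff)
 finally have sets: "sets \<mu> = sigma_sets (space \<mu>) G" using P by simp
 show ?thesis
 proof (rule ex_L2_onb[OF _ _ sets])
  show "Int_stable G"
  proof (rule Int_stableI)
   fix a b assume "a \<in> G" "b \<in> G"
   then obtain x y where "x \<in> C" "y \<in> C" "a = P \<inter> x" "b = P \<inter> y" by (auto simp: G_def)
   moreover from this have "a \<inter> b = P \<inter> (x \<inter> y)" by auto
   ultimately show "a \<inter> b \<in> G" using Cint unfolding G_def by blast
  qed
  show "space \<mu> \<in> G" unfolding P G_def using UC by (intro image_eqI[of _ _ UNIV]) auto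
  show "countable G" unfolding G_def using \<open>countable C\<close> by simp
 qed (auto simp: G_def P)
qed

text \<open>The features have two bounds: B at every point, which makes all integrands bounded, and
  \<kappa> almost everywhere, on which rates and step size depend.\<close>

locale feature_space = prob_space M + hilbert_basis v
 for M :: "'g measure" and v :: "nat => 'k::{real_inner,banach}" +
 fixes \<phi> :: "'g => 'k" and val :: "'k => 'g => real" and B \<kappa> :: real
 assumes wm_feature: "weak_meas M \<phi>"
  and feature_bound: "!!m. m \<in> space M ==> norm (\<phi> m) <= B"
  and feature_AE: "AE m in M. (norm (\<phi> m))^2 <= \<kappa>^2"
  and val: "!!h m. m \<in> space M ==> val h m = h \<bullet> \<phi> m"
begin

lemma B_nonneg: "0 <= B"
proof -
 obtain m where "m \<in> space M" using not_empty by blast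
 from order_trans[OF norm_ge_zero feature_bound[OF this]] show ?thesis .
qed

lemma val_L2 [intro]: "val h \<in> L2 M"
proof -
 have "val h \<in> borel_measurable M \<longleftrightarrow> (%m. h \<bullet> \<phi> m) \<in> borel_measurable M" by (intro measurable_cong) (simp add: val)
 hence "val h \<in> borel_measurable M" using wm_inner_const[OF wm_feature, of h] by (simp add: inner_commute)
 moreover have "\<bar>val h m\<bar> <= norm h * B" if "m \<in> space M" for m
  using order_trans[OF Cauchy_Schwarz_ineq2 mult_left_mono[OF feature_bound[OF that]], of h] by (simp add: val[OF that])
 ultimately show ?thesis by (intro bounded_L2[where c = "norm h * B"]) auto
qed

lemma L2_norm_val_le: "L2_norm M (val h) <= norm h * B"
proof -
 have "(LINT m|M. (val h m)^2) <= (LINT m|M. (norm h * B)^2)"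
 proof (rule integral_mono)
  fix m assume m: "m \<in> space M"
  have "\<bar>val h m\<bar> <= norm h * B" using order_trans[OF Cauchy_Schwarz_ineq2 mult_left_mono[OF feature_bound[OF m]], of h] by (simp add: val[OF m])
  hence "\<bar>val h m\<bar>^2 <= (norm h * B)^2" by (rule power_mono) simp
  thus "(val h m)^2 <= (norm h * B)^2" by simp
 qed (auto intro: L2_D val_L2)
 thus ?thesis unfolding L2_norm_def using B_nonneg by (intro real_le_lsqrt) (auto simp: prob_space)
qed

lemma L2_inner_cong_space:
 "(!!m. m \<in> space M ==> f m = f' m) ==> (!!m. m \<in> space M ==> g m = g' m) ==> L2_inner M f g = L2_inner M f' g'"
 unfolding L2_inner_def by (intro bochner_cong) auto

lemma val_add_space: "m \<in> space M ==> val (h + h') m = val h m + val h' m"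
 and val_scale_space: "m \<in> space M ==> val (a *\<^sub>R h) m = a * val h m"
 by (simp_all add: val inner_add_left)

section \<open>The adjoint of the inclusion, the population covariance and the effective
  dimension\<close>

lemma adj:
 assumes f: "f \<in> L2 M"
 shows "inclusion_adj M val f \<bullet> h = L2_inner M f (val h)"
proof -
 have "bounded_linear (%h. L2_inner M f (val h))"
 proof (rule bounded_linear_intro)
  show "L2_inner M f (val (x + y)) = L2_inner M f (val x) + L2_inner M f (val y)" for x y
  proof -
   have "L2_inner M f (val (x + y)) = L2_inner M (%m. val x m + val y m) f"
    by (subst L2_inner_commute, rule L2_inner_cong_space) (auto simp: val_add_space)
   thus ?thesis by (simp add: L2_inner_add f val_L2 L2_inner_commute[of f])
  qed
  show "L2_inner M f (val (r *\<^sub>R x)) = r *\<^sub>R L2_inner M f (val x)" for r x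
  proof -
   have "L2_inner M f (val (r *\<^sub>R x)) = L2_inner M (%m. r * val x m) f"
    by (subst L2_inner_commute, rule L2_inner_cong_space) (auto simp: val_scale_space)
   thus ?thesis by (simp add: L2_inner_scale L2_inner_commute[of f])
  qed
  show "norm (L2_inner M f (val h)) <= norm h * (L2_norm M f * B)" for h
  proof -
   have "\<bar>L2_inner M f (val h)\<bar> <= L2_norm M f * L2_norm M (val h)" by (intro L2_cauchy_schwarz f val_L2)
   also have "... <= L2_norm M f * (norm h * B)" by (intro mult_left_mono L2_norm_val_le) simp
   finally show ?thesis by (simp add: mult_ac)
  qed
 qed
 from theI'[OF riesz[OF this]] show ?thesis unfolding inclusion_adj_def by blast
qed

lemma adj_unique: "f \<in> L2 M ==> (!!h. g \<bullet> h = L2_inner M f (val h)) ==> inclusion_adj M val f = g"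
 by (rule vector_eq_rdot[THEN iffD1]) (simp add: adj)

text \<open>The population covariance operator on the RKHS; \<open>kernel_op\<close> composes the
  inclusion and its adjoint in the opposite order.\<close>

definition pop_op :: "'k => 'k" where
 "pop_op h = inclusion_adj M val (val h)"

lemma inner_pop_op: "pop_op h \<bullet> g = L2_inner M (val h) (val g)"
 unfolding pop_op_def by (rule adj) auto

lemma norm_adj_le:
 assumes "f \<in> L2 M"
 shows "norm (inclusion_adj M val f) <= L2_norm M f * B"
proof -
 let ?g = "inclusion_adj M val f"
 have "(norm ?g)^2 = L2_inner M f (val ?g)" by (simp add: power2_norm_eq_inner adj assms)
 also have "... <= L2_norm M f * L2_norm M (val ?g)" using L2_cauchy_schwarz[OF assms val_L2, of ?g] by simp
 also have "... <= L2_norm M f * (norm ?g * B)" by (intro mult_left_mono L2_norm_val_le) simp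
 finally have le: "norm ?g * norm ?g <= (L2_norm M f * B) * norm ?g" by (simp add: power2_eq_square mult_ac)
 thus ?thesis
 proof (cases "norm ?g = 0")
  case True
  thus ?thesis using B_nonneg by simp
 next
  case False
  show ?thesis by (rule mult_right_le_imp_le[OF le]) (use False in simp)
 qed
qed

lemma bounded_linear_pop_op: "bounded_linear pop_op"
proof (rule bounded_linear_intro)
 show "pop_op (x + y) = pop_op x + pop_op y" for x y
 proof -
  have "pop_op (x + y) \<bullet> h = (pop_op x + pop_op y) \<bullet> h" for h
  proof -
   have "L2_inner M (val (x + y)) (val h) = L2_inner M (%m. val x m + val y m) (val h)" by (rule L2_inner_cong_space) (auto simp: val_add_space)
   thus ?thesis by (simp add: inner_add_left inner_pop_op L2_inner_add val_L2)
  qed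
  thus ?thesis by (rule vector_eq_rdot[THEN iffD1, OF allI])
 qed
 show "pop_op (r *\<^sub>R x) = r *\<^sub>R pop_op x" for r x
 proof -
  have "pop_op (r *\<^sub>R x) \<bullet> h = (r *\<^sub>R pop_op x) \<bullet> h" for h
  proof -
   have "L2_inner M (val (r *\<^sub>R x)) (val h) = L2_inner M (%m. r * val x m) (val h)" by (rule L2_inner_cong_space) (auto simp: val_scale_space)
   thus ?thesis by (simp add: inner_pop_op L2_inner_scale)
  qed
  thus ?thesis by (rule vector_eq_rdot[THEN iffD1, OF allI])
 qed
 show "norm (pop_op x) <= norm x * (B * B)" for x
 proof -
  have "norm (pop_op x) <= L2_norm M (val x) * B" unfolding pop_op_def by (rule norm_adj_le) auto
  also have "... <= norm x * B * B" using L2_norm_val_le B_nonneg by (intro mult_right_mono)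
  finally show "norm (pop_op x) <= norm x * (B * B)" by (simp add: mult.assoc)
 qed
qed

lemma pop_op_sym: "pop_op x \<bullet> y = x \<bullet> pop_op y"
 unfolding inner_commute[of x] inner_pop_op by (rule L2_inner_commute)

lemma psd_op_pop:
 assumes "\<theta> > 0"
 shows "psd_op pop_op \<theta>"
proof (rule psd_op.intro[OF bounded_linear_pop_op _ pop_op_sym assms])
 show "0 <= x \<bullet> pop_op x" for x by (subst inner_commute) (simp add: inner_pop_op)
qed

text \<open>If g solves the equation and z is the adjoint of the inclusion applied to g, then
  applying this adjoint to the whole equation gives (T + \<theta>) z on one side and the adjoint of
  f on the other. So every choice that SOME can make has the same image. The first half of the proof
  supplies a solution to choose.\<close>

lemma kernel_op_shifted_inverse:
 assumes "\<theta> > 0" and f: "f \<in> L2 M"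
 shows "kernel_op M val (shifted_inverse M (kernel_op M val) \<theta> f)
  = val (resolvent pop_op \<theta> (inclusion_adj M val f))"
proof -
 interpret T: psd_op pop_op \<theta> by (rule psd_op_pop[OF assms(1)])
 define z0 where "z0 = resolvent pop_op \<theta> (inclusion_adj M val f)"
 define Q where "Q = (%g. g \<in> L2 M \<and> (AE m in M. kernel_op M val g m + \<theta> * g m = f m))"
 have "Q (%m. (1 / \<theta>) * (f m - val z0 m))"
 proof -
  let ?g = "%m. (1 / \<theta>) * (f m - val z0 m)"
  have g: "?g \<in> L2 M" by (intro L2_scale L2_diff f val_L2)
  have "inclusion_adj M val ?g = z0"
  proof (rule adj_unique[OF g], goal_cases)
   case (1 h)
   have "L2_inner M ?g (val h) = (1 / \<theta>) * ((inclusion_adj M val f - pop_op z0) \<bullet> h)"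
    unfolding L2_inner_scale by (simp add: L2_inner_diff f val_L2 inner_diff_left adj inner_pop_op)
   thus ?case using assms(1) by (simp add: z0_def T.op_resolvent inner_diff_left)
  qed
  thus ?thesis using g assms(1) by (auto simp: Q_def kernel_op_def)
 qed
 hence "Q (SOME g. Q g)" by (rule someI[where P = Q])
 hence Q: "Q (shifted_inverse M (kernel_op M val) \<theta> f)" unfolding shifted_inverse_def Q_def .
 define g where "g = shifted_inverse M (kernel_op M val) \<theta> f"
 have g: "g \<in> L2 M" and ae: "AE m in M. kernel_op M val g m + \<theta> * g m = f m" using Q by (auto simp: Q_def g_def)
 define z where "z = inclusion_adj M val g"
 have "inclusion_adj M val f = pop_op z + \<theta> *\<^sub>R z"
 proof (rule adj_unique[OF f], goal_cases)
  case (1 h)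
  have "L2_inner M f (val h) = L2_inner M (%m. val z m + \<theta> * g m) (val h)" unfolding L2_inner_def
  proof (rule integral_cong_AE, goal_cases)
   case 1 show ?case using f val_L2[of h] by (auto simp: L2_def)
   case 2 show ?case using g val_L2[of h] val_L2[of z] by (auto simp: L2_def)
   case 3 show ?case using ae by eventually_elim (simp add: kernel_op_def z_def)
  qed
  also have "... = (pop_op z + \<theta> *\<^sub>R z) \<bullet> h" by (simp add: L2_inner_add L2_inner_scale val_L2 g L2_scale inner_add_left inner_pop_op z_def adj)
  finally show ?case ..
 qed
 hence "resolvent pop_op \<theta> (inclusion_adj M val f) = z" by (intro T.resolvent_unique) simp
 thus ?thesis by (simp add: kernel_op_def z_def g_def)
qed

text \<open>A followed by the inclusion is a Hilbert-Schmidt operator: by symmetry of A and Bessel,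
  the sum over the basis at a point m is at most |A \<phi>(m)|^2.\<close>

lemma summable_L2_norm_val:
 assumes A: "!!x y. A x \<bullet> y = x \<bullet> A y" "!!x. norm (A x) <= norm x * K" and K: "0 <= K"
 shows "summable (%k. L2_inner M (val (A (v k))) (val (A (v k))))"
proof (rule bounded_imp_summable)
 fix k
 have "(\<Sum>i\<le>k. L2_inner M (val (A (v i))) (val (A (v i)))) = (LINT m|M. (\<Sum>i\<le>k. (val (A (v i)) m)^2))" unfolding L2_inner_def power2_eq_square
  by (subst bochner_sum) (auto intro!: L2_mult_integrable)
 also have "... <= (LINT m|M. (B * K)^2)"
 proof (rule integral_mono)
  show "integrable M (%m. \<Sum>i\<le>k. (val (A (v i)) m)^2)" by (auto intro!: L2_D(2) val_L2)
  fix m assume m: "m \<in> space M"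
  have "(\<Sum>i\<le>k. (val (A (v i)) m)^2) = (\<Sum>i<Suc k. (A (\<phi> m) \<bullet> v i)^2)" unfolding lessThan_Suc_atMost
   by (intro sum.cong refl arg_cong[where f = "%x. x^2"]) (metis A(1) inner_commute val[OF m])
  also have "... <= A (\<phi> m) \<bullet> A (\<phi> m)" using parseval[of "A (\<phi> m)" "A (\<phi> m)"] sum_le_suminf[of "%i. (A (\<phi> m) \<bullet> v i)^2" "{..<Suc k}"]
   by (auto simp: sums_iff power2_eq_square)
  also have "... = (norm (A (\<phi> m)))^2" by (simp add: power2_norm_eq_inner)
  also have "... <= (B * K)^2"
  proof (rule power_mono, goal_cases)
   case 1 have "norm (A (\<phi> m)) <= norm (\<phi> m) * K" by (rule A)
   also have "... <= B * K" using feature_bound[OF m] K by (rule mult_right_mono)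
   finally show ?case .
  qed simp
  finally show "(\<Sum>i\<le>k. (val (A (v i)) m)^2) <= (B * K)^2" .
 qed simp
 also have "... = (B * K)^2" by (simp add: prob_space)
 finally show "(\<Sum>i\<le>k. L2_inner M (val (A (v i))) (val (A (v i)))) <= (B * K)^2" .
qed simp

lemma summable_on_adj:
 assumes o: "L2_orthonormal I e"
  and s: "summable (%k. L2_inner M (f k) (f k))" and f: "!!k. f k \<in> L2 M"
 shows "(%(i, k). (L2_inner M (f k) (e i))^2) summable_on I \<times> (UNIV :: nat set)"
proof (rule nonneg_bdd_above_summable_on)
 let ?X = "%i k. %(i, k). (L2_inner M (f k) (e i))^2"
 show "bdd_above (sum (?X i k) ` {F. F \<subseteq> I \<times> UNIV \<and> finite F})"
 proof (rule bdd_aboveI2)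
  fix F :: "(nat \<times> nat) set" assume "F \<in> {F. F \<subseteq> I \<times> UNIV \<and> finite F}"
  hence F: "F \<subseteq> I \<times> UNIV" "finite F" by auto
  have "sum (?X i k) F <= sum (?X i k) (fst ` F \<times> snd ` F)" using F by (intro sum_mono2 subset_fst_snd) auto
  also have "... = (\<Sum>k\<in>snd ` F. \<Sum>i\<in>fst ` F. (L2_inner M (f k) (e i))^2)" by (simp add: sum.cartesian_product[symmetric] sum.swap[of _ "fst ` F"])
  also have "... <= (\<Sum>k\<in>snd ` F. L2_inner M (f k) (f k))" using F by (intro sum_mono L2_bessel[OF o] f) auto
  also have "... <= (\<Sum>k. L2_inner M (f k) (f k))" using F by (intro sum_le_suminf s) auto
  finally show "sum (?X i k) F <= (\<Sum>k. L2_inner M (f k) (f k))" .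
 qed
qed auto

text \<open>Cyclicity of the trace. The array x i k * y i k is absolutely summable, both factors
  being square summable. Its rows sum to the diagonal entries in the L2 basis, its columns to those
  of T(T + \<theta>)^(-1) in the basis v.\<close>

lemma trace_sums:
 assumes "\<theta> > 0" and onb: "L2_onb M I e"
 shows "((%i. L2_inner M (kernel_op M val (shifted_inverse M (kernel_op M val) \<theta> (e i))) (e i))
  has_sum (\<Sum>k. v k \<bullet> pop_op (resolvent pop_op \<theta> (v k)))) I"
  and "summable (%k. v k \<bullet> pop_op (resolvent pop_op \<theta> (v k)))"
proof -
 let ?X = "%i. L2_inner M (kernel_op M val (shifted_inverse M (kernel_op M val) \<theta> (e i))) (e i)"
 interpret T: psd_op pop_op \<theta> by (rule psd_op_pop[OF assms(1)])
 let ?R = "resolvent pop_op \<theta>"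
 have e: "e i \<in> L2 M" if "i \<in> I" for i using onb that by (auto simp: L2_onb_def)
 have o: "L2_orthonormal I e" using onb by (auto simp: L2_onb_def L2_orthonormal_def)
 define x where "x = (%i k. L2_inner M (val (v k)) (e i))"
 define y where "y = (%i k. L2_inner M (val (?R (v k))) (e i))"
 have sx: "(%(i, k). (x i k)^2) summable_on I \<times> UNIV" unfolding x_def by (rule summable_on_adj[OF o _ val_L2])
   (rule summable_L2_norm_val[where A = "%x. x" and K = 1], auto)
 have sy: "(%(i, k). (y i k)^2) summable_on I \<times> UNIV" unfolding y_def
 proof (rule summable_on_adj[OF o _ val_L2], rule summable_L2_norm_val[where K = "1 / \<theta>"])
  show "norm (?R x) <= norm x * (1 / \<theta>)" for x using T.norm_resolvent_le by simp
  show "0 <= 1 / \<theta>" using assms(1) by simp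
 qed (rule T.resolvent_sym)
 have "(%p. norm (case p of (i, k) => x i k * y i k)) summable_on I \<times> UNIV"
 proof (rule summable_on_comparison_test)
  show "(%p. (case p of (i, k) => (x i k)^2) + (case p of (i, k) => (y i k)^2)) summable_on I \<times> UNIV" by (rule summable_on_add[OF sx sy])
  show "norm (case p of (i, k) => x i k * y i k) <= (case p of (i, k) => (x i k)^2) + (case p of (i, k) => (y i k)^2)" for p
  proof (cases p)
   case (Pair i k)
   have "2 * \<bar>x i k\<bar> * \<bar>y i k\<bar> <= (x i k)^2 + (y i k)^2" using sum_squares_bound[of "\<bar>x i k\<bar>" "\<bar>y i k\<bar>"] by simp
   moreover have "0 <= \<bar>x i k\<bar> * \<bar>y i k\<bar>" by simp
   ultimately show ?thesis unfolding Pair prod.case real_norm_def abs_mult by linarith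
  qed
 qed auto
 hence "(%(i, k). x i k * y i k) summable_on I \<times> UNIV" by (rule abs_summable_summable)
 then obtain S where S: "((%(i, k). x i k * y i k) has_sum S) (I \<times> UNIV)" by (auto simp: summable_on_def)
 have row: "((%k. x i k * y i k) has_sum ?X i) UNIV" if i: "i \<in> I" for i
 proof -
  let ?a = "inclusion_adj M val (e i)"
  have "(%k. norm (x i k * y i k)) = (%k. norm ((?a \<bullet> v k) * (?R ?a \<bullet> v k)))"
   by (simp add: x_def y_def L2_inner_commute[of _ "e i"] adj[OF e[OF i], symmetric] T.resolvent_sym)
  have xy: "x i k * y i k = (?a \<bullet> v k) * (?R ?a \<bullet> v k)" for k
   by (simp add: x_def y_def L2_inner_commute[of _ "e i"] adj[OF e[OF i], symmetric] T.resolvent_sym)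
  have "(%k. x i k * y i k) sums (?a \<bullet> ?R ?a)" unfolding xy by (rule parseval)
  moreover have "summable (%k. norm (x i k * y i k))"
  proof (rule summable_comparison_test')
   show "summable (%k. (?a \<bullet> v k) * (?a \<bullet> v k) + (?R ?a \<bullet> v k) * (?R ?a \<bullet> v k))" by (intro summable_add sums_summable[OF parseval])
   fix k
   have "2 * \<bar>?a \<bullet> v k\<bar> * \<bar>?R ?a \<bullet> v k\<bar> <= (?a \<bullet> v k)^2 + (?R ?a \<bullet> v k)^2" using sum_squares_bound[of "\<bar>?a \<bullet> v k\<bar>" "\<bar>?R ?a \<bullet> v k\<bar>"] by simp
   moreover have "0 <= \<bar>?a \<bullet> v k\<bar> * \<bar>?R ?a \<bullet> v k\<bar>" by simp
   ultimately show "norm (norm (x i k * y i k)) <= (?a \<bullet> v k) * (?a \<bullet> v k) + (?R ?a \<bullet> v k) * (?R ?a \<bullet> v k)"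
    unfolding xy real_norm_def abs_abs abs_mult power2_eq_square by linarith
  qed
  ultimately have "((%k. x i k * y i k) has_sum (?a \<bullet> ?R ?a)) UNIV" by (metis norm_summable_imp_has_sum)
  moreover have "?X i = ?a \<bullet> ?R ?a" unfolding kernel_op_shifted_inverse[OF assms(1) e[OF i]] L2_inner_commute[of _ "e i"] adj[OF e[OF i]] ..
  ultimately show ?thesis by simp
 qed
 from has_sum_SigmaD[OF S] row
 have tr: "((%i. ?X i) has_sum S) I" by simp
 have col: "((%i. x i k * y i k) has_sum (v k \<bullet> pop_op (?R (v k)))) I" for k
 proof -
  have "((%i. x i k * y i k) has_sum L2_inner M (val (v k)) (val (?R (v k)))) I" unfolding x_def y_def by (intro L2_parseval[OF onb] val_L2)
  also have "L2_inner M (val (v k)) (val (?R (v k))) = v k \<bullet> pop_op (?R (v k))" by (simp add: inner_commute[of "v k"] inner_pop_op L2_inner_commute)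
  finally show ?thesis .
 qed
 have "((%(k, i). x i k * y i k) has_sum S) (UNIV \<times> I)" using S by (subst (asm) has_sum_swap) simp
 from has_sum_SigmaD[OF this] col
 have "((%k. v k \<bullet> pop_op (?R (v k))) has_sum S) UNIV" by simp
 hence sums: "(%k. v k \<bullet> pop_op (?R (v k))) sums S" by (rule has_sum_imp_sums)
 thus "summable (%k. v k \<bullet> pop_op (?R (v k)))" by (rule sums_summable)
 show "((%i. ?X i)
  has_sum (\<Sum>k. v k \<bullet> pop_op (?R (v k)))) I" using tr sums by (simp add: sums_iff)
qed

lemma effective_dim_sums:
 assumes "\<theta> > 0" and ex: "\<exists>I e. L2_onb M I e"
 shows "(%k. v k \<bullet> pop_op (resolvent pop_op \<theta> (v k))) sums effective_dim M val \<theta>"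
proof -
 let ?X = "\<Sum>k. v k \<bullet> pop_op (resolvent pop_op \<theta> (v k))"
 obtain I e where onb: "L2_onb M I e" using ex by blast
 have "effective_dim M val \<theta> = ?X" unfolding effective_dim_def L2_trace_def
 proof (rule the_equality)
  fix t assume "\<forall>I e. L2_onb M I e -->
   ((%i. L2_inner M (kernel_op M val (shifted_inverse M (kernel_op M val) \<theta> (e i))) (e i)) has_sum t) I"
  thus "t = ?X" using onb trace_sums(1)[OF assms(1) onb] has_sum_unique by blast
 qed (use trace_sums(1)[OF assms(1)] in auto)
 thus ?thesis using trace_sums(2)[OF assms(1) onb] by (simp add: summable_sums)
qed

end

section \<open>The regression sample\<close>

text \<open>Closed under sums, products and powers and integrable under finite measures, so that
  integrability can be read off the shape of an integrand.\<close>

definition bdd_meas :: "'w measure => ('w => real) => bool" where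
 "bdd_meas N f \<longleftrightarrow> f \<in> borel_measurable N \<and> (\<exists>c. \<forall>x\<in>space N. \<bar>f x\<bar> <= c)"

definition bdd_weak :: "'w measure => ('w => 'k::real_inner) => bool" where
 "bdd_weak N f \<longleftrightarrow> weak_meas N f \<and> (\<exists>c. \<forall>x\<in>space N. norm (f x) <= c)"

named_theorems bm_intros

lemma bmI: "f \<in> borel_measurable N ==> (!!x. x \<in> space N ==> \<bar>f x\<bar> <= c) ==> bdd_meas N f"
 by (auto simp: bdd_meas_def)

lemma bwmI: "weak_meas N f ==> (!!x. x \<in> space N ==> norm (f x) <= c) ==> bdd_weak N f"
 by (auto simp: bdd_weak_def)

lemma bm_measurable: "bdd_meas N f ==> f \<in> borel_measurable N"
 by (simp add: bdd_meas_def)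

lemma bwm_measurable: "bdd_weak N f ==> weak_meas N f"
 by (simp add: bdd_weak_def)

lemma bm_bound: "bdd_meas N f ==> \<exists>c\<ge>0. \<forall>x\<in>space N. \<bar>f x\<bar> <= c"
 unfolding bdd_meas_def by (meson abs_ge_zero order_trans max.cobounded1 max.cobounded2)

lemma bwm_bound: "bdd_weak N f ==> \<exists>c\<ge>0. \<forall>x\<in>space N. norm (f x) <= c"
 unfolding bdd_weak_def by (meson norm_ge_zero order_trans max.cobounded1 max.cobounded2)

lemma (in finite_measure) bm_integrable [intro]:
 assumes "bdd_meas M f"
 shows "integrable M f"
proof -
 obtain c where "\<forall>x\<in>space M. \<bar>f x\<bar> <= c" using assms by (auto simp: bdd_meas_def)
 thus ?thesis using bm_measurable[OF assms] by (intro integrable_const_bound[where B = c]) auto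
qed

lemma bm_const [bm_intros]: "bdd_meas N (%_. c)"
 by (rule bmI[where c = "\<bar>c\<bar>"]) auto

lemma bm_add [bm_intros]:
 assumes "bdd_meas N f" "bdd_meas N g"
 shows "bdd_meas N (%x. f x + g x)"
proof -
 obtain c d where "\<forall>x\<in>space N. \<bar>f x\<bar> <= c" "\<forall>x\<in>space N. \<bar>g x\<bar> <= d" using assms by (auto simp: bdd_meas_def)
 thus ?thesis using assms[THEN bm_measurable] by (intro bmI[where c = "c + d"]) (auto intro!: order_trans[OF abs_triangle_ineq] add_mono)
qed

lemma bm_mult [bm_intros]:
 assumes "bdd_meas N f" "bdd_meas N g"
 shows "bdd_meas N (%x. f x * g x)"
proof -
 obtain c d where "c >= 0" "\<forall>x\<in>space N. \<bar>f x\<bar> <= c" "\<forall>x\<in>space N. \<bar>g x\<bar> <= d" using bm_bound[OF assms(1)] bm_bound[OF assms(2)] by blast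
 thus ?thesis using assms[THEN bm_measurable] by (intro bmI[where c = "c * d"]) (auto simp: abs_mult intro!: mult_mono)
qed

lemma bm_diff [bm_intros]:
 "bdd_meas N f ==> bdd_meas N g ==> bdd_meas N (%x. f x - g x)" using bm_add[of N f "%x. (-1) * g x"] bm_mult[OF bm_const[of N "-1"], of g] by simp

lemma bm_power [bm_intros]: "bdd_meas N f ==> bdd_meas N (%x. f x ^ k)"
 by (induction k) (auto intro!: bm_intros)

lemma bm_sum [bm_intros]:
 "(!!i. i \<in> I ==> bdd_meas N (f i)) ==> bdd_meas N (%x. \<Sum>i\<in>I. f i x)" by (induction I rule: infinite_finite_induct) (auto intro!: bm_intros)

lemma bm_av [bm_intros]:
 "(!!J. J \<in> seqs n k ==> bdd_meas N (%x. f x J)) ==> bdd_meas N (%x. av n k (f x))" unfolding av_def divide_inverse by (intro bm_intros)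

lemma (in finite_measure) integral_av:
 assumes "!!J. J \<in> seqs n k ==> bdd_meas M (%x. f x J)"
 shows "(LINT x|M. av n k (f x)) = av n k (%J. (LINT x|M. f x J))"
 unfolding av_def using assms by (subst integral_divide_zero, subst bochner_sum) auto

context hilbert_basis
begin

lemma bwm_const [bm_intros]: "bdd_weak N (%_. c :: 'k)"
 by (rule bwmI[OF wm_const]) auto

lemma bwm_add [bm_intros]:
 fixes f g :: "'w => 'k"
 assumes "bdd_weak N f" "bdd_weak N g"
 shows "bdd_weak N (%x. f x + g x)"
proof -
 obtain c d where "\<forall>x\<in>space N. norm (f x) <= c" "\<forall>x\<in>space N. norm (g x) <= d" using assms by (auto simp: bdd_weak_def)
 thus ?thesis using assms[THEN bwm_measurable] by (intro bwmI[where c = "c + d"] wm_add) (auto intro!: order_trans[OF norm_triangle_ineq] add_mono)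
qed

lemma bwm_scaleR [bm_intros]:
 fixes f :: "'w => 'k"
 assumes "bdd_meas N a" "bdd_weak N f"
 shows "bdd_weak N (%x. a x *\<^sub>R f x)"
proof -
 obtain c d where "c >= 0" "\<forall>x\<in>space N. \<bar>a x\<bar> <= c" "\<forall>x\<in>space N. norm (f x) <= d" using bm_bound[OF assms(1)] bwm_bound[OF assms(2)] by blast
 thus ?thesis using bm_measurable[OF assms(1)] bwm_measurable[OF assms(2)] by (intro bwmI[where c = "c * d"] wm_scaleR) (auto intro!: mult_mono)
qed

lemma bwm_diff [bm_intros]:
 fixes f g :: "'w => 'k"
 shows "bdd_weak N f ==> bdd_weak N g ==>
  bdd_weak N (%x. f x - g x)"
 using bwm_add[of N f "%x. (-1) *\<^sub>R g x"] bwm_scaleR[OF bm_const[of N "-1"], of g] by simp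

lemma bwm_sum [bm_intros]:
 fixes f :: "'i => 'w => 'k"
 shows "(!!i. i \<in> I ==> bdd_weak N (f i)) ==> bdd_weak N (%x. \<Sum>i\<in>I. f i x)"
 by (induction I rule: infinite_finite_induct) (auto intro!: bm_intros)

lemma bm_inner [bm_intros]:
 fixes f g :: "'w => 'k"
 assumes "bdd_weak N f" "bdd_weak N g"
 shows "bdd_meas N (%x. f x \<bullet> g x)"
proof -
 obtain c d where "c >= 0" "\<forall>x\<in>space N. norm (f x) <= c" "\<forall>x\<in>space N. norm (g x) <= d" using bwm_bound[OF assms(1)] bwm_bound[OF assms(2)] by blast
 thus ?thesis using assms[THEN bwm_measurable]
  by (intro bmI[where c = "c * d"] wm_inner) (auto intro!: order_trans[OF Cauchy_Schwarz_ineq2] mult_mono)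
qed

lemma bm_norm [bm_intros]:
 fixes f :: "'w => 'k"
 assumes "bdd_weak N f"
 shows "bdd_meas N (%x. norm (f x))"
 using assms unfolding bdd_weak_def bdd_meas_def by (auto intro: wm_norm)

lemma bwm_fsgd [bm_intros]:
 fixes F :: "'w => nat => 'k"
 assumes F: "!!l. l \<in> {1..n} ==> bdd_weak N (%w. F w l)"
  and c: "!!l. l \<in> {1..n} ==> bdd_meas N (%w. c w l)"
  and J: "!!i. i \<in> {1..b * t} ==> J i \<in> {1..n}"
 shows "bdd_weak N (%w. fsgd b \<eta> (F w) (c w) J h t)"
 using J
proof (induction t)
 case (Suc t)
 have "bdd_weak N (%w. fsgd b \<eta> (F w) (c w) J h t)" by (rule Suc.IH) (use Suc.prems in auto)
 moreover have J: "J i \<in> {1..n}" if "i \<in> {b * t + 1..b * (t + 1)}" for i using that by (intro Suc.prems) auto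
 ultimately show ?case unfolding fsgd.simps by (intro bm_intros F c J)
qed (simp add: bm_intros)

lemma bm_leverage [bm_intros]:
 fixes F :: "'w => nat => 'k"
 assumes F: "!!l. l \<in> {1..n} ==> bdd_weak N (%w. F w l)"
  and f: "bdd_weak N f" and "n >= 1" "\<theta> > 0"
 shows "bdd_meas N (%w. leverage n (F w) \<theta> (f w))"
proof -
 have "\<forall>l. \<exists>c. l \<in> {1..n} --> 0 <= c \<and> (\<forall>x\<in>space N. norm (F x l) <= c)" using bwm_bound[OF F] by blast
 then obtain c where c: "!!l. l \<in> {1..n} ==> 0 <= c l \<and> (\<forall>x\<in>space N. norm (F x l) <= c l)" unfolding choice_iff by blast
 have "norm (F x l) <= (\<Sum>l=1..n. c l)" if "x \<in> space N" "l \<in> {1..n}" for x l using c[OF that(2)] c that member_le_sum[of l "{1..n}" c] by fastforce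
 hence m: "(%w. leverage n (F w) \<theta> (f w)) \<in> borel_measurable N" by (intro measurable_leverage[where \<kappa> = "\<Sum>l=1..n. c l"] bwm_measurable F f assms)
 obtain d where d: "\<forall>x\<in>space N. norm (f x) <= d" using bwm_bound[OF f] by blast
 show ?thesis
 proof (rule bmI[OF m])
  fix x assume x: "x \<in> space N"
  have "leverage n (F x) \<theta> (f x) <= (norm (f x))^2 / \<theta>" by (rule leverage_le[OF assms(4)])
  also have "... <= d^2 / \<theta>" using d x assms(4) by (intro divide_right_mono power_mono) auto
  finally show "\<bar>leverage n (F x) \<theta> (f x)\<bar> <= d^2 / \<theta>" using leverage_nonneg[OF assms(4), of n "F x" "f x"] by simp
 qed
qed

end

lemma sum_product_square: "(\<Sum>j\<in>I. a j * b j)^2 = (\<Sum>j\<in>I. \<Sum>k\<in>I. a j * a k * (b j * b k :: real))"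
 unfolding power2_eq_square sum_product by (simp add: mult_ac)

text \<open>
 The joint law \<open>\<rho>\<close> of features and labels; \<open>f\<close> is the regression function, and the last
 assumption says that the noise \<open>y - f(m)\<close> is centred given \<open>m\<close>.
\<close>

locale regression_model = feature_space M v \<phi> val B \<kappa> + R: prob_space \<rho>
 for M :: "'g measure" and v :: "nat => 'k::{real_inner,banach}" and \<phi> val B \<kappa>
  and \<rho> :: "('g \<times> real) measure" +
 fixes f :: "'g => real" and Y y0 :: real
 assumes embed_measurable: "(%m. (m, y0)) \<in> measurable M \<rho>"
  and fst_measurable: "fst \<in> measurable \<rho> M" and marginal: "distr \<rho> M fst = M"
  and snd_measurable: "snd \<in> borel_measurable \<rho>" and label_bound: "!!p. p \<in> space \<rho> ==> \<bar>snd p\<bar> <= Y"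
  and f_measurable: "f \<in> borel_measurable M" and f_bound: "!!m. m \<in> space M ==> \<bar>f m\<bar> <= Y"
  and noise_centred: "!!g. bdd_meas M g ==> (LINT p|\<rho>. (snd p - f (fst p)) * g (fst p)) = 0"
begin

lemma Y_nonneg: "0 <= Y"
proof -
 obtain p where "p \<in> space \<rho>" using R.not_empty by blast
 from order_trans[OF abs_ge_zero label_bound[OF this]] show ?thesis .
qed

lemma f_L2: "f \<in> L2 M"
 using f_measurable f_bound by (intro bounded_L2[where c = Y]) auto

abbreviation feat :: "(nat => 'g \<times> real) => nat => 'k" where
 "feat D l \<equiv> \<phi> (fst (D l))"

abbreviation label :: "(nat => 'g \<times> real) => nat => real" where
 "label D l \<equiv> snd (D l)"

abbreviation clean :: "(nat => 'g \<times> real) => nat => real" where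
 "clean D l \<equiv> f (fst (D l))"

end

locale regression_sample = regression_model M v \<phi> val B \<kappa> \<rho> f Y y0
 for M :: "'g measure" and v :: "nat => 'k::{real_inner,banach}" and \<phi> val B \<kappa> \<rho> f Y y0 +
 fixes n :: nat
 assumes n: "n >= 1"
begin

text \<open>Coordinate 0 of the sample is an independent test point.\<close>

abbreviation "sample \<equiv> Pi\<^sub>M {0..n} (%_. \<rho>)"

sublocale S: product_prob_space "%_::nat. \<rho>" "{0..n}" ..


lemma component: "l \<in> {0..n} ==> (%D. D l) \<in> measurable sample \<rho>"
 by (rule measurable_component_singleton)

lemma sample_space:
 assumes "D \<in> space sample" "l \<in> {0..n}"
 shows "D l \<in> space \<rho> \<and> fst (D l) \<in> space M"
 using measurable_space[OF component[OF assms(2)] assms(1)] measurable_space[OF fst_measurable] by blast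

lemma fst_component: "l \<in> {0..n} ==> (%D. fst (D l)) \<in> measurable sample M"
 by (rule measurable_compose[OF component fst_measurable])

lemma bm_label [bm_intros]:
 assumes "l \<in> {0..n}"
 shows "bdd_meas sample (%D. label D l)"
proof (rule bmI[OF measurable_compose[OF component[OF assms] snd_measurable]])
 show "\<bar>label D l\<bar> <= Y" if "D \<in> space sample" for D using label_bound[OF conjunct1[OF sample_space[OF that assms]]] .
qed

lemma bm_clean [bm_intros]: "l \<in> {0..n} ==> bdd_meas sample (%D. clean D l)"
 by (rule bmI[OF measurable_compose[OF fst_component f_measurable]]) (use f_bound sample_space in auto)

lemma bwm_feat [bm_intros]: "l \<in> {0..n} ==> bdd_weak sample (%D. feat D l)"
 by (rule bwmI[OF wm_compose[OF wm_feature fst_component]]) (use feature_bound sample_space in auto)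

lemma distr_component: "l \<in> {0..n} ==> distr sample \<rho> (%D. D l) = \<rho>"
 by (rule distr_PiM_component) (auto intro: R.prob_space_axioms)

lemma distr_fst_component: "l \<in> {0..n} ==> distr sample M (%D. fst (D l)) = M"
 using distr_distr[OF fst_measurable component, of l] by (simp add: distr_component marginal o_def)

lemma integral_component:
 fixes g :: "'g => real"
 assumes "l \<in> {0..n}" "g \<in> borel_measurable M"
 shows "(LINT D|sample. g (fst (D l))) = (LINT m|M. g m)"
 using integral_distr[OF fst_component[OF assms(1)] assms(2)] by (simp add: distr_fst_component[OF assms(1)])

lemma AE_component:
 assumes "l \<in> {0..n}" "AE m in M. P m"
 shows "AE D in sample. P (fst (D l))"
 using assms(2) by (subst (asm) distr_fst_component[OF assms(1), symmetric]) (rule AE_distrD[OF fst_component[OF assms(1)]])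

lemma AE_feat: "AE D in sample. \<forall>l\<in>{0..n}. (norm (feat D l))^2 <= \<kappa>^2"
 by (intro AE_ball_countable[THEN iffD2] ballI AE_component feature_AE) auto

definition exchange :: "nat => (nat => 'g \<times> real) => nat => 'g \<times> real" where
 "exchange i D = (\<lambda>l\<in>{0..n}. D (Transposition.transpose 0 i l))"

lemma transpose_range: "i \<in> {0..n} ==> l \<in> {0..n} ==> Transposition.transpose 0 i l \<in> {0..n}"
 by (auto simp: Transposition.transpose_def)

lemma distr_exchange:
 assumes "i \<in> {0..n}"
 shows "distr sample sample (exchange i) = sample"
proof -
 have "distr sample (Pi\<^sub>M {0..n} (%_. \<rho>)) (%D. \<lambda>l\<in>{0..n}. D (Transposition.transpose 0 i l)) = Pi\<^sub>M {0..n} (%_. \<rho>)"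
  by (rule distr_PiM_reindex[where f = "Transposition.transpose 0 i"])
   (use transpose_range[OF assms] in \<open>auto intro: R.prob_space_axioms inj_on_subset[OF inj_transpose]\<close>)
 thus ?thesis unfolding exchange_def .
qed

lemma measurable_exchange: "i \<in> {0..n} ==> exchange i \<in> measurable sample sample"
 unfolding exchange_def by (intro measurable_restrict measurable_component_singleton transpose_range)

lemma integral_exchange:
 fixes G :: "(nat => 'g \<times> real) => real"
 assumes "i \<in> {0..n}" "G \<in> borel_measurable sample"
 shows "(LINT D|sample. G (exchange i D)) = (LINT D|sample. G D)"
 using integral_distr[OF measurable_exchange[OF assms(1)] assms(2)] by (simp add: distr_exchange[OF assms(1)])

lemma bm_exchange [bm_intros]:
 "i \<in> {0..n} ==> bdd_meas sample G ==> bdd_meas sample (%D. G (exchange i D))" unfolding bdd_meas_def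
 using measurable_space[OF measurable_exchange] by (auto intro: measurable_compose[OF measurable_exchange])

lemma exchange_simps:
 assumes "i \<in> {1..n}"
 shows "exchange i D i = D 0" "exchange i D 0 = D i"
  "l \<in> {1..n} ==> l \<noteq> i ==> exchange i D l = D l" using assms by (auto simp: exchange_def Transposition.transpose_def)

text \<open>Integrate the j-th pair first: A sees only its input, and given the input the noise is
  centred.\<close>

lemma integral_noise_product:
 assumes j: "j \<in> {0..n}" and A: "bdd_meas sample A"
  and indep: "!!D z. D \<in> space sample ==> z \<in> space \<rho> ==> fst z = fst (D j) ==> A (D(j := z)) = A D"
 shows "(LINT D|sample. (label D j - clean D j) * A D) = 0"
proof -
 have I: "{0..n} = insert j ({0..n} - {j})" using j by auto
 let ?G = "%D. (label D j - clean D j) * A D"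
 have int: "integrable sample ?G" using j A by (intro S.P.bm_integrable bm_intros)
 have "(LINT D|sample. ?G D) = (LINT D|(Pi\<^sub>M (insert j ({0..n} - {j})) (%_. \<rho>)). ?G D)" using I by simp
 also have "... = (LINT x|(Pi\<^sub>M ({0..n} - {j}) (%_. \<rho>)). (LINT z|\<rho>. ?G (x(j := z))))" using int I by (intro S.product_integral_insert) auto
 also have "... = (LINT x|(Pi\<^sub>M ({0..n} - {j}) (%_. \<rho>)). 0)"
 proof (rule bochner_cong[OF refl], goal_cases)
  case (1 x) note x = 1
  have upd: "x(j := z) \<in> space sample" if "z \<in> space \<rho>" for z using x that j by (auto simp: space_PiM PiE_iff extensional_def)
  \<comment> \<open>A ignores the label in place j, so filling in the fixed label y0 makes it a
    function of the input m alone.\<close>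
  define g where "g = (%m. A (x(j := (m, y0))))"
  have emb: "(m, y0) \<in> space \<rho>" if "m \<in> space M" for m using measurable_space[OF embed_measurable that] .
  have "(%m. x(j := (m, y0))) \<in> measurable M sample"
   using I by (intro measurable_fun_upd[where J = "{0..n} - {j}"] measurable_const x embed_measurable) auto
  hence g: "bdd_meas M g" using A unfolding g_def bdd_meas_def by (auto intro: measurable_compose dest: measurable_space)
  have "(LINT z|\<rho>. ?G (x(j := z))) = (LINT z|\<rho>. (snd z - f (fst z)) * g (fst z))"
  proof (rule bochner_cong[OF refl], goal_cases)
   case (1 z) note z = 1
   have m: "fst z \<in> space M" using measurable_space[OF fst_measurable z] .
   have "A ((x(j := (fst z, y0)))(j := z)) = A (x(j := (fst z, y0)))" by (rule indep[OF upd[OF emb[OF m]] z]) simp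
   thus ?case by (simp add: g_def)
  qed
  also have "... = 0" by (rule noise_centred[OF g])
  finally show ?case .
 qed
 finally show ?thesis by simp
qed

end

section \<open>The first stage\<close>

lemma square_add_le: "(x + y)^2 <= 2 * x^2 + 2 * (y::real)^2"
 using zero_le_power2[of "x - y"] by (simp add: power2_eq_square algebra_simps)

lemma norm_add_square_le: "(norm (x + y))^2 <= 2 * (norm x)^2 + 2 * (norm y)^2"
 using order_trans[OF power_mono[OF norm_triangle_ineq norm_ge_zero, of x y 2] square_add_le] .

lemma inner_square_le: "(x \<bullet> y)^2 <= (norm x)^2 * (norm y)^2"
 using power_mono[OF Cauchy_Schwarz_ineq2[of x y], of 2] by (simp add: power_mult_distrib)

lemma norm_sum_square: "(norm (\<Sum>j\<in>A. x j))^2 = (\<Sum>j\<in>A. \<Sum>k\<in>A. x j \<bullet> x k)"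
 by (simp only: power2_norm_eq_inner inner_sum_left) (simp only: inner_sum_right)

lemma seqs_block:
 assumes "J \<in> seqs n (b * T)" "t <= T" "i \<in> {1..b * t}"
 shows "J i \<in> {1..n}"
proof (rule seqs_in[OF assms(1)], goal_cases)
 case 1 have "b * t <= b * T" by (rule mult_le_mono2[OF assms(2)])
 thus ?case using assms(3) unfolding atLeastAtMost_iff by linarith
qed

context regression_model
begin

definition excess :: "'k => real" where
 "excess h = L2_norm M (%m. val h m - f m)"

lemma excess_square: "(excess h)^2 = (LINT m|M. (h \<bullet> \<phi> m - f m)^2)"
 unfolding excess_def L2_norm_square L2_inner_def by (intro bochner_cong refl) (simp add: val power2_eq_square)

lemma bm_val [bm_intros]: "bdd_meas M (%m. h \<bullet> \<phi> m)"
 by (intro bm_inner bwm_const bwmI[OF wm_feature feature_bound])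

lemma bm_f [bm_intros]: "bdd_meas M f"
 by (rule bmI[OF f_measurable f_bound])

end

context regression_sample
begin

text \<open>The A j k depend on inputs only, so different noise terms are uncorrelated. A squared
  noise term is at most 4 Y^2, label and regression function both being bounded by Y.\<close>

lemma integral_noise_square:
 fixes A :: "nat => nat => (nat => 'g \<times> real) => real"
 assumes A: "!!j k. j \<in> {1..n} ==> k \<in> {1..n} ==> bdd_meas sample (A j k)"
  and indep: "!!j k D D'. (!!l. l \<in> {0..n} ==> fst (D l) = fst (D' l)) ==> A j k D = A j k D'"
  and pos: "!!j D. 0 <= A j j D"
 shows "(LINT D|sample. (\<Sum>j=1..n. \<Sum>k=1..n. (label D j - clean D j) * (label D k - clean D k) * A j k D))
  <= 4 * Y^2 * (LINT D|sample. (\<Sum>j=1..n. A j j D))"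
proof -
 let ?e = "%D j. label D j - clean D j"
 have e: "bdd_meas sample (%D. ?e D j)" if "j \<in> {1..n}" for j using that by (intro bm_intros) auto
 have bm: "bdd_meas sample (%D. ?e D j * ?e D k * A j k D)" if "j \<in> {1..n}" "k \<in> {1..n}" for j k using that by (intro bm_mult e A) auto
 have cross: "(LINT D|sample. ?e D j * ?e D k * A j k D) = 0" if jk: "j \<in> {1..n}" "k \<in> {1..n}" "j \<noteq> k" for j k
 proof -
  have "(LINT D|sample. ?e D j * (?e D k * A j k D)) = 0"
  proof (rule integral_noise_product)
   show "bdd_meas sample (%D. ?e D k * A j k D)" using jk by (intro bm_mult e A) auto
   fix D :: "nat => 'g \<times> real" and z :: "'g \<times> real" assume "fst z = fst (D j)"
   hence "A j k (D(j := z)) = A j k D" by (intro indep) auto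
   thus "?e (D(j := z)) k * A j k (D(j := z)) = ?e D k * A j k D" using jk by simp
  qed (use jk in auto)
  thus ?thesis by (simp add: mult.assoc)
 qed
 have diag: "(LINT D|sample. ?e D j * ?e D j * A j j D) <= (LINT D|sample. 4 * Y^2 * A j j D)" if j: "j \<in> {1..n}" for j
 proof (rule integral_mono, goal_cases)
  show "integrable sample (%D. ?e D j * ?e D j * A j j D)" "integrable sample (%D. 4 * Y^2 * A j j D)"
   using j by (intro S.P.bm_integrable bm_mult e A bm_const; simp)+
  case (3 D) note D = 3
  have "\<bar>?e D j\<bar> <= Y + Y" using label_bound[of "D j"] f_bound[of "fst (D j)"] sample_space[OF D, of j] j
   by (intro order_trans[OF abs_triangle_ineq4] add_mono) auto
  hence "\<bar>?e D j\<bar>^2 <= (Y + Y)^2" by (intro power_mono) auto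
  hence "?e D j * ?e D j <= 4 * Y^2" by (simp add: power2_eq_square)
  thus ?case by (intro mult_right_mono pos)
 qed
 have "(LINT D|sample. (\<Sum>j=1..n. \<Sum>k=1..n. ?e D j * ?e D k * A j k D))
  = (\<Sum>j=1..n. (LINT D|sample. (\<Sum>k=1..n. ?e D j * ?e D k * A j k D)))"
  by (intro bochner_sum S.P.bm_integrable bm_sum bm) auto
 also have "... = (\<Sum>j=1..n. \<Sum>k=1..n. (LINT D|sample. ?e D j * ?e D k * A j k D))" by (intro sum.cong refl bochner_sum S.P.bm_integrable bm) auto
 also have "... = (\<Sum>j=1..n. \<Sum>k=1..n. if j = k then (LINT D|sample. ?e D j * ?e D j * A j j D) else 0)" by (intro sum.cong refl) (auto simp: cross)
 also have "... = (\<Sum>j=1..n. (LINT D|sample. ?e D j * ?e D j * A j j D))" by simp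
 also have "... <= (\<Sum>j=1..n. (LINT D|sample. 4 * Y^2 * A j j D))" by (intro sum_mono diag)
 also have "... = 4 * Y^2 * (\<Sum>j=1..n. (LINT D|sample. A j j D))" by (simp add: sum_distrib_left)
 also have "(\<Sum>j=1..n. (LINT D|sample. A j j D)) = (LINT D|sample. (\<Sum>j=1..n. A j j D))"
  using A by (intro bochner_sum[symmetric] S.P.bm_integrable) auto
 finally show ?thesis .
qed

text \<open>Drawing coordinate 0 afresh turns an integral over a new test point into one over the
  sample, where points can be exchanged.\<close>

lemma integral_test_point:
 assumes G: "bdd_meas sample G"
 shows "(LINT D|sample. (LINT z|\<rho>. G (D(0 := z)))) = (LINT D|sample. G D)"
  and "bdd_meas sample (%D. (LINT z|\<rho>. G (D(0 := z))))"
proof -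
 let ?K = "%D. (LINT z|\<rho>. G (D(0 := z)))"
 let ?P = "Pi\<^sub>M {1..n} (%_. \<rho>)"
 have I: "{0..n} = insert 0 {1..n}" by auto
 have upd: "(%(D, z). D(0 := z)) \<in> measurable (sample \<Otimes>\<^sub>M \<rho>) sample" unfolding split_beta by (rule measurable_fun_upd[where J = "{0..n}"]) auto
 obtain c where c: "\<forall>D\<in>space sample. \<bar>G D\<bar> <= c" using bm_bound[OF G] by blast
 have "(%(D, z). G (D(0 := z))) \<in> borel_measurable (sample \<Otimes>\<^sub>M \<rho>)" using measurable_compose[OF upd bm_measurable[OF G]] by (simp add: split_beta)
 hence Km: "?K \<in> borel_measurable sample" by (rule R.borel_measurable_lebesgue_integral)
 have bnd: "\<bar>G (D(0 := z))\<bar> <= c" if "D \<in> space sample" "z \<in> space \<rho>" for D z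
  using c measurable_space[OF upd, of "(D, z)"] that by (auto simp: space_pair_measure)
 show K: "bdd_meas sample ?K"
 proof (rule bmI[OF Km])
  fix D assume D: "D \<in> space sample"
  have "(%z. G (D(0 := z))) \<in> borel_measurable \<rho>"
   using measurable_compose[OF measurable_Pair1'[OF D] measurable_compose[OF upd bm_measurable[OF G]]] by simp
  hence int: "integrable \<rho> (%z. G (D(0 := z)))" using bnd[OF D] by (intro R.bm_integrable bmI)
  have "\<bar>?K D\<bar> <= (LINT z|\<rho>. \<bar>G (D(0 := z))\<bar>)" by (rule integral_abs_bound)
  also have "... <= c" using int bnd[OF D] by (intro R.integral_le_const) auto
  finally show "\<bar>?K D\<bar> <= c" .
 qed
 have "(LINT D|sample. ?K D) = (LINT x|?P. (LINT z'|\<rho>. ?K (x(0 := z'))))"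
  unfolding I by (rule S.product_integral_insert) (use S.P.bm_integrable[OF K] I in auto)
 also have "... = (LINT x|?P. ?K x)" by (simp add: R.prob_space)
 also have "... = (LINT D|sample. G D)" unfolding I by (rule S.product_integral_insert[symmetric]) (use S.P.bm_integrable[OF G] I in auto)
 finally show "(LINT D|sample. ?K D) = (LINT D|sample. G D)" .
qed

lemma integral_fst:
 fixes g :: "'g => real"
 shows "g \<in> borel_measurable M ==> (LINT z|\<rho>. g (fst z)) = (LINT m|M. g m)"
 using integral_distr[OF fst_measurable, of g] by (simp add: marginal)

lemma integral_excess_square:
 assumes \<Psi>: "bdd_weak sample \<Psi>" and "!!D z. \<Psi> (D(0 := z)) = \<Psi> D"
 shows "(LINT D|sample. (excess (\<Psi> D))^2) = (LINT D|sample. (\<Psi> D \<bullet> feat D 0 - clean D 0)^2)"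
  and "bdd_meas sample (%D. (excess (\<Psi> D))^2)"
proof goal_cases
 case 1 have bm: "bdd_meas sample (%D. (\<Psi> D \<bullet> feat D 0 - clean D 0)^2)" by (intro bm_intros \<Psi>) auto
 have eq: "(LINT z|\<rho>. (\<Psi> (D(0 := z)) \<bullet> feat (D(0 := z)) 0 - clean (D(0 := z)) 0)^2) = (excess (\<Psi> D))^2" for D unfolding excess_square assms(2)
  using integral_fst[OF bm_measurable[OF bm_power[OF bm_diff[OF bm_val bm_f]]], of "\<Psi> D" 2] by simp
 show ?case using integral_test_point(1)[OF bm] unfolding eq .
 case 2 show ?case using integral_test_point(2)[OF bm] unfolding eq .
qed

end

text \<open>Under \<eta> \<kappa>^2 \<le> 1/4, steps with features of squared norm up to 2
  \<kappa>^2 still contract. The condition \<kappa>^2 \<le> n \<theta> lets an exchange of points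
  cost only absolute constants, both in the stability bound and for leverage scores.\<close>

locale sgd_sample = regression_sample M v \<phi> val B \<kappa> \<rho> f Y y0 n
 for M :: "'g measure" and v :: "nat => 'k::{real_inner,banach}" and \<phi> val B \<kappa> \<rho> f Y y0 n +
 fixes b T :: nat and \<eta> \<theta> :: real and h0 :: 'k
 assumes b: "b >= 1" and T: "T >= 1" and eta: "\<eta> > 0" "\<eta> * \<kappa>^2 <= 1 / 4" and kappa: "0 <= \<kappa>"
  and theta: "\<theta> = 1 / (\<eta> * real T)" "\<kappa>^2 <= real n * \<theta>"
begin

abbreviation "AV \<equiv> av n (b * T)"

abbreviation "citer D J t \<equiv> fsgd b \<eta> (feat D) (clean D) J h0 t"
abbreviation "niter D J t \<equiv> fsgd b \<eta> (feat D) (%l. label D l - clean D l) J 0 t"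
abbreviation "iter D J t \<equiv> fsgd b \<eta> (feat D) (label D) J h0 t"
abbreviation "uiter D j J t \<equiv> fsgd b \<eta> (feat D) (%l. if l = j then 1 else 0) J 0 t"

lemma theta_pos: "\<theta> > 0"
 using theta eta T by simp

lemma eta_half: "0 <= \<eta>" "\<eta> * \<kappa>^2 <= 1 / 2"
 using eta by auto

lemma iter_split: "iter D J t = citer D J t + niter D J t"
 using fsgd_add[of b \<eta> "feat D" "clean D" "%l. label D l - clean D l" J h0 0 t] by simp

lemma bwm_iters [bm_intros]:
 assumes "J \<in> seqs n (b * T)" "t <= T"
 shows "bdd_weak sample (%D. citer D J t)"
  "bdd_weak sample (%D. niter D J t)"
  "bdd_weak sample (%D. iter D J t)"
  "bdd_weak sample (%D. uiter D j J t)" by (intro bwm_fsgd[where n = n] bm_diff bm_label bm_clean bwm_feat bm_const seqs_block[OF assms];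
  simp)+

lemma AE_bounded: "AE D in sample. \<forall>l\<in>{0..n}. (norm (feat D l))^2 <= \<kappa>^2"
 by (rule AE_feat)

text \<open>A test error for i = 0 and a training error for i > 0. Summation up to T includes the
  last iterate.\<close>

definition cres :: "nat => (nat => 'g \<times> real) => real" where
 "cres i D = (\<Sum>t\<le>T. AV (%J. (citer D J t \<bullet> feat D i - clean D i)^2))"

lemma bm_cres [bm_intros]: "i \<in> {0..n} ==> bdd_meas sample (cres i)"
 unfolding cres_def by (intro bm_intros) auto

text \<open>After the exchange the old test point is the training point i, as
  \<open>exchange i D i = D 0\<close>. The test residual of one run is thus compared with a training
  residual of the other, and stability bounds the distance of the two runs.\<close>

lemma cres_exchange:
 assumes i: "i \<in> {1..n}" and D: "\<forall>l\<in>{0..n}. (norm (feat D l))^2 <= \<kappa>^2"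
 shows "cres 0 D <= 2 * cres i (exchange i D) + 30 * (cres i D + cres i (exchange i D))"
proof -
 let ?X = "%D J t. (citer D J t \<bullet> feat D 0 - clean D 0)^2"
 let ?D' = "exchange i D"
 let ?K = "6 * (real T / (real n)^2 + 1 / real n) * \<eta>^2 * \<kappa>^2"
 have F: "(norm (feat D l))^2 <= \<kappa>^2" if "l \<in> {1..n}" for l using D that by auto
 have F': "(norm (feat ?D' l))^2 <= \<kappa>^2" if "l \<in> {1..n}" for l
  using D that exchange_simps(1)[OF i] exchange_simps(3)[OF i that] by (cases "l = i") auto
 have stab: "AV (%J. (norm (citer D J t - citer ?D' J t))^2) <= ?K * (cres i D + cres i ?D')" (is "?L <= ?R") if "t <= T" for t
 proof -
  have "?L <= ?K *
   (\<Sum>s<t. AV (%J. (citer D J s \<bullet> feat D i - clean D i)^2 + (citer ?D' J s \<bullet> feat ?D' i - clean ?D' i)^2))"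
   by (rule fsgd_stability[OF b n eta_half T that kappa F F' i]) (use exchange_simps(3)[OF i] in auto)
  also have "... <= ?K * (\<Sum>s\<le>T. AV (%J. (citer D J s \<bullet> feat D i - clean D i)^2 + (citer ?D' J s \<bullet> feat ?D' i - clean ?D' i)^2))"
   using that by (intro mult_left_mono sum_mono2 av_nonneg) auto
  also have "... = ?R" unfolding cres_def av_add sum.distrib ..
  finally show ?thesis .
 qed
 have pos: "0 <= cres i D + cres i ?D'" unfolding cres_def by (intro add_nonneg_nonneg sum_nonneg av_nonneg) auto
 have "AV (%J. (?X D J t))
  <= 2 * AV (%J. (citer ?D' J t \<bullet> feat ?D' i - clean ?D' i)^2) + 2 * \<kappa>^2 * (?K * (cres i D + cres i ?D'))"
  if "t <= T" for t
 proof -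
  have "AV (%J. (?X D J t))
   <= AV (%J. 2 * (citer ?D' J t \<bullet> feat ?D' i - clean ?D' i)^2 + 2 * \<kappa>^2 * (norm (citer D J t - citer ?D' J t))^2)"
  proof (rule av_mono)
   fix J
   let ?x = "citer ?D' J t \<bullet> feat D 0 - clean D 0" and ?d = "citer D J t - citer ?D' J t"
   have "(?X D J t) = (?x + ?d \<bullet> feat D 0)^2" by (simp add: inner_diff_left)
   also have "... <= 2 * ?x^2 + 2 * (?d \<bullet> feat D 0)^2" by (rule square_add_le)
   also have "(?d \<bullet> feat D 0)^2 <= (norm ?d)^2 * (norm (feat D 0))^2" by (rule inner_square_le)
   also have "... <= (norm ?d)^2 * \<kappa>^2" using D by (intro mult_left_mono) auto
   finally show "(?X D J t)
    <= 2 * (citer ?D' J t \<bullet> feat ?D' i - clean ?D' i)^2 + 2 * \<kappa>^2 * (norm ?d)^2"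
    by (simp add: exchange_simps(1)[OF i] mult_ac)
  qed
  also have "... = 2 * AV (%J. (citer ?D' J t \<bullet> feat ?D' i - clean ?D' i)^2)
    + 2 * \<kappa>^2 * AV (%J. (norm (citer D J t - citer ?D' J t))^2)"
   by (simp only: av_add av_cmult)
  also have "... <= 2 * AV (%J. (citer ?D' J t \<bullet> feat ?D' i - clean ?D' i)^2)
    + 2 * \<kappa>^2 * (?K * (cres i D + cres i ?D'))"
   by (intro add_left_mono mult_left_mono stab that) auto
  finally show ?thesis .
 qed
 hence "cres 0 D <= (\<Sum>t\<le>T. 2 * AV (%J. (citer ?D' J t \<bullet> feat ?D' i - clean ?D' i)^2)
   + 2 * \<kappa>^2 * (?K * (cres i D + cres i ?D')))"
  unfolding cres_def[of 0] by (intro sum_mono) auto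
 also have "... = 2 * cres i ?D' + (2 * \<kappa>^2 * real (T + 1) * ?K) * (cres i D + cres i ?D')"
  by (simp add: sum.distrib sum_distrib_left[symmetric] cres_def[of i ?D'])
 also have "2 * \<kappa>^2 * real (T + 1) * ?K <= 30" (is "?l <= _")
 proof -
  \<comment> \<open>This is \<kappa>^2/(n \<theta>), at most 1. The 30 arises as 24 * (1 +
    1/4).\<close>
  define x where "x = \<kappa>^2 * \<eta> * real T / real n"
  have x: "0 <= x" "x <= 1"
  proof -
   have "\<kappa>^2 * (\<eta> * real T) <= real n * \<theta> * (\<eta> * real T)" using theta(2) eta(1) by (intro mult_right_mono) auto
   also have "... = real n" using theta(1) eta(1) T by simp
   finally show "x <= 1" using n by (simp add: x_def mult_ac)
  qed (use eta(1) in \<open>simp add: x_def\<close>)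
  have "?l <= 2 * \<kappa>^2 * (2 * real T) * ?K" using T by (intro mult_right_mono mult_left_mono) auto
  also have "... = 24 * (x^2 + x * (\<eta> * \<kappa>^2))" using n by (simp add: x_def power2_eq_square field_simps)
  also have "... <= 24 * (1 + 1 * (1 / 4))" using x eta by (intro mult_left_mono add_mono mult_mono power_le_one) auto
  finally show ?thesis by simp
 qed
 hence "(2 * \<kappa>^2 * real (T + 1) * ?K) * (cres i D + cres i ?D') <= 30 * (cres i D + cres i ?D')"
  by (rule mult_right_mono[OF _ pos])
 finally show ?thesis by simp
qed

lemma integral_affine:
 assumes "bdd_meas sample U"
 shows "(LINT D|sample. d * (c + k * U D)) = d * (c + k * (LINT D|sample. U D))"
  "(LINT D|sample. a + d * (c + k * U D)) = a + d * (c + k * (LINT D|sample. U D))" using S.P.bm_integrable[OF assms] S.P.prob_space by simp_all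

lemma integral_residual:
 "l \<in> {0..n} ==> (LINT D|sample. (clean D l - w \<bullet> feat D l)^2) = (excess w)^2" unfolding excess_square
 using integral_component[OF _ bm_measurable[OF bm_power[OF bm_diff[OF bm_f bm_val]]], of l w 2] by (simp add: power2_commute)

lemma integral_mean_residual:
 "(LINT D|sample. avg n (%l. (clean D l - w \<bullet> feat D l)^2)) = (excess w)^2"
proof -
 have "(LINT D|sample. (\<Sum>l=1..n. (clean D l - w \<bullet> feat D l)^2)) = (\<Sum>l=1..n. (LINT D|sample. (clean D l - w \<bullet> feat D l)^2))"
  by (intro bochner_sum S.P.bm_integrable bm_intros) auto
 also have "... = real n * (excess w)^2" using integral_residual by simp
 finally show ?thesis using n by simp
qed

lemma bm_mean_residual [bm_intros]:
 "bdd_meas sample (%D. avg n (%l. (clean D l - w \<bullet> feat D l)^2))" by (intro bm_intros) auto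

text \<open>Training residuals before and after the exchange have the same integral, so 62 = 2 + 30
  + 30 multiplies the training error, which the energy inequality bounds.\<close>

lemma clean_test_bound:
 "(LINT D|sample. cres 0 D) <= 62 / \<eta> * ((norm (h0 - w))^2 + 2 * \<eta> * real (T + 1) * (excess w)^2)"
proof -
 let ?X = "LINT D|sample. cres 0 D"
 let ?U = "(norm (h0 - w))^2 + 2 * \<eta> * real (T + 1) * (excess w)^2"
 let ?V = "%D. avg n (%l. (clean D l - w \<bullet> feat D l)^2)"
 let ?S = "%D t. %J. avg n (%l. (citer D J t \<bullet> feat D l - clean D l)^2)"
 let ?A = "LINT D|sample. avg n (%i. cres i D)"
 let ?E = "%i. LINT D|sample. cres i (exchange i D)"
 let ?Z = "%i. LINT D|sample. cres i D"
 have one: "?X <= 62 * (?Z i)" if i: "i \<in> {1..n}" for i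
 proof -
  have i0: "i \<in> {0..n}" using i by auto
  note bm = bm_cres[OF i0] bm_exchange[OF i0 bm_cres[OF i0]]
  have "?X
   <= (LINT D|sample. 2 * cres i (exchange i D) + 30 * (cres i D + cres i (exchange i D)))"
  proof (rule integral_mono_AE, goal_cases)
   case 1 show ?case by (intro S.P.bm_integrable bm_cres) simp
   case 2 show ?case by (intro S.P.bm_integrable bm_add bm_mult bm_const bm)
   case 3 show ?case using AE_bounded by eventually_elim (rule cres_exchange[OF i])
  qed
  also have "... = 2 * (?E i) + 30 * ((?Z i)
    + (?E i))"
   using S.P.bm_integrable[OF bm(1)] S.P.bm_integrable[OF bm(2)] by simp
  also have "(?E i) = (?Z i)" by (rule integral_exchange[OF i0 bm_measurable[OF bm(1)]])
  finally show ?thesis by simp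
 qed
 have "real n * ?X = (\<Sum>i=1..n. ?X)" by simp
 also have "... <= (\<Sum>i=1..n. 62 * (?Z i))" by (intro sum_mono one)
 also have "... = 62 * (LINT D|sample. (\<Sum>i=1..n. cres i D))" unfolding sum_distrib_left[symmetric]
  by (subst bochner_sum) (auto intro!: S.P.bm_integrable bm_cres)
 finally have 1: "?X <= 62 * ?A" using n by (simp add: field_simps)
 have "?A
  <= (LINT D|sample. (1 / \<eta>) * ((norm (h0 - w))^2 + 2 * \<eta> * real (T + 1) * (?V D)))"
 proof (rule integral_mono_AE, goal_cases)
  case 1 show ?case by (intro S.P.bm_integrable bm_intros) auto
  case 2 show ?case by (intro S.P.bm_integrable bm_mult bm_add bm_mean_residual bm_const)
  show "AE D in sample. avg n (%i. cres i D)
   <= (1 / \<eta>) * ((norm (h0 - w))^2 + 2 * \<eta> * real (T + 1) * (?V D))"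
   using AE_bounded
  proof eventually_elim
   case (elim D)
   have "avg n (%i. cres i D)
    = (\<Sum>t\<le>T. AV (?S D t))"
    unfolding cres_def av_cmult av_sum sum_distrib_left by (rule sum.swap)
   moreover have "\<eta> * (\<Sum>t\<le>T. AV (?S D t))
    <= (norm (h0 - w))^2 + 2 * \<eta> * real (T + 1) * (?V D)"
    by (rule fsgd_residuals[OF b n eta_half]) (use elim in auto)
   ultimately show ?case using eta(1) by (simp only:) (simp add: pos_le_divide_eq mult.commute)
  qed
 qed
 also have "... = (1 / \<eta>) * ?U" by (simp only: integral_affine[OF bm_mean_residual[of w]] integral_mean_residual)
 finally have "?X
  <= 62 * ((1 / \<eta>) * ?U)"
  using 1 by linarith
 also have "... = 62 / \<eta> * ?U" by (simp only: mult.assoc[symmetric] times_divide_eq_right mult_1_right)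
 finally show ?thesis .
qed

lemma clean_norm_bound:
 assumes "t <= T"
 shows "(LINT D|sample. AV (%J. (norm (citer D J t))^2))
  <= 2 * (norm w)^2 + 2 * ((norm (h0 - w))^2 + 2 * \<eta> * real T * (excess w)^2)" (is "_ <= ?R")
proof -
 let ?X = "%D. \<eta> * (\<Sum>s<t. AV (%J. avg n (%l. (citer D J s \<bullet> feat D l - clean D l)^2)))"
 let ?V = "%D. AV (%J. (norm (citer D J t - w))^2)"
 let ?S = "%D. AV (%J. (norm (citer D J t))^2)"
 let ?U = "%D. avg n (%l. (clean D l - w \<bullet> feat D l)^2)"
 have "(LINT D|sample. ?S D)
  <= (LINT D|sample. 2 * (norm w)^2 + 2 * ((norm (h0 - w))^2 + 2 * \<eta> * real T * ?U D))"
 proof (rule integral_mono_AE, goal_cases)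
  case 1 show ?case using assms by (intro S.P.bm_integrable bm_intros) auto
  case 2 show ?case by (intro S.P.bm_integrable bm_mult bm_add bm_mean_residual bm_const)
  show "AE D in sample. ?S D
   <= 2 * (norm w)^2 + 2 * ((norm (h0 - w))^2 + 2 * \<eta> * real T * ?U D)"
   using AE_bounded
  proof eventually_elim
   case (elim D)
   have U: "0 <= ?U D" by (intro mult_nonneg_nonneg sum_nonneg) auto
   have "?S D <= AV (%J. 2 * (norm w)^2 + 2 * (norm (citer D J t - w))^2)"
   proof (rule av_mono)
    show "(norm (citer D J t))^2 <= 2 * (norm w)^2 + 2 * (norm (citer D J t - w))^2" for J
     using norm_add_square_le[of w "citer D J t - w"] by simp
   qed
   also have "... = 2 * (norm w)^2 + 2 * ?V D" by (simp only: av_add av_cmult av_const[OF n])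
   also have "?V D <= (norm (h0 - w))^2 + 2 * \<eta> * real t * ?U D" (is "_ <= ?l")
   proof -
    have "0 <= ?X D" using eta(1) by (intro mult_nonneg_nonneg sum_nonneg av_nonneg) auto
    moreover have "?V D
     + ?X D
     <= ?l"
     by (rule fsgd_energy[OF b n eta_half assms]) (use elim in auto)
    ultimately show ?thesis by linarith
   qed
   also have "2 * \<eta> * real t * ?U D <= 2 * \<eta> * real T * ?U D" using assms eta(1) U by (intro mult_right_mono mult_left_mono) auto
   finally show ?case by simp
  qed
 qed
 also have "... = ?R" by (simp only: integral_affine[OF bm_mean_residual[of w]] integral_mean_residual)
 finally show ?thesis .
qed

text \<open>All noise sits in the coefficients while the vectors depend on the inputs only, as
  \<open>integral_noise_square\<close> requires.\<close>

lemma niter_sum: "niter D J t = (\<Sum>j=1..n. (label D j - clean D j) *\<^sub>R uiter D j J t)"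
 if "J \<in> seqs n (b * T)" "t <= T"
proof -
 have "niter D J t = fsgd b \<eta> (feat D) (%l. \<Sum>j=1..n. (label D j - clean D j) * (if l = j then 1 else 0)) J 0 t"
 proof (rule fsgd_label_cong[OF seqs_block[OF that]])
  fix l assume "l \<in> {1..n}"
  thus "label D l - clean D l = (\<Sum>j=1..n. (label D j - clean D j) * (if l = j then 1 else 0))" by (simp add: if_distrib[of "%x. _ * x"] cong: if_cong)
 qed auto
 also have "... = (\<Sum>j=1..n. (label D j - clean D j) *\<^sub>R uiter D j J t)" by (rule fsgd_sum) simp
 finally show ?thesis .
qed

lemma uiter_indep:
 assumes "!!l. l \<in> {0..n} ==> fst (D l) = fst (D' l)" "J \<in> seqs n (b * T)" "t <= T"
 shows "uiter D j J t = uiter D' j J t"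
 by (rule fsgd_label_cong[OF seqs_block[OF assms(2,3)]]) (use assms(1) in auto)

definition mlev :: "(nat => 'g \<times> real) => real" where
 "mlev D = avg n (%j. leverage n (feat D) \<theta> (feat D j))"

lemma bm_leverage_feat:
 "i \<in> {0..n} ==> bdd_meas sample (%D. leverage n (feat D) \<theta> (feat D i))" using n theta_pos by (intro bm_leverage bwm_feat) auto

lemma bm_mlev [bm_intros]: "bdd_meas sample mlev"
 unfolding mlev_def by (intro bm_mult bm_const bm_sum bm_leverage_feat) auto

lemma noise_test_bound:
 assumes t: "t <= T"
 shows "(LINT D|sample. AV (%J. (niter D J t \<bullet> feat D 0)^2))
  <= 4 * Y^2 * (9 / real n * (LINT D|sample. leverage n (feat D) \<theta> (feat D 0)) + 20 * (\<eta> / real b) * \<kappa>^2)"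
proof -
 let ?X = "LINT D|sample. 9 / real n * leverage n (feat D) \<theta> (feat D 0) + 20 * (\<eta> / real b) * \<kappa>^2"
 let ?U = "%D J t. niter D J t \<bullet> feat D 0"
 let ?u = "%j J D. uiter D j J t \<bullet> feat D 0"
 have bmu: "bdd_meas sample (?u j J)" if "J \<in> seqs n (b * T)" for j J using that t by (intro bm_inner bwm_iters(4) bwm_feat) auto
 have one: "(LINT D|sample. (?U D J t)^2) <= 4 * Y^2 * (LINT D|sample. (\<Sum>j=1..n. (?u j J D)^2))" if J: "J \<in> seqs n (b * T)" for J
 proof -
  have "(?U D J t)^2
   = (\<Sum>j=1..n. \<Sum>k=1..n. (label D j - clean D j) * (label D k - clean D k) * (?u j J D * ?u k J D))" for D
   unfolding niter_sum[OF J t] inner_sum_left inner_scaleR_left by (rule sum_product_square)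
  hence "(LINT D|sample. (?U D J t)^2) <= 4 * Y^2 * (LINT D|sample. (\<Sum>j=1..n. ?u j J D * ?u j J D))"
   by (simp only:) (rule integral_noise_square, auto intro!: bm_mult bmu J arg_cong2[where f = "(*)"]
    arg_cong2[where f = "(\<bullet>)"] uiter_indep[OF _ J t] arg_cong[where f = \<phi>])
  thus ?thesis by (simp only: power2_eq_square)
 qed
 \<comment> \<open>The noise is integrated for fixed indices, so the average over J has to be
   outside first.\<close>
 have "(LINT D|sample. AV (%J. (?U D J t)^2)) = AV (%J. (LINT D|sample. (?U D J t)^2))"
  using t by (intro S.P.integral_av bm_power bm_inner bwm_iters(2) bwm_feat) auto
 also have "... <= AV (%J. 4 * Y^2 * (LINT D|sample. (\<Sum>j=1..n. (?u j J D)^2)))" by (rule av_mono[OF one])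
 also have "... = 4 * Y^2 * (LINT D|sample. AV (%J. \<Sum>j=1..n. (?u j J D)^2))"
  unfolding av_cmult by (subst S.P.integral_av) (auto intro!: bm_sum bm_power bmu)
 also have "... <= 4 * Y^2 * ?X"
 proof (rule mult_left_mono[OF integral_mono_AE], goal_cases)
  case 1 show ?case by (intro S.P.bm_integrable bm_av bm_sum bm_power bmu)
  case 2 show ?case by (intro S.P.bm_integrable bm_add bm_mult bm_const bm_leverage_feat) auto
  case 3 show ?case using AE_bounded
  proof eventually_elim
   case (elim D)
   have "AV (%J. \<Sum>j=1..n. (?u j J D)^2) <= 9 / real n * leverage n (feat D) \<theta> (feat D 0) + 20 * (\<eta> / real b) * (norm (feat D 0))^2" unfolding av_sum
    by (rule noise_bounds(1)[OF n eta_half theta_pos _ b t]) (use elim theta T eta in auto)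
   also have "20 * (\<eta> / real b) * (norm (feat D 0))^2 <= 20 * (\<eta> / real b) * \<kappa>^2" using elim eta(1) by (intro mult_left_mono) auto
   finally show ?case by simp
  qed
 qed auto
 also have "?X
  = 9 / real n * (LINT D|sample. leverage n (feat D) \<theta> (feat D 0)) + 20 * (\<eta> / real b) * \<kappa>^2"
  using S.P.bm_integrable[OF bm_leverage_feat[of 0]] S.P.prob_space by simp
 finally show ?thesis .
qed

lemma noise_norm_bound:
 assumes t: "t <= T"
 shows "(LINT D|sample. AV (%J. (norm (niter D J t))^2))
  <= 4 * Y^2 * (9 / (real n * \<theta>) * (LINT D|sample. mlev D) + 30 * real T * (\<eta>^2 / real b) * \<kappa>^2)" (is "?L <= _")
proof -
 let ?X = "30 * real T * (\<eta>^2 / real b) * \<kappa>^2"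
 let ?U = "%J t. LINT D|sample. (norm (niter D J t))^2"
 let ?u = "%j J D. uiter D j J t"
 have bmu: "bdd_weak sample (?u j J)" if "J \<in> seqs n (b * T)" for j J using that t by (intro bwm_iters(4)) auto
 have one: "(?U J t) <= 4 * Y^2 * (LINT D|sample. (\<Sum>j=1..n. (norm (?u j J D))^2))" if J: "J \<in> seqs n (b * T)" for J
 proof -
  have "(norm (niter D J t))^2
   = (\<Sum>j=1..n. \<Sum>k=1..n. (label D j - clean D j) * (label D k - clean D k) * (?u j J D \<bullet> ?u k J D))" for D
   unfolding niter_sum[OF J t] norm_sum_square inner_scaleR_left inner_scaleR_right by (simp only: mult_ac)
  hence "(?U J t) <= 4 * Y^2 * (LINT D|sample. (\<Sum>j=1..n. ?u j J D \<bullet> ?u j J D))"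
   by (simp only:) (rule integral_noise_square, auto intro!: bm_inner bmu J 
    arg_cong2[where f = "(\<bullet>)"] uiter_indep[OF _ J t])
  thus ?thesis by (simp only: power2_norm_eq_inner)
 qed
 have "?L = AV (%J. (?U J t))" using t by (intro S.P.integral_av bm_power bm_norm bwm_iters(2)) auto
 also have "... <= AV (%J. 4 * Y^2 * (LINT D|sample. (\<Sum>j=1..n. (norm (?u j J D))^2)))" by (rule av_mono[OF one])
 also have "... = 4 * Y^2 * (LINT D|sample. AV (%J. \<Sum>j=1..n. (norm (?u j J D))^2))"
  unfolding av_cmult by (subst S.P.integral_av) (auto intro!: bm_sum bm_power bm_norm bmu)
 also have "... <= 4 * Y^2 * (LINT D|sample. 9 / (real n * \<theta>) * mlev D + ?X)"
 proof (rule mult_left_mono[OF integral_mono_AE], goal_cases)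
  case 1 show ?case by (intro S.P.bm_integrable bm_av bm_sum bm_power bm_norm bmu)
  case 2 show ?case by (intro S.P.bm_integrable bm_add bm_mult bm_const bm_mlev)
  case 3 show ?case using AE_bounded
  proof eventually_elim
   case (elim D)
   have "AV (%J. \<Sum>j=1..n. (norm (?u j J D))^2) <= 9 / (real n * \<theta>) * mlev D + 30 * real t * (\<eta>^2 / real b) * \<kappa>^2"
    unfolding av_sum mlev_def by (rule noise_bounds(2)[OF n eta_half theta_pos _ b t]) (use elim theta T eta in auto)
   also have "30 * real t * (\<eta>^2 / real b) * \<kappa>^2 <= ?X" using t by (intro mult_right_mono mult_left_mono) auto
   finally show ?case by simp
  qed
 qed auto
 also have "(LINT D|sample. 9 / (real n * \<theta>) * mlev D + ?X)
  = 9 / (real n * \<theta>) * (LINT D|sample. mlev D) + ?X"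
  using S.P.bm_integrable[OF bm_mlev] S.P.prob_space by simp
 finally show ?thesis .
qed

end

section \<open>Leverage of a test point and concavity of the effective dimension\<close>

context sgd_sample
begin

text \<open>A point left out of the sample has at most 1 + \<kappa>^2/(n \<theta>) \<le> 2 times the
  leverage that it has as a member; exchangeability makes the test point a member.\<close>

lemma leverage_test_bound:
 "(LINT D|sample. leverage n (feat D) \<theta> (feat D 0)) <= 2 * (LINT D|sample. mlev D)"
proof -
 let ?L = "%i D. leverage n (feat D) \<theta> (feat D i)"
 have one: "(LINT D|sample. ?L 0 D) <= 2 * (LINT D|sample. ?L i D)" if i: "i \<in> {1..n}" for i
 proof -
  have i0: "i \<in> {0..n}" using i by auto
  have "(LINT D|sample. ?L 0 D) <= (LINT D|sample. 2 * ?L i (exchange i D))"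
  proof (rule integral_mono_AE, goal_cases)
   case 1 show ?case by (intro S.P.bm_integrable bm_leverage_feat) auto
   case 2 show ?case by (intro S.P.bm_integrable bm_mult bm_const bm_exchange i0 bm_leverage_feat)
   case 3 show ?case using AE_bounded
   proof eventually_elim
    case (elim D)
    have "?L 0 D <= (1 + \<kappa>^2 / (real n * \<theta>)) * leverage n (feat (exchange i D)) \<theta> (feat D 0)" using exchange_simps(1,3)[OF i] elim
     by (intro leverage_replace_one[OF n theta_pos i]) auto
    also have "... <= 2 * leverage n (feat (exchange i D)) \<theta> (feat D 0)"
     using theta(2) n theta_pos by (intro mult_right_mono leverage_nonneg theta_pos) (auto simp: field_simps)
    finally show ?case by (simp add: exchange_simps(1)[OF i])
   qed
  qed
  also have "... = 2 * (LINT D|sample. ?L i (exchange i D))" by simp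
  also have "(LINT D|sample. ?L i (exchange i D)) = (LINT D|sample. ?L i D)"
   by (rule integral_exchange[OF i0 bm_measurable[OF bm_leverage_feat[OF i0]]])
  finally show ?thesis .
 qed
 have "real n * (LINT D|sample. ?L 0 D) = (\<Sum>i=1..n. (LINT D|sample. ?L 0 D))" by simp
 also have "... <= (\<Sum>i=1..n. 2 * (LINT D|sample. ?L i D))" by (intro sum_mono one)
 also have "... = 2 * (LINT D|sample. (\<Sum>i=1..n. ?L i D))" unfolding sum_distrib_left[symmetric]
  by (subst bochner_sum) (auto intro!: S.P.bm_integrable bm_leverage_feat)
 finally show ?thesis using n unfolding mlev_def by (simp add: field_simps)
qed

text \<open>
 The trace of \<open>T(T + \<theta>)\<^sup>-\<^sup>1\<close> is a concave function of \<open>T\<close>; term by term in an orthonormal basis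
 this is the variational characterisation of the resolvent.
\<close>

lemma mlev_bound:
 assumes N: "(%k. v k \<bullet> pop_op (resolvent pop_op \<theta> (v k))) sums N"
 shows "(LINT D|sample. mlev D) <= N"
proof -
 let ?X = "%D l k. feat D l \<bullet> v k"
 let ?U = "B^2 + (B / \<theta>)^2"
 let ?V = "%k d. v k \<bullet> pop_op (d k)"
 let ?S = "%d k D. avg n (%l. (d k \<bullet> feat D l)^2) + \<theta> * (norm (d k))^2"
 interpret T: psd_op pop_op \<theta> by (rule psd_op_pop[OF theta_pos])
 let ?c = "%D l. resolvent (emp_op n (feat D)) \<theta> (feat D l)"
 let ?R = "%D. resolvent (emp_op n (feat D)) \<theta>"
 \<comment> \<open>Partial sums of the empirical trace over the basis v. The passage to the limit
   under the integral is left to dominated convergence at the end.\<close>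
 define s where "s = (%m D. avg n (%l. \<Sum>k<m. (?X D l k) * (?c D l \<bullet> v k)))"
 have seq: "s m D = (\<Sum>k<m. v k \<bullet> v k - \<theta> * (v k \<bullet> ?R D (v k)))" for m D
 proof -
  interpret E: psd_op "emp_op n (feat D)" \<theta> by (rule psd_op_emp[OF theta_pos])
  have "s m D = (\<Sum>k<m. avg n (%l. (v k \<bullet> feat D l) * (?R D (v k) \<bullet> feat D l)))" unfolding s_def sum_distrib_left by (subst sum.swap)
    (simp add: E.resolvent_sym inner_commute[of "feat D _"])
  also have "... = (\<Sum>k<m. ?R D (v k) \<bullet> emp_op n (feat D) (v k))" by (simp only: inner_emp_op)
  also have "... = (\<Sum>k<m. v k \<bullet> emp_op n (feat D) (?R D (v k)))" by (intro sum.cong refl) (metis emp_op_sym inner_commute)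
  finally show ?thesis by (simp add: E.op_resolvent inner_diff_right)
 qed
 \<comment> \<open>The population resolvents serve as test vectors in the empirical variational
   principle. The resulting bound is affine in the empirical operator, so integration replaces the
   latter by the population operator.\<close>
 define d where "d = (%k. resolvent pop_op \<theta> (v k))"
 have Td: "pop_op (d k) = v k - \<theta> *\<^sub>R d k" for k by (simp add: d_def T.op_resolvent)
 have term_nonneg: "0 <= ?V k d" for k
 proof -
  have "?V k d = (pop_op (d k) + \<theta> *\<^sub>R d k) \<bullet> pop_op (d k)" by (simp add: Td)
  also have "... = pop_op (d k) \<bullet> pop_op (d k) + \<theta> * (d k \<bullet> pop_op (d k))" by (simp add: inner_add_left)
  finally show ?thesis using T.pos[of "d k"] theta_pos by simp
 qed
 have pop_int: "(LINT D|sample. avg n (%l. (x \<bullet> feat D l)^2)) = x \<bullet> pop_op x" for x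
 proof -
  have "(LINT D|sample. (x \<bullet> feat D l)^2) = x \<bullet> pop_op x" (is "?L = _") if "l \<in> {1..n}" for l
  proof -
   have "?L = (LINT m|M. (x \<bullet> \<phi> m)^2)" using integral_component[OF _ bm_measurable[OF bm_power[OF bm_val]], of l x 2] that by simp
   also have "... = L2_inner M (val x) (val x)" unfolding L2_inner_def by (intro bochner_cong) (auto simp: val power2_eq_square)
   finally show ?thesis by (simp add: inner_pop_op[symmetric] inner_commute)
  qed
  moreover have "(LINT D|sample. (\<Sum>l=1..n. (x \<bullet> feat D l)^2)) = (\<Sum>l=1..n. (LINT D|sample. (x \<bullet> feat D l)^2))"
   by (intro bochner_sum S.P.bm_integrable bm_power bm_inner bwm_const bwm_feat) auto
  ultimately show ?thesis using n by simp
 qed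
 define u where "u = (%k D. v k \<bullet> v k - \<theta> * (2 * (v k \<bullet> d k) -
  (?S d k D)))"
 have bq: "bdd_meas sample (%D. avg n (%l. (x \<bullet> feat D l)^2))" for x by (intro bm_intros) auto
 have bu: "bdd_meas sample (u k)" for k unfolding u_def by (intro bm_diff bm_add bm_mult bm_const bq)
 have int_u: "(LINT D|sample. u k D) = ?V k d" for k
 proof -
  have "(LINT D|sample. u k D) = v k \<bullet> v k - \<theta> * (2 * (v k \<bullet> d k) - (d k \<bullet> pop_op (d k) + \<theta> * (norm (d k))^2))"
   unfolding u_def pop_int[symmetric] using S.P.bm_integrable[OF bq] S.P.prob_space by simp
  thus ?thesis by (simp add: Td inner_diff_right power2_norm_eq_inner inner_commute algebra_simps)
 qed
 have su: "s m D <= (\<Sum>k<m. u k D)" for m D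
 proof -
  interpret E: psd_op "emp_op n (feat D)" \<theta> by (rule psd_op_emp[OF theta_pos])
  have "\<theta> * (2 * (v k \<bullet> d k) - (?S d k D))
   <= \<theta> * (v k \<bullet> ?R D (v k))" for k
   using E.resolvent_variational[of "v k" "d k"] theta_pos by (simp add: emp_op_quadratic)
  thus ?thesis unfolding seq u_def by (intro sum_mono) simp
 qed
 have smeas: "s m \<in> borel_measurable sample" for m unfolding s_def
  by (intro borel_measurable_times borel_measurable_const borel_measurable_sum wm_inner_const
    wm_resolvent[where \<kappa> = B] bwm_measurable bwm_feat n theta_pos) (auto intro!: feature_bound conjunct2[OF sample_space])
 have bound: "\<bar>s m D\<bar> <= ?U" if D: "D \<in> space sample" for m D
 proof -
  interpret E: psd_op "emp_op n (feat D)" \<theta> by (rule psd_op_emp[OF theta_pos])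
  have "\<bar>\<Sum>k<m. (?X D l k) * (?c D l \<bullet> v k)\<bar> <= ?U" (is "?l <= _") if l: "l \<in> {1..n}" for l
  proof -
   have nF: "norm (feat D l) <= B" using feature_bound conjunct2[OF sample_space[OF D, of l]] l by auto
   hence nc: "norm (?c D l) <= B / \<theta>" using E.norm_resolvent_le[of "feat D l"] theta_pos by (meson divide_right_mono less_imp_le order_trans)
   have bessel: "(\<Sum>k<m. (x \<bullet> v k)^2) <= (norm x)^2" for x using parseval[of x x] sum_le_suminf[of "%k. (x \<bullet> v k)^2" "{..<m}"]
    by (auto simp: sums_iff power2_eq_square[of "x \<bullet> _"] power2_norm_eq_inner)
   have "?l <= (\<Sum>k<m. (?X D l k)^2 + (?c D l \<bullet> v k)^2)"
   proof (intro order_trans[OF sum_abs] sum_mono)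
    fix k
    have "2 * \<bar>x\<bar> * \<bar>y\<bar> <= x^2 + y^2" for x y :: real using sum_squares_bound[of "\<bar>x\<bar>" "\<bar>y\<bar>"] by simp
    from this[of "?X D l k" "?c D l \<bullet> v k"]
    show "\<bar>(?X D l k) * (?c D l \<bullet> v k)\<bar> <= (?X D l k)^2 + (?c D l \<bullet> v k)^2"
     using mult_nonneg_nonneg[OF abs_ge_zero abs_ge_zero, of "?X D l k" "?c D l \<bullet> v k"] unfolding abs_mult by linarith
   qed
   also have "... <= (norm (feat D l))^2 + (norm (?c D l))^2" unfolding sum.distrib by (intro add_mono bessel)
   also have "... <= ?U" using nF nc by (intro add_mono power_mono) auto
   finally show ?thesis .
  qed
  hence "avg n (%l. \<bar>\<Sum>k<m. (?X D l k) * (?c D l \<bullet> v k)\<bar>) <= ?U" by (rule mean_le[OF n])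
  moreover have "\<bar>s m D\<bar> <= avg n (%l. \<bar>\<Sum>k<m. (?X D l k) * (?c D l \<bullet> v k)\<bar>)" unfolding s_def abs_mult by (intro mult_mono sum_abs) auto
  ultimately show ?thesis by linarith
 qed
 have lim: "(%m. s m D) \<longlonglongrightarrow> mlev D" for D unfolding s_def mlev_def leverage_def
  by (intro tendsto_mult tendsto_const tendsto_sum parseval[unfolded sums_def])
 have "(%m. (LINT D|sample. s m D)) \<longlonglongrightarrow> (LINT D|sample. mlev D)" by (rule integral_dominated_convergence[where w = "%_. ?U"])
   (use bm_measurable[OF bm_mlev] smeas lim bound in auto)
 thus ?thesis
 proof (rule LIMSEQ_le_const2, intro exI allI impI)
  fix m :: nat
  have "(LINT D|sample. s m D) <= (LINT D|sample. (\<Sum>k<m. u k D))"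
  proof (rule integral_mono, goal_cases)
   case 1 show ?case by (intro S.P.bm_integrable bmI[OF smeas bound])
   case 2 show ?case by (intro S.P.bm_integrable bm_sum bu)
  qed (rule su)
  also have "... = (\<Sum>k<m. ?V k d)" by (subst bochner_sum) (auto simp: int_u intro!: S.P.bm_integrable bu)
  also have "... <= N" using N sum_le_suminf[of "%k. ?V k d" "{..<m}"] term_nonneg by (auto simp: sums_iff d_def)
  finally show "(LINT D|sample. s m D) <= N" .
 qed
qed

end

section \<open>Mean bounds for the first-stage iterates and the comparison of norms\<close>

context sgd_sample
begin

lemma sums_nonneg:
 assumes "(%k. v k \<bullet> pop_op (resolvent pop_op \<theta> (v k))) sums Ne"
 shows "0 <= Ne"
proof -
 have "0 <= (LINT D|sample. mlev D)"
  unfolding mlev_def by (intro integral_nonneg_AE AE_I2 mult_nonneg_nonneg sum_nonneg leverage_nonneg theta_pos) auto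
 thus ?thesis using mlev_bound[OF assms] by linarith
qed

lemma T_eq: "real T = 1 / (\<eta> * \<theta>)"
 unfolding theta(1) using eta(1) T by simp

lemma iter_test_point: "J \<in> seqs n (b * T) ==> t <= T ==> iter (D(0 := z)) J t = iter D J t"
 by (rule fsgd_label_cong[OF seqs_block]) auto

lemma bm_excess_iter:
 assumes "J \<in> seqs n (b * T)" "t <= T"
 shows "bdd_meas sample (%D. (excess (iter D J t))^2)"
 using integral_excess_square(2)[of "%D. iter D J t"] bwm_iters(3)[OF assms] iter_test_point[OF assms] by simp

text \<open>
 The right-hand side collects approximation error, penalty of the comparison vector, variance
 and mini-batch noise.
\<close>

definition rate :: "'k => real => real" where
 "rate w N = (excess w)^2 + \<theta> * (norm w)^2 + \<theta> * (norm h0)^2 + Y^2 * (N / real n + \<eta> * \<kappa>^2 / real b)"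

lemma norm_diff_square_le: "(norm (x - y))^2 <= 2 * (norm x)^2 + 2 * (norm y)^2" for x y :: 'k
 using norm_add_square_le[of x "- y"] by simp

text \<open>The factor 124 = 2 * 62 together with T + 1 \<le> 2 T and the splitting of |h0 - w|^2
  leads to coefficients of at most 496; 1000 is a round majorant that serves
  \<open>iter_norm_bound\<close> as well.\<close>

lemma iter_excess_bound:
 assumes N: "(%k. v k \<bullet> pop_op (resolvent pop_op \<theta> (v k))) sums N"
 shows "(LINT D|sample. (1 / real T) * (\<Sum>t\<le>T. AV (%J. (excess (iter D J t))^2))) <= 1000 * rate w N"
proof -
 let ?X = "LINT D|sample. cres 0 D"
 let ?U = "(2 * (norm h0)^2 + 2 * (norm w)^2) + 2 * \<eta> * (2 * real T) * (excess w)^2"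
 let ?V = "\<theta> * (norm h0)^2"
 let ?S = "%D J t. citer D J t \<bullet> feat D 0 - clean D 0"
 let ?e = "%D t. AV (%J. (excess (iter D J t))^2)"
 let ?r = "%D t. AV (%J. (iter D J t \<bullet> feat D 0 - clean D 0)^2)"
 let ?c = "%D t. AV (%J. (?S D J t)^2)"
 let ?z = "%D t. AV (%J. (niter D J t \<bullet> feat D 0)^2)"
 let ?W = "(norm (h0 - w))^2 + 2 * \<eta> * real (T + 1) * (excess w)^2"
 have eq: "(LINT D|sample. ?e D t) = (LINT D|sample. ?r D t)" if t: "t <= T" for t
 proof -
  have "(LINT D|sample. ?e D t) = AV (%J. (LINT D|sample. (excess (iter D J t))^2))" using t by (intro S.P.integral_av bm_excess_iter)
  also have "... = AV (%J. (LINT D|sample. (iter D J t \<bullet> feat D 0 - clean D 0)^2))"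
   using t by (intro av_cong integral_excess_square(1) bwm_iters(3) iter_test_point)
  also have "... = (LINT D|sample. ?r D t)"
   using t by (intro S.P.integral_av[symmetric] bm_power bm_diff bm_inner bwm_iters(3) bwm_feat bm_clean) auto
  finally show ?thesis .
 qed
 have split: "(iter D J t \<bullet> feat D 0 - clean D 0)^2
   <= 2 * (?S D J t)^2 + 2 * (niter D J t \<bullet> feat D 0)^2" for D J t
  using square_add_le[of "?S D J t" "niter D J t \<bullet> feat D 0"] by (simp add: iter_split inner_add_left algebra_simps)
 have bm1: "bdd_meas sample (%D. ?r D t)"
  "bdd_meas sample (%D. ?c D t)"
  "bdd_meas sample (%D. ?z D t)" if "t <= T" for t using that by (intro bm_av bm_power bm_diff bm_inner bwm_iters bwm_feat bm_clean; simp)+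
 let ?E = "\<eta> / real b * \<kappa>^2"
 have nb: "(LINT D|sample. ?z D t) <= 4 * Y^2 * (18 * (N / real n) + 20 * ?E)" if t: "t <= T" for t
 proof -
  have "9 / real n * (LINT D|sample. leverage n (feat D) \<theta> (feat D 0)) <= 9 / real n * (2 * N)"
   using order_trans[OF leverage_test_bound mult_left_mono[OF mlev_bound[OF N], of 2]] by (intro mult_left_mono) auto
  thus ?thesis by (intro order_trans[OF noise_test_bound[OF t]] mult_left_mono) auto
 qed
 have "(LINT D|sample. (\<Sum>t\<le>T. ?e D t))
  = (\<Sum>t\<le>T. (LINT D|sample. ?r D t))"
  by (subst bochner_sum) (auto intro!: S.P.bm_integrable bm_av bm_excess_iter sum.cong eq)
 also have "... <= (\<Sum>t\<le>T. (LINT D|sample. 2 * ?c D t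
   + 2 * ?z D t))"
 proof (intro sum_mono integral_mono S.P.bm_integrable bm_add bm_mult bm_const bm1)
  fix t D
  show "?r D t <= 2 * ?c D t
   + 2 * ?z D t"
   unfolding av_cmult[symmetric] av_add[symmetric] by (intro av_mono split)
 qed auto
 also have "... = 2 * (\<Sum>t\<le>T. (LINT D|sample. ?c D t))
   + 2 * (\<Sum>t\<le>T. (LINT D|sample. ?z D t))"
  unfolding sum_distrib_left sum.distrib[symmetric] by (intro sum.cong refl, subst Bochner_Integration.integral_add)
   (auto intro!: S.P.bm_integrable bm_mult[OF bm_const] bm1)
 also have "(\<Sum>t\<le>T. (LINT D|sample. ?c D t)) = ?X" unfolding cres_def by (intro bochner_sum[symmetric] S.P.bm_integrable bm1) auto
 finally have A: "(LINT D|sample. (\<Sum>t\<le>T. ?e D t)) <= 2 * ?X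
  + 2 * (\<Sum>t\<le>T. (LINT D|sample. ?z D t))" .
 have "2 * ?X <= 2 * (62 / \<eta> * ?W)" by (intro mult_left_mono clean_test_bound) auto
 also have "2 * (62 / \<eta> * ?W)
  = 124 / \<eta> * ?W"
  by (simp only: mult.assoc[symmetric] times_divide_eq_right)
 finally have B: "2 * ?X
  <= 124 / \<eta> * ?W" .
 have "2 * (\<Sum>t\<le>T. (LINT D|sample. ?z D t)) <= 2 * (\<Sum>t\<le>T. 4 * Y^2 * (18 * (N / real n) + 20 * ?E))" by (intro mult_left_mono sum_mono nb) auto
 also have "2 * (\<Sum>t\<le>T. 4 * Y^2 * (18 * (N / real n) + 20 * ?E)) = 8 * real (T + 1) * (Y^2 * (18 * (N / real n) + 20 * ?E))"
  by (simp only: sum_constant card_atMost Suc_eq_plus1)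
 finally have C: "2 * (\<Sum>t\<le>T. (LINT D|sample. ?z D t))
  <= 8 * real (T + 1) * (Y^2 * (18 * (N / real n) + 20 * ?E))" .
 from order_trans[OF A add_mono[OF B C]] have 1: "(LINT D|sample. (\<Sum>t\<le>T. ?e D t))
  <= 124 / \<eta> * ?W
   + 8 * real (T + 1) * (Y^2 * (18 * (N / real n) + 20 * ?E))" .
 note N0 = sums_nonneg[OF N]
 have T2: "real (T + 1) <= 2 * real T" using T by simp
 have E0: "0 <= ?E" using eta(1) by simp
 note 1
 also have "124 / \<eta> * ?W
  <= 124 / \<eta> * ?U"
  using eta(1) T2 by (intro mult_left_mono add_mono mult_right_mono norm_diff_square_le) auto
 also have "8 * real (T + 1) * (Y^2 * (18 * (N / real n) + 20 * ?E)) <= 8 * (2 * real T) * (Y^2 * (18 * (N / real n) + 20 * ?E))"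
  using T2 N0 E0 by (intro mult_right_mono mult_left_mono) auto
 also have "124 / \<eta> * ?U
   + 8 * (2 * real T) * (Y^2 * (18 * (N / real n) + 20 * ?E))
  = real T * (248 * (?V) + 248 * (\<theta> * (norm w)^2) + 496 * (excess w)^2
   + 288 * (Y^2 * (N / real n)) + 320 * (Y^2 * ?E))"
  unfolding T_eq using eta(1) theta_pos n b by (simp add: field_simps)
 also have "... <= real T * (1000 * rate w N)"
 proof (rule mult_left_mono)
  have "0 <= ?V" "0 <= \<theta> * (norm w)^2" "0 <= (excess w)^2" "0 <= Y^2 * (N / real n)" "0 <= Y^2 * ?E" using theta_pos N0 eta(1) by auto
  moreover have "rate w N = (excess w)^2 + \<theta> * (norm w)^2 + ?V + (Y^2 * (N / real n) + Y^2 * ?E)" by (simp add: rate_def algebra_simps)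
  ultimately show "248 * (?V) + 248 * (\<theta> * (norm w)^2) + 496 * (excess w)^2
   + 288 * (Y^2 * (N / real n)) + 320 * (Y^2 * ?E) <= 1000 * rate w N" by linarith
 qed simp
 finally show ?thesis using T by (simp add: field_simps)
qed

lemma iter_norm_bound:
 assumes N: "(%k. v k \<bullet> pop_op (resolvent pop_op \<theta> (v k))) sums N" and t: "t <= T"
 shows "\<theta> * (LINT D|sample. AV (%J. (norm (iter D J t))^2)) <= 1000 * rate w N"
proof -
 let ?X = "9 / (real n * \<theta>) * N + 30 * real T * (\<eta>^2 / real b) * \<kappa>^2"
 let ?e = "%D. AV (%J. (norm (iter D J t))^2)"
 let ?c = "%D. AV (%J. (norm (citer D J t))^2)"
 let ?z = "%D. AV (%J. (norm (niter D J t))^2)"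
 let ?W = "2 * (norm w)^2 + 2 * ((2 * (norm h0)^2 + 2 * (norm w)^2) + 2 * \<eta> * real T * (excess w)^2)"
 let ?E = "\<eta> / real b * \<kappa>^2"
 have bm1: "bdd_meas sample (%D. ?e D)"
  "bdd_meas sample (%D. ?c D)"
  "bdd_meas sample (%D. ?z D)" using t by (intro bm_av bm_power bm_norm bwm_iters; simp)+
 have "(LINT D|sample. ?e D)
  <= (LINT D|sample. 2 * ?c D + 2 * ?z D)"
 proof (intro integral_mono S.P.bm_integrable bm_add bm_mult bm_const bm1)
  show "?e D <= 2 * ?c D + 2 * ?z D" for D unfolding av_cmult[symmetric] av_add[symmetric] iter_split by (intro av_mono norm_add_square_le)
 qed
 also have "... = 2 * (LINT D|sample. ?c D) + 2 * (LINT D|sample. ?z D)" using S.P.bm_integrable[OF bm1(2)] S.P.bm_integrable[OF bm1(3)] by simp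
 also have "... <= 2 * ?W
  + 2 * (4 * Y^2 * ?X)"
 proof (intro add_mono mult_left_mono)
  show "(LINT D|sample. ?c D)
   <= ?W"
   by (rule order_trans[OF clean_norm_bound[OF t, of w]]) (intro add_left_mono mult_left_mono add_right_mono norm_diff_square_le; simp)
  show "(LINT D|sample. ?z D)
   <= 4 * Y^2 * ?X"
   by (rule order_trans[OF noise_norm_bound[OF t]], intro mult_left_mono add_right_mono mlev_bound[OF N]) (use theta_pos in auto)
 qed auto
 finally have "\<theta> * (LINT D|sample. ?e D) <=
  \<theta> * (2 * ?W
  + 2 * (4 * Y^2 * ?X))"
  using theta_pos by (intro mult_left_mono) auto
 also have "... = 12 * (\<theta> * (norm w)^2) + 8 * (\<theta> * (norm h0)^2) + 8 * (excess w)^2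
   + 72 * (Y^2 * (N / real n)) + 240 * (Y^2 * ?E)"
 proof -
  show ?thesis unfolding T_eq using eta(1) theta_pos n b by (simp add: field_simps power2_eq_square)
 qed
 also have "... <= 1000 * rate w N"
 proof -
  have "0 <= \<theta> * (norm h0)^2" "0 <= \<theta> * (norm w)^2" "0 <= (excess w)^2" "0 <= Y^2 * (N / real n)" "0 <= Y^2 * ?E"
   using theta_pos eta(1) sums_nonneg[OF N] by auto
  moreover have "rate w N = (excess w)^2 + \<theta> * (norm w)^2 + \<theta> * (norm h0)^2 + (Y^2 * (N / real n) + Y^2 * ?E)" by (simp add: rate_def algebra_simps)
  ultimately show ?thesis by linarith
 qed
 finally show ?thesis .
qed

text \<open>The price of passing from the empirical to the population norm, given the sample. Its
  integral is at most twice the effective dimension.\<close>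

definition plev :: "(nat => 'g \<times> real) => real" where
 "plev D = (LINT m|M. leverage n (feat D) \<theta> (\<phi> m))"

lemma bm_leverage_const: "bdd_meas M (%m. leverage n F \<theta> (\<phi> m))"
 using n theta_pos by (intro bm_leverage bwm_const bwmI[OF wm_feature feature_bound])

lemma plev_nonneg: "0 <= plev D"
 unfolding plev_def by (intro integral_nonneg_AE AE_I2 leverage_nonneg theta_pos)

lemma plev_test_point:
 "plev D = (LINT z|\<rho>. leverage n (feat (D(0 := z))) \<theta> (feat (D(0 := z)) 0))"
proof -
 have "leverage n (feat (D(0 := z))) \<theta> x = leverage n (feat D) \<theta> x" for z x
 proof -
  have "emp_op n (feat (D(0 := z))) = emp_op n (feat D)" by (auto simp: emp_op_def)
  thus ?thesis by (simp add: leverage_def)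
 qed
 thus ?thesis unfolding plev_def by (subst integral_fst[symmetric, OF bm_measurable[OF bm_leverage_const]]) simp
qed

lemma bm_plev: "bdd_meas sample plev"
 using integral_test_point(2)[OF bm_leverage_feat[of 0]] unfolding plev_test_point[symmetric] by simp

lemma integral_plev:
 assumes N: "(%k. v k \<bullet> pop_op (resolvent pop_op \<theta> (v k))) sums N"
 shows "(LINT D|sample. plev D) <= 2 * N"
proof -
 have "(LINT D|sample. plev D) = (LINT D|sample. leverage n (feat D) \<theta> (feat D 0))"
  unfolding plev_test_point by (rule integral_test_point(1)[OF bm_leverage_feat]) simp
 also have "... <= 2 * (LINT D|sample. mlev D)" by (rule leverage_test_bound)
 finally show ?thesis using mlev_bound[OF N] by linarith
qed

text \<open>Cauchy-Schwarz for the resolvent at every point m, integrated over m. It takes the place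
  of a concentration inequality for the empirical operator.\<close>

lemma L2_norm_val_le:
 "(L2_norm M (val d))^2 <= plev D * (d \<bullet> emp_op n (feat D) d + \<theta> * (norm d)^2)"
proof -
 interpret E: psd_op "emp_op n (feat D)" \<theta> by (rule psd_op_emp[OF theta_pos])
 have "(L2_norm M (val d))^2 = (LINT m|M. (d \<bullet> \<phi> m)^2)" unfolding L2_norm_square L2_inner_def
  by (intro bochner_cong refl) (simp add: val power2_eq_square)
 also have "... <= (LINT m|M. leverage n (feat D) \<theta> (\<phi> m) * (d \<bullet> emp_op n (feat D) d + \<theta> * (norm d)^2))" unfolding leverage_def
  by (intro integral_mono bm_integrable bm_power bm_val bm_mult[OF _ bm_const] bm_leverage_const[unfolded leverage_def])
   (use E.resolvent_cauchy_schwarz[of "\<phi> _" d] in \<open>simp add: inner_commute\<close>)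
 finally show ?thesis by (simp add: plev_def)
qed

end

section \<open>The source condition\<close>

context feature_space
begin

text \<open>
 The comparison vector is a spectral cutoff: an eigenvalue \<open>\<sigma>\<close> above \<open>\<theta>\<close> contributes
 \<open>\<theta> \<sigma>\<^bsup>2r - 1\<^esup>\<close> to the penalty and one below contributes \<open>\<sigma>\<^bsup>2r\<^esup>\<close> to the error; both are at most
 \<open>\<theta>\<^bsup>2r\<^esup>\<close>, and \<open>O(\<theta>)\<close> for a fixed eigenvalue.
\<close>

lemma source_condition:
 assumes power: "is_op_power M (kernel_op M val) r h f" and h: "h \<in> L2 M"
  and r: "0 < r" "2 * r < 1" and \<tau>: "0 < \<tau>"
 shows "\<exists>\<theta>\<^sub>0>0. \<forall>\<theta>. 0 < \<theta> --> \<theta> < \<theta>\<^sub>0 -->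
  (\<exists>w. (L2_norm M (%m. val w m - f m))^2 + \<theta> * (norm w)^2 <= \<tau> * \<theta> powr (2 * r))"
proof -
 from power obtain \<sigma> e where f: "f \<in> L2 M" and spec: "spectral_system M (kernel_op M val) \<sigma> e"
  and lim: "(%k. L2_norm M (%m. f m - (\<Sum>i<k. \<sigma> i powr r * L2_inner M h (e i) * e i m))) \<longlonglongrightarrow> 0"
  unfolding is_op_power_def by blast
 define I where "I = {i. \<sigma> i > 0}"
 have \<sigma>0: "0 <= \<sigma> i" and e: "e i \<in> L2 M" for i using spec by (auto simp: spectral_system_def)
 have onI: "L2_inner M (e i) (e j) = (if i = j then 1 else 0)" if "i \<in> I" "j \<in> I" for i j using spec that by (auto simp: spectral_system_def I_def)
 have o: "L2_orthonormal I e" using e onI by (auto simp: L2_orthonormal_def)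
 \<comment> \<open>Represents \<sigma> i times e i inside the RKHS. The e i themselves are mere L2
   functions, so w has to be built from the u i.\<close>
 define u where "u = (%i. inclusion_adj M val (e i))"
 have u_AE: "AE m in M. val (u i) m = \<sigma> i * e i m" if i: "i \<in> I" for i
 proof -
  have eq: "(\<Sum>j<k. \<sigma> j * L2_inner M (e i) (e j) * e j m) = \<sigma> i * e i m" (is "?L = _") if "i < k" for k m
  proof -
   have "?L = (\<Sum>j<k. if j = i then \<sigma> i * e i m else 0)" using i onI[OF i] \<sigma>0 by (intro sum.cong refl) (auto simp: I_def less_le)
   thus ?thesis using that by simp
  qed
  have "(%k. L2_norm M (%m. kernel_op M val (e i) m - (\<Sum>j<k. \<sigma> j * L2_inner M (e i) (e j) * e j m))) \<longlonglongrightarrow> 0"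
   using spec e by (auto simp: spectral_system_def)
  moreover have "(%k. L2_norm M (%m. kernel_op M val (e i) m - (\<Sum>j<k. \<sigma> j * L2_inner M (e i) (e j) * e j m)))
   \<longlonglongrightarrow> L2_norm M (%m. val (u i) m - \<sigma> i * e i m)"
   by (rule tendsto_eventually, rule eventually_sequentiallyI[of "Suc i"]) (simp add: eq kernel_op_def u_def)
  ultimately have "L2_norm M (%m. val (u i) m - \<sigma> i * e i m) = 0" using LIMSEQ_unique by blast
  from L2_norm_zero_AE[OF L2_diff[OF val_L2 L2_scale[OF e]] this] show ?thesis by simp
 qed
 have u_inner: "u i \<bullet> u j = (if i = j then \<sigma> i else 0)" (is "?R = ?l") if ij: "i \<in> I" "j \<in> I" for i j
 proof -
  have "?R = L2_inner M (e i) (val (u j))" unfolding u_def by (rule adj[OF e])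
  also have "... = L2_inner M (%m. \<sigma> j * e j m) (e i)" unfolding L2_inner_def using u_AE[OF ij(2)] L2_D(1)[OF e] L2_D(1)[OF val_L2]
   by (intro integral_cong_AE) (auto intro!: borel_measurable_times)
  also have "... = ?l" using onI[OF ij(2,1)] by (simp add: L2_inner_scale)
  finally show ?thesis .
 qed
 define c where "c = (%i. if i \<in> I then (L2_inner M h (e i))^2 else 0)"
 have c0: "0 <= c i" for i by (simp add: c_def)
 have "summable c"
 proof (rule summableI_nonneg_bounded)
  fix k
  have "(\<Sum>i<k. c i) = (\<Sum>i\<in>{..<k} \<inter> I. (L2_inner M h (e i))^2)" by (simp add: c_def sum.inter_restrict)
  also have "... <= L2_inner M h h" by (rule L2_bessel[OF o _ _ h]) auto
  finally show "(\<Sum>i<k. c i) <= L2_inner M h h" .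
 qed (rule c0)
 \<comment> \<open>Beyond k0 the squared coefficients of h have a small sum, and the finitely many
   before k0 contribute O(\<theta>), which is o(\<theta>^(2r)) as 2 r < 1. This split improves the
   usual order \<theta>^(2r) to an arbitrarily small multiple.\<close>
 then obtain k0 where k0: "!!m. norm (\<Sum>i=k0..<m. c i) < \<tau> / 6"
  using summable_Cauchy[THEN iffD1] \<tau> by (metis divide_pos_pos order_refl zero_less_numeral)
 define C where "C = (\<Sum>i<k0. \<sigma> i powr (2 * r - 1) * c i)"
 have C0: "0 <= C" unfolding C_def by (intro sum_nonneg mult_nonneg_nonneg c0) auto
 define \<theta>\<^sub>0 where "\<theta>\<^sub>0 = (\<tau> / (6 * (C + 1))) powr (1 / (1 - 2 * r))"
 have "\<theta>\<^sub>0 > 0" using \<tau> C0 by (simp add: \<theta>\<^sub>0_def)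
 moreover have "\<exists>w. (L2_norm M (%m. val w m - f m))^2 + \<theta> * (norm w)^2 <= \<tau> * \<theta> powr (2 * r)" if \<theta>: "0 < \<theta>" "\<theta> < \<theta>\<^sub>0" for \<theta>
 proof -
  have tp: "\<theta> powr (2 * r) > 0" using \<theta> by simp
  let ?t = "\<tau> / 6 * \<theta> powr (2 * r)"
  have "\<theta> powr (1 - 2 * r) <= \<theta>\<^sub>0 powr (1 - 2 * r)" using \<theta> r by (intro powr_mono2) auto
  also have "... = \<tau> / (6 * (C + 1))" using r \<tau> C0 by (simp add: \<theta>\<^sub>0_def powr_powr)
  finally have "\<theta> powr (1 - 2 * r) * (C + 1) <= \<tau> / 6" using C0 by (simp add: field_simps)
  moreover have "\<theta> powr (1 - 2 * r) * C <= \<theta> powr (1 - 2 * r) * (C + 1)" by (intro mult_left_mono) auto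
  ultimately have "\<theta> powr (1 - 2 * r) * C <= \<tau> / 6" by linarith
  hence "\<theta> powr (1 - 2 * r) * C * \<theta> powr (2 * r) <= ?t" using tp by (intro mult_right_mono) auto
  moreover have "\<theta> powr (1 - 2 * r) * C * \<theta> powr (2 * r) = \<theta> * C" using \<theta> by (simp add: mult.commute mult.left_commute powr_add[symmetric])
  ultimately have head: "\<theta> * C <= ?t" by simp
  \<comment> \<open>Of six shares \<tau>/6, truncating the expansion of f at k takes two, the head
    and the tail of the coefficients two each.\<close>
  define \<epsilon> where "\<epsilon> = sqrt ?t"
  have "\<epsilon> > 0" using \<tau> tp by (simp add: \<epsilon>_def)
  have "\<exists>k. L2_norm M (%m. f m - (\<Sum>i<k. \<sigma> i powr r * L2_inner M h (e i) * e i m)) < \<epsilon>" using LIMSEQ_D[OF lim \<open>\<epsilon> > 0\<close>] by (auto simp: abs_of_nonneg)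
  then obtain k where k: "L2_norm M (%m. f m - (\<Sum>i<k. \<sigma> i powr r * L2_inner M h (e i) * e i m)) < \<epsilon>" ..
  define b where "b = (%i. \<sigma> i powr r * L2_inner M h (e i))"
  define F where "F = {i \<in> {..<k}. \<theta> <= \<sigma> i}"
  define F' where "F' = {i \<in> {..<k}. \<sigma> i < \<theta>} \<inter> I"
  have F: "finite F" "F \<subseteq> I" "finite F'" "F' \<subseteq> I" "F \<inter> F' = {}" "F \<union> F' = {..<k} \<inter> I" using \<theta> by (auto simp: F_def F'_def I_def)
  define w where "w = (\<Sum>i\<in>F. (b i / \<sigma> i) *\<^sub>R u i)"
  have "(norm w)^2 = (\<Sum>i\<in>F. \<Sum>j\<in>F. (b i / \<sigma> i) * ((b j / \<sigma> j) * (u i \<bullet> u j)))"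
   unfolding w_def norm_sum_square by (simp add: mult.left_commute mult.commute)
  also have "... = (\<Sum>i\<in>F. \<Sum>j\<in>F. if j = i then (b i)^2 / \<sigma> i else 0)"
   using F(2) u_inner by (intro sum.cong refl) (auto simp: I_def power2_eq_square subset_iff)
  also have "... = (\<Sum>i\<in>F. (b i)^2 / \<sigma> i)" using F(1) by simp
  finally have nw: "(norm w)^2 = (\<Sum>i\<in>F. (b i)^2 / \<sigma> i)" .
  let ?s = "%A m. \<Sum>i\<in>A. b i * e i m"
  let ?D = "L2_norm M (%m. f m - (\<Sum>i<k. b i * e i m))" and ?x = "(L2_norm M (%m. val w m - f m))^2"
  have sL2: "?s A \<in> L2 M" for A using e by (auto intro!: L2_sum)
  have "AE m in M. \<forall>i\<in>F. val (u i) m = \<sigma> i * e i m" using F u_AE by (intro AE_finite_allI) auto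
  moreover have "AE m in M. m \<in> space M" by (rule AE_space)
  ultimately have val_w: "AE m in M. val w m = ?s F m"
  proof eventually_elim
   case (elim m)
   have "val w m = (\<Sum>i\<in>F. (b i / \<sigma> i) * val (u i) m)" using elim(2) by (simp add: val w_def inner_sum_left)
   also have "... = ?s F m" using elim(1) F(2) by (intro sum.cong refl) (auto simp: I_def)
   finally show ?case .
  qed
  have full: "(\<Sum>i<k. b i * e i m) = ?s F m + ?s F' m" (is "?r = ?L1") for m
  proof -
   have "?r = (\<Sum>i\<in>{..<k} \<inter> I. b i * e i m)" using \<sigma>0 by (intro sum.mono_neutral_right) (auto simp: I_def b_def less_le)
   also have "... = ?L1" unfolding F(6)[symmetric] by (rule sum.union_disjoint) (use F in auto)
   finally show ?thesis .
  qed
  have "L2_norm M (%m. val w m - f m) = L2_norm M (%m. (f m - (\<Sum>i<k. b i * e i m)) + ?s F' m)" unfolding L2_norm_def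
  proof (intro arg_cong[where f = sqrt] integral_cong_AE, goal_cases)
   case 1 show ?case using L2_D(1)[OF val_L2] L2_D(1)[OF f] by auto
   case 2 show ?case using L2_D(1)[OF e] L2_D(1)[OF f] by auto
   case 3 show ?case using val_w by eventually_elim (simp add: full power2_commute)
  qed
  also have "... <= ?D + L2_norm M (?s F')" by (intro L2_norm_triangle L2_diff f sL2)
  finally have "?x <= (?D + L2_norm M (?s F'))^2" by (rule power_mono) simp
  also have "... <= 2 * ?D^2 + 2 * (L2_norm M (?s F'))^2" by (rule square_add_le)
  also have "(L2_norm M (?s F'))^2 = (\<Sum>i\<in>F'. (b i)^2)" unfolding L2_norm_square by (rule L2_combination_norm[OF o F(3,4)])
  also have "?D^2 <= \<epsilon>^2" using k by (intro power_mono) (auto simp: b_def)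
  also have "\<epsilon>^2 = ?t" using \<tau> tp by (simp add: \<epsilon>_def)
  finally have ex: "?x <= 2 * ?t + 2 * (\<Sum>i\<in>F'. (b i)^2)" by simp
  have b2: "(b i)^2 = \<sigma> i powr (2 * r) * c i" if "i \<in> I" for i
   using that powr_add[of "\<sigma> i" r r] by (simp add: b_def c_def power_mult_distrib power2_eq_square[of "_ powr _"])
  have split_powr: "\<sigma> i powr (2 * r) = \<sigma> i * \<sigma> i powr (2 * r - 1)" if "i \<in> I" for i using that powr_add[of "\<sigma> i" 1 "2 * r - 1"] by (simp add: I_def)
  \<comment> \<open>The smaller one of \<theta> \<sigma>^(2r-1) and \<sigma>^(2r): penalty and error
    become a single sum over the eigenvalues.\<close>
  define g where "g = (%i. if \<theta> <= \<sigma> i then \<theta> * \<sigma> i powr (2 * r - 1) else \<sigma> i powr (2 * r))"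
  let ?S = "%A. \<Sum>i\<in>A. g i * c i"
  have g1: "g i <= \<theta> * \<sigma> i powr (2 * r - 1)" if "i \<in> I" for i unfolding g_def split_powr[OF that] by (auto intro!: mult_right_mono)
  have g2: "g i <= \<theta> powr (2 * r)" if i: "i \<in> I" for i
  proof (cases "\<theta> <= \<sigma> i")
   case True
   have "\<theta> * \<sigma> i powr (2 * r - 1) <= \<theta> * \<theta> powr (2 * r - 1)" using True \<theta> r by (intro mult_left_mono powr_mono2') auto
   also have "... = \<theta> powr (2 * r)" using \<theta> powr_add[of \<theta> 1 "2 * r - 1"] by simp
   finally show ?thesis using True by (simp add: g_def)
  next
   case False
   thus ?thesis using r i \<theta> by (auto simp: g_def I_def intro!: powr_mono2)
  qed
  have nwF: "\<theta> * (norm w)^2 = ?S F" unfolding nw sum_distrib_left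
  proof (intro sum.cong refl, goal_cases)
   case (1 i)
   hence "i \<in> I" "\<theta> <= \<sigma> i" "\<sigma> i > 0" using F \<theta> by (auto simp: F_def)
   thus ?case by (simp add: b2 split_powr g_def)
  qed
  have exF: "(\<Sum>i\<in>F'. (b i)^2) = ?S F'" using F(4) by (intro sum.cong refl) (auto simp: b2 g_def F'_def)
  have g0: "0 <= g i" for i using \<theta> by (simp add: g_def)
  have "?S F + ?S F' = ?S (F \<union> F')" by (rule sum.union_disjoint[symmetric]) (use F in auto)
  also have "... = ?S {..<k}" unfolding F(6) by (intro sum.mono_neutral_left) (auto simp: c_def)
  also have "... <= ?S ({..<k0} \<union> {k0..<k})" by (intro sum_mono2 mult_nonneg_nonneg g0 c0) auto
  also have "... = (\<Sum>i<k0. g i * c i) + (\<Sum>i=k0..<k. g i * c i)" by (rule sum.union_disjoint) auto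
  also have "(\<Sum>i<k0. g i * c i) <= (\<Sum>i<k0. \<theta> * (\<sigma> i powr (2 * r - 1) * c i))"
  proof (rule sum_mono)
   show "g i * c i <= \<theta> * (\<sigma> i powr (2 * r - 1) * c i)" for i using mult_right_mono[OF g1 c0, of i i] by (cases "i \<in> I") (auto simp: c_def mult.assoc)
  qed
  also have "... = \<theta> * C" by (simp add: C_def sum_distrib_left)
  also have "(\<Sum>i=k0..<k. g i * c i) <= (\<Sum>i=k0..<k. \<theta> powr (2 * r) * c i)"
  proof (rule sum_mono)
   show "g i * c i <= \<theta> powr (2 * r) * c i" for i using mult_right_mono[OF g2 c0, of i i] by (cases "i \<in> I") (auto simp: c_def)
  qed
  also have "... = \<theta> powr (2 * r) * (\<Sum>i=k0..<k. c i)" by (simp add: sum_distrib_left)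
  also have "... <= \<theta> powr (2 * r) * (\<tau> / 6)" using k0[of k] by (intro mult_left_mono) auto
  finally have sum: "?S F + ?S F' <= \<theta> * C + \<theta> powr (2 * r) * (\<tau> / 6)" by simp
  have S0: "0 <= ?S F" by (intro sum_nonneg mult_nonneg_nonneg g0 c0)
  have lin: "x + s <= 2 * a + 2 * d" if "x <= 2 * a + 2 * s'" "s + s' <= d" "0 <= s" for x s s' a d :: real using that by linarith
  have "?x + \<theta> * (norm w)^2
   <= 2 * ?t + 2 * (\<theta> * C + \<theta> powr (2 * r) * (\<tau> / 6))"
   unfolding nwF by (rule lin[OF ex[unfolded exF] sum S0])
  also have "... <= \<tau> * \<theta> powr (2 * r)" using head by (simp add: field_simps)
  finally show ?thesis by blast
 qed
 ultimately show ?thesis by blast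
qed

end

section \<open>The second stage\<close>

lemma measurable_ident_subalgebra: "subalgebra M F ==> bdd_meas F W ==> bdd_meas M W"
 unfolding bdd_meas_def subalgebra_def by (auto intro: measurable_from_subalg simp: subalgebra_def)

text \<open>The conditional law of the draws is given through products of sets only. A finite
  partition on whose cells k is almost constant reduces the deviation of a Hilbert-valued mean to
  the frequencies of finitely many sets.\<close>

definition cell_partition :: "('x::topological_space => 'g::real_normed_vector) => real => nat => (nat => 'g) => (nat => 'x set) => bool" where
 "cell_partition k \<tau> p t A \<longleftrightarrow>
  (\<forall>q<p. A q \<in> sets borel \<and> t q \<in> range k \<and> (\<forall>s\<in>A q. norm (k s - t q) <= \<tau>)) \<and> (\<forall>s. \<exists>!q. q < p \<and> s \<in> A q)"

text \<open>The compact image of k has a finite net, and each point goes to the first ball that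
  contains its image; this makes the cells disjoint and Borel.\<close>

lemma ex_cell_partition:
 fixes k :: "'x::topological_space => 'g::real_normed_vector"
 assumes "compact (UNIV :: 'x set)" and k: "continuous_on UNIV k" and \<tau>: "\<tau> > 0"
 shows "\<exists>p t A. cell_partition k \<tau> p t A"
proof -
 have "compact (range k)" by (rule compact_continuous_image[OF k assms(1)])
 from seq_compact_imp_totally_bounded[OF this[THEN compact_imp_seq_compact], rule_format, OF \<tau>]
 obtain C where C: "finite C" "C \<subseteq> range k" "range k \<subseteq> (\<Union>c\<in>C. ball c \<tau>)" by blast
 obtain cs where cs: "set cs = C" using finite_list[OF C(1)] by blast
 define V where "V = (%q. k -` ball (cs ! q) \<tau>)"
 define A where "A = (%q. V q - (\<Union>j<q. V j))"
 have V: "V q \<in> sets borel" for q unfolding V_def using open_vimage[OF open_ball k] by (intro borel_open)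
 have "\<exists>!q. q < length cs \<and> s \<in> A q" for s
 proof -
  have "\<exists>q. q < length cs \<and> s \<in> V q" using C(3) unfolding V_def cs[symmetric] by (fastforce simp: in_set_conv_nth subset_iff)
  hence ex: "\<exists>q. s \<in> V q" and lt: "(LEAST q. s \<in> V q) < length cs" by (auto intro: le_less_trans[OF Least_le])
  have iff: "s \<in> A q \<longleftrightarrow> q = (LEAST q. s \<in> V q)" for q
  proof
   assume "s \<in> A q"
   hence "s \<in> V q" "!!y. s \<in> V y ==> q <= y" by (auto simp: A_def not_less[symmetric])
   thus "q = (LEAST q. s \<in> V q)" by (rule Least_equality[symmetric])
  next
   assume "q = (LEAST q. s \<in> V q)"
   hence q: "q = Least (%q. s \<in> V q)" .
   have "s \<in> V q" unfolding q by (rule LeastI_ex[OF ex])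
   moreover have "s \<notin> V j" if "j < q" for j using that unfolding q by (rule not_less_Least)
   ultimately show "s \<in> A q" by (auto simp: A_def)
  qed
  show ?thesis using lt by (auto simp: iff)
 qed
 moreover have "A q \<in> sets borel" for q unfolding A_def using V by (intro sets.Diff sets.finite_UN) auto
 moreover have "cs ! q \<in> range k" if "q < length cs" for q using C(2) cs that nth_mem by blast
 moreover have "norm (k s - cs ! q) <= \<tau>" if "s \<in> A q" for s q using that by (auto simp: A_def V_def dist_norm norm_minus_commute intro: less_imp_le)
 ultimately have "cell_partition k \<tau> (length cs) (%q. cs ! q) A" unfolding cell_partition_def by blast
 thus ?thesis by blast
qed

lemma cell_sum:
 assumes "cell_partition k \<tau> p t A"
 obtains q where "q < p" "s \<in> A q"
  "!!c. (\<Sum>q<p. indicator (A q) s *\<^sub>R c q) = (c q :: 'g::real_vector)" "(\<Sum>q<p. indicator (A q) s) = (1::real)"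
proof -
 obtain q where q: "q < p" "s \<in> A q" "!!q'. q' < p ==> s \<in> A q' ==> q' = q" using assms unfolding cell_partition_def by metis
 have i: "indicator (A q') s = (if q' = q then 1 else 0 :: real)" if "q' < p" for q'
  using q(2) q(3)[OF that] by (cases "q' = q") (auto simp: indicator_def)
 have "(\<Sum>q'<p. indicator (A q') s *\<^sub>R c q') = (\<Sum>q'<p. if q' = q then c q else 0)" for c :: "nat => 'g" using i by (intro sum.cong refl) auto
 moreover have "(\<Sum>q'<p. indicator (A q') s) = (\<Sum>q'<p. if q' = q then 1 else 0 :: real)" using i by (intro sum.cong refl) auto
 ultimately show ?thesis using q(1,2) by (intro that[of q]) simp_all
qed

section \<open>Draws that are independent given the first stage\<close>

locale conditional_sample = prob_space \<Omega>
 for \<Omega> :: "'w measure" +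
 fixes F :: "'w measure" and x :: "'w => 'x::topological_space measure" and s :: "nat => 'w => 'x" and N :: nat
 assumes sub: "subalgebra \<Omega> F"
  and law: "!!w. w \<in> space \<Omega> ==> x w \<in> borel_probs"
  and draw_measurable: "!!i. i \<in> {1..N} ==> s i \<in> \<Omega> \<rightarrow>\<^sub>M borel"
  and conditional: "!!A. (!!i. A i \<in> sets borel) ==>
   AE w in \<Omega>. real_cond_exp \<Omega> F (indicator {w \<in> space \<Omega>. \<forall>i\<in>{1..N}. s i w \<in> A i}) w = (\<Prod>i=1..N. measure (x w) (A i))"
  and N: "N >= 1"
begin

sublocale sub: finite_measure_subalgebra \<Omega> F using sub by unfold_locales

lemma bm_F: "bdd_meas F W ==> bdd_meas \<Omega> W"
 by (rule measurable_ident_subalgebra[OF sub])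

abbreviation hit :: "nat => 'x set => 'w => real" where
 "hit i A w \<equiv> indicator A (s i w)"

lemma bm_hit: "i \<in> {1..N} ==> A \<in> sets borel ==> bdd_meas \<Omega> (hit i A)"
 by (rule bmI[where c = 1]) (auto intro: measurable_compose[OF draw_measurable] simp: indicator_def)

text \<open>A version of the conditional law of a draw that is measurable for each Borel set.\<close>

definition cprob :: "'x set => 'w => real" where
 "cprob A w = max 0 (min 1 (real_cond_exp \<Omega> F (indicator {w \<in> space \<Omega>. s 1 w \<in> A}) w))"

lemma bm_cprob: "bdd_meas F (cprob A)"
 unfolding cprob_def[abs_def] by (rule bmI[where c = 1]) auto

lemma cprob_le: "0 <= cprob A w" "cprob A w <= 1"
 by (auto simp: cprob_def)

text \<open>Draws outside I are left free: UNIV takes their place and has mass 1 under every x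
  w.\<close>

lemma cond_product:
 assumes I: "I \<subseteq> {1..N}" and A: "!!i. i \<in> I ==> A i \<in> sets borel"
 shows "AE w in \<Omega>. real_cond_exp \<Omega> F (%w. \<Prod>i\<in>I. hit i (A i) w) w = (\<Prod>i\<in>I. measure (x w) (A i))"
proof -
 define A' where "A' = (%i. if i \<in> I then A i else UNIV)"
 have fin: "finite I" using I finite_subset by blast
 have "AE w in \<Omega>. real_cond_exp \<Omega> F (indicator {w \<in> space \<Omega>. \<forall>i\<in>{1..N}. s i w \<in> A' i}) w = (\<Prod>i=1..N. measure (x w) (A' i))"
  by (rule conditional) (auto simp: A'_def A)
 moreover have "AE w in \<Omega>. real_cond_exp \<Omega> F (%w. \<Prod>i\<in>I. hit i (A i) w) w
   = real_cond_exp \<Omega> F (indicator {w \<in> space \<Omega>. \<forall>i\<in>{1..N}. s i w \<in> A' i}) w"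
 proof (rule sub.real_cond_exp_cong, goal_cases)
  show meas: "(%w. \<Prod>i\<in>I. hit i (A i) w) \<in> borel_measurable \<Omega>" using I A by (intro borel_measurable_prod bm_measurable[OF bm_hit]) auto
  have eq: "(\<Prod>i\<in>I. hit i (A i) w) = indicator {w \<in> space \<Omega>. \<forall>i\<in>{1..N}. s i w \<in> A' i} w" if "w \<in> space \<Omega>" for w
  proof (cases "\<forall>i\<in>I. s i w \<in> A i")
   case True
   thus ?thesis using that by (auto simp: A'_def)
  next
   case False
   hence "(\<Prod>i\<in>I. hit i (A i) w) = 0" using fin by (intro prod_zero) (auto simp: indicator_def)
   moreover obtain i where "i \<in> I" "s i w \<notin> A i" using False by blast
   hence "w \<notin> {w \<in> space \<Omega>. \<forall>i\<in>{1..N}. s i w \<in> A' i}" using I by (auto simp: A'_def)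
   ultimately show ?thesis by simp
  qed
  thus "AE w in \<Omega>. (\<Prod>i\<in>I. hit i (A i) w) = indicator {w \<in> space \<Omega>. \<forall>i\<in>{1..N}. s i w \<in> A' i} w" by auto
  case 3 let ?i = "indicator {w \<in> space \<Omega>. \<forall>i\<in>{1..N}. s i w \<in> A' i} :: 'w => real"
  show ?case
  proof -
   have "?i \<in> borel_measurable \<Omega> \<longleftrightarrow> (%w. \<Prod>i\<in>I. hit i (A i) w) \<in> borel_measurable \<Omega>" by (rule measurable_cong) (rule eq[symmetric])
   thus ?thesis using meas by simp
  qed
 qed
 moreover have "AE w in \<Omega>. w \<in> space \<Omega>" by (rule AE_space)
 ultimately show ?thesis
 proof eventually_elim
  case (elim w)
  have "measure (x w) UNIV = 1"
   using law[OF elim(3)] prob_space.prob_space[of "x w"] sets_eq_imp_space_eq[of "x w" borel] by (auto simp: borel_probs_def)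
  hence "(\<Prod>i=1..N. measure (x w) (A' i)) = (\<Prod>i\<in>I. measure (x w) (A i))" using I by (intro prod.mono_neutral_cong_right) (auto simp: A'_def)
  thus ?case using elim by simp
 qed
qed

lemma cprob_AE:
 assumes "A \<in> sets borel"
 shows "AE w in \<Omega>. cprob A w = measure (x w) A"
proof -
 have "AE w in \<Omega>. real_cond_exp \<Omega> F (%w. hit 1 A w) w = measure (x w) A" using cond_product[of "{1}" "%_. A"] N assms by simp
 moreover have "AE w in \<Omega>. real_cond_exp \<Omega> F (%w. hit 1 A w) w = real_cond_exp \<Omega> F (indicator {w \<in> space \<Omega>. s 1 w \<in> A}) w"
 proof (rule sub.real_cond_exp_cong)
  show m: "(%w. hit 1 A w) \<in> borel_measurable \<Omega>" using bm_measurable[OF bm_hit[OF _ assms]] N by auto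
  let ?i = "indicator {w \<in> space \<Omega>. s 1 w \<in> A} :: 'w => real"
  show "?i \<in> borel_measurable \<Omega>"
  proof -
   have "?i \<in> borel_measurable \<Omega> \<longleftrightarrow> (%w. hit 1 A w) \<in> borel_measurable \<Omega>" by (rule measurable_cong) (simp add: indicator_def)
   thus ?thesis using m by simp
  qed
 qed (auto simp: indicator_def)
 moreover have "AE w in \<Omega>. w \<in> space \<Omega>" by (rule AE_space)
 ultimately show ?thesis
 proof eventually_elim
  case (elim w)
  have "measure (x w) A <= 1" using law[OF elim(3)] by (auto simp: borel_probs_def intro: prob_space.prob_le_1)
  thus ?case using elim measure_nonneg[of "x w" A] by (simp add: cprob_def)
 qed
qed

lemma cond_integral:
 assumes I: "I \<subseteq> {1..N}" and A: "!!i. i \<in> I ==> A i \<in> sets borel" and W: "bdd_meas F W"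
 shows "(LINT w|\<Omega>. W w * (\<Prod>i\<in>I. hit i (A i) w)) = (LINT w|\<Omega>. W w * (\<Prod>i\<in>I. cprob (A i) w))" (is "?L = ?R")
proof -
 have fin: "finite I" using I finite_subset by blast
 have bmp: "bdd_meas N' (%w. \<Prod>i\<in>I. f i w)" if "!!i. i \<in> I ==> bdd_meas N' (f i)" for f :: "nat => 'w => real" and N'
  using fin that by (induction I) (auto intro: bm_const bm_mult)
 have bh: "bdd_meas \<Omega> (%w. \<Prod>i\<in>I. hit i (A i) w)" using I A by (intro bmp bm_hit) auto
 have "?L
  = (LINT w|\<Omega>. W w * real_cond_exp \<Omega> F (%w. \<Prod>i\<in>I. hit i (A i) w) w)"
  by (intro sub.real_cond_exp_intg(2)[symmetric] bm_integrable bm_mult bm_F[OF W] bh bm_measurable[OF W] bm_measurable[OF bh])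
 also have "... = ?R"
 proof (rule integral_cong_AE, goal_cases)
  case 1 show ?case using bm_measurable[OF bm_F[OF W]] by auto
  case 2 show ?case by (intro bm_measurable bm_mult bm_F[OF W] bmp bm_F[OF bm_cprob])
  case 3 have "AE w in \<Omega>. \<forall>i\<in>I. cprob (A i) w = measure (x w) (A i)" using fin A cprob_AE by (intro AE_finite_allI) auto
  moreover have "AE w in \<Omega>. real_cond_exp \<Omega> F (%w. \<Prod>i\<in>I. hit i (A i) w) w = (\<Prod>i\<in>I. measure (x w) (A i))" by (rule cond_product[OF I A])
  ultimately show ?case by eventually_elim simp
 qed
 finally show ?thesis .
qed

lemma cross_zero:
 assumes i: "i \<in> {1..N}" "j \<in> {1..N}" "i \<noteq> j" and A: "A \<in> sets borel" "A' \<in> sets borel" and W: "bdd_meas F W"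
 shows "(LINT w|\<Omega>. W w * ((hit i A w - cprob A w) * (hit j A' w - cprob A' w))) = 0" (is "?L = _")
proof -
 note bm = bm_hit[OF i(1) A(1)] bm_hit[OF i(2) A(2)] bm_F[OF bm_cprob] bm_F[OF W]
 have 1: "(LINT w|\<Omega>. W w * (hit i A w * hit j A' w)) = (LINT w|\<Omega>. W w * (cprob A w * cprob A' w))"
  using cond_integral[of "{i, j}" "%l. if l = i then A else A'", OF _ _ W] i A by simp
 have 2: "(LINT w|\<Omega>. W w * cprob A' w * hit i A w) = (LINT w|\<Omega>. W w * cprob A' w * cprob A w)"
  using cond_integral[of "{i}" "%l. A", OF _ _ bm_mult[OF W bm_cprob]] i A by simp
 have 3: "(LINT w|\<Omega>. W w * cprob A w * hit j A' w) = (LINT w|\<Omega>. W w * cprob A w * cprob A' w)"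
  using cond_integral[of "{j}" "%l. A'", OF _ _ bm_mult[OF W bm_cprob]] i A by simp
 have "?L
  = (LINT w|\<Omega>. W w * (hit i A w * hit j A' w) - W w * cprob A' w * hit i A w
   - W w * cprob A w * hit j A' w + W w * (cprob A w * cprob A' w))"
  by (intro bochner_cong refl) (simp add: algebra_simps)
 also have "... = (LINT w|\<Omega>. W w * (hit i A w * hit j A' w)) - (LINT w|\<Omega>. W w * cprob A' w * hit i A w)
   - (LINT w|\<Omega>. W w * cprob A w * hit j A' w) + (LINT w|\<Omega>. W w * (cprob A w * cprob A' w))"
  by (subst Bochner_Integration.integral_add Bochner_Integration.integral_diff, (intro bm_integrable bm_add bm_diff bm_mult bm)+)+ simp
 also have "... = 0" unfolding 1 2 3 by (simp add: mult_ac)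
 finally show ?thesis .
qed

text \<open>The exponential of a sum of indicators expands over subsets of the draws into products
  of indicators, for which the conditional law is known. After conditioning the sum collapses to a
  binomial moment generating function, and exp z - 1 - z \<le> z^2 for |z| \<le> 1.\<close>

lemma exp_moment:
 assumes A: "A \<in> sets borel" and z: "\<bar>z\<bar> <= 1"
 shows "(LINT w|\<Omega>. exp (z * ((\<Sum>i=1..N. hit i A w) - real N * cprob A w))) <= exp (real N * z^2)" (is "?L <= ?R")
proof -
 define c where "c = exp z - 1"
 define W where "W = (%w. exp (- (z * (real N * cprob A w))))"
 have "(%w. W w) \<in> borel_measurable F" unfolding W_def using bm_measurable[OF bm_cprob[of A]] by auto
 hence W: "bdd_meas F W"
 proof (rule bmI)
  fix w
  have "- (z * (real N * cprob A w)) <= \<bar>z\<bar> * (real N * cprob A w)"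
   using cprob_le[of A w] by (metis abs_ge_minus_self abs_mult abs_of_nonneg mult_nonneg_nonneg of_nat_0_le_iff)
  also have "... <= 1 * (real N * 1)" using z cprob_le[of A w] by (intro mult_mono) auto
  finally show "\<bar>W w\<bar> <= exp (real N)" by (simp add: W_def)
 qed
 have exp_hit: "exp (z * (\<Sum>i=1..N. hit i A w)) = (\<Sum>I\<in>Pow {1..N}. c ^ card I * (\<Prod>i\<in>I. hit i A w))" (is "?l = ?r") for w
 proof -
  have "?l = (\<Prod>i=1..N. exp (z * hit i A w))" unfolding sum_distrib_left by (rule exp_sum) simp
  also have "... = (\<Prod>i=1..N. c * hit i A w + 1)" by (intro prod.cong refl) (simp add: c_def indicator_def)
  also have "... = ?r" by (subst prod_add) (auto simp: prod.distrib)
  finally show ?thesis .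
 qed
 have bmp: "bdd_meas N' (%w. \<Prod>i\<in>I. f i w)" if "finite I" "!!i. i \<in> I ==> bdd_meas N' (f i)" for f :: "nat => 'w => real" and N' and I
  using that by (induction I) (auto intro: bm_const bm_mult)
 have "exp (z * ((\<Sum>i=1..N. hit i A w) - real N * cprob A w)) = (\<Sum>I\<in>Pow {1..N}. c ^ card I * (W w * (\<Prod>i\<in>I. hit i A w)))" for w
 proof -
  have gen: "exp (z * (S - q)) = exp (z * S) * exp (- (z * q))" for S q :: real by (simp add: exp_add[symmetric] right_diff_distrib)
  show ?thesis unfolding gen exp_hit W_def sum_distrib_right by (simp only: mult_ac)
 qed
 hence "?L
  = (LINT w|\<Omega>. (\<Sum>I\<in>Pow {1..N}. c ^ card I * (W w * (\<Prod>i\<in>I. hit i A w))))" by (simp only:)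
 also have "... = (\<Sum>I\<in>Pow {1..N}. c ^ card I * (LINT w|\<Omega>. W w * (\<Prod>i\<in>I. hit i A w)))" unfolding integral_mult_right_zero[symmetric]
  by (intro bochner_sum bm_integrable bm_mult[OF bm_const] bm_mult[OF bm_F[OF W]] bmp bm_hit A) (auto intro: finite_subset)
 also have "... = (\<Sum>I\<in>Pow {1..N}. c ^ card I * (LINT w|\<Omega>. W w * (\<Prod>i\<in>I. cprob A w)))"
  by (intro sum.cong refl arg_cong[where f = "%x. _ * x"] cond_integral[OF _ A W]) auto
 also have "... = (LINT w|\<Omega>. (\<Sum>I\<in>Pow {1..N}. c ^ card I * (W w * (\<Prod>i\<in>I. cprob A w))))" unfolding integral_mult_right_zero[symmetric]
  by (intro bochner_sum[symmetric] bm_integrable bm_mult[OF bm_const] bm_mult[OF bm_F[OF W]] bmp bm_F[OF bm_cprob]) (auto intro: finite_subset)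
 also have "... <= (LINT w|\<Omega>. exp (real N * z^2))"
 proof (intro integral_mono bm_integrable bm_sum bm_mult bm_const bm_F[OF W] bmp bm_F[OF bm_cprob])
  fix w
  define p where "p = cprob A w"
  have p: "0 <= p" "p <= 1" using cprob_le by (auto simp: p_def)
  have "(\<Sum>I\<in>Pow {1..N}. c ^ card I * (\<Prod>i\<in>I. p)) = (\<Prod>i=1..N. c * p + 1)" by (subst prod_add) (auto simp: prod.distrib power_mult_distrib)
  hence "(\<Sum>I\<in>Pow {1..N}. c ^ card I * (W w * (\<Prod>i\<in>I. p))) = W w * (c * p + 1) ^ N"
   by (simp add: sum_distrib_left[symmetric] mult.left_commute[of _ "W w"])
  also have "... <= W w * exp (c * p) ^ N"
  proof (intro mult_left_mono power_mono)
   show "0 <= c * p + 1"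
   proof -
    have "- 1 <= c" by (simp add: c_def)
    hence "-1 * p <= c * p" using p by (intro mult_right_mono) auto
    thus ?thesis using p by linarith
   qed
   show "c * p + 1 <= exp (c * p)" using exp_ge_add_one_self[of "c * p"] by linarith
  qed (simp add: W_def)
  also have "... = exp (real N * ((c - z) * p))" by (simp add: W_def p_def[symmetric] exp_of_nat_mult[symmetric] exp_add[symmetric] algebra_simps)
  also have "... <= ?R"
  proof -
   have "exp z <= 1 + z + z^2"
   proof (cases "z >= 0")
    case True
    thus ?thesis using exp_bound[of z] z by simp
   next
    case False
    have "exp (- z) >= 1 + (- z) + (- z)^2 / 2" using exp_lower_Taylor_quadratic[of "- z"] False by simp
    hence "exp z * (1 - z + z^2 / 2) <= exp z * exp (- z)" by (intro mult_left_mono) auto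
    hence e: "exp z * (1 - z + z^2 / 2) <= 1" by (simp add: exp_minus)
    have "1 <= (1 + z + z^2) * (1 - z + z^2 / 2)" (is "_ <= ?R1")
    proof -
     have "?R1 = 1 + z^2 * ((1 - z + z^2) / 2)" by (simp add: power2_eq_square field_simps)
     moreover have "0 <= z^2 * ((1 - z + z^2) / 2)" using False by (intro mult_nonneg_nonneg) (auto intro: add_nonneg_nonneg)
     ultimately show ?thesis by simp
    qed
    moreover have "0 < 1 - z + z^2 / 2" using False by (intro add_pos_nonneg) auto
    ultimately show ?thesis using e by (meson mult_right_le_imp_le order_trans)
   qed
   hence "c - z <= z^2" by (simp add: c_def)
   moreover have "0 <= c - z" using exp_ge_add_one_self[of z] unfolding c_def by linarith
   ultimately have "(c - z) * p <= z^2 * 1" using p by (intro mult_mono) auto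
   thus ?thesis by (simp add: mult_left_mono)
  qed
  finally show "(\<Sum>I\<in>Pow {1..N}. c ^ card I * (W w * (\<Prod>i\<in>I. cprob A w))) <= ?R" unfolding p_def .
 qed (auto intro: finite_subset)
 finally show ?thesis by (simp add: prob_space)
qed

end

lemma bm_exp: "bdd_meas M f ==> bdd_meas M (%x. exp (f x))"
 for f :: "'w => real"
proof -
 assume f: "bdd_meas M f"
 then obtain c where "\<forall>x\<in>space M. \<bar>f x\<bar> <= c" using bm_bound by blast
 thus ?thesis using bm_measurable[OF f] by (intro bmI[where c = "exp c"]) (auto simp: abs_le_iff)
qed

section \<open>Deviation of the empirical embedding from the mean embedding\<close>

locale conditional_embedding = conditional_sample \<Omega> F x s N
 for \<Omega> F :: "'w measure" and x :: "'w => 'x::topological_space measure" and s N +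
 fixes k :: "'x => 'g::{real_inner,banach,second_countable_topology}" and B :: real
 assumes compact: "compact (UNIV :: 'x set)" and k: "continuous_on UNIV k" "!!s. norm (k s) <= B"
  and mean_measurable: "(%w. LINT s|(x w). k s) \<in> borel_measurable \<Omega>"
begin

definition dev :: "'w => 'g" where
 "dev w = (1 / real N) *\<^sub>R (\<Sum>i=1..N. k (s i w)) - (LINT s|(x w). k s)"

lemma B_nonneg: "0 <= B"
 using order_trans[OF norm_ge_zero k(2)] .

lemma k_borel: "k \<in> borel_measurable borel"
 by (rule borel_measurable_continuous_onI[OF k(1)])

lemma
 assumes "w \<in> space \<Omega>"
 shows law_prob: "prob_space (x w)" and law_sets: "sets (x w) = sets borel"
  and integrable_k: "integrable (x w) k"
proof -
 show p: "prob_space (x w)" and s: "sets (x w) = sets borel" using law[OF assms] by (auto simp: borel_probs_def)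
 interpret X: prob_space "x w" by (rule p)
 have "k \<in> borel_measurable (x w)" using k_borel by (simp add: measurable_cong_sets[OF s refl])
 thus "integrable (x w) k" using k(2) by (intro X.integrable_const_bound[where B = B]) auto
qed

lemma norm_mean_le: "w \<in> space \<Omega> ==> norm (LINT s|(x w). k s) <= B"
proof -
 assume w: "w \<in> space \<Omega>"
 interpret X: prob_space "x w" by (rule law_prob[OF w])
 have "norm (LINT s|(x w). k s) <= (LINT s|(x w). norm (k s))" by (rule integral_norm_bound)
 also have "... <= B" using integrable_k[OF w] k(2) by (intro X.integral_le_const) auto
 finally show ?thesis .
qed

lemma norm_average_le:
 fixes a :: "nat => 'h::real_normed_vector"
 assumes "!!i. i \<in> {1..N} ==> norm (a i) <= c"
 shows "norm ((1 / real N) *\<^sub>R (\<Sum>i=1..N. a i)) <= c"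
proof -
 have "norm (\<Sum>i=1..N. a i) <= real (card {1..N}) * c" by (rule sum_norm_bound[OF assms])
 thus ?thesis using N by (simp add: divide_le_eq mult.commute)
qed

lemma norm_dev_le: "w \<in> space \<Omega> ==> norm (dev w) <= 2 * B"
 unfolding dev_def using norm_average_le[of "%i. k (s i w)" B, OF k(2)] norm_mean_le[of w] by (intro order_trans[OF norm_triangle_ineq4]) auto

lemma bm_norm_dev: "bdd_meas \<Omega> (%w. norm (dev w))"
proof (rule bmI, goal_cases)
 case 1 have "(%w. k (s i w)) \<in> borel_measurable \<Omega>" if "i \<in> {1..N}" for i by (rule measurable_compose[OF draw_measurable[OF that] k_borel])
 hence "(%w. (1 / real N) *\<^sub>R (\<Sum>i=1..N. k (s i w))) \<in> borel_measurable \<Omega>" by (intro borel_measurable_scaleR borel_measurable_sum) auto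
 from borel_measurable_diff[OF this mean_measurable]
 show ?case unfolding dev_def by measurable
qed (use norm_dev_le in auto)

context
 fixes \<tau> p t A
 assumes cells: "cell_partition k \<tau> p t A"
begin

lemma A_borel: "q < p ==> A q \<in> sets borel"
 using cells by (simp add: cell_partition_def)

lemma norm_t: "q < p ==> norm (t q) <= B"
 using cells k(2) unfolding cell_partition_def by (metis rangeE)

lemma step_close: "norm (k y - (\<Sum>q<p. indicator (A q) y *\<^sub>R t q)) <= \<tau>"
proof -
 obtain q where "q < p" "y \<in> A q" "(\<Sum>q<p. indicator (A q) y *\<^sub>R t q) = t q" using cell_sum[OF cells, of y] by metis
 thus ?thesis using cells by (simp add: cell_partition_def)
qed

lemma dev_cells:
 assumes w: "w \<in> space \<Omega>"
 shows "norm (dev w) <= 2 * \<tau> + norm (\<Sum>q<p. ((1 / real N) * (\<Sum>i=1..N. hit i (A q) w) - measure (x w) (A q)) *\<^sub>R t q)"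
proof -
 let ?X = "\<Sum>q<p. measure (x w) (A q) *\<^sub>R t q"
 let ?U = "\<Sum>q<p. ((1 / real N) * (\<Sum>i=1..N. hit i (A q) w) - measure (x w) (A q)) *\<^sub>R t q"
 interpret X: prob_space "x w" by (rule law_prob[OF w])
 let ?g = "%y. \<Sum>q<p. indicator (A q) y *\<^sub>R t q"
 have A: "A q \<in> sets (x w)" if "q < p" for q using A_borel[OF that] law_sets[OF w] by simp
 have ig: "integrable (x w) (%y. indicator (A q) y *\<^sub>R t q)" if "q < p" for q
  by (rule integrable_indicator[OF A[OF that]]) (simp add: X.emeasure_eq_measure)
 have "(LINT y|(x w). ?g y) = (\<Sum>q<p. (LINT y|(x w). indicator (A q) y *\<^sub>R t q))" using ig by (intro bochner_sum) auto
 also have "... = ?X" using A by (intro sum.cong refl) (simp add: X.emeasure_eq_measure)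
 finally have int_g: "(LINT y|(x w). ?g y) = ?X" .
 have "integrable (x w) ?g" using ig by (intro Bochner_Integration.integrable_sum) auto
 hence d: "integrable (x w) (%y. k y - ?g y)" "(LINT y|(x w). k y) - (LINT y|(x w). ?g y) = (LINT y|(x w). k y - ?g y)"
  using integrable_k[OF w] by auto
 have "norm (LINT y|(x w). k y - ?g y) <= (LINT y|(x w). norm (k y - ?g y))" by (rule integral_norm_bound)
 also have "... <= \<tau>" using d(1) step_close by (intro X.integral_le_const) auto
 finally have 1: "norm ((LINT y|(x w). k y) - ?X) <= \<tau>" using d(2) int_g by simp
 have 2: "norm ((1 / real N) *\<^sub>R (\<Sum>i=1..N. k (s i w) - ?g (s i w))) <= \<tau>" by (rule norm_average_le) (rule step_close)
 have "(\<Sum>q<p. ((1 / real N) * (\<Sum>i=1..N. hit i (A q) w)) *\<^sub>R t q) = (1 / real N) *\<^sub>R (\<Sum>i=1..N. ?g (s i w))"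
  unfolding scaleR_scaleR[symmetric] scaleR_sum_right[symmetric] scaleR_sum_left by (subst sum.swap) (rule refl)
 hence "dev w = (1 / real N) *\<^sub>R (\<Sum>i=1..N. k (s i w) - ?g (s i w))
  + ?U
  - ((LINT y|(x w). k y) - ?X)"
  unfolding dev_def scaleR_diff_left sum_subtractf scaleR_diff_right by simp
 also have "norm \<dots> <= \<tau> + norm ?U + \<tau>" by (intro order_trans[OF norm_triangle_ineq4] add_mono 1 order_trans[OF norm_triangle_ineq] 2 order_refl)
 finally show ?thesis by simp
qed

text \<open>Given the first stage, the \<open>\<xi>\<^sub>i\<close> are centred and pairwise uncorrelated.\<close>

lemma dev_square_cells:
 assumes W: "bdd_meas F W" "!!w. w \<in> space \<Omega> ==> 0 <= W w"
 shows "(LINT w|\<Omega>. W w * (norm (dev w))^2) <= (8 * \<tau>^2 + 8 * B^2 / real N) * (LINT w|\<Omega>. W w)" (is "?L <= ?R")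
proof -
 let ?d = "%i q w. hit i (A q) w - cprob (A q) w"
 define \<xi> where "\<xi> = (%i w. \<Sum>q<p. ?d i q w *\<^sub>R t q)"
 have inner_\<xi>: "\<xi> i w \<bullet> \<xi> j w = (\<Sum>q<p. \<Sum>q'<p. (t q \<bullet> t q') * (?d i q w * ?d j q' w))" for i j w
  unfolding \<xi>_def inner_sum_left by (simp only: inner_sum_right inner_scaleR_left inner_scaleR_right mult_ac)
 let ?w = "%i j w. W w * (\<xi> i w \<bullet> \<xi> j w)" and ?I = "(LINT w|\<Omega>. W w)"
 have bmd: "bdd_meas \<Omega> (?d i q)" if "i \<in> {1..N}" "q < p" for i q using that by (intro bm_diff bm_hit bm_F[OF bm_cprob] A_borel)
 have bm\<xi>: "bdd_meas \<Omega> (%w. \<xi> i w \<bullet> \<xi> j w)" if "i \<in> {1..N}" "j \<in> {1..N}" for i j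
  unfolding inner_\<xi> using that by (intro bm_sum bm_mult bm_const bmd) auto
 note bW = bm_F[OF W(1)]
 have cross: "(LINT w|\<Omega>. ?w i j w) = 0" (is "?l = _") if ij: "i \<in> {1..N}" "j \<in> {1..N}" "i \<noteq> j" for i j
 proof -
  have bmt: "bdd_meas \<Omega> (%w. (t q \<bullet> t q') * (W w * (?d i q w * ?d j q' w)))" if "q < p" "q' < p" for q q'
   using ij that by (intro bm_mult bm_const bW bmd)
  have "?l = (LINT w|\<Omega>. (\<Sum>q<p. \<Sum>q'<p. (t q \<bullet> t q') * (W w * (?d i q w * ?d j q' w))))"
   unfolding inner_\<xi> sum_distrib_left by (simp only: mult.left_commute)
  also have "... = (\<Sum>q<p. (LINT w|\<Omega>. (\<Sum>q'<p. (t q \<bullet> t q') * (W w * (?d i q w * ?d j q' w)))))" by (intro bochner_sum bm_integrable bm_sum bmt) auto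
  also have "... = (\<Sum>q<p. \<Sum>q'<p. (LINT w|\<Omega>. (t q \<bullet> t q') * (W w * (?d i q w * ?d j q' w))))"
   by (intro sum.cong refl bochner_sum bm_integrable bmt) auto
  also have "... = 0" unfolding integral_mult_right_zero using cross_zero[OF ij A_borel A_borel W(1)] by (intro sum.neutral ballI) simp
  finally show ?thesis .
 qed
 have eqAE: "AE w in \<Omega>. \<forall>q\<in>{..<p}. cprob (A q) w = measure (x w) (A q)" using cprob_AE A_borel by (intro AE_finite_allI) auto
 have \<xi>_le: "AE w in \<Omega>. (norm (\<xi> i w))^2 <= 4 * B^2" for i using eqAE AE_space
 proof eventually_elim
  case (elim w)
  interpret X: prob_space "x w" by (rule law_prob[OF elim(2)])
  have "norm (\<Sum>q<p. hit i (A q) w *\<^sub>R t q) <= B" using cell_sum[OF cells, of "s i w"] norm_t by metis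
  moreover have "norm (\<Sum>q<p. measure (x w) (A q) *\<^sub>R t q) <= (\<Sum>q<p. measure (x w) (A q) * B)"
   using norm_t by (intro order_trans[OF norm_sum] sum_mono) (auto intro: mult_left_mono)
  moreover have "(\<Sum>q<p. measure (x w) (A q)) <= 1" (is "?r <= _")
  proof -
   have disj: "disjoint_family_on A {..<p}" using cells unfolding cell_partition_def disjoint_family_on_def by blast
   have "?r = measure (x w) (\<Union>q\<in>{..<p}. A q)" using A_borel law_sets[OF elim(2)] disj by (intro X.finite_measure_finite_Union[symmetric]) auto
   thus ?thesis by simp
  qed
  hence "(\<Sum>q<p. measure (x w) (A q) * B) <= 1 * B" unfolding sum_distrib_right[symmetric] using B_nonneg by (intro mult_right_mono)
  ultimately have "norm (\<xi> i w) <= 2 * B" using norm_triangle_ineq4[of "\<Sum>q<p. hit i (A q) w *\<^sub>R t q" "\<Sum>q<p. measure (x w) (A q) *\<^sub>R t q"] elim(1)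
   by (simp add: \<xi>_def scaleR_diff_left sum_subtractf)
  hence "(norm (\<xi> i w))^2 <= (2 * B)^2" by (intro power_mono) auto
  thus ?case by (simp add: power2_eq_square)
 qed
 define \<Xi> where "\<Xi> = (%w. \<Sum>i=1..N. \<xi> i w)"
 have bm\<Xi>: "bdd_meas \<Omega> (%w. (norm (\<Xi> w))^2)" unfolding \<Xi>_def norm_sum_square by (intro bm_sum bm\<xi>)
 have "(LINT w|\<Omega>. W w * (norm (\<Xi> w))^2) = (LINT w|\<Omega>. (\<Sum>i=1..N. \<Sum>j=1..N. ?w i j w))" unfolding \<Xi>_def norm_sum_square sum_distrib_left ..
 also have "... = (\<Sum>i=1..N. (LINT w|\<Omega>. (\<Sum>j=1..N. ?w i j w)))" by (intro bochner_sum bm_integrable bm_sum bm_mult bW bm\<xi>)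
 also have "... = (\<Sum>i=1..N. \<Sum>j=1..N. (LINT w|\<Omega>. ?w i j w))" by (intro sum.cong refl bochner_sum bm_integrable bm_mult bW bm\<xi>)
 also have "... = (\<Sum>i=1..N. \<Sum>j=1..N. if i = j then (LINT w|\<Omega>. ?w i i w) else 0)" by (intro sum.cong refl) (auto simp: cross)
 also have "... = (\<Sum>i=1..N. (LINT w|\<Omega>. ?w i i w))" by simp
 also have "... <= (\<Sum>i=1..N. (LINT w|\<Omega>. W w * (4 * B^2)))"
 proof (intro sum_mono integral_mono_AE bm_integrable bm_mult bW bm_const bm\<xi>)
  fix i
  show "AE w in \<Omega>. W w * (\<xi> i w \<bullet> \<xi> i w) <= W w * (4 * B^2)"
   using \<xi>_le[of i] AE_space by eventually_elim (use W(2) in \<open>auto simp: power2_norm_eq_inner intro!: mult_left_mono\<close>)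
 qed auto
 also have "... = real N * (4 * B^2 * ?I)" by simp
 finally have sq: "(LINT w|\<Omega>. W w * (norm (\<Xi> w))^2) <= real N * (4 * B^2 * ?I)" .
 have "?L <= (LINT w|\<Omega>. 8 * \<tau>^2 * W w + 2 / (real N)^2 * (W w * (norm (\<Xi> w))^2))"
 proof (intro integral_mono_AE bm_integrable bm_add bm_mult bm_const bW bm\<Xi> bm_power bm_norm_dev, goal_cases)
  case 1 show ?case using eqAE AE_space
  proof eventually_elim
   case (elim w)
   have "(\<Sum>q<p. ((1 / real N) * (\<Sum>i=1..N. hit i (A q) w) - measure (x w) (A q)) *\<^sub>R t q) = (1 / real N) *\<^sub>R \<Xi> w" (is "?L1 = ?R1")
   proof -
    have "?R1 = (\<Sum>q<p. (1 / real N) *\<^sub>R ((\<Sum>i=1..N. ?d i q w) *\<^sub>R t q))" unfolding \<Xi>_def \<xi>_def scaleR_sum_left scaleR_sum_right by (rule sum.swap)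
    also have "... = ?L1" using elim(1) N by (intro sum.cong refl) (auto simp: sum_subtractf diff_divide_distrib)
    finally show ?thesis ..
   qed
   hence "norm (dev w) <= 2 * \<tau> + norm ((1 / real N) *\<^sub>R \<Xi> w)" using dev_cells[OF elim(2)] by simp
   hence "(norm (dev w))^2 <= (2 * \<tau> + norm (\<Xi> w) / real N)^2" by (intro power_mono) auto
   also have "... <= 2 * (2 * \<tau>)^2 + 2 * (norm (\<Xi> w) / real N)^2" by (rule square_add_le)
   finally have "W w * (norm (dev w))^2 <= W w * (2 * (2 * \<tau>)^2 + 2 * (norm (\<Xi> w) / real N)^2)" by (rule mult_left_mono) (rule W(2)[OF elim(2)])
   thus ?case by (simp add: power_divide power_mult_distrib algebra_simps)
  qed
 qed
 also have "... = 8 * \<tau>^2 * ?I + 2 / (real N)^2 * (LINT w|\<Omega>. W w * (norm (\<Xi> w))^2)"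
  using bm_integrable[OF bW] bm_integrable[OF bm_mult[OF bW bm\<Xi>]] by simp
 also have "... <= 8 * \<tau>^2 * ?I + 2 / (real N)^2 * (real N * (4 * B^2 * ?I))" by (intro add_left_mono mult_left_mono sq) auto
 also have "... = ?R" using N by (simp add: power2_eq_square field_simps)
 finally show ?thesis .
qed

text \<open>Chernoff's bound at z = \<beta>/2 and z = -\<beta>/2 for each cell, where \<beta> \<le>
  2 ensures |z| \<le> 1, and a union bound over p cells and two signs. Each draw contributes
  \<beta>^2/2 - \<beta>^2/4 to the exponent.\<close>

lemma dev_tail_cells:
 assumes \<beta>: "0 < \<beta>" "\<beta> <= 2" and \<epsilon>: "2 * \<tau> + real p * (\<beta> * B) <= \<epsilon>"
 shows "prob {w \<in> space \<Omega>. norm (dev w) > \<epsilon>} <= 2 * real p * exp (- (real N * \<beta>^2 / 4))" (is "?L <= _")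
proof -
 let ?X = "%q w. (1 / real N) * (\<Sum>i=1..N. hit i (A q) w) - measure (x w) (A q)"
 let ?A = "real N * \<beta>^2 / 2"
 let ?E = "exp (- (real N * \<beta>^2 / 4))"
 let ?S = "%q w. (\<Sum>i=1..N. hit i (A q) w) - real N * cprob (A q) w"
 have bmS: "bdd_meas \<Omega> (?S q)" if "q < p" for q using that by (intro bm_diff bm_sum bm_hit bm_mult bm_const bm_F[OF bm_cprob] A_borel)
 let ?U = "%z q. {w \<in> space \<Omega>. exp (?A) <= exp (z * ?S q w)}"
 have U: "?U z q \<in> events" if "q < p" for z q using bm_measurable[OF bm_exp[OF bm_mult[OF bm_const bmS[OF that]]]] by measurable
 have U_le: "prob (?U z q) <= ?E" if q: "q < p" and z: "\<bar>z\<bar> = \<beta> / 2" for z q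
 proof -
  have "prob (?U z q) <= (1 / exp (?A)) * (LINT w|\<Omega>. exp (z * ?S q w))"
   using integral_Markov_inequality_measure[OF bm_integrable[OF bm_exp[OF bm_mult[OF bm_const[of _ z] bmS[OF q]]]],
     of "space \<Omega>" "exp (?A)"] by simp
  also have "... <= (1 / exp (?A)) * exp (real N * z^2)" using z \<beta> by (intro mult_left_mono exp_moment A_borel q) auto
  also have "z^2 = \<beta>^2 / 4" using arg_cong[OF z, of "%u. u^2"] by (simp add: power_divide)
  also have "(1 / exp (?A)) * exp (real N * (\<beta>^2 / 4)) = ?E"
  proof -
   have "exp (real N * (\<beta>^2 / 4)) = exp (?A) * ?E" unfolding exp_add[symmetric] by simp
   thus ?thesis by simp
  qed
  finally show ?thesis .
 qed
 let ?V = "(\<Union>q<p. ?U (\<beta> / 2) q \<union> ?U (- (\<beta> / 2)) q)"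
 have "AE w in \<Omega>. norm (dev w) > \<epsilon> --> w \<in> ?V"
 proof -
  have "AE w in \<Omega>. \<forall>q\<in>{..<p}. cprob (A q) w = measure (x w) (A q)" using cprob_AE A_borel by (intro AE_finite_allI) auto
  thus ?thesis using AE_space
  proof eventually_elim
   case (elim w)
   have "norm (dev w) <= \<epsilon>" if no: "w \<notin> ?V"
   proof -
    have "norm ((?X q w) *\<^sub>R t q) <= \<beta> * B" if q: "q < p" for q
    proof -
     have cancel: "S < real N * \<beta>" if "\<beta> / 2 * S < ?A" for S
     proof -
      have "\<beta> * S < \<beta> * (real N * \<beta>)" using that by (simp add: power2_eq_square mult.left_commute)
      thus ?thesis using \<beta>(1) mult_less_cancel_left_pos by blast
     qed
     have 1: "\<beta> / 2 * ?S q w < ?A" "\<beta> / 2 * (- ?S q w) < ?A" using no elim(2) q by (auto simp: not_le simp del: minus_diff_eq)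
     have "?S q w < real N * \<beta>" "- ?S q w < real N * \<beta>" by (rule cancel[OF 1(1)], rule cancel[OF 1(2)])
     moreover have "?S q w = real N * (?X q w)" using elim(1) q N by (simp add: right_diff_distrib)
     ultimately have "\<bar>real N * (?X q w)\<bar> <= real N * \<beta>" by linarith
     hence "\<bar>(1 / real N) * (\<Sum>i=1..N. hit i (A q) w) - measure (x w) (A q)\<bar> <= \<beta>" using N unfolding abs_mult by simp
     thus ?thesis unfolding norm_scaleR real_norm_def using norm_t[OF q] \<beta> by (intro mult_mono) auto
    qed
    hence "norm (\<Sum>q<p. (?X q w) *\<^sub>R t q) <= real (card {..<p}) * (\<beta> * B)" by (intro sum_norm_bound) auto
    thus ?thesis using dev_cells[OF elim(2)] \<epsilon> by simp
   qed
   thus ?case by force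
  qed
 qed
 hence "?L <= prob ?V"
 proof (intro finite_measure_mono_AE sets.finite_UN sets.Un U, goal_cases)
  case 1
  thus ?case
  proof eventually_elim
   case (elim w)
   thus ?case by blast
  qed
 qed simp_all
 also have "... <= (\<Sum>q<p. prob (?U (\<beta> / 2) q \<union> ?U (- (\<beta> / 2)) q))" by (intro finite_measure_subadditive_finite image_subsetI sets.Un U) simp_all
 also have "... <= (\<Sum>q<p. 2 * ?E)"
 proof (rule sum_mono, goal_cases)
  case (1 q)
  hence q: "q < p" by simp
  have "prob (?U (\<beta> / 2) q \<union> ?U (- (\<beta> / 2)) q) <= prob (?U (\<beta> / 2) q) + prob (?U (- (\<beta> / 2)) q)" by (rule measure_Un_le) (rule U[OF q])+
  also have "... <= 2 * ?E" using U_le[OF q, of "\<beta> / 2"] U_le[OF q, of "- (\<beta> / 2)"] \<beta> by simp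
  finally show ?case .
 qed
 also have "... = 2 * real p * ?E" by simp
 finally show ?thesis .
qed

end

text \<open>The number of cells does not enter \<open>dev_square_cells\<close>, so the mesh may
  shrink with N, and sqrt (1/N) balances the two terms. The weight W allows for factors such as a
  leverage that depend on the first stage.\<close>

lemma dev_square_bound:
 assumes W: "bdd_meas F W" "!!w. w \<in> space \<Omega> ==> 0 <= W w"
 shows "(LINT w|\<Omega>. W w * (norm (dev w))^2) <= 8 * (1 + B^2) / real N * (LINT w|\<Omega>. W w)"
proof -
 have "0 < sqrt (1 / real N)" using N by simp
 then obtain p t A where "cell_partition k (sqrt (1 / real N)) p t A" using ex_cell_partition[OF compact k(1)] by blast
 from dev_square_cells[OF this W] show ?thesis by (simp add: field_simps add_divide_distrib)
qed

end

text \<open>Each step can enlarge the norm by the factor 1 + \<eta> B^2. The bound serves for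
  features of which only B is known, where no contraction is available.\<close>

lemma fsgd_norm_le:
 assumes "b >= 1" "0 <= \<eta>" "0 <= B" "0 <= Y"
  and J: "!!i. i \<in> {1..b * t} ==> norm (F (J i)) <= B \<and> \<bar>c (J i)\<bar> <= Y"
 shows "norm (fsgd b \<eta> F c J h t) <= exp (\<eta> * real t * B^2) * (norm h + \<eta> * real t * (B * Y))"
proof -
 have "norm (fsgd b \<eta> F c J h t) <= (1 + \<eta> * B^2) ^ t * (norm h + real t * (\<eta> * (B * Y)))" using J
 proof (induction t)
  case (Suc t)
  let ?h = "fsgd b \<eta> F c J h t" and ?g = "1 + \<eta> * B^2"
  let ?S = "\<Sum>i = b * t + 1..b * (t + 1). (?h \<bullet> F (J i) - c (J i)) *\<^sub>R F (J i)"
  have IH: "norm ?h <= ?g ^ t * (norm h + real t * (\<eta> * (B * Y)))" by (rule Suc.IH) (use Suc.prems in auto)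
  have "norm ?S <= real (card {b * t + 1..b * (t + 1)}) * ((norm ?h * B + Y) * B)"
  proof (rule sum_norm_bound, goal_cases)
   case (1 i)
   hence "i \<in> {1..b * Suc t}" by auto
   hence F: "norm (F (J i)) <= B" "\<bar>c (J i)\<bar> <= Y" using Suc.prems by auto
   have "\<bar>?h \<bullet> F (J i) - c (J i)\<bar> <= norm ?h * B + Y" using order_trans[OF Cauchy_Schwarz_ineq2 mult_left_mono[OF F(1) norm_ge_zero], of ?h] F(2)
    by (intro order_trans[OF abs_triangle_ineq4] add_mono)
   thus ?case using F(1) by (simp add: mult_mono')
  qed
  hence S: "norm ?S <= real b * ((norm ?h * B + Y) * B)" unfolding block_card .
  have "norm ((\<eta> * (1 / real b)) *\<^sub>R ?S) <= (\<eta> * (1 / real b)) * (real b * ((norm ?h * B + Y) * B))"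
   unfolding norm_scaleR using assms(2) by (intro mult_mono S) auto
  also have "... = \<eta> * B^2 * norm ?h + \<eta> * (B * Y)" using assms(1) by (simp add: power2_eq_square algebra_simps)
  finally have "norm (fsgd b \<eta> F c J h (Suc t)) <= ?g * norm ?h + \<eta> * (B * Y)"
   unfolding fsgd.simps using norm_triangle_ineq4[of ?h "(\<eta> * (1 / real b)) *\<^sub>R ?S"] by (simp add: algebra_simps)
  also have "... <= ?g * (?g ^ t * (norm h + real t * (\<eta> * (B * Y)))) + ?g ^ Suc t * (\<eta> * (B * Y))"
  proof (intro add_mono mult_left_mono IH)
   have "1 <= ?g ^ Suc t" using assms(2) by (intro one_le_power) auto
   thus "\<eta> * (B * Y) <= ?g ^ Suc t * (\<eta> * (B * Y))" using assms(2-4) mult_right_mono[of 1 "?g ^ Suc t" "\<eta> * (B * Y)"] by simp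
  qed (use assms(2) in auto)
  also have "... = ?g ^ Suc t * (norm h + real (Suc t) * (\<eta> * (B * Y)))" by (simp add: algebra_simps)
  finally show ?case .
 qed simp
 also have "(1 + \<eta> * B^2) ^ t <= exp (\<eta> * B^2) ^ t" using assms(2) by (intro power_mono) (auto simp: exp_ge_add_one_self)
 also have "exp (\<eta> * B^2) ^ t = exp (\<eta> * real t * B^2)" by (simp add: exp_of_nat_mult[symmetric] mult_ac)
 finally show ?thesis using assms(2-4) by (simp add: mult_right_mono mult_ac)
qed

text \<open>Linearises a bound by products, so that afterwards the summands can be integrated one by
  one.\<close>

lemma le_sum_of_products:
 fixes z x y u v :: real
 assumes "0 <= x" "0 <= y" "0 <= u" "0 <= v" "z^2 <= x * y + 2 * (u * v)"
 shows "z <= (x + y) + (u + v)"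
proof (rule power2_le_imp_le, goal_cases)
 case 1 have "0 <= (x - y)^2" "0 <= (u - v)^2" "0 <= (x + y) * (u + v)" "0 <= x * y" "0 <= u * v" using assms by auto
 moreover have "((x + y) + (u + v))^2 = (x - y)^2 + 4 * (x * y) + ((u - v)^2 + 4 * (u * v)) + 2 * ((x + y) * (u + v))"
  by (simp add: power2_eq_square algebra_simps)
 ultimately show ?case using assms(5) by linarith
qed (use assms in auto)

lemma tail_count:
 assumes "T >= 1"
 shows "1 <= (2 / real T) * real (card {T div 2 + 1..T})" "(2 / real T) * real (card {T div 2 + 1..T}) <= 1 + 1 / real T"
  "(2 / real T) * real (card {T div 2 + 1..T}) <= 2"
proof -
 let ?X = "real (2 * card {T div 2 + 1..T})"
 let ?U = "(2 / real T) * real (card {T div 2 + 1..T})"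
 have "real T <= ?X" "?X <= real (T + 1)"
  "?X <= real (2 * T)" unfolding of_nat_le_iff using assms by auto
 hence "real T / real T <= ?X / real T"
  "?X / real T <= real (T + 1) / real T"
  "?X / real T <= real (2 * T) / real T" by (intro divide_right_mono; simp)+
 thus "1 <= ?U" "?U <= 1 + 1 / real T"
  "?U <= 2" using assms by (simp_all add: add_divide_distrib)
qed

lemma tail_sum_le:
 assumes "T >= 1" "!!t. t <= T ==> x t <= a + y t" "!!t. 0 <= y t" "0 <= (a::real)"
 shows "(2 / real T) * (\<Sum>t = T div 2 + 1..T. x t) <= 2 * a + (2 / real T) * (\<Sum>t\<le>T. y t)" (is "?L <= ?R")
proof -
 have "?L <= (2 / real T) * (\<Sum>t = T div 2 + 1..T. a + y t)" using assms by (intro mult_left_mono sum_mono) auto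
 also have "... = (2 / real T) * real (card {T div 2 + 1..T}) * a + (2 / real T) * (\<Sum>t = T div 2 + 1..T. y t)"
  by (simp only: sum.distrib sum_constant distrib_left mult.assoc)
 also have "... <= ?R" using assms tail_count(3)[OF assms(1)] by (intro add_mono mult_right_mono mult_left_mono sum_mono2) auto
 finally show ?thesis .
qed

section \<open>Excess risk of tail averages\<close>

context regression_model
begin

lemma L2_norm_bounded: "g \<in> L2 M ==> (!!m. m \<in> space M ==> \<bar>g m\<bar> <= c) ==> 0 <= c ==> L2_norm M g <= c"
 unfolding L2_norm_def
proof (rule real_le_lsqrt)
 assume g: "g \<in> L2 M" "!!m. m \<in> space M ==> \<bar>g m\<bar> <= c" and "0 <= c"
 show "(LINT m|M. (g m)^2) <= c^2" using g power_mono[OF g(2) abs_ge_zero, of _ 2] by (intro integral_le_const L2_D) auto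
qed auto

lemma L2_norm_f: "L2_norm M f <= Y"
 by (rule L2_norm_bounded[OF f_L2 f_bound Y_nonneg])

lemma excess_le: "excess h <= norm h * B + Y"
proof -
 have "excess h = L2_norm M (%m. val h m + (-1) * f m)" by (simp add: excess_def)
 also have "... <= L2_norm M (val h) + L2_norm M (%m. (-1) * f m)" by (intro L2_norm_triangle val_L2 L2_scale f_L2)
 also have "... <= norm h * B + Y" using L2_norm_val_le L2_norm_f unfolding L2_norm_scale by (intro add_mono) auto
 finally show ?thesis .
qed

lemma excess_nonneg: "0 <= excess h"
 by (simp add: excess_def)

lemma L2_norm_cong_space: "(!!m. m \<in> space M ==> g m = g' m) ==> L2_norm M g = L2_norm M g'"
 unfolding L2_norm_def by (intro arg_cong[where f = sqrt] bochner_cong) auto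

lemma excess_add: "excess (h + d) <= excess h + L2_norm M (val d)"
proof -
 have "excess (h + d) = L2_norm M (%m. (val h m - f m) + val d m)" unfolding excess_def by (rule L2_norm_cong_space) (simp add: val_add_space)
 also have "... <= L2_norm M (%m. val h m - f m) + L2_norm M (val d)" by (intro L2_norm_triangle L2_diff val_L2 f_L2)
 finally show ?thesis by (simp add: excess_def)
qed

lemma L2_norm_sum: "finite A ==> (!!i. i \<in> A ==> g i \<in> L2 M) ==> L2_norm M (%m. \<Sum>i\<in>A. g i m) <= (\<Sum>i\<in>A. L2_norm M (g i))"
proof (induction A rule: finite_induct)
 case (insert i A)
 have "L2_norm M (%m. \<Sum>i\<in>insert i A. g i m) = L2_norm M (%m. g i m + (\<Sum>i\<in>A. g i m))" using insert by simp
 also have "... <= L2_norm M (g i) + L2_norm M (%m. \<Sum>i\<in>A. g i m)" using insert by (intro L2_norm_triangle L2_sum) auto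
 finally show ?case using insert by fastforce
qed (simp add: L2_norm_def)

text \<open>For odd \<open>T\<close> the weights of the tail average sum to \<open>1 + 1/T\<close>, which leaves a multiple of \<open>f\<close>.\<close>

lemma excess_tail_average:
 assumes T: "T >= 1"
 shows "excess (tail_average T h) <= (2 / real T) * (\<Sum>t = T div 2 + 1..T. excess (h t)) + Y / real T"
proof -
 let ?A = "{T div 2 + 1..T}" and ?c = "2 / real T"
 define w where "w = ?c * real (card ?A) - 1"
 have w: "0 <= w" "w <= 1 / real T" using tail_count[OF T] by (auto simp: w_def)
 have "excess (tail_average T h) = L2_norm M (%m. ?c * (\<Sum>t\<in>?A. val (h t) m - f m) + w * f m)" unfolding excess_def
 proof (rule L2_norm_cong_space, goal_cases)
  case (1 m) note m = 1
  have "val (tail_average T h) m = ?c * (\<Sum>t\<in>?A. val (h t) m)" by (simp only: val[OF m] tail_average_def inner_scaleR_left inner_sum_left)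
  thus ?case by (simp only: sum_subtractf sum_constant w_def) (simp add: algebra_simps)
 qed
 also have "... <= L2_norm M (%m. ?c * (\<Sum>t\<in>?A. val (h t) m - f m)) + L2_norm M (%m. w * f m)"
  by (intro L2_norm_triangle L2_scale L2_sum L2_diff val_L2 f_L2)
 also have "... <= ?c * (\<Sum>t\<in>?A. excess (h t)) + Y / real T"
 proof (rule add_mono, goal_cases)
  case 1 show ?case unfolding L2_norm_scale excess_def using T by (auto intro!: divide_right_mono L2_norm_sum L2_diff val_L2 f_L2)
  case 2 have "\<bar>w\<bar> * L2_norm M f <= 1 / real T * Y" using w L2_norm_f by (intro mult_mono) auto
  thus ?case unfolding L2_norm_scale by simp
 qed
 finally show ?thesis .
qed

end

section \<open>Effect of perturbed features on the tail average\<close>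

context sgd_sample
begin

text \<open>The 16 \<kappa>^2 is the 8 \<kappa>^2 of \<open>fsgd_perturbation\<close> for features
  bounded by sqrt 2 \<kappa>.\<close>

definition mean_norm :: "(nat => 'g \<times> real) => real" where
 "mean_norm D = (1 / real T) * (\<Sum>s<T. 16 * \<kappa>^2 * AV (%J. (norm (iter D J s))^2) + 2 * Y^2)"

definition mean_excess :: "(nat => 'g \<times> real) => real" where
 "mean_excess D = (1 / real T) * (\<Sum>t\<le>T. AV (%J. (excess (iter D J t))^2))"

abbreviation "perturbed F D J t \<equiv> fsgd b \<eta> F (label D) J h0 t"

definition gap :: "(nat => 'k) => (nat => 'g \<times> real) => real" where
 "gap F D = avg n (%l. (norm (F l - feat D l))^2)"

lemma gap_nonneg: "0 <= gap F D"
 unfolding gap_def by (intro mult_nonneg_nonneg sum_nonneg) auto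

text \<open>The empirical form in the true features is traded, at the price of the gap, for the one
  in F, whose dissipation \<open>fsgd_perturbation\<close> controls. The parameter a weighs the
  leverage against the size of d and is chosen only at the very end.\<close>

lemma val_le_split:
 assumes a: "a > 0"
 shows "L2_norm M (val d) <= (a * plev D + gap F D * plev D / \<theta>)
  + ((2 * (avg n (%l. (d \<bullet> F l)^2)) + \<theta> * (norm d)^2) / a + \<theta> * (norm d)^2)" (is "?L <= _")
proof -
 define q where "q = avg n (%l. (d \<bullet> F l)^2)"
 have q: "0 <= q" unfolding q_def by (intro mult_nonneg_nonneg sum_nonneg) auto
 note g = gap_nonneg[of F D]
 have "d \<bullet> emp_op n (feat D) d <= avg n (%l. 2 * (d \<bullet> F l)^2 + 2 * ((norm d)^2 * (norm (F l - feat D l))^2))" unfolding emp_op_quadratic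
 proof (intro mult_left_mono sum_mono, goal_cases)
  case (1 l)
  have "(d \<bullet> feat D l)^2 <= 2 * (d \<bullet> F l)^2 + 2 * (d \<bullet> (feat D l - F l))^2"
   using square_add_le[of "d \<bullet> F l" "d \<bullet> (feat D l - F l)"] by (simp add: inner_diff_right)
  also have "(d \<bullet> (feat D l - F l))^2 <= (norm d)^2 * (norm (F l - feat D l))^2"
   using inner_square_le[of d "feat D l - F l"] by (simp add: norm_minus_commute)
  finally show ?case by simp
 qed auto
 also have "... = 2 * q + 2 * (gap F D * (norm d)^2)" unfolding q_def gap_def sum.distrib sum_distrib_left[symmetric] by (simp add: algebra_simps)
 finally have "d \<bullet> emp_op n (feat D) d <= 2 * q + 2 * (gap F D * (norm d)^2)" .
 hence "?L^2 <= plev D * ((2 * q + 2 * (gap F D * (norm d)^2)) + \<theta> * (norm d)^2)"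
  by (intro order_trans[OF L2_norm_val_le[of d D]] mult_left_mono add_right_mono plev_nonneg)
 also have "... = (a * plev D) * ((2 * q + \<theta> * (norm d)^2) / a)
   + 2 * ((gap F D * plev D / \<theta>) * (\<theta> * (norm d)^2))"
  using a theta_pos by (simp add: field_simps)
 finally have "?L <= (a * plev D + (2 * q + \<theta> * (norm d)^2) / a)
   + (gap F D * plev D / \<theta> + \<theta> * (norm d)^2)"
  using a theta_pos q g plev_nonneg[of D]
  by (intro le_sum_of_products) (auto intro!: mult_nonneg_nonneg divide_nonneg_nonneg add_nonneg_nonneg)
 thus ?thesis by (simp add: q_def)
qed

lemma perturbation_tail:
 assumes D: "!!l. l \<in> {1..n} ==> (norm (feat D l))^2 <= \<kappa>^2" "!!l. l \<in> {1..n} ==> \<bar>label D l\<bar> <= Y"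
  and F: "!!l. l \<in> {1..n} ==> (norm (F l))^2 <= 2 * \<kappa>^2" and a: "0 < a" "a <= 1"
 shows "(2 / real T) * (\<Sum>t = T div 2 + 1..T. AV (%J. L2_norm M (val (perturbed F D J t - iter D J t))))
  <= 2 * a * plev D + 2 * gap F D * plev D / \<theta> + 96 * gap F D * mean_norm D / (a * \<theta>)"
proof -
 let ?f = "%s. 16 * \<kappa>^2 * AV (%J. (norm (iter D J s))^2) + 2 * Y^2" and ?p = "a * plev D + gap F D * plev D / \<theta>"
 let ?d = "%J t. perturbed F D J t - iter D J t"
 define e where "e = (%t. AV (%J. (norm (?d J t))^2))"
 define q where "q = (%t. AV (%J. avg n (%l. (?d J t \<bullet> F l)^2)))"
 have e0: "0 <= e t" for t unfolding e_def by (intro av_nonneg) auto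
 have q0: "0 <= q t" for t unfolding q_def by (intro av_nonneg mult_nonneg_nonneg sum_nonneg) auto
 note g0 = gap_nonneg[of F D]
 have p0: "0 <= plev D" by (rule plev_nonneg)
 \<comment> \<open>Common bound for e t and for \<eta> times the accumulated dissipation up to any t
   \<le> T. The denominator comes from \<eta>^2 T^2 = 1/\<theta>^2.\<close>
 define X where "X = 6 * gap F D * mean_norm D / \<theta>^2"
 have m0: "0 <= mean_norm D" unfolding mean_norm_def by (intro mult_nonneg_nonneg sum_nonneg add_nonneg_nonneg av_nonneg) auto
 have X0: "0 <= X" unfolding X_def using g0 m0 by auto
 let ?k = "\<theta> * (2 * real T * X)" and ?h = "%t. (2 * q t + \<theta> * e t) / a + \<theta> * e t" and ?s = "(\<Sum>t\<le>T. e t)"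
 have energy: "e t + \<eta> * (\<Sum>s<t. q s) <= X" if t: "t <= T" for t
 proof -
  have s2: "(sqrt 2 * \<kappa>)^2 = 2 * \<kappa>^2" by (simp add: power_mult_distrib)
  have "e t + \<eta> * (\<Sum>s<t. q s) <= 3 * (1 + real T) * \<eta>^2 * gap F D *
   (\<Sum>s<t. 8 * (sqrt 2 * \<kappa>)^2 * AV (%J. (norm (iter D J s))^2) + 2 * Y^2)"
   unfolding e_def q_def gap_def
  proof (rule fsgd_perturbation[OF b n])
   show "\<eta> * (sqrt 2 * \<kappa>)^2 <= 1 / 2" using eta(2) unfolding s2 by simp
   show "(norm (feat D l))^2 <= (sqrt 2 * \<kappa>)^2" if "l \<in> {1..n}" for l using D(1)[OF that] unfolding s2 by (smt (verit) zero_le_power2)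
  qed (use eta T t kappa F D(2) s2 in auto)
  also have "... <= 3 * (2 * real T) * \<eta>^2 * gap F D * (\<Sum>s<T. ?f s)"
  proof (rule mult_mono, goal_cases)
   case 1 show ?case using T g0 by (intro mult_right_mono) auto
   show "(\<Sum>s<t. 8 * (sqrt 2 * \<kappa>)^2 * AV (%J. (norm (iter D J s))^2) + 2 * Y^2)
    <= (\<Sum>s<T. ?f s)" (is "?L <= ?R")
   proof -
    have "?L
     = (\<Sum>s<t. ?f s)" unfolding s2 by (simp add: mult.assoc)
    also have "... <= ?R"
    proof (rule sum_mono2)
     fix s
     show "0 <= ?f s" by (intro add_nonneg_nonneg mult_nonneg_nonneg av_nonneg) auto
    qed (use t in auto)
    finally show ?thesis .
   qed
  qed (auto intro!: mult_nonneg_nonneg g0 sum_nonneg add_nonneg_nonneg av_nonneg)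
  also have "... = X" unfolding X_def mean_norm_def using T eta(1) by (simp add: theta(1) power2_eq_square field_simps)
  finally show ?thesis .
 qed
 have eX: "e t <= X" if "t <= T" for t using energy[OF that] eta(1) q0 by (smt (verit) mult_nonneg_nonneg sum_nonneg)
 \<comment> \<open>The accumulated dissipation stops before T; its last term is bounded through the
   norm, as 2 \<eta> \<kappa>^2 \<le> 1.\<close>
 have qT: "\<eta> * q T <= X"
 proof -
  have "q T <= AV (%J. 2 * \<kappa>^2 * (norm (?d J T))^2)" unfolding q_def
  proof (intro av_mono mean_le[OF n], goal_cases)
   case (1 J l)
   thus ?case using inner_square_le[of "?d J T" "F l"] mult_left_mono[OF F, of l "(norm (?d J T))^2"] by (simp add: mult.commute)
  qed
  hence "\<eta> * q T <= \<eta> * (2 * \<kappa>^2 * e T)" using eta(1) by (simp add: av_cmult e_def)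
  also have "... = (2 * (\<eta> * \<kappa>^2)) * e T" by simp
  also have "... <= 1 * e T" using eta(2) by (intro mult_right_mono e0) auto
  finally show ?thesis using eX[of T] by simp
 qed
 have "{..T} = insert T {..<T}" by auto
 hence sq: "\<eta> * (\<Sum>t\<le>T. q t) <= 2 * X" using energy[of T] qT e0[of T] by (simp add: distrib_left)
 have se: "?s <= 2 * real T * X"
 proof -
  have "?s <= (\<Sum>t\<le>T. X)" by (intro sum_mono eX) auto
  also have "... = (1 + real T) * X" by simp
  also have "... <= 2 * real T * X" using T X0 by (intro mult_right_mono) auto
  finally show ?thesis .
 qed
 have pt: "AV (%J. L2_norm M (val (?d J t))) <= ?p
  + (?h t)" (is "?l <= _") for t
 proof -
  have "?l <= AV (%J. ?p
   + ((1 / a) * (2 * (avg n (%l. (?d J t \<bullet> F l)^2)) + \<theta> * (norm (?d J t))^2) + \<theta> * (norm (?d J t))^2))"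
   by (intro av_mono) (use val_le_split[OF a(1), of "?d _ t" D F] in simp)
  thus ?thesis unfolding q_def e_def av_add av_cmult av_const[OF n] by simp
 qed
 have "(2 / real T) * (\<Sum>t = T div 2 + 1..T. AV (%J. L2_norm M (val (?d J t))))
  <= 2 * ?p + (2 / real T) * (\<Sum>t\<le>T. ?h t)"
  using a theta_pos g0 p0 q0 e0 by (intro tail_sum_le[OF T] pt) (auto intro!: add_nonneg_nonneg divide_nonneg_nonneg)
 also have "(2 / real T) * (\<Sum>t\<le>T. ?h t) <= 16 * \<theta> * X / a" (is "?r <= ?L1")
 proof -
  have "(\<Sum>t\<le>T. ?h t) = (2 * (\<Sum>t\<le>T. q t) + \<theta> * ?s) / a + \<theta> * ?s"
   by (simp add: sum.distrib sum_distrib_left sum_divide_distrib add_divide_distrib)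
  also have "... <= (2 * (2 * X / \<eta>) + ?k) / a + ?k / a"
  proof (intro add_mono divide_right_mono mult_left_mono se, goal_cases)
   case 1 show ?case using sq eta(1) by (simp add: pos_le_divide_eq mult.commute)
   have "\<theta> * ?s <= ?k" using se theta_pos by (intro mult_left_mono) auto
   also have "... <= ?k / a" using a theta_pos X0 by (simp add: pos_le_divide_eq mult_left_le)
   finally show "\<theta> * ?s <= ?k / a" .
  qed (use a theta_pos in auto)
  also have "... = 8 * (real T * \<theta> * X / a)"
  proof -
   have e: "1 / \<eta> = real T * \<theta>" using theta(1) eta(1) T by simp
   have "2 * X / \<eta> = 2 * X * (real T * \<theta>)" unfolding e[symmetric] by simp
   thus ?thesis using a by (simp add: field_simps)
  qed
  finally have "?r <= (2 / real T) * (8 * (real T * \<theta> * X / a))" by (intro mult_left_mono) auto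
  also have "... = ?L1" using T by simp
  finally show ?thesis .
 qed
 also have "16 * \<theta> * X / a = 96 * gap F D * mean_norm D / (a * \<theta>)" unfolding X_def using theta_pos a by (simp add: power2_eq_square mult_ac)
 finally show ?thesis by (simp add: algebra_simps)
qed

lemma tail_excess_bound:
 assumes D: "!!l. l \<in> {1..n} ==> (norm (feat D l))^2 <= \<kappa>^2" "!!l. l \<in> {1..n} ==> \<bar>label D l\<bar> <= Y"
  and F: "!!l. l \<in> {1..n} ==> (norm (F l))^2 <= 2 * \<kappa>^2" and a: "0 < a" "a <= 1" and \<epsilon>: "\<epsilon> > 0"
 shows "AV (%J. excess (tail_average T (perturbed F D J))) <= \<epsilon> + mean_excess D / \<epsilon> + Y / real T
  + (2 * a * plev D + 2 * gap F D * plev D / \<theta> + 96 * gap F D * mean_norm D / (a * \<theta>))" (is "?L <= _")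
proof -
 let ?A = "{T div 2 + 1..T}"
 let ?d = "%J t. L2_norm M (val (perturbed F D J t - iter D J t))"
 have "?L
  <= AV (%J. (2 / real T) * (\<Sum>t\<in>?A. excess (iter D J t) + ?d J t) + Y / real T)"
 proof (rule av_mono, goal_cases)
  case (1 J)
  have "excess (perturbed F D J t) <= excess (iter D J t) + ?d J t" for t using excess_add[of "iter D J t" "perturbed F D J t - iter D J t"] by simp
  hence "(2 / real T) * (\<Sum>t\<in>?A. excess (perturbed F D J t)) <= (2 / real T) * (\<Sum>t\<in>?A. excess (iter D J t) + ?d J t)"
   by (intro mult_left_mono sum_mono) auto
  thus ?case using excess_tail_average[OF T, of "perturbed F D J"] by linarith
 qed
 also have "... = (2 / real T) * (\<Sum>t\<in>?A. AV (%J. excess (iter D J t))) + (2 / real T) * (\<Sum>t\<in>?A. AV (%J. ?d J t)) + Y / real T"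
  by (simp only: av_add av_cmult av_sum av_const[OF n] sum.distrib distrib_left)
 also have "(2 / real T) * (\<Sum>t\<in>?A. AV (%J. excess (iter D J t))) <= 2 * (\<epsilon> / 2) + (2 / real T) * (\<Sum>t\<le>T. 1 / (2 * \<epsilon>) * AV (%J. (excess (iter D J t))^2))"
 proof (rule tail_sum_le[OF T], goal_cases)
  case (1 t)
  \<comment> \<open>A tangent to the square root: with \<epsilon> of the size of the target rate,
    only second moments of the excess are left.\<close>
  have "excess (iter D J t) <= \<epsilon> / 2 + 1 / (2 * \<epsilon>) * (excess (iter D J t))^2" for J
   using zero_le_power2[of "excess (iter D J t) - \<epsilon>"] \<epsilon> by (simp add: power2_eq_square field_simps)
  hence "AV (%J. excess (iter D J t)) <= AV (%J. \<epsilon> / 2 + 1 / (2 * \<epsilon>) * (excess (iter D J t))^2)" by (intro av_mono)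
  thus ?case by (simp only: av_add av_cmult av_const[OF n])
 qed (use \<epsilon> in \<open>auto intro!: divide_nonneg_nonneg av_nonneg\<close>)
 also have "... = \<epsilon> + mean_excess D / \<epsilon>" unfolding sum_distrib_left[symmetric] mean_excess_def using T \<epsilon> by simp
 also note perturbation_tail[OF D F a]
 finally show ?thesis by (simp add: algebra_simps)
qed

text \<open>Since \<eta> T = 1/\<theta>, the accumulated growth of \<open>fsgd_norm_le\<close> is at
  most exp (B^2/\<theta>).\<close>

lemma excess_crude:
 assumes J: "J \<in> seqs n (b * T)" and "!!l. l \<in> {1..n} ==> norm (F l) <= B" "!!l. l \<in> {1..n} ==> \<bar>c l\<bar> <= Y"
 shows "excess (tail_average T (fsgd b \<eta> F c J h0)) <= 2 * (exp (B^2 / \<theta>) * (norm h0 + B * Y / \<theta>) * B + Y) + Y" (is "?L <= _")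
proof -
 have eT: "\<eta> * real T = 1 / \<theta>" using theta(1) eta(1) T by simp
 have h: "norm (fsgd b \<eta> F c J h0 t) <= exp (B^2 / \<theta>) * (norm h0 + B * Y / \<theta>)" if t: "t <= T" for t
 proof -
  have et: "\<eta> * real t <= 1 / \<theta>" unfolding eT[symmetric] using t eta(1) by simp
  have "norm (fsgd b \<eta> F c J h0 t) <= exp (\<eta> * real t * B^2) * (norm h0 + \<eta> * real t * (B * Y))"
   using seqs_block[OF J t] assms(2,3) b eta(1) B_nonneg Y_nonneg by (intro fsgd_norm_le) auto
  also have "... <= exp (1 / \<theta> * B^2) * (norm h0 + 1 / \<theta> * (B * Y))" using et eta(1) B_nonneg Y_nonneg theta_pos
   by (intro mult_mono add_left_mono mult_right_mono exp_le_cancel_iff[THEN iffD2]) auto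
  finally show ?thesis by simp
 qed
 have "?L <= (2 / real T) * (\<Sum>t = T div 2 + 1..T. excess (fsgd b \<eta> F c J h0 t)) + Y / real T" by (rule excess_tail_average[OF T])
 also have "(2 / real T) * (\<Sum>t = T div 2 + 1..T. excess (fsgd b \<eta> F c J h0 t))
  <= 2 * (exp (B^2 / \<theta>) * (norm h0 + B * Y / \<theta>) * B + Y) + (2 / real T) * (\<Sum>t\<le>T. 0)"
  using B_nonneg Y_nonneg theta_pos h by (intro tail_sum_le[OF T]) (auto intro!: order_trans[OF excess_le] mult_right_mono)
 also have "Y / real T <= Y" using T Y_nonneg by (simp add: divide_le_eq mult_le_cancel_left1)
 finally show ?thesis by simp
qed

end

lemma bm_cong:
 assumes "!!x. x \<in> space M ==> f x = g x"
 shows "bdd_meas M f \<longleftrightarrow> bdd_meas M g"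
 unfolding bdd_meas_def using measurable_cong[of M f g borel, OF assms] by (simp add: assms)

lemma sigma_sets_vimage_subset:
 "g \<in> N \<rightarrow>\<^sub>M M ==> sigma_sets (space N) {g -` A \<inter> space N |A. A \<in> sets M} \<subseteq> sets N" by (intro sets.sigma_sets_subset) (auto intro: measurable_sets)

section \<open>Integration over the random indices\<close>

context prob_space
begin

text \<open>The index sequence is uniform on \<open>seqs n k\<close> and independent of H. Splitting
  the integral along its finitely many values and using independence on each event E j gives the
  average.\<close>

lemma integral_random_index:
 fixes J :: "nat => 'a => nat" and V :: "(nat => nat) => 'a => real"
 assumes n: "n >= 1" and J: "indep_vars (%_. count_space {1..n}) J {1..k}"
  and unif: "!!i. i \<in> {1..k} ==> distr M (count_space {1..n}) (J i) = uniform_count_measure {1..n}"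
  and sub: "subalgebra M H"
  and indep: "indep_set (sets H)
   (sets (vimage_algebra (space M) (%w. \<lambda>i\<in>{1..k}. J i w) (\<Pi>\<^sub>M i\<in>{1..k}. count_space {1..n})))"
  and V: "!!j. j \<in> seqs n k ==> bdd_meas H (V j)"
  and k: "k >= 1"
 shows "(LINT w|M. V (\<lambda>i\<in>{1..k}. J i w) w) = av n k (%j. (LINT w|M. V j w))"
  and "bdd_meas M (%w. V (\<lambda>i\<in>{1..k}. J i w) w)"
proof -
 have rJ: "J i \<in> M \<rightarrow>\<^sub>M count_space {1..n}" if "i \<in> {1..k}" for i using J that by (simp add: indep_vars_def)
 have Jin: "J i w \<in> {1..n}" if "i \<in> {1..k}" "w \<in> space M" for i w using measurable_space[OF rJ[OF that(1)] that(2)] by simp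
 let ?J = "%w. \<lambda>i\<in>{1..k}. J i w"
 have Js: "?J w \<in> seqs n k" if "w \<in> space M" for w unfolding seqs_def using Jin[OF _ that] by (intro restrict_PiE_iff[THEN iffD2]) auto
 define E where "E = (%j. {w \<in> space M. ?J w = j})"
 let ?JA = "vimage_algebra (space M) ?J (\<Pi>\<^sub>M i\<in>{1..k}. count_space {1..n})"
 have E_JA: "E j \<in> sets ?JA" if j: "j \<in> seqs n k" for j
 proof -
  have "Pi\<^sub>E {1..k} (%i. {j i}) \<in> sets (\<Pi>\<^sub>M i\<in>{1..k}. count_space {1..n})" using seqs_in[OF j] by (intro sets_PiM_I_finite) auto
  moreover have "Pi\<^sub>E {1..k} (%i. {j i}) = {j}" using j by (intro PiE_singleton) (auto simp: seqs_def PiE_iff)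
  ultimately have "?J -` {j} \<inter> space M \<in> sets ?JA" by (metis in_vimage_algebra)
  moreover have "?J -` {j} \<inter> space M = E j" by (auto simp: E_def)
  ultimately show ?thesis by simp
 qed
 have E_ev: "E j \<in> events" if "j \<in> seqs n k" for j using indep_setD_ev2[OF indep] E_JA[OF that] by blast
 have prob_E: "prob (E j) = 1 / real (n ^ k)" if j: "j \<in> seqs n k" for j
 proof -
  have "E j = (\<Inter>i\<in>{1..k}. J i -` {j i} \<inter> space M)" using k j by (auto simp: E_def seqs_def PiE_iff extensional_def fun_eq_iff restrict_def)
  also have "prob \<dots> = (\<Prod>i\<in>{1..k}. prob (J i -` {j i} \<inter> space M))" by (rule indep_varsD_finite[OF J]) (use k seqs_in[OF j] in auto)
  also have "... = (\<Prod>i\<in>{1..k}. 1 / real n)"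
  proof (rule prod.cong[OF refl])
   fix i assume i: "i \<in> {1..k}"
   have ji: "j i \<in> {1..n}" by (rule seqs_in[OF j i])
   have "prob (J i -` {j i} \<inter> space M) = measure (distr M (count_space {1..n}) (J i)) {j i}" using ji by (intro measure_distr[symmetric] rJ i) auto
   also have "... = 1 / real n" unfolding unif[OF i] using ji n by (simp add: measure_uniform_count_measure)
   finally show "prob (J i -` {j i} \<inter> space M) = 1 / real n" .
  qed
  finally show ?thesis by (simp add: power_one_over)
 qed
 have split: "V (?J w) w = (\<Sum>j\<in>seqs n k. indicator (E j) w * V j w)" (is "_ = ?R") if w: "w \<in> space M" for w
 proof -
  have "?R = (\<Sum>j\<in>seqs n k. if j = ?J w then V (?J w) w else 0)" using w by (intro sum.cong refl) (auto simp: E_def indicator_def)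
  thus ?thesis using Js[OF w] by simp
 qed
 have bV: "bdd_meas M (V j)" if "j \<in> seqs n k" for j by (rule measurable_ident_subalgebra[OF sub V[OF that]])
 have bE: "bdd_meas M (indicator (E j))" if "j \<in> seqs n k" for j using E_ev[OF that] by (intro bmI[where c = 1]) (auto simp: indicator_def)
 have bs: "bdd_meas M (%w. \<Sum>j\<in>seqs n k. indicator (E j) w * V j w)" by (intro bm_sum bm_mult bE bV)
 moreover have "bdd_meas M (%w. V (?J w) w) \<longleftrightarrow>
  bdd_meas M (%w. \<Sum>j\<in>seqs n k. indicator (E j) w * V j w)"
  by (rule bm_cong) (rule split)
 ultimately show "bdd_meas M (%w. V (?J w) w)" by blast
 have prod: "(LINT w|M. indicator (E j) w * V j w) = 1 / real (n ^ k) * (LINT w|M. V j w)" if j: "j \<in> seqs n k" for j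
 proof -
  have "indep_var borel (V j) borel (indicator (E j) :: 'a => real)" unfolding indep_var_eq
  proof (intro conjI)
   show "indep_set (sigma_sets (space M) {V j -` A \<inter> space M |A. A \<in> sets borel})
    (sigma_sets (space M) {(indicator (E j) :: 'a => real) -` A \<inter> space M |A. A \<in> sets borel})"
    using indep unfolding indep_set_def
   proof (rule indep_sets_mono_sets)
    fix i :: bool
    have sp: "space H = space M" using sub by (simp add: subalgebra_def)
    have "sigma_sets (space M) {V j -` A \<inter> space M |A. A \<in> sets borel} \<subseteq> sets H"
     unfolding sp[symmetric] by (rule sigma_sets_vimage_subset[OF bm_measurable[OF V[OF j]]])
    moreover have "(indicator (E j) :: 'a => real) \<in> borel_measurable ?JA" using E_JA[OF j] by (intro borel_measurable_indicator)
    from sigma_sets_vimage_subset[OF this]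
    have "sigma_sets (space M) {(indicator (E j) :: 'a => real) -` A \<inter> space M |A. A \<in> sets borel} \<subseteq> sets ?JA" by (simp only: space_vimage_algebra)
    ultimately show "(case i of True => sigma_sets (space M) {V j -` A \<inter> space M |A. A \<in> sets borel}
      | False => sigma_sets (space M) {(indicator (E j) :: 'a => real) -` A \<inter> space M |A. A \<in> sets borel})
     \<subseteq> (case i of True => sets H | False => sets ?JA)" by (cases i) (simp_all only: bool.case)
   qed
  qed (use bm_measurable[OF bV[OF j]] bm_measurable[OF bE[OF j]] in auto)
  from indep_var_lebesgue_integral[OF this bm_integrable[OF bV[OF j]] bm_integrable[OF bE[OF j]]]
  have "(LINT w|M. V j w * indicator (E j) w) = (LINT w|M. V j w) * (LINT w|M. indicator (E j) w)" .
  thus ?thesis using E_ev[OF j] prob_E[OF j] by (simp add: mult.commute Int_absorb1 sets.sets_into_space)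
 qed
 have "(LINT w|M. V (?J w) w) = (LINT w|M. (\<Sum>j\<in>seqs n k. indicator (E j) w * V j w))" by (intro bochner_cong refl split)
 also have "... = (\<Sum>j\<in>seqs n k. (LINT w|M. indicator (E j) w * V j w))" by (intro bochner_sum bm_integrable bm_mult bE bV)
 also have "... = (\<Sum>j\<in>seqs n k. 1 / real (n ^ k) * (LINT w|M. V j w))" by (intro sum.cong refl prod)
 finally show "(LINT w|M. V (?J w) w) = av n k (%j. (LINT w|M. V j w))" by (simp add: av_def card_seqs sum_divide_distrib)
qed

end

context regression_model
begin

lemma excess_square_inner:
 "(excess h)^2 = h \<bullet> pop_op h - 2 * (h \<bullet> inclusion_adj M val f) + L2_inner M f f"
proof -
 have "(excess h)^2 = L2_inner M (%m. val h m - 1 * f m) (%m. val h m - 1 * f m)" unfolding excess_def L2_norm_square by simp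
 also have "... = L2_inner M (val h) (val h) - 2 * L2_inner M (val h) f + L2_inner M f f" unfolding L2_diff_square[OF val_L2 f_L2] by simp
 finally show ?thesis by (simp add: inner_pop_op[symmetric] adj[OF f_L2, symmetric] L2_inner_commute[of "val h"] inner_commute)
qed

text \<open>The squared excess is a sum of inner products of h w with its image under
  \<open>pop_op\<close> and with fixed vectors; these are measurable by weak measurability, as
  \<open>pop_op\<close> is symmetric.\<close>

lemma bm_excess:
 assumes h: "bdd_weak N h"
 shows "bdd_meas N (%w. excess (h w))"
proof -
 obtain c where c: "\<forall>w\<in>space N. norm (h w) <= c" using bwm_bound[OF h] by blast
 have wm: "weak_meas N h" by (rule bwm_measurable[OF h])
 have wp: "weak_meas N (%w. pop_op (h w))" unfolding weak_meas_def pop_op_sym using wm by (simp add: weak_meas_def)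
 have "(%w. (excess (h w))^2) \<in> borel_measurable N" unfolding excess_square_inner
  by (intro borel_measurable_add borel_measurable_diff borel_measurable_times borel_measurable_const wm_inner wm wp wm_const)
 hence "(%w. sqrt ((excess (h w))^2)) \<in> borel_measurable N" by measurable
 hence "(%w. excess (h w)) \<in> borel_measurable N" using excess_nonneg by simp
 thus ?thesis
 proof (rule bmI)
  fix w assume "w \<in> space N"
  hence "norm (h w) * B + Y <= c * B + Y" using c B_nonneg by (intro add_right_mono mult_right_mono) auto
  thus "\<bar>excess (h w)\<bar> <= c * B + Y" using excess_le[of "h w"] excess_nonneg[of "h w"] by linarith
 qed
qed

end

text \<open>F is the first-stage \<sigma>-algebra. \<open>emp_in\<close> makes empirical embeddings
  inputs of the model too, so that the Hoelder condition applies to a pair of an empirical and a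
  true embedding.\<close>

locale two_stage_sgd = sgd_sample M v \<phi> val B \<kappa> \<rho> f Y y0 n b T \<eta> \<theta> h0 + Om: prob_space \<Omega>
 for M :: "'g::{real_inner,banach,second_countable_topology} measure" and v :: "nat => 'k::{real_inner,banach}"
  and \<phi> val B \<kappa> \<rho> f Y y0 n b T \<eta> \<theta> h0 and \<Omega> :: "'w measure" +
 fixes F :: "'w measure" and x :: "nat => 'w => 'x::topological_space measure" and y :: "nat => 'w => real"
  and s :: "nat => nat => 'w => 'x" and N :: nat and k :: "'x => 'g" and Bk L \<alpha> :: real
 assumes stage: "!!l. l \<in> {1..n} ==> conditional_embedding \<Omega> F (x l) (s l) N k Bk"
  and holder: "!!m m'. m \<in> space M ==> m' \<in> space M ==> norm (\<phi> m - \<phi> m') <= L * norm (m - m') powr \<alpha>"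
  and alpha: "0 < \<alpha>" "\<alpha> <= 1" and L: "0 < L" and kappa_pos: "0 < \<kappa>"
  and sets_M: "sets M = sets (restrict_space borel (space M))"
  and emp_in: "!!t. (1 / real N) *\<^sub>R (\<Sum>i=1..N. k (t i)) \<in> space M"
  and data_measurable: "(%w'. \<lambda>l\<in>{1..n}. (LINT u|(x l w'). k u, y l w')) \<in> F \<rightarrow>\<^sub>M Pi\<^sub>M {1..n} (%_. \<rho>)"
  and data_law: "distr \<Omega> (Pi\<^sub>M {1..n} (%_. \<rho>)) (%w'. \<lambda>l\<in>{1..n}. (LINT u|(x l w'). k u, y l w')) = Pi\<^sub>M {1..n} (%_. \<rho>)"
begin

abbreviation emb :: "nat => 'w => 'g" where "emb l w' \<equiv> LINT u|(x l w'). k u"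
abbreviation emp :: "nat => 'w => 'g" where "emp l w' \<equiv> (1 / real N) *\<^sub>R (\<Sum>i=1..N. k (s l i w'))"
abbreviation "Dat w' \<equiv> \<lambda>l\<in>{1..n}. (emb l w', y l w')"
abbreviation "Fhat w' l \<equiv> \<phi> (emp l w')"
abbreviation "dev l w' \<equiv> emp l w' - emb l w'"
abbreviation "Pi1 \<equiv> Pi\<^sub>M {1..n} (%_. \<rho>)"

definition z0 where "z0 = (SOME z. z \<in> space \<rho>)"

text \<open>An arbitrary point fills the test coordinate, so that the data becomes a point of
  \<open>sample\<close>. \<open>integral_Dw\<close> is restricted to functions that ignore this
  coordinate.\<close>

definition Dw :: "'w => nat => 'g \<times> real" where
 "Dw w' = (Dat w')(0 := z0)"

lemma z0: "z0 \<in> space \<rho>"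
 unfolding z0_def using R.not_empty by (auto intro: someI)

lemma Dw_l: "l \<in> {1..n} ==> Dw w' l = (emb l w', y l w')"
 by (simp add: Dw_def)

lemma sub: "subalgebra \<Omega> F"
proof -
 interpret C: conditional_embedding \<Omega> F "x 1" "s 1" N k Bk using n by (intro stage) auto
 show ?thesis by (rule C.sub)
qed

lemma N: "N >= 1"
proof -
 interpret C: conditional_embedding \<Omega> F "x 1" "s 1" N k Bk using n by (intro stage) auto
 show ?thesis by (rule C.N)
qed

lemma upd0: "(%(D, z). D(0 := z)) \<in> Pi1 \<Otimes>\<^sub>M \<rho> \<rightarrow>\<^sub>M sample"
 unfolding split_beta by (rule measurable_fun_upd[where J = "{1..n}"]) auto

lemma Dw_F: "Dw \<in> F \<rightarrow>\<^sub>M sample"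
proof -
 have "(%w'. (Dat w', z0)) \<in> F \<rightarrow>\<^sub>M Pi1 \<Otimes>\<^sub>M \<rho>" using data_measurable z0 by measurable
 from measurable_compose[OF this upd0] show ?thesis by (simp add: Dw_def[abs_def])
qed

lemma data_\<Omega>: "Dat \<in> \<Omega> \<rightarrow>\<^sub>M Pi1"
 by (rule measurable_from_subalg[OF sub data_measurable])

lemma space_F: "space F = space \<Omega>"
 using sub by (simp add: subalgebra_def)

lemma Dw_space: "w' \<in> space \<Omega> ==> Dw w' \<in> space sample"
 using measurable_space[OF Dw_F] by (simp add: space_F)

lemma data_point: "l \<in> {1..n} ==> w' \<in> space \<Omega> ==> emb l w' \<in> space M \<and> \<bar>y l w'\<bar> <= Y"
 using sample_space[OF Dw_space, of w' l] label_bound[of "Dw w' l"] by (auto simp: Dw_l)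

lemma bm_Dw: "bdd_meas sample W ==> bdd_meas F (%w'. W (Dw w'))"
 unfolding bdd_meas_def using measurable_space[OF Dw_F] by (auto intro: measurable_compose[OF Dw_F])

lemma integral_Dw:
 assumes W: "bdd_meas sample W" and indep: "!!D z. W (D(0 := z)) = W D"
 shows "(LINT w'|\<Omega>. W (Dw w')) = (LINT D|sample. W D)" (is "?L = ?R")
proof -
 have I: "{0..n} = insert 0 {1..n}" by auto
 have "(%D. (D, z0)) \<in> Pi1 \<rightarrow>\<^sub>M Pi1 \<Otimes>\<^sub>M \<rho>" using z0 by measurable
 from measurable_compose[OF measurable_compose[OF this upd0] bm_measurable[OF W]]
 have m: "(%D. W (D(0 := z0))) \<in> borel_measurable Pi1" by simp
 have "?L = (LINT D|(distr \<Omega> Pi1 Dat). W (D(0 := z0)))" unfolding Dw_def by (rule integral_distr[symmetric, OF data_\<Omega> m])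
 also have "... = (LINT D|Pi1. W (D(0 := z0)))" unfolding data_law ..
 also have "... = (LINT D|Pi1. (LINT z|\<rho>. W (D(0 := z))))" unfolding indep by (simp add: R.prob_space)
 also have "... = ?R" unfolding I by (rule S.product_integral_insert[symmetric]) (use S.P.bm_integrable[OF W] I in auto)
 finally show ?thesis .
qed

lemma AE_Dw_feat: "AE w' in \<Omega>. \<forall>l\<in>{1..n}. (norm (feat (Dw w') l))^2 <= \<kappa>^2"
proof (intro AE_ball_countable[THEN iffD2] ballI)
 fix l assume l: "l \<in> {1..n}"
 have c: "(%D. D l) \<in> Pi1 \<rightarrow>\<^sub>M \<rho>" by (rule measurable_component_singleton[OF l])
 have "distr Pi1 \<rho> (%D. D l) = \<rho>" by (rule distr_PiM_component) (use l in \<open>auto intro: R.prob_space_axioms\<close>)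
 hence "distr Pi1 M (%D. fst (D l)) = M" using distr_distr[OF fst_measurable c] by (simp add: marginal o_def)
 hence "AE m in distr Pi1 M (%D. fst (D l)). (norm (\<phi> m))^2 <= \<kappa>^2" using feature_AE by (simp only:)
 hence "AE D in Pi1. (norm (\<phi> (fst (D l))))^2 <= \<kappa>^2" by (rule AE_distrD[OF measurable_compose[OF c fst_measurable]])
 hence "AE D in distr \<Omega> Pi1 Dat. (norm (\<phi> (fst (D l))))^2 <= \<kappa>^2" by (simp only: data_law)
 hence "AE w' in \<Omega>. (norm (\<phi> (fst (Dat w' l))))^2 <= \<kappa>^2" by (rule AE_distrD[OF data_\<Omega>])
 thus "AE w' in \<Omega>. (norm (feat (Dw w') l))^2 <= \<kappa>^2" using l by (simp add: Dw_l)
qed simp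

lemma emp_measurable:
 assumes "!!l i. l \<in> {1..n} ==> i \<in> {1..N} ==> s l i \<in> H \<rightarrow>\<^sub>M borel" "l \<in> {1..n}"
 shows "emp l \<in> H \<rightarrow>\<^sub>M M"
proof -
 interpret C: conditional_embedding \<Omega> F "x l" "s l" N k Bk by (rule stage[OF assms(2)])
 have "(%w'. k (s l i w')) \<in> borel_measurable H" if "i \<in> {1..N}" for i by (rule measurable_compose[OF assms(1)[OF assms(2) that] C.k_borel])
 hence emp: "emp l \<in> borel_measurable H" by (intro borel_measurable_scaleR borel_measurable_sum) auto
 show ?thesis unfolding measurable_cong_sets[OF refl sets_M] by (rule measurable_restrict_space2[OF _ emp]) (intro funcsetI emp_in)
qed

lemma bwm_Fhat:
 assumes "!!l i. l \<in> {1..n} ==> i \<in> {1..N} ==> s l i \<in> H \<rightarrow>\<^sub>M borel" "l \<in> {1..n}"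
 shows "bdd_weak H (%w'. Fhat w' l)"
 by (rule bwmI[where c = B, OF wm_compose[OF wm_feature emp_measurable[OF assms]]]) (assumption | rule feature_bound[OF emp_in])+

lemma draws: "l \<in> {1..n} ==> i \<in> {1..N} ==> s l i \<in> \<Omega> \<rightarrow>\<^sub>M borel"
proof -
 assume l: "l \<in> {1..n}" and i: "i \<in> {1..N}"
 interpret C: conditional_embedding \<Omega> F "x l" "s l" N k Bk by (rule stage[OF l])
 show ?thesis by (rule C.draw_measurable[OF i])
qed

abbreviation "final w' J \<equiv> excess (tail_average T (fsgd b \<eta> (Fhat w') (%l. y l w') J h0))"

lemma bm_final:
 assumes "!!l i. l \<in> {1..n} ==> i \<in> {1..N} ==> s l i \<in> H \<rightarrow>\<^sub>M borel" "space H = space \<Omega>"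
  and "!!l. l \<in> {1..n} ==> y l \<in> borel_measurable H" and J: "J \<in> seqs n (b * T)"
 shows "bdd_meas H (%w'. final w' J)"
proof -
 have bmy: "bdd_meas H (y l)" if "l \<in> {1..n}" for l using data_point[OF that] assms(2) by (intro bmI[OF assms(3)[OF that]]) auto
 have "bdd_weak H (%w'. fsgd b \<eta> (Fhat w') (%l. y l w') J h0 t)" if "t <= T" for t
  by (rule bwm_fsgd[OF bwm_Fhat[OF assms(1)] bmy seqs_block[OF J that]])
 thus ?thesis unfolding tail_average_def by (intro bm_excess bwm_scaleR bm_const bwm_sum) auto
qed

lemma y_measurable: "l \<in> {1..n} ==> y l \<in> borel_measurable \<Omega>"
proof -
 assume l: "l \<in> {1..n}"
 have "(%w'. snd (Dat w' l)) \<in> borel_measurable \<Omega>"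
  by (rule measurable_compose[OF measurable_compose[OF data_\<Omega> measurable_component_singleton[OF l]] snd_measurable])
 thus ?thesis using l by simp
qed

text \<open>Splitting at u^2 = 1/N gives a bound that is affine in u^2 and of order N^(-\<alpha>)
  when u^2 is of order 1/N. An affine bound can be integrated against the weights of
  \<open>dev_square_bound\<close>.\<close>

lemma powr_two_alpha_le:
 assumes "0 <= u"
 shows "(u powr \<alpha>)^2 <= real N powr (1 - \<alpha>) * u^2 + real N powr (- \<alpha>)"
proof (cases "u = 0")
 case False
 hence u: "u > 0" using assms by simp
 have e: "(u powr \<alpha>)^2 = (u^2) powr \<alpha>" using u by (simp add: power2_eq_square powr_mult)
 have N0: "real N > 0" using N by simp
 show ?thesis
 proof (cases "u^2 <= 1 / real N")
  case True
  have "(u^2) powr \<alpha> <= (1 / real N) powr \<alpha>" using True alpha u by (intro powr_mono2) auto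
  also have "... = real N powr (- \<alpha>)" using N0 by (simp add: powr_divide powr_minus_divide)
  finally show ?thesis unfolding e by (simp add: add_increasing)
 next
  case False
  hence "(u^2) powr (\<alpha> - 1) <= (1 / real N) powr (\<alpha> - 1)" using alpha N0 by (intro powr_mono2') auto
  also have "... = real N powr (1 - \<alpha>)" using N0 powr_minus_divide[of "real N" "\<alpha> - 1"] by (simp add: powr_divide)
  finally have "u^2 * (u^2) powr (\<alpha> - 1) <= u^2 * real N powr (1 - \<alpha>)" by (intro mult_left_mono) auto
  also have "u^2 * (u^2) powr (\<alpha> - 1) = (u^2) powr \<alpha>" using u powr_add[of "u^2" 1 "\<alpha> - 1"] by simp
  finally show ?thesis unfolding e by (simp add: add_increasing2 mult.commute)
 qed
qed (use alpha in simp)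

definition G :: "'w => real" where
 "G w' = avg n (%l. L^2 * (real N powr (1 - \<alpha>) * (norm (dev l w'))^2 + real N powr (- \<alpha>)))"

lemma gap_le_G:
 assumes w': "w' \<in> space \<Omega>"
 shows "gap (Fhat w') (Dw w') <= G w'"
 unfolding gap_def G_def
proof (intro mult_left_mono sum_mono)
 let ?X = "%l. L^2 * (real N powr (1 - \<alpha>) * (norm (dev l w'))^2 + real N powr (- \<alpha>))"
 let ?U = "%l. norm (Fhat w' l - feat (Dw w') l)"
 fix l assume l: "l \<in> {1..n}"
 have "?U l <= L * norm (dev l w') powr \<alpha>" using holder[OF emp_in, of "emb l w'" "%i. s l i w'"] data_point[OF l w'] l by (simp add: Dw_l)
 hence "(?U l)^2 <= (L * norm (dev l w') powr \<alpha>)^2" by (rule power_mono) simp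
 also have "... <= ?X l" unfolding power_mult_distrib by (intro mult_left_mono powr_two_alpha_le) auto
 finally show "(?U l)^2 <= ?X l" .
qed simp

lemma dev_eq: "conditional_embedding.dev (x l) (s l) N k = dev l" if "l \<in> {1..n}"
 using conditional_embedding.dev_def[OF stage[OF that]] by (simp add: fun_eq_iff)

lemma bm_dev: "l \<in> {1..n} ==> bdd_meas \<Omega> (%w'. norm (dev l w'))"
 using conditional_embedding.bm_norm_dev[OF stage] by (simp add: dev_eq)

lemma bm_G: "bdd_meas \<Omega> G"
 unfolding G_def[abs_def] by (intro bm_mult bm_const bm_sum bm_add bm_power bm_dev)

text \<open>The constant is 8 (1 + Bk^2) from \<open>dev_square_bound\<close> plus 1 from the
  additive term of \<open>powr_two_alpha_le\<close>.\<close>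

abbreviation "gap_rate \<equiv> L^2 * (9 + 8 * Bk^2) * real N powr (- \<alpha>)"

lemma integral_G:
 assumes W: "bdd_meas sample W" "!!D. 0 <= W D" and indep: "!!D z. W (D(0 := z)) = W D"
 shows "(LINT w'|\<Omega>. G w' * W (Dw w')) <= gap_rate * (LINT D|sample. W D)"
proof -
 let ?w = "%w'. W (Dw w')"
 have bF: "bdd_meas F ?w" by (rule bm_Dw[OF W(1)])
 have bw: "bdd_meas \<Omega> ?w" by (rule measurable_ident_subalgebra[OF sub bF])
 define I where "I = (LINT w'|\<Omega>. ?w w')"
 have I: "I = (LINT D|sample. W D)" unfolding I_def by (rule integral_Dw[OF W(1) indep])
 have I0: "0 <= I" unfolding I_def by (intro integral_nonneg_AE AE_I2 W(2))
 let ?c = "L^2 * real N powr (1 - \<alpha>)" and ?d = "L^2 * real N powr (- \<alpha>)"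
 have bl: "bdd_meas \<Omega> (%w'. ?w w' * (norm (dev l w'))^2)" if "l \<in> {1..n}" for l using that by (intro bm_mult bw bm_power bm_dev)
 have one: "(LINT w'|\<Omega>. ?c * (?w w' * (norm (dev l w'))^2) + ?d * ?w w') <= gap_rate * I" if l: "l \<in> {1..n}" for l
 proof -
  have "(LINT w'|\<Omega>. ?w w' * (norm (dev l w'))^2) <= 8 * (1 + Bk^2) / real N * I"
   using conditional_embedding.dev_square_bound[OF stage[OF l] bF W(2)] unfolding dev_eq[OF l] I_def .
  hence "?c * (LINT w'|\<Omega>. ?w w' * (norm (dev l w'))^2) + ?d * I <= ?c * (8 * (1 + Bk^2) / real N * I) + ?d * I"
   by (intro add_right_mono mult_left_mono) auto
  also have "?c * (8 * (1 + Bk^2) / real N * I) = ?d * (8 * (1 + Bk^2) * I)"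
   using N powr_diff[of "real N" "- \<alpha>" "- 1"] by (simp add: powr_minus_divide powr_diff field_simps)
  finally show ?thesis using Om.bm_integrable[OF bl[OF l]] Om.bm_integrable[OF bw] by (simp add: I_def[symmetric] algebra_simps)
 qed
 have "(LINT w'|\<Omega>. G w' * ?w w') = (LINT w'|\<Omega>. avg n (%l. ?c * (?w w' * (norm (dev l w'))^2) + ?d * ?w w'))" by (intro bochner_cong refl)
   (simp only: G_def mult.assoc sum_distrib_right, simp add: algebra_simps)
 also have "... = avg n (%l. (LINT w'|\<Omega>. ?c * (?w w' * (norm (dev l w'))^2) + ?d * ?w w'))" unfolding integral_mult_right_zero
  by (intro arg_cong[where f = "%u. _ * u"] bochner_sum Om.bm_integrable bm_add bm_mult bm_const bw bm_power bm_dev)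
 also have "... <= gap_rate * I" by (rule mean_le[OF n one])
 finally show ?thesis unfolding I .
qed

lemma bm_mean_norm: "bdd_meas sample mean_norm"
 unfolding mean_norm_def[abs_def] by (intro bm_mult bm_const bm_sum bm_add bm_av bm_power bm_norm bwm_iters(3)) auto

lemma bm_mean_excess: "bdd_meas sample mean_excess"
 unfolding mean_excess_def[abs_def] by (intro bm_mult bm_const bm_sum bm_av bm_excess_iter) auto

lemma test_point_free:
 "mean_norm (D(0 := z)) = mean_norm D" "mean_excess (D(0 := z)) = mean_excess D" "plev (D(0 := z)) = plev D"
proof goal_cases
 case 1 show ?case unfolding mean_norm_def by (intro arg_cong[where f = "%u. _ * u"] sum.cong refl arg_cong2[where f = "(+)"] av_cong)
   (simp only: iter_test_point lessThan_iff less_imp_le)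
 case 2 show ?case unfolding mean_excess_def by (intro arg_cong[where f = "%u. _ * u"] sum.cong refl av_cong) (simp only: iter_test_point atMost_iff)
 case 3 have "emp_op n (feat (D(0 := z))) = emp_op n (feat D)" by (auto simp: emp_op_def)
 thus ?case by (simp add: plev_def leverage_def)
qed

lemma integral_mean_norm:
 assumes Ne: "(%k. v k \<bullet> pop_op (resolvent pop_op \<theta> (v k))) sums Ne"
 shows "(LINT D|sample. mean_norm D) <= 16000 * \<kappa>^2 * rate w Ne / \<theta> + 2 * Y^2" (is "?L <= ?R")
proof -
 let ?X = "?R"
 let ?U = "%D t. %J. (norm (iter D J t))^2"
 have bm: "bdd_meas sample (%D. AV (?U D t))" if "t < T" for t using that by (intro bm_av bm_power bm_norm bwm_iters(3)) auto
 have le: "(LINT D|sample. 16 * \<kappa>^2 * AV (?U D t) + 2 * Y^2) <= ?X" if t: "t < T" for t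
 proof -
  have "(LINT D|sample. AV (?U D t)) <= 1000 * rate w Ne / \<theta>"
   using iter_norm_bound[OF Ne, of t w] t theta_pos by (simp add: pos_le_divide_eq mult.commute)
  hence "16 * \<kappa>^2 * (LINT D|sample. AV (?U D t)) <= 16 * \<kappa>^2 * (1000 * rate w Ne / \<theta>)" by (intro mult_left_mono) auto
  thus ?thesis using S.P.bm_integrable[OF bm[OF t]] S.P.prob_space by simp
 qed
 have "?L = (1 / real T) * (\<Sum>t<T. (LINT D|sample. 16 * \<kappa>^2 * AV (?U D t) + 2 * Y^2))" unfolding mean_norm_def integral_mult_right_zero
  by (intro arg_cong[where f = "%u. _ * u"] bochner_sum S.P.bm_integrable bm_add bm_mult bm_const bm) auto
 also have "... <= (1 / real T) * (\<Sum>t<T. ?X)" by (intro mult_left_mono sum_mono le) auto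
 also have "... = ?X" using T by (simp only: sum_constant card_lessThan) simp
 finally show ?thesis .
qed

text \<open>One integrable majorant covers two cases: the stability bound for perturbed features
  near the true ones, plus the crude bound times the number of embeddings that deviate by more than
  \<zeta>. The gap is not independent of leverage and norms of the first stage, so their products
  are integrated by conditioning.\<close>

lemma two_stage_bound:
 assumes Ne: "(%k. v k \<bullet> pop_op (resolvent pop_op \<theta> (v k))) sums Ne"
  and a: "0 < a" "a <= 1" and \<epsilon>: "0 < \<epsilon>"
  and cells: "cell_partition k \<tau> p t A" "0 < \<beta>" "\<beta> <= 2" "2 * \<tau> + real p * (\<beta> * Bk) <= \<zeta>"
  and \<zeta>: "0 < \<zeta>" "L * \<zeta> powr \<alpha> <= 2 / 5 * \<kappa>"
 shows "(LINT w'|\<Omega>. AV (%J. final w' J)) <= \<epsilon> + 1000 * rate w Ne / \<epsilon> + Y / real T + 4 * a * Ne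
  + 4 * gap_rate * Ne / \<theta> + 96 * gap_rate * (16000 * \<kappa>^2 * rate w Ne / \<theta> + 2 * Y^2) / (a * \<theta>)
  + real n * (2 * real p * exp (- (real N * \<beta>^2 / 4))) * (2 * (exp (B^2 / \<theta>) * (norm h0 + B * Y / \<theta>) * B + Y) + Y)"
proof -
 let ?X = "2 * real p * exp (- (real N * \<beta>^2 / 4))"
 let ?U = "gap_rate * (16000 * \<kappa>^2 * rate w Ne / \<theta> + 2 * Y^2)"
 let ?V = "%bad. LINT w'|\<Omega>. (\<Sum>l=1..n. indicator (bad l) w')"
 let ?S = "\<epsilon> + Y / real T"
 let ?A = "%w'. AV (%J. final w' J)"
 let ?E = "LINT w'|\<Omega>. G w' * plev (Dw w')"
 let ?Z = "LINT w'|\<Omega>. G w' * mean_norm (Dw w')"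
 let ?W = "LINT w'|\<Omega>. plev (Dw w')"
 define Big where "Big = 2 * (exp (B^2 / \<theta>) * (norm h0 + B * Y / \<theta>) * B + Y) + Y"
 have Big0: "0 <= Big" unfolding Big_def using B_nonneg Y_nonneg theta_pos by (intro add_nonneg_nonneg mult_nonneg_nonneg divide_nonneg_nonneg) auto
 define bad where "bad = (%l. {w' \<in> space \<Omega>. norm (dev l w') > \<zeta>})"
 have bad_ev: "bad l \<in> Om.events" if "l \<in> {1..n}" for l unfolding bad_def using bm_measurable[OF bm_dev[OF that]] by measurable
 have prob_bad: "Om.prob (bad l) <= ?X" if l: "l \<in> {1..n}" for l
  using conditional_embedding.dev_tail_cells[OF stage[OF l] cells] unfolding dev_eq[OF l] bad_def .
 let ?H = "%w'. ?S + 1 / \<epsilon> * mean_excess (Dw w') + 2 * a * plev (Dw w')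
  + 2 / \<theta> * (G w' * plev (Dw w')) + 96 / (a * \<theta>) * (G w' * mean_norm (Dw w'))
  + Big * (\<Sum>l=1..n. indicator (bad l) w')"
 note bD = measurable_ident_subalgebra[OF sub bm_Dw]
 note bms = bD[OF bm_mean_excess] bD[OF bm_plev] bD[OF bm_mean_norm] bm_G
 have b_bad: "bdd_meas \<Omega> (indicator (bad l) :: 'w => real)" if "l \<in> {1..n}" for l
  using bad_ev[OF that] by (intro bmI[where c = 1]) (auto simp: indicator_def)
 have bfin: "bdd_meas \<Omega> (%w'. ?A w')" by (intro bm_av bm_final draws y_measurable refl)
 have mnn: "0 <= mean_norm D" "0 <= mean_excess D" for D
  unfolding mean_norm_def mean_excess_def by (intro mult_nonneg_nonneg sum_nonneg add_nonneg_nonneg av_nonneg; simp)+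
 have G0: "0 <= G w'" for w' unfolding G_def by (intro mult_nonneg_nonneg sum_nonneg add_nonneg_nonneg) auto
 have "(LINT w'|\<Omega>. ?A w') <= (LINT w'|\<Omega>. ?H w')"
 proof (intro integral_mono_AE Om.bm_integrable bfin bm_add bm_mult bm_const bms bm_sum b_bad)
  show "AE w' in \<Omega>. ?A w' <= ?H w'" using AE_Dw_feat AE_space
  proof eventually_elim
   case (elim w')
   note w' = elim(2)
   have lab: "\<bar>label (Dw w') l\<bar> <= Y" if "l \<in> {1..n}" for l using data_point[OF that w'] that by (simp add: Dw_l)
   show ?case
   proof (cases "\<exists>l\<in>{1..n}. w' \<in> bad l")
    case True
    then obtain l where l: "l \<in> {1..n}" "w' \<in> bad l" by blast
    have "?A w' <= AV (%J. Big)" unfolding Big_def using data_point[OF _ w'] by (intro av_mono excess_crude feature_bound emp_in) auto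
    also have "... = Big" by (rule av_const[OF n])
    also have "... <= Big * (\<Sum>l=1..n. indicator (bad l) w')"
    proof -
     have "indicator (bad l) w' <= (\<Sum>l=1..n. indicator (bad l) w' :: real)" by (rule member_le_sum[OF l(1)]) auto
     thus ?thesis using mult_left_mono[OF _ Big0, of 1] l(2) by simp
    qed
    also have "... <= ?H w'"
    proof -
     have "0 <= ?S + 1 / \<epsilon> * mean_excess (Dw w') + 2 * a * plev (Dw w')
      + 2 / \<theta> * (G w' * plev (Dw w')) + 96 / (a * \<theta>) * (G w' * mean_norm (Dw w'))"
      using \<epsilon> a theta_pos Y_nonneg mnn G0 plev_nonneg by (intro add_nonneg_nonneg mult_nonneg_nonneg divide_nonneg_nonneg) auto
     thus ?thesis by linarith
    qed
    finally show ?thesis .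
   next
    case False
    \<comment> \<open>The tolerance 2/5 is chosen such that (1 + 2/5)^2 = 49/25 \<le> 2.\<close>
    have Fh: "(norm (Fhat w' l))^2 <= 2 * \<kappa>^2" if l: "l \<in> {1..n}" for l
    proof -
     have "norm (dev l w') <= \<zeta>" using False l w' by (auto simp: bad_def not_less)
     hence "norm (dev l w') powr \<alpha> <= \<zeta> powr \<alpha>" using alpha by (intro powr_mono2) auto
     hence "L * norm (dev l w') powr \<alpha> <= L * \<zeta> powr \<alpha>" using L by (intro mult_left_mono) auto
     hence "norm (Fhat w' l - feat (Dw w') l) <= 2 / 5 * \<kappa>"
      using holder[OF emp_in, of "emb l w'" "%i. s l i w'"] data_point[OF l w'] \<zeta>(2) l by (simp add: Dw_l)
     moreover have "norm (feat (Dw w') l) <= \<kappa>" using elim(1) l kappa by (auto intro: power2_le_imp_le)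
     ultimately have "norm (Fhat w' l) <= 7 / 5 * \<kappa>" using norm_triangle_ineq[of "Fhat w' l - feat (Dw w') l" "feat (Dw w') l"] by simp
     hence "(norm (Fhat w' l))^2 <= (7 / 5 * \<kappa>)^2" by (intro power_mono) auto
     also have "... <= 2 * \<kappa>^2" by (simp add: power_mult_distrib power_divide)
     finally show ?thesis .
    qed
    have "?A w' = AV (%J. excess (tail_average T (perturbed (Fhat w') (Dw w') J)))"
    proof (rule av_cong, goal_cases)
     case (1 J) note J = 1
     have "fsgd b \<eta> (Fhat w') (%l. y l w') J h0 t = perturbed (Fhat w') (Dw w') J t" if "t <= T" for t
      by (rule fsgd_label_cong[OF seqs_block[OF J that]]) (auto simp: Dw_l)
     thus ?case unfolding tail_average_def by (intro arg_cong[where f = excess] arg_cong[where f = "%u. _ *\<^sub>R u"] sum.cong refl) auto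
    qed
    also have "... <= \<epsilon> + mean_excess (Dw w') / \<epsilon> + Y / real T + (2 * a * plev (Dw w')
     + 2 * gap (Fhat w') (Dw w') * plev (Dw w') / \<theta> + 96 * gap (Fhat w') (Dw w') * mean_norm (Dw w') / (a * \<theta>))"
     using elim(1) by (intro tail_excess_bound a \<epsilon> Fh lab) auto
    also have "... <= \<epsilon> + mean_excess (Dw w') / \<epsilon> + Y / real T + (2 * a * plev (Dw w')
     + 2 * G w' * plev (Dw w') / \<theta> + 96 * G w' * mean_norm (Dw w') / (a * \<theta>))"
     using a theta_pos by (intro add_left_mono add_mono divide_right_mono mult_right_mono mult_left_mono gap_le_G[OF w']
       plev_nonneg mnn) auto
    also have "... <= ?H w'"
    proof -
     have "0 <= Big * (\<Sum>l=1..n. indicator (bad l) w')" using Big0 by (intro mult_nonneg_nonneg sum_nonneg) auto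
     thus ?thesis by (simp add: mult.assoc)
    qed
    finally show ?thesis .
   qed
  qed
 qed
 also have "... = ?S + 1 / \<epsilon> * (LINT w'|\<Omega>. mean_excess (Dw w')) + 2 * a * ?W
  + 2 / \<theta> * ?E + 96 / (a * \<theta>) * ?Z
  + Big * (?V bad)"
 proof -
  have affine: "(LINT w'|\<Omega>. c + c1 * f1 w' + c2 * f2 w' + c3 * f3 w' + c4 * f4 w' + c5 * f5 w')
   = c + c1 * (LINT w'|\<Omega>. f1 w') + c2 * (LINT w'|\<Omega>. f2 w') + c3 * (LINT w'|\<Omega>. f3 w') + c4 * (LINT w'|\<Omega>. f4 w') + c5 * (LINT w'|\<Omega>. f5 w')"
   if "bdd_meas \<Omega> f1" "bdd_meas \<Omega> f2" "bdd_meas \<Omega> f3" "bdd_meas \<Omega> f4" "bdd_meas \<Omega> f5" for c c1 c2 c3 c4 c5 :: real and f1 f2 f3 f4 f5 :: "'w => real"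
   using that[THEN Om.bm_integrable] Om.prob_space by simp
  show ?thesis by (rule affine) (intro bms bm_mult bm_sum b_bad)+
 qed
 also have "... <= ?S + 1 / \<epsilon> * (1000 * rate w Ne) + 2 * a * (2 * Ne)
  + 2 / \<theta> * (gap_rate * (2 * Ne)) + 96 / (a * \<theta>) * (?U)
  + Big * (real n * (?X))"
 proof (intro add_mono mult_left_mono order_refl, goal_cases)
  case 1 have gr: "0 <= gap_rate" by simp
  show ?case unfolding integral_Dw[OF bm_mean_excess test_point_free(2)] unfolding mean_excess_def by (rule iter_excess_bound[OF Ne])
  show "?W <= 2 * Ne" using integral_plev[OF Ne] integral_Dw[OF bm_plev test_point_free(3)] by simp
  show "?E <= gap_rate * (2 * Ne)"
   using integral_G[OF bm_plev plev_nonneg test_point_free(3)] mult_left_mono[OF integral_plev[OF Ne] gr] by linarith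
  show "?Z <= ?U" using integral_G[OF bm_mean_norm mnn(1) test_point_free(1)] mult_left_mono[OF integral_mean_norm[OF Ne, of w] gr] by linarith
  have "(?V bad) = (\<Sum>l=1..n. Om.prob (bad l))" using bad_ev by (subst bochner_sum)
    (auto intro!: Om.bm_integrable b_bad sum.cong simp: Int_absorb1 sets.sets_into_space)
  also have "... <= (\<Sum>l=1..n. ?X)" by (intro sum_mono prob_bad)
  finally show "(?V bad) <= real n * (?X)" by simp
 qed (use a \<epsilon> theta_pos Big0 in auto)
 finally have fin: "(LINT w'|\<Omega>. ?A w') <= ?S + 1 / \<epsilon> * (1000 * rate w Ne) + 2 * a * (2 * Ne)
  + 2 / \<theta> * (gap_rate * (2 * Ne)) + 96 / (a * \<theta>) * (?U)
  + Big * (real n * (?X))" .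
 have "(\<epsilon> + u) + 1 / \<epsilon> * r + 2 * a * (2 * Ne) + 2 / \<theta> * (g * (2 * Ne)) + 96 / (a * \<theta>) * (g * m) + c * q
  = \<epsilon> + r / \<epsilon> + u + 4 * a * Ne + 4 * g * Ne / \<theta> + 96 * g * m / (a * \<theta>) + q * c" for u r g m c q
  by (simp add: mult_ac)
 from fin[unfolded this] show ?thesis unfolding Big_def .
qed

end

section \<open>Choice of the parameters\<close>

lemma powr_small:
 fixes c s e :: real
 assumes "s > 0" "e > 0"
 shows "eventually (%u. c * u powr s <= e) (at_right 0)"
proof -
 have "((%u. c * u powr s) \<longlongrightarrow> c * 0) (at_right 0)" using assms by (intro tendsto_mult tendsto_const tendsto_zero_powrI[where b = s])
   (auto intro: tendsto_ident_at eventually_at_right_less simp: eventually_at_filter)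
 hence "eventually (%u. c * u powr s < e) (at_right 0)" using assms by (intro order_tendstoD(2)) auto
 thus ?thesis by eventually_elim simp
qed

text \<open>The event of probability \<open>exp (- k u\<^bsup>-2\<^esup>)\<close> absorbs an iterate of size \<open>exp (K u\<^bsup>-1\<^esup>)\<close>.\<close>

lemma gaussian_small:
 fixes K k r e c0 c1 c2 :: real
 assumes "k > 0" "e > 0" "K >= 0" "c0 >= 0" "c1 >= 0" "c2 >= 0" "r <= 1"
 shows "eventually (%u. u powr (-2) * (c0 * exp (- (k * u powr (-2)))) * (c1 * exp (K / u) / u + c2) <= e * u powr r) (at_right 0)"
proof -
 let ?z = "\<lambda>u::real. 1 / u"
 define c where "c = c0 * (c1 + c2) + 1"
 have c: "c > 0" using assms by (auto simp: c_def intro!: add_nonneg_pos)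
 have "((\<lambda>z::real. z ^ 4 * exp (- z)) \<longlongrightarrow> 0) at_top" by real_asymp
 hence "eventually (\<lambda>z::real. z ^ 4 * exp (- z) < e / c) at_top" using assms c by (intro order_tendstoD(2)) auto
 moreover have "eventually (\<lambda>z::real. z >= max 1 ((K + 1) / k)) at_top" by (rule eventually_ge_at_top)
 ultimately have "eventually (\<lambda>z::real. z ^ 4 * exp (- z) < e / c \<and> z >= max 1 ((K + 1) / k)) at_top" by eventually_elim simp
 hence "eventually (%u. ?z u ^ 4 * exp (- ?z u) < e / c \<and> ?z u >= max 1 ((K + 1) / k)) (at_right 0)"
  using filterlim_inverse_at_top_right unfolding filterlim_iff by (auto simp: inverse_eq_divide)
 moreover have "eventually (\<lambda>u::real. u > 0) (at_right 0)" by (rule eventually_at_right_less)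
 ultimately show ?thesis
 proof eventually_elim
  case (elim u)
  define z where "z = 1 / u"
  have z: "z >= 1" "z >= (K + 1) / k" "z ^ 4 * exp (- z) < e / c" "z > 0" using elim by (auto simp: z_def)
  have u: "u = 1 / z" using elim by (simp add: z_def)
  have p2: "u powr (-2) = z^2" using elim(2) powr_realpow[of u 2] by (simp add: z_def powr_minus power_divide inverse_eq_divide)
  have kz: "K * z - k * z^2 <= - z"
  proof -
   have "(K + 1) <= k * z" using z(2) assms(1) by (simp add: field_simps)
   hence "(K + 1) * z <= k * z * z" using z(4) by (intro mult_right_mono) auto
   thus ?thesis by (simp add: power2_eq_square algebra_simps)
  qed
  have "c1 * exp (K / u) / u + c2 <= (c1 + c2) * (exp (K * z) * z)"
  proof -
   have "1 * 1 <= exp (K * z) * z" using z assms by (intro mult_mono) auto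
   hence "c2 * 1 <= c2 * (exp (K * z) * z)" using assms by (intro mult_left_mono) auto
   moreover have "c1 * exp (K / u) / u = c1 * (exp (K * z) * z)" using z(4) by (simp add: u)
   ultimately show ?thesis by (simp add: distrib_right)
  qed
  hence "u powr (-2) * (c0 * exp (- (k * u powr (-2)))) * (c1 * exp (K / u) / u + c2)
   <= z^2 * (c0 * exp (- (k * z^2))) * ((c1 + c2) * (exp (K * z) * z))"
   unfolding p2 using assms by (intro mult_left_mono) auto
  also have "... = (c0 * (c1 + c2)) * (z ^ 3 * exp (K * z - k * z^2))" by (simp add: exp_diff exp_minus field_simps power2_eq_square power3_eq_cube)
  also have "... <= c * (z ^ 3 * exp (- z))" using kz z assms by (intro mult_mono) (auto simp: c_def)
  also have "... = c * (z ^ 4 * exp (- z)) * u" using z(4) by (simp add: u power_Suc numeral_eq_Suc)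
  also have "... <= e * u" using z(3) c elim(2) by (intro mult_right_mono) (auto simp: pos_less_divide_eq mult.commute intro: less_imp_le)
  also have "... <= e * u powr r"
  proof -
   have "u <= 1" using z(1) by (simp add: u)
   hence "u powr 1 <= u powr r" using elim(2) assms by (intro powr_mono') auto
   thus ?thesis using assms elim(2) by (intro mult_left_mono) auto
  qed
  finally show ?case .
 qed
qed

text \<open>
 The choices \<open>\<epsilon> = \<sigma> u\<^bsup>r\<^esup>\<close> and \<open>a = \<sigma> u\<^bsup>(1 + \<nu>)/2\<^esup>\<close> balance the terms of the two-stage bound; all
 of them are then \<open>O(\<sigma> u\<^bsup>r\<^esup>)\<close> or \<open>o(u\<^bsup>r\<^esup>)\<close>.
\<close>

definition stage_total where
 "stage_total (\<alpha> :: real) \<kappa> Y H B k g p \<theta> Ne E \<eta>b n T N \<epsilon> a = (let \<psi> = E + \<theta> * H^2 + Y^2 * (Ne / n + \<eta>b * \<kappa>^2); G = g * N powr (- \<alpha>) in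
  \<epsilon> + 1000 * \<psi> / \<epsilon> + Y / T + 4 * a * Ne + 4 * G * Ne / \<theta> + 96 * G * (16000 * \<kappa>^2 * \<psi> / \<theta> + 2 * Y^2) / (a * \<theta>)
  + n * (2 * p * exp (- (N * k))) * (2 * (exp (B^2 / \<theta>) * (H + B * Y / \<theta>) * B + Y) + Y))"

text \<open>E stands for squared excess plus penalty of the comparison vector, \<eta>b for \<eta>/b,
  and l for R^2/(M^2 log^q n), which is 1/(n u). The condition l \<le> l0 is what the logarithm
  provides.\<close>

definition regime where
 "regime (r :: real) \<nu> \<alpha> c1 c2 c3 c\<nu> \<tau> l0 u \<theta> Ne E \<eta>b n T N l \<longleftrightarrow>
  c1 * u <= \<theta> \<and> \<theta> <= c2 * u \<and> 0 <= Ne \<and> Ne <= c\<nu> * \<theta> powr (- \<nu>) \<and> 0 <= \<eta>b \<and> \<eta>b <= c3 * u powr (2 * r + \<nu>) \<and>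
  0 < n \<and> 1 / n = u * l \<and> l <= l0 \<and> n <= u powr (-2) \<and> 0 < T \<and> 1 / T <= 2 * u \<and> u powr (- ((3 - 2 * r) / \<alpha>)) <= N \<and>
  0 <= E \<and> E <= \<tau> * \<theta> powr (2 * r)"

text \<open>Terms of order \<sigma> u^r have their constants collected in D, and \<sigma> =
  \<delta>/(2 D) makes them \<delta>/2 in total. The other four are o(u^r) and receive \<delta>/8
  each. Source condition and logarithm supply the small factors \<tau> and l0 by which \<psi> \<le>
  \<sigma>^2 u^(2r).\<close>

lemma balance:
 fixes r \<nu> \<alpha> \<delta> c1 c2 c3 c\<nu> \<kappa> Y H B k g p :: real
 assumes r: "0 < r" "0 < \<nu>" "2 * r + \<nu> <= 1" and \<alpha>: "0 < \<alpha>" "\<alpha> <= 1" and \<delta>: "0 < \<delta>"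
  and c: "0 < c1" "0 < c2" "0 < c3" "0 <= c\<nu>" and pos: "0 <= Y" "0 <= H" "0 <= B" "0 < k" "0 <= g" "0 <= p"
 shows "\<exists>\<tau>>0. \<exists>l0>0. eventually (%u. \<forall>\<theta> Ne E \<eta>b n T N l. regime r \<nu> \<alpha> c1 c2 c3 c\<nu> \<tau> l0 u \<theta> Ne E \<eta>b n T N l -->
  (\<exists>\<epsilon> a. 0 < \<epsilon> \<and> 0 < a \<and> a <= 1 \<and> stage_total \<alpha> \<kappa> Y H B k g p \<theta> Ne E \<eta>b n T N \<epsilon> a <= \<delta> * u powr r)) (at_right 0)"
  (is "\<exists>\<tau>>0. \<exists>l0>0. eventually (%u. ?Q \<tau> l0 u) _")
proof -
 define C1 where "C1 = c\<nu> * c1 powr (- \<nu>)"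
 have C1: "0 <= C1" using c by (simp add: C1_def)
 define D where "D = 1001 + 4 * C1 + 1536000 * g * \<kappa>^2 / c1^2"
 have D: "D > 0" using C1 pos c by (auto simp: D_def intro!: add_pos_nonneg)
 define \<sigma> where "\<sigma> = \<delta> / (2 * D)"
 have \<sigma>: "\<sigma> > 0" using \<delta> D by (simp add: \<sigma>_def)
 \<comment> \<open>Shares of \<sigma>^2 u^(2r) in \<psi>: one half for E, and one sixth each for the
   initial vector, the variance (through l0) and the mini-batch noise.\<close>
 define \<tau> where "\<tau> = \<sigma>^2 / (2 * c2 powr (2 * r))"
 have \<tau>: "\<tau> > 0" using \<sigma> c by (simp add: \<tau>_def)
 define l0 where "l0 = \<sigma>^2 / (6 * (Y^2 * C1 + 1))"
 have YC: "0 < Y^2 * C1 + 1" using C1 by (intro add_nonneg_pos) auto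
 have l0: "l0 > 0" using \<sigma> YC by (simp add: l0_def)
 have "eventually (%u. c2 * H^2 * u powr (1 - 2 * r) <= \<sigma>^2 / 6) (at_right 0)"
  "eventually (%u. Y^2 * c3 * \<kappa>^2 * u powr \<nu> <= \<sigma>^2 / 6) (at_right 0)"
  "eventually (%u. 2 * Y * u powr (1 - r) <= \<delta> / 8) (at_right 0)"
  "eventually (%u. 4 * g * C1 / c1 * u powr (1 - r) <= \<delta> / 8) (at_right 0)"
  "eventually (%u. 192 * g * Y^2 / (c1 * \<sigma>) * u powr ((1 + \<nu>) / 2 - r) <= \<delta> / 8) (at_right 0)"
  "eventually (%u. \<sigma> * u powr ((1 + \<nu>) / 2) <= 1) (at_right 0)" using r \<sigma> \<delta> by (intro powr_small; simp)+
 moreover have "eventually (%u. u powr (-2) * (2 * p * exp (- (k * u powr (-2)))) *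
   (2 * ((H + B * Y / c1) * B) * exp (B^2 / c1 / u) / u + 3 * Y) <= \<delta> / 8 * u powr r) (at_right 0)"
  using r \<delta> pos c by (intro gaussian_small mult_nonneg_nonneg add_nonneg_nonneg divide_nonneg_nonneg) auto
 moreover have "eventually (\<lambda>u::real. u > 0) (at_right 0)" by (rule eventually_at_right_less)
 moreover have "eventually (\<lambda>u::real. u < 1) (at_right 0)" by (rule order_tendstoD(2)[OF tendsto_ident_at]) simp
 ultimately have "eventually (%u. ?Q \<tau> l0 u) (at_right 0)"
 proof eventually_elim
  case (elim u)
  note small = elim(1-7) and u0 = elim(8) and u1 = elim(9)
  have mono: "u powr s <= u powr s'" if "s' <= s" for s s' using that u0 u1 by (intro powr_mono') auto
  have add: "u powr s * u powr s' = u powr (s + s')" for s s' by (simp add: powr_add)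
  have up: "0 < u powr s" for s using u0 by simp
  show ?case
  proof (intro allI impI)
   fix \<theta> Ne E \<eta>b n T N l
   assume "regime r \<nu> \<alpha> c1 c2 c3 c\<nu> \<tau> l0 u \<theta> Ne E \<eta>b n T N l"
   hence \<theta>: "c1 * u <= \<theta>" "\<theta> <= c2 * u" and Ne0: "0 <= Ne" "Ne <= c\<nu> * \<theta> powr (- \<nu>)" and \<eta>b: "0 <= \<eta>b" "\<eta>b <= c3 * u powr (2 * r + \<nu>)"
    and n: "0 < n" "1 / n = u * l" "l <= l0" "n <= u powr (-2)" and T: "0 < T" "1 / T <= 2 * u"
    and N: "u powr (- ((3 - 2 * r) / \<alpha>)) <= N" and E: "0 <= E" "E <= \<tau> * \<theta> powr (2 * r)"
    unfolding regime_def by auto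
   have \<theta>0: "\<theta> > 0" using \<theta>(1) u0 c by (intro less_le_trans[OF _ \<theta>(1)]) simp
   have l: "l > 0" using n u0 by (metis zero_less_divide_1_iff zero_less_mult_pos)
   have Ne: "Ne <= C1 * u powr (- \<nu>)"
   proof -
    have "\<theta> powr (- \<nu>) <= (c1 * u) powr (- \<nu>)" using \<theta> u0 c r by (intro powr_mono2') auto
    hence "c\<nu> * \<theta> powr (- \<nu>) <= c\<nu> * (c1 powr (- \<nu>) * u powr (- \<nu>))" using c u0 by (intro mult_left_mono) (auto simp: powr_mult)
    thus ?thesis using Ne0(2) by (simp add: C1_def mult.assoc)
   qed
   define \<psi> where "\<psi> = E + \<theta> * H^2 + Y^2 * (Ne / n + \<eta>b * \<kappa>^2)"
   have \<psi>0: "0 <= \<psi>" unfolding \<psi>_def using E \<theta>0 Ne0 n \<eta>b by (intro add_nonneg_nonneg mult_nonneg_nonneg divide_nonneg_nonneg) auto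
   have \<psi>: "\<psi> <= \<sigma>^2 * u powr (2 * r)"
   proof -
    have "E <= \<tau> * (c2 * u) powr (2 * r)" using E(2) \<theta> \<theta>0 \<tau> r by (intro order_trans[OF E(2)] mult_left_mono powr_mono2) auto
    also have "... = \<sigma>^2 / 2 * u powr (2 * r)" using c u0 by (simp add: \<tau>_def powr_mult)
    finally have 1: "E <= \<sigma>^2 / 2 * u powr (2 * r)" .
    have "\<theta> * H^2 <= c2 * u * H^2" using \<theta> by (intro mult_right_mono) auto
    also have "... = (c2 * H^2 * u powr (1 - 2 * r)) * u powr (2 * r)" using u0 by (simp add: add mult.assoc)
    also have "... <= \<sigma>^2 / 6 * u powr (2 * r)" by (intro mult_right_mono small(1)) simp
    finally have 2: "\<theta> * H^2 <= \<sigma>^2 / 6 * u powr (2 * r)" .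
    have "Y^2 * (Ne / n) <= Y^2 * (C1 * u powr (- \<nu>) * (u * l))"
     using Ne Ne0 n u0 l unfolding n(2)[symmetric] divide_inverse[of Ne] inverse_eq_divide by (intro mult_left_mono mult_right_mono) auto
    also have "... = Y^2 * C1 * l * u powr (1 - \<nu>)" using u0 add[of "- \<nu>" 1] by (simp add: mult_ac)
    also have "... <= (Y^2 * C1 + 1) * l0 * u powr (2 * r)" using C1 n l l0 r by (intro mult_mono mono) auto
    also have "(Y^2 * C1 + 1) * l0 = \<sigma>^2 / 6"
    proof -
     have "Z * (\<sigma>^2 / (6 * Z)) = \<sigma>^2 / 6" if "0 < Z" for Z using that by simp
     from this[OF YC] show ?thesis unfolding l0_def .
    qed
    finally have 3: "Y^2 * (Ne / n) <= \<sigma>^2 / 6 * u powr (2 * r)" .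
    have "Y^2 * (\<eta>b * \<kappa>^2) <= Y^2 * ((c3 * u powr (2 * r + \<nu>)) * \<kappa>^2)" using \<eta>b by (intro mult_left_mono mult_right_mono) auto
    also have "... = (Y^2 * c3 * \<kappa>^2 * u powr \<nu>) * u powr (2 * r)" by (simp add: powr_add mult_ac)
    also have "... <= \<sigma>^2 / 6 * u powr (2 * r)" by (intro mult_right_mono small(2)) simp
    finally have 4: "Y^2 * (\<eta>b * \<kappa>^2) <= \<sigma>^2 / 6 * u powr (2 * r)" .
    show ?thesis using 1 2 3 4 unfolding \<psi>_def distrib_left by linarith
   qed
   define G where "G = g * N powr (- \<alpha>)"
   have N0: "N > 0" using N up by (rule less_le_trans[rotated])
   have G: "0 <= G" "G <= g * u powr (3 - 2 * r)"
   proof -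
    have "N powr (- \<alpha>) <= (u powr (- ((3 - 2 * r) / \<alpha>))) powr (- \<alpha>)" using N up \<alpha> by (intro powr_mono2') auto
    also have "... = u powr (3 - 2 * r)" using \<alpha> by (simp add: powr_powr)
    finally show "G <= g * u powr (3 - 2 * r)" unfolding G_def using pos by (intro mult_left_mono)
    show "0 <= G" unfolding G_def using pos by simp
   qed
   define \<epsilon> where "\<epsilon> = \<sigma> * u powr r"
   define a where "a = \<sigma> * u powr ((1 + \<nu>) / 2)"
   have \<epsilon>: "\<epsilon> > 0" and a: "a > 0" "a <= 1" using \<sigma> up small(6) by (auto simp: \<epsilon>_def a_def)
   have t2: "1000 * \<psi> / \<epsilon> <= 1000 * \<sigma> * u powr r"
   proof -
    have "1000 * \<psi> <= 1000 * \<sigma> * u powr r * \<epsilon>" using \<psi> add[of r r] by (simp add: \<epsilon>_def power2_eq_square mult_ac)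
    thus ?thesis using \<epsilon> by (simp add: pos_divide_le_eq)
   qed
   have t3: "Y / T <= \<delta> / 8 * u powr r"
   proof -
    have "Y * (1 / T) <= Y * (2 * u)" using T pos by (intro mult_left_mono)
    also have "... = (2 * Y * u powr (1 - r)) * u powr r" using u0 by (simp add: add mult_ac)
    also have "... <= \<delta> / 8 * u powr r" by (intro mult_right_mono small(3)) simp
    finally show ?thesis by simp
   qed
   have half: "u powr ((1 - \<nu>) / 2) <= u powr r" using r by (intro mono) auto
   have t4: "4 * a * Ne <= 4 * C1 * \<sigma> * u powr r"
   proof -
    have "4 * a * Ne <= 4 * a * (C1 * u powr (- \<nu>))" using Ne a by (intro mult_left_mono) auto
    also have "... = 4 * C1 * \<sigma> * (u powr ((1 + \<nu>) / 2) * u powr (- \<nu>))" by (simp add: a_def mult_ac)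
    also have "... = 4 * C1 * \<sigma> * u powr ((1 - \<nu>) / 2)" unfolding add by (simp add: field_simps)
    also have "... <= 4 * C1 * \<sigma> * u powr r" using half C1 \<sigma> by (intro mult_left_mono) auto
    finally show ?thesis .
   qed
   have inv\<theta>: "1 / \<theta> <= 1 / c1 * u powr (-1)" using \<theta>(1) u0 c \<theta>0 by (simp add: powr_minus_divide frac_le)
   have t5: "4 * G * Ne / \<theta> <= \<delta> / 8 * u powr r"
   proof -
    have "4 * G * Ne * (1 / \<theta>) <= 4 * (g * u powr (3 - 2 * r)) * (C1 * u powr (- \<nu>)) * (1 / c1 * u powr (-1))"
     using G Ne Ne0 inv\<theta> \<theta>0 pos C1 by (intro mult_mono mult_nonneg_nonneg) auto
    also have "... = 4 * g * C1 / c1 * (u powr (3 - 2 * r) * u powr (- \<nu>) * u powr (-1))" by simp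
    also have "u powr (3 - 2 * r) * u powr (- \<nu>) * u powr (-1) = u powr (2 - 2 * r - \<nu>)" unfolding add by (simp add: algebra_simps)
    also have "4 * g * C1 / c1 * u powr (2 - 2 * r - \<nu>) <= 4 * g * C1 / c1 * u powr 1" using pos C1 c r by (intro mult_left_mono mono) auto
    also have "... = (4 * g * C1 / c1 * u powr (1 - r)) * u powr r" by (simp add: add mult.assoc del: powr_one_gt_zero_iff powr_one)
    also have "... <= \<delta> / 8 * u powr r" by (intro mult_right_mono small(4)) simp
    finally show ?thesis by simp
   qed
   have inva: "1 / a = 1 / \<sigma> * u powr (- ((1 + \<nu>) / 2))" by (simp add: a_def powr_minus_divide)
   \<comment> \<open>This is the term that the exponent 3 - 2 r of the gap has to serve: together
     with 1/\<theta>^2, 1/a and \<psi> the power of u is (1 - \<nu>)/2, which is at least r by 2 r +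
     \<nu> \<le> 1.\<close>
   have t6: "96 * G * (16000 * \<kappa>^2 * \<psi> / \<theta> + 2 * Y^2) / (a * \<theta>) <= 1536000 * g * \<kappa>^2 / c1^2 * \<sigma> * u powr r + \<delta> / 8 * u powr r" (is "?L <= _")
   proof -
    have m: "16000 * \<kappa>^2 * \<psi> * (1 / \<theta>) <= 16000 * \<kappa>^2 * (\<sigma>^2 * u powr (2 * r)) * (1 / c1 * u powr (-1))"
     using \<psi> \<psi>0 inv\<theta> \<theta>0 by (intro mult_mono mult_left_mono mult_nonneg_nonneg) auto
    have "?L
     = 96 * G * (1 / \<theta>) * (1 / a) * (16000 * \<kappa>^2 * \<psi> * (1 / \<theta>) + 2 * Y^2)" by simp
    also have "... <= 96 * (g * u powr (3 - 2 * r)) * (1 / c1 * u powr (-1)) * (1 / \<sigma> * u powr (- ((1 + \<nu>) / 2)))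
     * (16000 * \<kappa>^2 * (\<sigma>^2 * u powr (2 * r)) * (1 / c1 * u powr (-1)) + 2 * Y^2)"
     unfolding inva using G inv\<theta> \<theta>0 \<psi>0 \<sigma> pos c by (intro mult_mono mult_nonneg_nonneg add_nonneg_nonneg add_right_mono m) auto
    also have "... = 1536000 * g * \<kappa>^2 / c1^2 * \<sigma> * (u powr (3 - 2 * r) * u powr (-1) * u powr (- ((1 + \<nu>) / 2)) * u powr (2 * r) * u powr (-1))
     + 192 * g * Y^2 / (c1 * \<sigma>) * (u powr (3 - 2 * r) * u powr (-1) * u powr (- ((1 + \<nu>) / 2)))"
     using \<sigma> by (simp add: power2_eq_square distrib_left distrib_right mult_ac)
    also have "u powr (3 - 2 * r) * u powr (-1) * u powr (- ((1 + \<nu>) / 2)) * u powr (2 * r) * u powr (-1) = u powr ((1 - \<nu>) / 2)"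
     unfolding add by (rule arg_cong[where f = "%s. u powr s"]) (simp add: field_simps)
    also have "u powr (3 - 2 * r) * u powr (-1) * u powr (- ((1 + \<nu>) / 2)) = u powr (2 - 2 * r - (1 + \<nu>) / 2)"
     unfolding add by (rule arg_cong[where f = "%s. u powr s"]) simp
    also have "1536000 * g * \<kappa>^2 / c1^2 * \<sigma> * u powr ((1 - \<nu>) / 2) + 192 * g * Y^2 / (c1 * \<sigma>) * u powr (2 - 2 * r - (1 + \<nu>) / 2)
     <= 1536000 * g * \<kappa>^2 / c1^2 * \<sigma> * u powr r + 192 * g * Y^2 / (c1 * \<sigma>) * u powr ((1 + \<nu>) / 2)"
     using half pos \<sigma> c r by (intro add_mono mult_left_mono mono) (auto simp: field_simps)
    also have "192 * g * Y^2 / (c1 * \<sigma>) * u powr ((1 + \<nu>) / 2) = (192 * g * Y^2 / (c1 * \<sigma>) * u powr ((1 + \<nu>) / 2 - r)) * u powr r"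
     by (simp add: add mult.assoc)
    also have "... <= \<delta> / 8 * u powr r" by (intro mult_right_mono small(5)) simp
    finally show ?thesis by simp
   qed
   have t7: "n * (2 * p * exp (- (N * k))) * (2 * (exp (B^2 / \<theta>) * (H + B * Y / \<theta>) * B + Y) + Y) <= \<delta> / 8 * u powr r" (is "?R <= _")
   proof -
    \<comment> \<open>Holds because (3 - 2 r)/\<alpha> \<ge> 2. A quadratic exponent in 1/u then
      beats the linear one in exp (B^2/(c1 u)).\<close>
    have N2: "u powr (-2) <= N"
    proof -
     have "2 * \<alpha> <= 3 - 2 * r" using \<alpha> r by linarith
     hence "2 <= (3 - 2 * r) / \<alpha>" using \<alpha> by (simp add: pos_le_divide_eq)
     thus ?thesis using N mono[of "- ((3 - 2 * r) / \<alpha>)" "-2"] mono[of "-2" "- ((3 - 2 * r) / \<alpha>)"] by linarith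
    qed
    have i\<theta>: "x / \<theta> <= x / c1 / u" if "0 <= x" for x using \<theta>(1) \<theta>0 c u0 that by (simp add: frac_le)
    have e: "exp (B^2 / \<theta>) <= exp (B^2 / c1 / u)" using i\<theta>[of "B^2"] by simp
    have h: "H + B * Y / \<theta> <= (H + B * Y / c1) / u"
    proof -
     have "H <= H / u" using pos u0 u1 by (simp add: le_divide_eq mult_left_le)
     thus ?thesis using i\<theta>[of "B * Y"] pos by (simp add: add_divide_distrib)
    qed
    have "exp (B^2 / \<theta>) * (H + B * Y / \<theta>) * B <= exp (B^2 / c1 / u) * ((H + B * Y / c1) / u) * B"
     using e h pos \<theta>0 u0 c by (intro mult_mono mult_right_mono) auto
    hence "2 * (exp (B^2 / \<theta>) * (H + B * Y / \<theta>) * B + Y) + Y <= 2 * ((H + B * Y / c1) * B) * exp (B^2 / c1 / u) / u + 3 * Y"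
    proof -
     have "2 * (h * B) * e / u = 2 * (e * (h / u) * B)" for h e by (simp add: mult_ac)
     moreover have "2 * (X + Y) + Y <= 2 * X' + 3 * Y" if "X <= X'" for X X' using that by simp
     ultimately show ?thesis using \<open>exp (B^2 / \<theta>) * (H + B * Y / \<theta>) * B <= _\<close> by presburger
    qed
    moreover have "n * (2 * p * exp (- (N * k))) <= u powr (-2) * (2 * p * exp (- (k * u powr (-2))))"
     using n(1,4) N2 pos by (intro mult_mono mult_left_mono) (auto simp: mult.commute mult_left_mono)
    ultimately have "?R
     <= u powr (-2) * (2 * p * exp (- (k * u powr (-2)))) * (2 * ((H + B * Y / c1) * B) * exp (B^2 / c1 / u) / u + 3 * Y)"
     using pos \<theta>0 by (intro mult_mono[where a = "n * (2 * p * exp (- (N * k)))"]) (auto intro!: mult_nonneg_nonneg add_nonneg_nonneg)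
    thus ?thesis using small(7) by linarith
   qed
   have "stage_total \<alpha> \<kappa> Y H B k g p \<theta> Ne E \<eta>b n T N \<epsilon> a
   <= \<sigma> * u powr r + 1000 * \<sigma> * u powr r + \<delta> / 8 * u powr r + 4 * C1 * \<sigma> * u powr r + \<delta> / 8 * u powr r
    + (1536000 * g * \<kappa>^2 / c1^2 * \<sigma> * u powr r + \<delta> / 8 * u powr r) + \<delta> / 8 * u powr r"
    unfolding stage_total_def Let_def \<psi>_def[symmetric] G_def[symmetric] \<epsilon>_def[symmetric] by (intro add_mono order_refl t2 t3 t4 t5 t6 t7)
   also have "... = (D * \<sigma> + \<delta> / 2) * u powr r" unfolding D_def by (simp add: algebra_simps)
   also have "D * \<sigma> = \<delta> / 2" using D by (simp add: \<sigma>_def)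
   finally show "\<exists>\<epsilon> a. 0 < \<epsilon> \<and> 0 < a \<and> a <= 1 \<and> stage_total \<alpha> \<kappa> Y H B k g p \<theta> Ne E \<eta>b n T N \<epsilon> a <= \<delta> * u powr r"
    using \<epsilon> a by (intro exI[of _ \<epsilon>] exI[of _ a]) simp
  qed
 qed
 thus ?thesis using \<tau> l0 by blast
qed

section \<open>The prescribed batch sizes, step sizes and numbers of iterations\<close>

lemma scaled_size_powr: "inv_scaled_size R M q n > 0 ==> scaled_size R M q n powr s = inv_scaled_size R M q n powr (- s)"
proof -
 assume u: "inv_scaled_size R M q n > 0"
 have "scaled_size R M q n = 1 / inv_scaled_size R M q n" by (simp add: scaled_size_def inv_scaled_size_def)
 thus ?thesis using u by (simp add: powr_divide powr_minus_divide)
qed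

lemma rounds_bounds: "rounds k z ==> 2 <= z ==> z / 2 <= real k \<and> real k <= 2 * z"
 unfolding rounds_def by linarith

lemma between_inverse:
 fixes x u e :: real
 assumes "0 < u" "0 < e" "e / (2 * u) <= x" "x <= 2 * e / u"
 shows "1 / (2 * e) * u <= 1 / x" "1 / x <= 2 / e * u"
proof goal_cases
 case 1 have x: "0 < x" using assms by (intro less_le_trans[OF _ assms(3)]) auto
 show ?case using assms x by (simp add: field_simps)
 case 2 have "e <= x * (2 * u)" using assms(1,3) by (simp add: pos_divide_le_eq)
 thus ?case using assms x by (simp add: field_simps)
qed

text \<open>For small u all prescribed sizes that are rounded are at least 2, so rounding changes
  them by a factor of at most 2; this explains the factors 2 in the constants.\<close>

lemma tuning_bounds:
 assumes s: "0 < 2 * r + \<nu>" "2 * r + \<nu> <= 1" and \<eta>\<^sub>0: "0 < \<eta>\<^sub>0"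
  and tuning: "tuning R M q r \<nu> \<eta>\<^sub>0 n b \<eta> T" and u: "u = inv_scaled_size R M q n"
   "0 < u" "u <= 1 / 2" "2 <= u powr (- (2 * r + \<nu>))"
 shows "b >= 1 \<and> T >= 1 \<and> \<eta> > 0 \<and> min (1 / 2) (1 / (2 * \<eta>\<^sub>0)) * u <= 1 / (\<eta> * real T) \<and>
  1 / (\<eta> * real T) <= max 2 (2 / \<eta>\<^sub>0) * u \<and> \<eta> / real b <= max 1 (2 * \<eta>\<^sub>0) * u powr (2 * r + \<nu>) \<and> 1 / real T <= 2 * u"
proof -
 define s where "s = 2 * r + \<nu>"
 have s: "0 < s" "s <= 1" using s by (auto simp: s_def)
 have sp: "scaled_size R M q n powr a = u powr (- a)" for a using scaled_size_powr[of R M q n] u(1,2) by simp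
 have sc: "scaled_size R M q n = 1 / u" by (simp add: u(1) scaled_size_def inv_scaled_size_def)
 have z: "2 <= 1 / u" using u by (simp add: field_simps)
 have us: "u <= u powr s" using u s powr_mono'[of s 1 u] by simp
 have S2: "2 <= u powr (- s)" using u(4) by (simp add: s_def)
 have up: "0 < u powr s" using u by simp
 have inv: "u powr (- s) = 1 / u powr s" by (rule powr_minus_divide)
 have p1: "u powr (- (s + 1)) = 1 / (u powr s * u)" unfolding powr_minus_divide powr_add using u(2) by simp
 \<comment> \<open>The last two choices differ only in the prescribed batch size w, of which just
   1/w \<le> u^s matters; hence they share a case.\<close>
 from tuning consider (1) "b = 1" "\<eta> = u powr s" "rounds T (u powr (- (s + 1)))"
  | (2) "\<exists>w. 2 <= w \<and> 1 / w <= u powr s \<and> rounds b w" "\<eta> = \<eta>\<^sub>0" "rounds T (1 / u)"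
  unfolding tuning_def sp unfolding sc unfolding u(1)[symmetric] s_def[symmetric] using S2 z us inv by fastforce
 thus ?thesis
 proof cases
  case 1
  have "2 <= u powr (- (s + 1))"
  proof -
   have "2 * (1 / 2) <= u powr (- s) * (1 / u)" using S2 z by (intro mult_mono) auto
   hence "1 / u <= u powr (- s) * (1 / u) \<and> True" using S2 u by (simp add: divide_right_mono)
   thus ?thesis using z unfolding p1 inv by simp
  qed
  from rounds_bounds[OF 1(3) this] have T: "1 / (u powr s * u) / 2 <= real T" "real T <= 2 * (1 / (u powr s * u))" unfolding p1 by auto
  have \<eta>T: "1 / (2 * u) <= \<eta> * real T" "\<eta> * real T <= 2 * 1 / u"
   using mult_left_mono[OF T(1), of "u powr s"] mult_left_mono[OF T(2), of "u powr s"] up 1(2) by simp_all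
  have "1 / (2 * u) <= 1 / (u powr s * u) / 2"
  proof -
   have "u powr s <= 1" using u s by (simp add: powr_le1)
   thus ?thesis using u(2) up by (simp add: frac_le mult_left_le_one_le)
  qed
  hence Tu: "1 / (2 * u) <= real T" using T by linarith
  have T0: "real T > 0" using Tu u(2) by (intro less_le_trans[OF _ Tu]) simp
  note B = between_inverse[OF u(2) _ \<eta>T]
  have "1 / real T <= 2 * u" using Tu T0 u(2) by (simp add: field_simps)
  moreover have "min (1 / 2) (1 / (2 * \<eta>\<^sub>0)) * u <= 1 / (\<eta> * real T)" by (rule order_trans[OF mult_right_mono B(1)]) (use u(2) in auto)
  moreover have "1 / (\<eta> * real T) <= max 2 (2 / \<eta>\<^sub>0) * u" by (rule order_trans[OF B(2) mult_right_mono]) (use u(2) in auto)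
  moreover have "1 * u powr s <= max 1 (2 * \<eta>\<^sub>0) * u powr s" by (intro mult_right_mono; simp)
  ultimately show ?thesis using 1 T0 up unfolding s_def[symmetric] by simp
 next
  case 2
  then obtain w where w: "2 <= w" "1 / w <= u powr s" "rounds b w" by blast
  have b: "w / 2 <= real b" using rounds_bounds[OF w(3,1)] by simp
  from rounds_bounds[OF 2(3) z] have T: "1 / u / 2 <= real T" "real T <= 2 * (1 / u)" by auto
  have T0: "real T > 0" using u(2) by (intro less_le_trans[OF _ T(1)]) simp
  have b0: "real b > 0" using w(1) b by linarith
  have \<eta>T: "\<eta>\<^sub>0 / (2 * u) <= \<eta>\<^sub>0 * real T" "\<eta>\<^sub>0 * real T <= 2 * \<eta>\<^sub>0 / u"
   using mult_left_mono[OF T(1), of \<eta>\<^sub>0] mult_left_mono[OF T(2), of \<eta>\<^sub>0] \<eta>\<^sub>0 by (simp_all add: mult.commute)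
  note B = between_inverse[OF u(2) \<eta>\<^sub>0 \<eta>T]
  have "1 / real b <= 1 / (w / 2)" using b w by (intro divide_left_mono) auto
  also have "... <= 2 * u powr s" using w(2) by simp
  finally have "\<eta>\<^sub>0 * (1 / real b) <= \<eta>\<^sub>0 * (2 * u powr s)" using \<eta>\<^sub>0 by (intro mult_left_mono) auto
  moreover have "1 / real T <= 2 * u" using T(1) T0 u(2) by (simp add: field_simps)
  moreover have "min (1 / 2) (1 / (2 * \<eta>\<^sub>0)) * u <= 1 / (\<eta> * real T)" unfolding 2(2) by (rule order_trans[OF mult_right_mono B(1)]) (use u(2) in auto)
  moreover have "1 / (\<eta> * real T) <= max 2 (2 / \<eta>\<^sub>0) * u" unfolding 2(2) by (rule order_trans[OF B(2) mult_right_mono]) (use u(2) in auto)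
  moreover have "(2 * \<eta>\<^sub>0) * u powr s <= max 1 (2 * \<eta>\<^sub>0) * u powr s" by (intro mult_right_mono; simp)
  ultimately have "\<eta> / real b <= max 1 (2 * \<eta>\<^sub>0) * u powr s" using 2(2) by simp
  thus ?thesis unfolding s_def[symmetric]
   using 2(2) T0 b0 \<eta>\<^sub>0 \<open>1 / real T <= 2 * u\<close> \<open>min (1 / 2) (1 / (2 * \<eta>\<^sub>0)) * u <= _\<close> \<open>_ <= max 2 (2 / \<eta>\<^sub>0) * u\<close> by simp
 qed
qed

lemma inv_scaled_size_tendsto:
 assumes "R > 0" "M > 0" "q > 1"
 shows "filterlim (%n. inv_scaled_size R M q n) (at_right 0) sequentially"
  and "eventually (%n. real n <= inv_scaled_size R M q n powr (-2)) sequentially"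
  and "((%n. R^2 / (M^2 * ln (real n) powr q)) \<longlongrightarrow> 0) sequentially"
proof goal_cases
 let ?X = "%n. inv_scaled_size R M q n"
 case 1 have "((%n. ln (real n) powr q / real n) \<longlongrightarrow> 0) sequentially" using assms by real_asymp
 from tendsto_mult[OF tendsto_const[of "M^2 / R^2"] this]
 have "(%n. ?X n) \<longlonglongrightarrow> 0" by (simp add: inv_scaled_size_def)
 moreover have pos: "eventually (%n. ?X n > 0) sequentially" using eventually_gt_at_top[of 1]
 proof eventually_elim
  case (elim n)
  hence "ln (real n) > 0" by simp
  thus ?case using assms elim by (simp add: inv_scaled_size_def)
 qed
 ultimately show ?case unfolding filterlim_at by (auto elim: eventually_mono)
 case 2 have "((%n. real n * (ln (real n) powr q / real n)^2) \<longlongrightarrow> 0) sequentially" using assms by real_asymp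
 from tendsto_mult[OF tendsto_const[of "(M^2 / R^2)^2"] this]
 have "(%n. real n * (?X n)^2) \<longlonglongrightarrow> 0" by (simp add: inv_scaled_size_def power_divide power_mult_distrib mult_ac)
 hence "eventually (%n. real n * (?X n)^2 < 1) sequentially" by (rule order_tendstoD(2)) simp
 with pos show ?case
 proof eventually_elim
  case (elim n)
  hence "?X n powr (-2) = 1 / (?X n)^2" using powr_realpow[of "?X n" 2] by (simp add: powr_minus_divide)
  thus ?case using elim by (simp add: le_divide_eq)
 qed
 case 3 have "((%n. 1 / ln (real n) powr q) \<longlongrightarrow> 0) sequentially" using assms by real_asymp
 from tendsto_mult[OF tendsto_const[of "R^2 / M^2"] this]
 show ?case by simp
qed

section \<open>Mean embeddings and the proof of the theorem\<close>

lemma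
 assumes rk: "rkhs_on A K val" and x: "x \<in> A"
 shows kernel_section_val: "y \<in> A ==> val (kernel_section A K val x) y = K x y"
  and kernel_section_inner: "h \<bullet> kernel_section A K val x = val h x"
proof -
 have lin: "linear (%f. val f y)" if "y \<in> A" for y using rk that by (simp add: rkhs_on_def)
 obtain k where k: "\<forall>y\<in>A. val k y = K x y" "\<forall>f. f \<bullet> k = val f x" using rk x unfolding rkhs_on_def by meson
 have "k' = k" if "\<forall>y\<in>A. val k' y = K x y" for k'
 proof -
  have "\<forall>y\<in>A. val (k' - k) y = 0" using that k(1) linear_diff[OF lin] by simp
  hence "k' - k = 0" using rk unfolding rkhs_on_def by blast
  thus ?thesis by simp
 qed
 hence "kernel_section A K val x = k" unfolding kernel_section_def using k(1) by (intro the_equality)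
 thus "y \<in> A ==> val (kernel_section A K val x) y = K x y" "h \<bullet> kernel_section A K val x = val h x" using k by auto
qed

lemma kernel_section_inner_section:
 "rkhs_on A K val ==> x \<in> A ==> y \<in> A ==> kernel_section A K val x \<bullet> kernel_section A K val y = K x y"
 by (simp add: kernel_section_inner kernel_section_val)

lemma rkhs_total:
 assumes rk: "rkhs_on A K val" and "!!x. x \<in> A ==> h \<bullet> kernel_section A K val x = 0"
 shows "h = 0"
proof -
 have "val h x = 0" if "x \<in> A" for x using assms(2)[OF that] kernel_section_inner[OF rk that, of h] by simp
 thus ?thesis using rk unfolding rkhs_on_def by blast
qed

lemma ex_hilbert_basis_of_dense:
 fixes d :: "nat => 'k::{real_inner,banach}"
 assumes "!!x. (!!i. x \<bullet> d i = 0) ==> x = 0"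
 shows "hilbert_basis (gram_schmidt d)"
proof
 show "orthonormal_seq (gram_schmidt d)" by (rule gram_schmidt_orthonormal)
 show "x = 0" if "!!i. x \<bullet> gram_schmidt d i = 0" for x using gram_schmidt_total[OF that] by (rule assms)
qed

lemma ex_countable_dense_sequence:
 fixes P :: "'g::{metric_space,second_countable_topology} set"
 assumes "P \<noteq> {}"
 shows "\<exists>d :: nat => 'g. range d \<subseteq> P \<and> P \<subseteq> closure (range d)"
proof -
 obtain T where T: "countable T" "T \<subseteq> P" "P \<subseteq> closure T" using separable[of P] by blast
 have "T \<noteq> {}" using T(3) assms by auto
 hence "range (from_nat_into T) = T" using T(1) by (rule range_from_nat_into)
 thus ?thesis using T by metis
qed

text \<open>By continuity, a vector orthogonal to the sections at a countable dense set of points is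
  orthogonal to all sections and vanishes; Gram-Schmidt does the rest. This yields a countable basis
  although the type of the RKHS carries no separability.\<close>

lemma ex_hilbert_basis_section:
 fixes K :: "'g::{metric_space,second_countable_topology} => 'g => real" and val :: "'k::{real_inner,banach} => 'g => real"
 assumes rk: "rkhs_on P K val" and ne: "P \<noteq> {}" and cont: "continuous_on P (kernel_section P K val)"
 shows "\<exists>v :: nat => 'k. hilbert_basis v"
proof -
 obtain d :: "nat => 'g" where d: "range d \<subseteq> P" "P \<subseteq> closure (range d)" using ex_countable_dense_sequence[OF ne] by blast
 let ?f = "kernel_section P K val"
 have "hilbert_basis (gram_schmidt (%i. ?f (d i)))"
 proof (rule ex_hilbert_basis_of_dense, goal_cases)
  case (1 h) note 0 = 1
  show ?case
  proof (rule rkhs_total[OF rk], goal_cases)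
   case (1 m) note m = 1
   hence "m \<in> closure (range d)" using d(2) by (rule subsetD[rotated])
   then obtain s where s: "!!i::nat. s i \<in> range d" "s \<longlonglongrightarrow> m" unfolding closure_sequential by auto
   have sP: "s i \<in> P" for i using s(1) d(1) by (rule subsetD[rotated])
   have "(%i. ?f (s i)) \<longlonglongrightarrow> ?f m" by (rule continuous_on_tendsto_compose[OF cont s(2) m]) (simp add: sP)
   from tendsto_inner[OF tendsto_const this, of h]
   have "(%i. h \<bullet> ?f (s i)) \<longlonglongrightarrow> h \<bullet> ?f m" .
   moreover have "h \<bullet> ?f (s i) = 0" for i using s(1)[of i] 0 by auto
   ultimately show ?case by (simp add: LIMSEQ_const_iff)
  qed
 qed
 thus ?thesis by blast
qed

lemma ex_hilbert_basis_separable: "\<exists>v :: nat => 'g::{real_inner,banach,second_countable_topology}. hilbert_basis v"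
proof -
 obtain d :: "nat => 'g" where d: "UNIV \<subseteq> closure (range d)" using ex_countable_dense_sequence[of UNIV] by blast
 have "hilbert_basis (gram_schmidt d)"
 proof (rule ex_hilbert_basis_of_dense, goal_cases)
  case (1 h) note 0 = 1
  have "h \<in> closure (range d)" using d by auto
  then obtain s where s: "!!i::nat. s i \<in> range d" "s \<longlonglongrightarrow> h" unfolding closure_sequential by auto
  have "(%i. h \<bullet> s i) \<longlonglongrightarrow> h \<bullet> h" by (intro tendsto_intros s)
  moreover have "h \<bullet> s i = 0" for i using s(1)[of i] 0 by auto
  ultimately have "h \<bullet> h = 0" by (simp add: LIMSEQ_const_iff del: inner_eq_zero_iff)
  thus ?case by simp
 qed
 thus ?thesis by blast
qed

text \<open>Pettis' theorem: in a separable space an open set is a countable union of balls, and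
  distances to fixed points are measurable by Parseval's identity.\<close>

lemma wm_imp_borel:
 fixes f :: "'w => 'g::{real_inner,banach,second_countable_topology}"
 assumes "weak_meas N f"
 shows "f \<in> borel_measurable N"
proof (rule borel_measurableI)
 obtain v :: "nat => 'g" where "hilbert_basis v" using ex_hilbert_basis_separable by blast
 then interpret hilbert_basis v .
 fix S :: "'g set" assume S: "open S"
 obtain D :: "'g set" where D: "countable D" "!!X. open X ==> X \<noteq> {} ==> \<exists>d\<in>D. d \<in> X" using countable_dense_setE by metis
 define I where "I = {(d, q). d \<in> D \<and> q \<in> \<rat> \<and> ball d q \<subseteq> S}"
 have ball: "f -` ball d q \<inter> space N \<in> sets N" for d q
 proof -
  have [measurable]: "(%w. norm (f w - d)) \<in> borel_measurable N" by (intro wm_norm wm_diff assms wm_const)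
  have "f -` ball d q \<inter> space N = {w \<in> space N. norm (f w - d) < q}" by (auto simp: dist_norm norm_minus_commute)
  thus ?thesis by simp
 qed
 have I: "countable I" by (rule countable_subset[OF _ countable_SIGMA[OF D(1) countable_rat]]) (auto simp: I_def)
 have S: "S = (\<Union>p\<in>I. ball (fst p) (snd p))"
 proof (intro equalityI subsetI)
  fix x assume "x \<in> S"
  then obtain e where e: "e > 0" "ball x e \<subseteq> S" using S open_contains_ball by blast
  obtain q where q: "q \<in> \<rat>" "0 < q" "q < e / 2" using Rats_dense_in_real[of 0 "e / 2"] e by auto
  obtain d where d: "d \<in> D" "d \<in> ball x q" using D(2)[of "ball x q"] q by auto
  have "ball d q \<subseteq> ball x e"
  proof
   fix z assume "z \<in> ball d q"
   thus "z \<in> ball x e" using d(2) q dist_triangle[of x z d] by auto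
  qed
  hence "(d, q) \<in> I" "x \<in> ball d q" using d q e by (auto simp: dist_commute I_def)
  thus "x \<in> (\<Union>p\<in>I. ball (fst p) (snd p))" by force
 qed (auto simp: I_def)
 have "f -` S \<inter> space N = (\<Union>p\<in>I. f -` ball (fst p) (snd p) \<inter> space N)" unfolding S by auto
 also have "... \<in> sets N" by (rule sets.countable_UN''[OF I ball])
 finally show "f -` S \<inter> space N \<in> sets N" .
qed

section \<open>Measurability with respect to the weak topology, and mean embeddings\<close>

lemma space_weak_borel: "space weak_borel = borel_probs"
 unfolding weak_borel_def by (simp add: space_measure_of_conv)

lemma sets_weak_borel: "openin weak_topology U ==> U \<in> sets weak_borel"
proof -
 assume U: "openin weak_topology U"
 have "topspace weak_topology \<subseteq> borel_probs" unfolding weak_topology_def by auto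
 hence "{U :: 'a measure set. openin weak_topology U} \<subseteq> Pow borel_probs" using openin_subset by blast
 thus ?thesis using U unfolding weak_borel_def by (subst sets_measure_of) auto
qed

lemma weak_integral_measurable:
 fixes f :: "'x::topological_space => real"
 assumes "continuous_on UNIV f" "bounded (range f)"
 shows "(%x. (LINT s|x. f s)) \<in> borel_measurable weak_borel"
proof (rule borel_measurableI, goal_cases)
 case (1 U)
 hence "openin weak_topology {x \<in> borel_probs. (LINT s|x. f s) \<in> U}"
  unfolding weak_topology_def using assms by (intro topology_generated_by_Basis) blast
 moreover have "(%x. (LINT s|x. f s)) -` U \<inter> space weak_borel = {x \<in> borel_probs. (LINT s|x. f s) \<in> U}" by (auto simp: space_weak_borel)
 ultimately show ?case using sets_weak_borel by simp
qed

locale mercer_embedding =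
 fixes G :: "'x::topological_space => 'x => real"
  and evG :: "'g::{real_inner,banach,second_countable_topology} => 'x => real"
 assumes compact_UNIV: "compact (UNIV :: 'x set)" and mercer: "mercer_kernel G" and rkhs: "rkhs_on UNIV G evG"
begin

abbreviation k :: "'x => 'g" where "k \<equiv> kernel_section UNIV G evG"

lemma continuous_k: "continuous_on UNIV k"
 unfolding continuous_on_def
proof
 fix s :: 'x
 have Gc: "continuous_on UNIV (%(s, t). G s t)" using mercer by (simp add: mercer_kernel_def)
 have Gp: "((%t. G (f t) (g t)) \<longlongrightarrow> G a b) (at s within UNIV)" if "(f \<longlongrightarrow> a) (at s within UNIV)" "(g \<longlongrightarrow> b) (at s within UNIV)" for f g a b
  using continuous_on_tendsto_compose[OF Gc tendsto_Pair[OF that]] by simp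
 have "((%t. G t t - 2 * G s t + G s s) \<longlongrightarrow> G s s - 2 * G s s + G s s) (at s within UNIV)"
  by (intro tendsto_add tendsto_diff tendsto_mult tendsto_const Gp tendsto_ident_at)
 moreover have "(norm (k t - k s))^2 = G t t - 2 * G s t + G s s" for t
 proof -
  have "(norm (k t - k s))^2 = G t t - G t s - (G s t - G s s)"
   unfolding power2_norm_eq_inner inner_diff_left inner_diff_right kernel_section_inner_section[OF rkhs UNIV_I UNIV_I] by simp
  moreover have "G t s = G s t" using mercer by (simp add: mercer_kernel_def)
  ultimately show ?thesis by simp
 qed
 ultimately have "((%t. (norm (k t - k s))^2) \<longlongrightarrow> 0) (at s within UNIV)" by simp
 from tendsto_real_sqrt[OF this] have "((%t. norm (k t - k s)) \<longlongrightarrow> 0) (at s within UNIV)" by simp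
 thus "(k \<longlongrightarrow> k s) (at s within UNIV)" by (simp add: tendsto_norm_zero_iff LIM_zero_iff)
qed

lemma k_bounded: "\<exists>B\<ge>0. \<forall>s. norm (k s) <= B"
proof -
 have "bounded (range k)" by (rule compact_imp_bounded[OF compact_continuous_image[OF continuous_k compact_UNIV]])
 then obtain B where "!!s. norm (k s) <= B" by (auto simp: bounded_iff)
 thus ?thesis using norm_ge_zero order_trans by blast
qed

lemma k_borel: "k \<in> borel_measurable borel"
 by (rule borel_measurable_continuous_onI[OF continuous_k])

lemma emb_eq: "mean_embedding G evG x = (LINT s|x. k s)"
 by (simp add: mean_embedding_def)

lemma emb_in: "x \<in> borel_probs ==> (LINT s|x. k s) \<in> mean_embeddings G evG"
 by (auto simp: mean_embeddings_def emb_eq)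

lemma integrable_k: "x \<in> borel_probs ==> integrable x k"
proof -
 assume x: "x \<in> borel_probs"
 then interpret prob_space x by (simp add: borel_probs_def)
 obtain B where "\<forall>s. norm (k s) <= B" using k_bounded by blast
 moreover have "k \<in> borel_measurable x" using k_borel x by (simp add: borel_probs_def cong: measurable_cong_sets)
 ultimately show ?thesis by (intro integrable_const_bound[where B = B]) auto
qed

lemma norm_emb_le:
 assumes "\<forall>s. norm (k s) <= B" "m \<in> mean_embeddings G evG"
 shows "norm m <= B"
proof -
 obtain x where x: "x \<in> borel_probs" and m: "m = (LINT s|x. k s)" using assms(2) by (auto simp: mean_embeddings_def emb_eq)
 interpret prob_space x using x by (simp add: borel_probs_def)
 have "norm m <= (LINT s|x. norm (k s))" unfolding m by (rule integral_norm_bound)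
 also have "... <= B" using integrable_k[OF x] assms(1) by (intro integral_le_const) auto
 finally show ?thesis .
qed

text \<open>Inner products of the embedding with fixed vectors are integrals of bounded continuous
  functions, measurable by the definition of the weak topology; separability turns this into Borel
  measurability.\<close>

lemma emb_measurable: "(%x. (LINT s|x. k s)) \<in> borel_measurable weak_borel"
proof (rule wm_imp_borel, unfold weak_meas_def, rule allI, goal_cases)
 case (1 h)
 obtain B where B: "\<forall>s. norm (k s) <= B" using k_bounded by blast
 have "\<bar>k s \<bullet> h\<bar> <= B * norm h" for s using order_trans[OF Cauchy_Schwarz_ineq2 mult_right_mono[OF _ norm_ge_zero], of "k s" B h] B by simp
 hence "(%x. (LINT s|x. k s \<bullet> h)) \<in> borel_measurable weak_borel"
  by (intro weak_integral_measurable continuous_on_inner continuous_k continuous_on_const) (auto simp: bounded_iff)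
 moreover have "(LINT s|x. k s) \<bullet> h = (LINT s|x. k s \<bullet> h)" if "x \<in> space weak_borel" for x
  using that integrable_k by (intro integral_inner_left[symmetric]) (auto simp: space_weak_borel)
 ultimately show ?case by (subst measurable_cong[of _ _ "%x. (LINT s|x. k s \<bullet> h)"]) auto
qed

text \<open>An empirical embedding is the embedding of the empirical measure, here the image of the
  uniform distribution on \<open>{1..N}\<close>.\<close>

lemma empirical_in:
 assumes N: "N >= 1"
 shows "(1 / real N) *\<^sub>R (\<Sum>i=1..N. k (t i)) \<in> mean_embeddings G evG"
proof -
 let ?u = "measure_pmf (pmf_of_set {1..N})" and ?t = "%i. t i"
 have t: "?t \<in> ?u \<rightarrow>\<^sub>M borel" by simp
 have x: "distr ?u borel ?t \<in> borel_probs" unfolding borel_probs_def using prob_space.prob_space_distr[OF prob_space_measure_pmf t] by simp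
 have "(LINT s|(distr ?u borel ?t). k s) = (LINT i|?u. k (t i))" by (rule integral_distr[OF t k_borel])
 also have "... = (\<Sum>i\<in>{1..N}. pmf (pmf_of_set {1..N}) i *\<^sub>R k (t i))" by (rule integral_measure_pmf) (use N in \<open>auto simp: set_pmf_of_set\<close>)
 also have "... = (1 / real N) *\<^sub>R (\<Sum>i=1..N. k (t i))" unfolding scaleR_sum_right using N by (intro sum.cong refl) (simp add: pmf_of_set)
 finally show ?thesis using emb_in[OF x] by simp
qed

end

text \<open>\<rho> is recovered from its marginal and the kernel c by \<open>bind\<close>, both
  measures agreeing on rectangles. Integrating over the label first then cancels the noise.\<close>

lemma centred_noise:
 fixes \<rho> :: "('g \<times> real) measure" and Y :: "real measure"
 assumes \<rho>: "prob_space \<rho>" "sets \<rho> = sets (M \<Otimes>\<^sub>M Y)" and M: "prob_space M" and Yb: "(%y. y) \<in> borel_measurable Y" "!!y. y \<in> space Y ==> \<bar>y\<bar> <= b"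
  and c: "regular_conditional \<rho> M Y c" and g: "bdd_meas M g" and f: "regression_function c \<in> borel_measurable M"
 shows "(LINT p|\<rho>. (snd p - regression_function c (fst p)) * g (fst p)) = 0"
  and "m \<in> space M ==> \<bar>regression_function c m\<bar> <= b"
proof -
 interpret M: prob_space M by (rule M)
 let ?\<kappa> = "%m. distr (c m) (M \<Otimes>\<^sub>M Y) (Pair m)"
 have cm: "c \<in> M \<rightarrow>\<^sub>M prob_algebra Y" and rect: "!!A B. A \<in> sets M ==> B \<in> sets Y ==> emeasure \<rho> (A \<times> B) = (\<integral>\<^sup>+m\<in>A. emeasure (c m) B \<partial>M)"
  using c by (auto simp: regular_conditional_def)
 have cs: "c \<in> M \<rightarrow>\<^sub>M subprob_algebra Y" by (rule measurable_prob_algebraD[OF cm])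
 have c_prob: "prob_space (c m)" and c_sets: "sets (c m) = sets Y" if "m \<in> space M" for m
  using measurable_space[OF cm that] by (auto simp: space_prob_algebra)
 have \<kappa>: "?\<kappa> \<in> M \<rightarrow>\<^sub>M subprob_algebra (M \<Otimes>\<^sub>M Y)" by (rule measurable_distr2[OF _ cs]) (simp add: case_prod_beta')
 have Pm: "Pair m \<in> c m \<rightarrow>\<^sub>M M \<Otimes>\<^sub>M Y" if "m \<in> space M" for m
  unfolding measurable_cong_sets[OF c_sets[OF that] refl] by (rule measurable_Pair1'[OF that])
 have \<rho>_eq: "\<rho> = M \<bind> ?\<kappa>" (is "_ = ?R")
 proof (rule measure_eqI_generator_eq[OF Int_stable_pair_measure_generator pair_measure_closed])
  show "sets \<rho> = sigma_sets (space M \<times> space Y) {a \<times> b |a b. a \<in> sets M \<and> b \<in> sets Y}" by (simp add: \<rho>(2) sets_pair_measure)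
  have "sets ?R = sets (M \<Otimes>\<^sub>M Y)" using \<kappa> M.not_empty by (intro sets_bind) (auto dest: sets_kernel)
  thus "sets ?R = sigma_sets (space M \<times> space Y) {a \<times> b |a b. a \<in> sets M \<and> b \<in> sets Y}" by (simp add: sets_pair_measure)
  show "emeasure \<rho> X = emeasure ?R X" if "X \<in> {a \<times> b |a b. a \<in> sets M \<and> b \<in> sets Y}" for X
  proof -
   from that obtain A B where X: "X = A \<times> B" and A: "A \<in> sets M" "B \<in> sets Y" by blast
   have "emeasure ?R X = (\<integral>\<^sup>+m. emeasure (?\<kappa> m) X \<partial>M)" using A M.not_empty by (intro emeasure_bind[OF _ \<kappa>]) (auto simp: X)
   also have "... = (\<integral>\<^sup>+m. emeasure (c m) B * indicator A m \<partial>M)"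
   proof (rule nn_integral_cong)
    fix m assume m: "m \<in> space M"
    have "emeasure (?\<kappa> m) X = emeasure (c m) (Pair m -` X \<inter> space (c m))" using A by (intro emeasure_distr Pm m) (auto simp: X)
    also have "Pair m -` X \<inter> space (c m) = (if m \<in> A then B else {})"
     using sets.sets_into_space[OF A(2)] sets_eq_imp_space_eq[OF c_sets[OF m]] by (auto simp: X)
    finally show "emeasure (?\<kappa> m) X = emeasure (c m) B * indicator A m" by (simp split: if_splits)
   qed
   finally show ?thesis using rect[OF A] by (simp add: X)
  qed
  show "range (%_::nat. space M \<times> space Y) \<subseteq> {a \<times> b |a b. a \<in> sets M \<and> b \<in> sets Y}" by auto
  show "emeasure \<rho> (space M \<times> space Y) \<noteq> \<infinity>" using finite_measure.emeasure_finite[OF prob_space.finite_measure[OF \<rho>(1)]] by simp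
 qed auto
 have int_id: "integrable (c m) (%y. y)" and fb: "\<bar>regression_function c m\<bar> <= b" if m: "m \<in> space M" for m
 proof -
  interpret C: prob_space "c m" by (rule c_prob[OF m])
  have meas: "(%y. y) \<in> borel_measurable (c m)" using Yb(1) by (simp add: measurable_cong_sets[OF c_sets[OF m] refl])
  have bd: "!!y. y \<in> space (c m) ==> \<bar>y\<bar> <= b" using Yb(2) sets_eq_imp_space_eq[OF c_sets[OF m]] by simp
  show int: "integrable (c m) (%y. y)" using meas bd by (intro C.integrable_const_bound[where B = b]) auto
  have "\<bar>(LINT y|(c m). y)\<bar> <= (LINT y|(c m). \<bar>y\<bar>)" by (rule integral_abs_bound)
  also have "... <= b" using int bd by (intro C.integral_le_const) auto
  finally show "\<bar>regression_function c m\<bar> <= b" by (simp add: regression_function_def)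
 qed
 thus "m \<in> space M ==> \<bar>regression_function c m\<bar> <= b" by blast
 obtain gb where gb: "gb >= 0" "\<forall>m\<in>space M. \<bar>g m\<bar> <= gb" using bm_bound[OF g] by blast
 let ?F = "%p. (snd p - regression_function c (fst p)) * g (fst p)"
 have gm: "g \<in> borel_measurable M" by (rule bm_measurable[OF g])
 have F: "?F \<in> borel_measurable (M \<Otimes>\<^sub>M Y)"
  using measurable_compose[OF measurable_snd Yb(1)] measurable_compose[OF measurable_fst f] measurable_compose[OF measurable_fst gm]
  by (intro borel_measurable_times borel_measurable_diff) auto
 have "(LINT p|\<rho>. ?F p) = (LINT m|M. (LINT p|(?\<kappa> m). ?F p))" unfolding \<rho>_eq
 proof (rule integral_bind[OF F _ \<kappa> M.finite_measure_axioms, where B = "(b + b) * gb" and B' = 1])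
  fix p assume "p \<in> space (M \<Otimes>\<^sub>M Y)"
  hence p: "fst p \<in> space M" "snd p \<in> space Y" by (auto simp: space_pair_measure)
  show "\<bar>?F p\<bar> <= (b + b) * gb" unfolding abs_mult using p gb fb Yb(2)
   by (intro mult_mono order_trans[OF abs_triangle_ineq4] add_mono) (auto intro: order_trans[OF abs_ge_zero])
 next
  show "AE m in M. emeasure (?\<kappa> m) (space (?\<kappa> m)) <= ennreal 1"
  proof (rule AE_I2)
   fix m assume "m \<in> space M"
   hence "subprob_space (?\<kappa> m)" using measurable_space[OF \<kappa>] by (simp add: space_subprob_algebra)
   from subprob_space.emeasure_space_le_1[OF this] show "emeasure (?\<kappa> m) (space (?\<kappa> m)) <= ennreal 1" by (simp only: ennreal_1)
  qed
 qed
 also have "... = (LINT m|M. 0)"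
 proof (rule bochner_cong[OF refl])
  fix m assume m: "m \<in> space M"
  interpret C: prob_space "c m" by (rule c_prob[OF m])
  have "(LINT p|(?\<kappa> m). ?F p) = (LINT y|(c m). (y - regression_function c m) * g m)" using integral_distr[OF Pm[OF m] F] by simp
  also have "... = ((LINT y|(c m). y) - regression_function c m) * g m" using int_id[OF m] C.prob_space by simp
  finally show "(LINT p|(?\<kappa> m). ?F p) = 0" by (simp add: regression_function_def)
 qed
 finally show "(LINT p|\<rho>. ?F p) = 0" by simp
qed

text \<open>Conditional expectation preserves the integral and the sign, whatever the
  sub-\<sigma>-algebra, so only the unconditional mean of Z has to be bounded.\<close>

lemma (in prob_space) cond_exp_markov:
 assumes sub: "subalgebra M F" and Z: "bdd_meas M Z" "!!w. w \<in> space M ==> 0 <= Z w"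
  and c: "0 < c" "(LINT w|M. Z w) <= \<delta> * c"
 shows "measure M {w \<in> space M. real_cond_exp M F Z w <= c} >= 1 - \<delta>"
proof -
 interpret sub: finite_measure_subalgebra M F using sub by unfold_locales
 let ?E = "real_cond_exp M F Z"
 have int: "integrable M ?E" and eq: "(LINT w|M. ?E w) = (LINT w|M. Z w)" using sub.real_cond_exp_int[OF bm_integrable[OF Z(1)]] by auto
 have pos: "AE w in M. 0 <= ?E w" using Z by (intro sub.real_cond_exp_pos bm_measurable) auto
 have "prob {w \<in> space M. ?E w >= c} <= (LINT w|M. ?E w) / c" using integral_Markov_inequality_measure[OF int _ pos c(1), of "space M"] by simp
 also have "... <= \<delta>" using c eq by (simp add: divide_le_eq)
 finally have "prob {w \<in> space M. ?E w >= c} <= \<delta>" .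
 moreover have "space M - {w \<in> space M. ?E w >= c} \<subseteq> {w \<in> space M. ?E w <= c}" by auto
 hence "prob (space M - {w \<in> space M. ?E w >= c}) <= prob {w \<in> space M. ?E w <= c}" by (intro finite_measure_mono) auto
 ultimately show ?thesis by (subst (asm) prob_compl) auto
qed

lemma subalgebra_vimage: "f \<in> M \<rightarrow>\<^sub>M N ==> subalgebra M (vimage_algebra (space M) f N)"
 unfolding subalgebra_def using sets_image_in_sets[of M "space M" f N] by simp

section \<open>The setting of the theorem as an instance of the regression model\<close>

locale distribution_regression = mercer_embedding G evG
 for G :: "'x::topological_space => 'x => real"
  and evG :: "'g::{real_inner,banach,second_countable_topology} => 'x => real" +
 fixes K :: "'g => 'g => real"
  and evK :: "'k::{real_inner,banach} => 'g => real"
  and P :: "'g set" and Y :: "real set" and M :: real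
  and Q :: "('x measure \<times> real) measure"
  and \<rho> :: "('g \<times> real) measure" and \<rho>\<mu> :: "'g measure"
  and c :: "'g => real measure" and f\<rho> :: "'g => real"
  and \<kappa> \<alpha> L :: real
 assumes M: "M > 0" "Y \<subseteq> {-M..M}"
  and P: "P = mean_embeddings G evG"
  and K: "rkhs_on P K evK"
  and rho: "prob_space \<rho>" "sets \<rho> = sets (restrict_space borel P \<Otimes>\<^sub>M restrict_space borel Y)"
   "\<rho>\<mu> = distr \<rho> (restrict_space borel P) fst"
  and cond: "regular_conditional \<rho> \<rho>\<mu> (restrict_space borel Y) c" "f\<rho> = regression_function c"
  and Q: "prob_space Q" "sets Q = sets (weak_borel \<Otimes>\<^sub>M restrict_space borel Y)"
   "distr Q \<rho> (%(x, y). (mean_embedding G evG x, y)) = \<rho>"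
  and ii: "AE m in \<rho>\<mu>. K m m <= \<kappa>^2"
  and iii: "0 < \<alpha>" "\<alpha> <= 1" "L > 0"
   "\<forall>m1\<in>P. \<forall>m2\<in>P. norm (kernel_section P K evK m1 - kernel_section P K evK m2) <= L * norm (m1 - m2) powr \<alpha>"
  and f_L2: "f\<rho> \<in> L2 \<rho>\<mu>" and kappa: "\<kappa> \<noteq> 0"
begin

abbreviation \<phi> :: "'g => 'k" where "\<phi> \<equiv> kernel_section P K evK"
abbreviation emb :: "'x measure => 'g" where "emb x \<equiv> (LINT u|x. k u)"

lemma space_rho: "space \<rho> = P \<times> Y"
 using sets_eq_imp_space_eq[OF rho(2)] by (simp add: space_pair_measure space_restrict_space)

lemma space_rhomu: "space \<rho>\<mu> = P" and sets_rhomu: "sets \<rho>\<mu> = sets (restrict_space borel P)"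
 by (simp_all add: rho(3) space_restrict_space)

lemma fst_rho: "fst \<in> \<rho> \<rightarrow>\<^sub>M restrict_space borel P"
 unfolding measurable_cong_sets[OF rho(2) refl] by (rule measurable_fst)

lemma prob_rhomu: "prob_space \<rho>\<mu>"
 unfolding rho(3) by (rule prob_space.prob_space_distr[OF rho(1) fst_rho])

lemma nonempty: "P \<noteq> {}" "Y \<noteq> {}"
 using prob_space.not_empty[OF rho(1)] by (auto simp: space_rho)

lemma continuous_feature: "continuous_on P \<phi>"
 unfolding continuous_on_def
proof
 fix m assume m: "m \<in> P"
 have "((%m'. norm (m' - m)) \<longlongrightarrow> norm (m - m)) (at m within P)" by (intro tendsto_intros)
 hence "((%m'. norm (m' - m)) \<longlongrightarrow> 0) (at m within P)" by simp
 hence "((%m'. norm (m' - m) powr \<alpha>) \<longlongrightarrow> 0) (at m within P)" using iii(1) by (intro tendsto_zero_powrI[where b = \<alpha>]) (auto intro: tendsto_const)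
 hence "((%m'. L * norm (m' - m) powr \<alpha>) \<longlongrightarrow> L * 0) (at m within P)" by (intro tendsto_mult tendsto_const)
 hence lim: "((%m'. L * norm (m' - m) powr \<alpha>) \<longlongrightarrow> 0) (at m within P)" by simp
 have "((%m'. norm (\<phi> m' - \<phi> m)) \<longlongrightarrow> 0) (at m within P)"
 proof (rule tendsto_sandwich[OF _ _ tendsto_const lim])
  show "eventually (%m'. norm (\<phi> m' - \<phi> m) <= L * norm (m' - m) powr \<alpha>) (at m within P)" using iii(4) m by (auto simp: eventually_at_filter)
 qed auto
 thus "(\<phi> \<longlongrightarrow> \<phi> m) (at m within P)" by (simp add: tendsto_norm_zero_iff LIM_zero_iff)
qed

lemma ex_regression_model: "\<exists>v B y0. regression_model \<rho>\<mu> v \<phi> evK B \<bar>\<kappa>\<bar> \<rho> f\<rho> M y0"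
proof -
 obtain v :: "nat => 'k" where v: "hilbert_basis v" using ex_hilbert_basis_section[OF K nonempty(1) continuous_feature] by blast
 obtain m0 where m0: "m0 \<in> P" using nonempty by blast
 obtain y0 where y0: "y0 \<in> Y" using nonempty by blast
 obtain Bk where Bk: "Bk >= 0" "\<forall>s. norm (k s) <= Bk" using k_bounded by blast
 \<comment> \<open>P is bounded since embeddings have norm at most Bk; the Hoelder condition spreads
   the norm of the feature at m0 over all of P.\<close>
 define B where "B = norm (\<phi> m0) + L * (2 * Bk) powr \<alpha>"
 have bound: "norm (\<phi> m) <= B" if m: "m \<in> P" for m
 proof -
  have "norm (m - m0) <= 2 * Bk"
  proof -
   have "norm m <= Bk" "norm m0 <= Bk" using norm_emb_le[OF Bk(2)] m m0 unfolding P by auto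
   thus ?thesis using norm_triangle_ineq4[of m m0] by linarith
  qed
  hence "L * norm (m - m0) powr \<alpha> <= L * (2 * Bk) powr \<alpha>" using iii by (intro mult_left_mono powr_mono2) auto
  moreover have "norm (\<phi> m - \<phi> m0) <= L * norm (m - m0) powr \<alpha>" using iii(4) m m0 by blast
  ultimately have "norm (\<phi> m - \<phi> m0) <= L * (2 * Bk) powr \<alpha>" by linarith
  thus ?thesis unfolding B_def using norm_triangle_ineq[of "\<phi> m - \<phi> m0" "\<phi> m0"] by simp
 qed
 have "regression_model \<rho>\<mu> v \<phi> evK B \<bar>\<kappa>\<bar> \<rho> f\<rho> M y0"
 proof (intro regression_model.intro feature_space.intro feature_space_axioms.intro regression_model_axioms.intro prob_rhomu v rho(1), goal_cases)
  case 1 show ?case unfolding weak_meas_def measurable_cong_sets[OF sets_rhomu refl]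
   by (intro allI borel_measurable_continuous_on_restrict continuous_on_inner continuous_feature continuous_on_const)
  show "norm (\<phi> m) <= B" if "m \<in> space \<rho>\<mu>" for m using bound that by (simp add: space_rhomu)
  case 3 show ?case using ii AE_space
  proof eventually_elim
   case (elim m)
   thus ?case using kernel_section_inner_section[OF K, of m m] by (simp add: space_rhomu power2_norm_eq_inner)
  qed
  show "evK h m = h \<bullet> \<phi> m" if "m \<in> space \<rho>\<mu>" for h m using kernel_section_inner[OF K, of m h] that by (simp add: space_rhomu)
  case 5 show ?case
   unfolding measurable_cong_sets[OF sets_rhomu rho(2)] using y0 by (intro measurable_Pair measurable_ident measurable_const) (simp_all add: space_restrict_space)
  case 7 show fst: "fst \<in> \<rho> \<rightarrow>\<^sub>M \<rho>\<mu>" unfolding measurable_cong_sets[OF refl sets_rhomu] by (rule fst_rho)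
  show ?case using distr_cong[OF refl sets_rhomu, of \<rho> fst fst] by (simp add: rho(3))
  case 8 have id: "(%y. y) \<in> borel_measurable (restrict_space borel Y)" by (rule measurable_restrict_space1) simp
  have "snd \<in> \<rho> \<rightarrow>\<^sub>M restrict_space borel Y" unfolding measurable_cong_sets[OF rho(2) refl] by (rule measurable_snd)
  from measurable_compose[OF this id] show ?case .
  have Yb: "\<bar>y\<bar> <= M" if "y \<in> Y" for y
  proof -
   have "y \<in> {-M..M}" using M(2) that by blast
   thus ?thesis by auto
  qed
  thus "\<bar>snd p\<bar> <= M" if "p \<in> space \<rho>" for p using that by (auto simp: space_rho)
  show fm: "f\<rho> \<in> borel_measurable \<rho>\<mu>" using f_L2 by (simp add: L2_def)
  have sets: "sets \<rho> = sets (\<rho>\<mu> \<Otimes>\<^sub>M restrict_space borel Y)" unfolding rho(2) by (intro sets_pair_measure_cong sets_rhomu[symmetric] refl)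
  have Yb': "\<bar>y\<bar> <= M" if "y \<in> space (restrict_space borel Y)" for y using that Yb by (simp add: space_restrict_space)
  show "(LINT p|\<rho>. (snd p - f\<rho> (fst p)) * g (fst p)) = 0" if "bdd_meas \<rho>\<mu> g" for g
   using centred_noise(1)[OF rho(1) sets prob_rhomu id Yb' cond(1) that] fm unfolding cond(2) by blast
  show "\<bar>f\<rho> m\<bar> <= M" if "m \<in> space \<rho>\<mu>" for m
   using centred_noise(2)[OF rho(1) sets prob_rhomu id Yb' cond(1) bm_const[of _ 0]] fm that unfolding cond(2) by blast
 qed
 thus ?thesis by blast
qed

lemma space_Q: "space Q = borel_probs \<times> Y"
 using sets_eq_imp_space_eq[OF Q(2)] by (simp add: space_pair_measure space_restrict_space space_weak_borel)

lemma embed_Q: "(%z. (emb (fst z), snd z)) \<in> Q \<rightarrow>\<^sub>M \<rho>"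
 unfolding measurable_cong_sets[OF Q(2) rho(2)]
proof (rule measurable_Pair, goal_cases)
 case 1 have "(%z. emb (fst z)) \<in> borel_measurable (weak_borel \<Otimes>\<^sub>M restrict_space borel Y)"
  by (rule measurable_compose[OF measurable_fst emb_measurable])
 thus ?case using emb_in by (intro measurable_restrict_space2) (auto simp: space_pair_measure space_weak_borel P)
qed (rule measurable_snd)

lemma law_rho: "distr Q \<rho> (%z. (emb (fst z), snd z)) = \<rho>"
 using Q(3) by (simp add: emb_eq case_prod_beta')

context
 fixes \<Omega> :: "'w measure" and n N b T :: nat and x y s J
 assumes smp: "two_stage_sample \<Omega> Q n N (b * T) x y s J" and n: "n >= 1" and N: "N >= 1"
begin

abbreviation "X1 w \<equiv> \<lambda>j\<in>{1..n}. (x j w, y j w)"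
text \<open>The conditional law of the second stage is given with respect to this \<sigma>-algebra.
  \<open>data_algebra\<close>, which sees x j only through its embedding, enters solely through
  \<open>cond_exp_markov\<close>.\<close>

abbreviation "Fst \<equiv> vimage_algebra (space \<Omega>) (%w. X1 w) (Pi\<^sub>M {1..n} (%_. Q))"
abbreviation "X2 w \<equiv> \<lambda>p\<in>{1..n} \<times> {1..N}. s (fst p) (snd p) w"
abbreviation "Both \<equiv> vimage_algebra (space \<Omega>) (%w. (X1 w, X2 w))
 (Pi\<^sub>M {1..n} (%_. Q) \<Otimes>\<^sub>M Pi\<^sub>M ({1..n} \<times> {1..N}) (%_. borel))"
abbreviation "Dat w \<equiv> \<lambda>l\<in>{1..n}. (emb (x l w), y l w)"

lemmas sample = smp[unfolded two_stage_sample_def]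
lemmas sample3 = conjunct2[OF conjunct2[OF conjunct2[OF sample]]]
lemmas sample5 = conjunct2[OF conjunct2[OF sample3]]

lemmas prob_Omega = conjunct1[OF sample]
lemmas indep_xy = conjunct1[OF conjunct2[OF sample]]
lemmas laws = conjunct1[OF conjunct2[OF conjunct2[OF sample]]]
lemmas conditional_law = conjunct1[OF sample3]
lemmas indep_J = conjunct1[OF conjunct2[OF sample3]]
lemmas uniform_J = conjunct1[OF sample5]
lemmas indep_stages = conjunct2[OF sample5]

lemma xy_measurable: "j \<in> {1..n} ==> (%w. (x j w, y j w)) \<in> \<Omega> \<rightarrow>\<^sub>M Q"
 using indep_xy unfolding prob_space.indep_vars_def2[OF prob_Omega] by blast

lemma s_measurable: "j \<in> {1..n} ==> i \<in> {1..N} ==> s j i \<in> \<Omega> \<rightarrow>\<^sub>M borel"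
 using laws by blast

lemma X1_measurable: "(%w. X1 w) \<in> \<Omega> \<rightarrow>\<^sub>M Pi\<^sub>M {1..n} (%_. Q)"
 by (intro measurable_restrict xy_measurable)

lemma X2_measurable: "(%w. X2 w) \<in> \<Omega> \<rightarrow>\<^sub>M Pi\<^sub>M ({1..n} \<times> {1..N}) (%_. borel)"
 by (intro measurable_restrict s_measurable) auto

lemma sub_Fst: "subalgebra \<Omega> Fst"
 by (rule subalgebra_vimage[OF X1_measurable])

lemma sub_Both: "subalgebra \<Omega> Both"
 by (rule subalgebra_vimage[OF measurable_Pair[OF X1_measurable X2_measurable]])

lemma X1_Fst: "(%w. X1 w) \<in> Fst \<rightarrow>\<^sub>M Pi\<^sub>M {1..n} (%_. Q)"
 using measurable_space[OF X1_measurable] by (intro measurable_vimage_algebra1) auto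

lemma X_Both: "(%w. (X1 w, X2 w)) \<in> Both \<rightarrow>\<^sub>M Pi\<^sub>M {1..n} (%_. Q) \<Otimes>\<^sub>M Pi\<^sub>M ({1..n} \<times> {1..N}) (%_. borel)"
 using measurable_space[OF measurable_Pair[OF X1_measurable X2_measurable]] by (intro measurable_vimage_algebra1) auto

lemma s_Both: "j \<in> {1..n} ==> i \<in> {1..N} ==> s j i \<in> Both \<rightarrow>\<^sub>M borel"
proof -
 assume "j \<in> {1..n}" "i \<in> {1..N}"
 hence m: "(j, i) \<in> {1..n} \<times> {1..N}" by simp
 have "(%w. X2 w (j, i)) \<in> Both \<rightarrow>\<^sub>M borel"
  using measurable_compose[OF measurable_compose[OF X_Both measurable_snd] measurable_component_singleton[OF m]] by simp
 thus ?thesis using m by simp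
qed

lemma law_in: "j \<in> {1..n} ==> w \<in> space \<Omega> ==> x j w \<in> borel_probs"
 using measurable_space[OF xy_measurable] by (fastforce simp: space_Q)

lemma y_Both: "j \<in> {1..n} ==> y j \<in> borel_measurable Both"
proof -
 assume j: "j \<in> {1..n}"
 have "snd \<in> Q \<rightarrow>\<^sub>M restrict_space borel Y" unfolding measurable_cong_sets[OF Q(2) refl] by (rule measurable_snd)
 hence snd: "snd \<in> borel_measurable Q" by (rule measurable_compose) (rule measurable_restrict_space1, simp)
 have "(%w. snd (X1 w j)) \<in> borel_measurable Both"
  using measurable_compose[OF measurable_compose[OF measurable_compose[OF X_Both measurable_fst] measurable_component_singleton[OF j]] snd] by simp
 thus ?thesis using j by simp
qed

lemma Dat_Fst: "(%w. Dat w) \<in> Fst \<rightarrow>\<^sub>M Pi\<^sub>M {1..n} (%_. \<rho>)"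
proof (rule measurable_restrict, goal_cases)
 case (1 l) note l = 1
 have "(%w. (emb (fst (X1 w l)), snd (X1 w l))) \<in> Fst \<rightarrow>\<^sub>M \<rho>"
  by (rule measurable_compose[OF measurable_compose[OF X1_Fst measurable_component_singleton[OF l]] embed_Q])
 thus ?case using l by simp
qed

lemma Dat_law: "distr \<Omega> (Pi\<^sub>M {1..n} (%_. \<rho>)) (%w. Dat w) = Pi\<^sub>M {1..n} (%_. \<rho>)"
proof -
 interpret Om: prob_space \<Omega> by (rule prob_Omega)
 let ?D = "%l w. (emb (x l w), y l w)"
 have Dm: "?D l \<in> \<Omega> \<rightarrow>\<^sub>M \<rho>" if "l \<in> {1..n}" for l using measurable_compose[OF xy_measurable[OF that] embed_Q] by simp
 from Om.indep_vars_compose2[OF indep_xy embed_Q] have "Om.indep_vars (%_. \<rho>) ?D {1..n}" by simp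
 hence "distr \<Omega> (Pi\<^sub>M {1..n} (%_. \<rho>)) (%w. Dat w) = Pi\<^sub>M {1..n} (%l. distr \<Omega> \<rho> (?D l))"
  by (rule iffD1[OF Om.indep_vars_iff_distr_eq_PiM', rotated 2]) (use n Dm in auto)
 also have "... = Pi\<^sub>M {1..n} (%_. \<rho>)"
 proof (rule PiM_cong[OF refl], goal_cases)
  case (1 l) note l = 1
  have "distr \<Omega> \<rho> (?D l) = distr (distr \<Omega> Q (%w. (x l w, y l w))) \<rho> (%z. (emb (fst z), snd z))"
   using distr_distr[OF embed_Q xy_measurable[OF l]] by (simp add: o_def)
  also have "distr \<Omega> Q (%w. (x l w, y l w)) = Q" using laws l by blast
  finally show ?case by (simp add: law_rho)
 qed
 finally show ?thesis .
qed

lemma conditional_stage: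
 assumes l: "l \<in> {1..n}" and Bk: "\<forall>u. norm (k u) <= Bk"
 shows "conditional_embedding \<Omega> Fst (x l) (s l) N k Bk"
proof (intro conditional_embedding.intro conditional_sample.intro conditional_sample_axioms.intro conditional_embedding_axioms.intro
  prob_Omega sub_Fst compact_UNIV continuous_k N)
 show "x l w \<in> borel_probs" if "w \<in> space \<Omega>" for w by (rule law_in[OF l that])
 show "s l i \<in> \<Omega> \<rightarrow>\<^sub>M borel" if "i \<in> {1..N}" for i by (rule s_measurable[OF l that])
 show "norm (k u) <= Bk" for u using Bk by blast
 have "fst \<in> Q \<rightarrow>\<^sub>M weak_borel" unfolding measurable_cong_sets[OF Q(2) refl] by (rule measurable_fst)
 from measurable_compose[OF measurable_compose[OF xy_measurable[OF l] this] emb_measurable]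
 show "(%w. emb (x l w)) \<in> borel_measurable \<Omega>" by simp
 fix A :: "nat => 'x set" assume A: "!!i. A i \<in> sets borel"
 \<comment> \<open>The draws belonging to other indices are left free: UNIV has mass 1, so their
   factors disappear.\<close>
 define A' where "A' = (%j i. if j = l then A i else UNIV)"
 have "\<forall>j i. A' j i \<in> sets borel" using A by (simp add: A'_def)
 with conditional_law have ae: "AE w in \<Omega>. real_cond_exp \<Omega> Fst (indicator {w \<in> space \<Omega>. \<forall>j\<in>{1..n}. \<forall>i\<in>{1..N}. s j i w \<in> A' j i}) w
  = (\<Prod>j=1..n. \<Prod>i=1..N. measure (x j w) (A' j i))"
  by blast
 have set: "{w \<in> space \<Omega>. \<forall>j\<in>{1..n}. \<forall>i\<in>{1..N}. s j i w \<in> A' j i} = {w \<in> space \<Omega>. \<forall>i\<in>{1..N}. s l i w \<in> A i}" using l by (auto simp: A'_def)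
 show "AE w in \<Omega>. real_cond_exp \<Omega> Fst (indicator {w \<in> space \<Omega>. \<forall>i\<in>{1..N}. s l i w \<in> A i}) w = (\<Prod>i=1..N. measure (x l w) (A i))"
  using ae[unfolded set] AE_space
 proof eventually_elim
  case (elim w)
  have one: "(\<Prod>i=1..N. measure (x j w) (A' j i)) = (if j = l then \<Prod>i=1..N. measure (x l w) (A i) else 1)" if j: "j \<in> {1..n}" for j
  proof -
   have "measure (x j w) UNIV = 1"
    using law_in[OF j elim(2)] prob_space.prob_space[of "x j w"] sets_eq_imp_space_eq[of "x j w" borel] by (auto simp: borel_probs_def)
   thus ?thesis by (simp add: A'_def)
  qed
  have "(\<Prod>j=1..n. \<Prod>i=1..N. measure (x j w) (A' j i)) = (\<Prod>j=1..n. if j = l then \<Prod>i=1..N. measure (x l w) (A i) else 1)" by (intro prod.cong refl one)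
  also have "... = (\<Prod>i=1..N. measure (x l w) (A i))" using l by simp
  finally show ?case using elim(1) by simp
 qed
qed

lemma two_stage_sgd_interpretation:
 assumes "sgd_sample \<rho>\<mu> v \<phi> evK B \<bar>\<kappa>\<bar> \<rho> f\<rho> M y0 n b T \<eta> \<theta>" and Bk: "\<forall>u. norm (k u) <= Bk"
 shows "two_stage_sgd \<rho>\<mu> v \<phi> evK B \<bar>\<kappa>\<bar> \<rho> f\<rho> M y0 n b T \<eta> \<theta> \<Omega> Fst x y s N k Bk L \<alpha>"
proof (intro two_stage_sgd.intro assms two_stage_sgd_axioms.intro prob_Omega conditional_stage iii Dat_Fst Dat_law)
 show "norm (\<phi> m - \<phi> m') <= L * norm (m - m') powr \<alpha>" if "m \<in> space \<rho>\<mu>" "m' \<in> space \<rho>\<mu>" for m m' using iii(4) that by (simp add: space_rhomu)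
 show "0 < \<bar>\<kappa>\<bar>" using kappa by simp
 show "sets \<rho>\<mu> = sets (restrict_space borel (space \<rho>\<mu>))" unfolding space_rhomu by (rule sets_rhomu)
 show "(1 / real N) *\<^sub>R (\<Sum>i=1..N. k (t i)) \<in> space \<rho>\<mu>" for t unfolding space_rhomu P by (rule empirical_in[OF N])
qed

text \<open>The reproducing property at empirical embeddings, which lie in P because N \<ge>
  1.\<close>

lemma sgd_eq_fsgd:
 "sgd P K evK b \<eta> (%j. empirical_embedding G evG N (%i. s j i w)) yy J' h0 t
  = fsgd b \<eta> (%j. \<phi> ((1 / real N) *\<^sub>R (\<Sum>i=1..N. k (s j i w)))) yy J' h0 t"
proof (induction t)
 let ?X = "%j. (1 / real N) *\<^sub>R (\<Sum>i=1..N. k (s j i w))"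
 case (Suc t)
 have "evK h ((?X j)) = h \<bullet> \<phi> ((?X j))" for h j using kernel_section_inner[OF K, of "(?X j)" h] empirical_in[OF N, of "%i. s j i w"] by (simp only: P)
 thus ?case unfolding sgd.simps fsgd.simps empirical_embedding_def Suc[unfolded empirical_embedding_def] by (simp only:)
qed simp

definition Z :: "real => 'k => 'w => real" where
 "Z \<eta> h0 w = L2_norm \<rho>\<mu> (%m. evK (tail_average T (sgd P K evK b \<eta>
  (%j. empirical_embedding G evG N (%i. s j i w)) (%j. y j w) (%i. J i w) h0)) m - f\<rho> m)"

lemma
 assumes sgd: "sgd_sample \<rho>\<mu> v \<phi> evK B \<bar>\<kappa>\<bar> \<rho> f\<rho> M y0 n b T \<eta> \<theta>" and Bk: "\<forall>u. norm (k u) <= Bk"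
 shows bm_Z: "bdd_meas \<Omega> (Z \<eta> h0)"
  and integral_Z: "(LINT w|\<Omega>. Z \<eta> h0 w) = (LINT w|\<Omega>. av n (b * T) (%j. regression_model.excess \<rho>\<mu> evK f\<rho>
   (tail_average T (fsgd b \<eta> (%l. \<phi> ((1 / real N) *\<^sub>R (\<Sum>i=1..N. k (s l i w)))) (%l. y l w) j h0))))"
proof goal_cases
 let ?X = "%w. %l. \<phi> ((1 / real N) *\<^sub>R (\<Sum>i=1..N. k (s l i w)))"
 case 1 interpret S: two_stage_sgd \<rho>\<mu> v \<phi> evK B "\<bar>\<kappa>\<bar>" \<rho> f\<rho> M y0 n b T \<eta> \<theta> h0 \<Omega> Fst x y s N k Bk L \<alpha> by (rule two_stage_sgd_interpretation[OF assms])
 let ?V = "%j w. S.final w j"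
 have V: "bdd_meas Both (?V j)" if "j \<in> seqs n (b * T)" for j by (intro S.bm_final s_Both y_Both that) auto
 \<comment> \<open>The run reads no index beyond b T, so the random sequence may be cut down to an
   element of \<open>seqs\<close>.\<close>
 have eq: "Z \<eta> h0 w = ?V (\<lambda>i\<in>{1..b * T}. J i w) w" for w
 proof -
  have "fsgd b \<eta> (?X w) (%l. y l w) (%i. J i w) h0 t
   = fsgd b \<eta> (?X w) (%l. y l w) (\<lambda>i\<in>{1..b * T}. J i w) h0 t" if "t <= T" for t
  proof (rule fsgd_cong, goal_cases)
   case (1 i) note i = 1
   have "b * t <= b * T" by (rule mult_le_mono2[OF that])
   hence "i \<in> {1..b * T}" using i unfolding atLeastAtMost_iff by linarith
   thus ?case by (simp only: restrict_apply')
  qed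
  thus ?thesis unfolding Z_def sgd_eq_fsgd S.excess_def tail_average_def
   by (intro arg_cong[where f = "%h. L2_norm \<rho>\<mu> (%m. evK (_ *\<^sub>R h) m - f\<rho> m)"] sum.cong refl) auto
 qed
 have bT: "b * T >= 1" using S.b S.T by simp
 note R = S.Om.integral_random_index[where V = ?V, OF n indep_J bspec[OF uniform_J] sub_Both indep_stages V bT]
 show ?case using R(2) by (simp only: ext[of "Z \<eta> h0", OF eq])
 have "(LINT w|\<Omega>. Z \<eta> h0 w) = av n (b * T) (%j. (LINT w|\<Omega>. ?V j w))" unfolding eq by (rule R(1))
 also have "... = (LINT w|\<Omega>. av n (b * T) (%j. ?V j w))" by (rule S.Om.integral_av[symmetric]) (rule measurable_ident_subalgebra[OF sub_Both V])
 finally show "(LINT w|\<Omega>. Z \<eta> h0 w) = (LINT w|\<Omega>. av n (b * T) (%j. S.excess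
   (tail_average T (fsgd b \<eta> (?X w) (%l. y l w) j h0))))" .
qed

lemma sub_data: "subalgebra \<Omega> (data_algebra \<Omega> \<rho> (mean_embedding G evG) n x y)"
 unfolding data_algebra_def emb_eq by (rule subalgebra_vimage[OF measurable_from_subalg[OF sub_Fst Dat_Fst]])

end

end

theorem corollary3p7:
  fixes G :: "'x::topological_space \<Rightarrow> 'x \<Rightarrow> real"
    and evG :: "'g::{real_inner,banach,second_countable_topology} \<Rightarrow> 'x \<Rightarrow> real"
    and K :: "'g \<Rightarrow> 'g \<Rightarrow> real"
    and evK :: "'k::{real_inner,banach} \<Rightarrow> 'g \<Rightarrow> real"
    and P :: "'g set" and Y :: "real set" and M :: real
    and Q :: "('x measure \<times> real) measure"
    and \<rho> :: "('g \<times> real) measure" and \<rho>\<mu> :: "'g measure"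
    and c :: "'g \<Rightarrow> real measure" and f\<rho> h\<rho> :: "'g \<Rightarrow> real" and h\<^sub>0 :: 'k
    and \<gamma> \<kappa> \<alpha> L r R \<nu> c\<nu> \<eta>\<^sub>0 q :: real
  assumes compact: "compact (UNIV :: 'x set)"
    and M: "M > 0" "Y \<subseteq> {-M..M}"
    and G: "mercer_kernel G" "rkhs_on UNIV G evG"
    and P: "P = mean_embeddings G evG"
    and K: "rkhs_on P K evK"
    and rho: "prob_space \<rho>"
      "sets \<rho> = sets (restrict_space borel P \<Otimes>\<^sub>M restrict_space borel Y)"
      "\<rho>\<mu> = distr \<rho> (restrict_space borel P) fst"
    and cond: "regular_conditional \<rho> \<rho>\<mu> (restrict_space borel Y) c"
      "f\<rho> = regression_function c"
    and Q: "prob_space Q" "sets Q = sets (weak_borel \<Otimes>\<^sub>M restrict_space borel Y)"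
      "distr Q \<rho> (\<lambda>(x, y). (mean_embedding G evG x, y)) = \<rho>"
    and q: "q > 1"
    and i: "\<forall>x\<in>borel_probs. AE s in x. G s s \<le> \<gamma>\<^sup>2"
    and ii: "AE m in \<rho>\<mu>. K m m \<le> \<kappa>\<^sup>2"
    and iii: "0 < \<alpha>" "\<alpha> \<le> 1" "L > 0"
      "\<forall>m1\<in>P. \<forall>m2\<in>P. norm (kernel_section P K evK m1 - kernel_section P K evK m2)
         \<le> L * norm (m1 - m2) powr \<alpha>"
    and iv: "0 < r" "r \<le> 1/2" "R > 0" "h\<rho> \<in> L2 \<rho>\<mu>" "L2_norm \<rho>\<mu> h\<rho> \<le> R"
      "is_op_power \<rho>\<mu> (kernel_op \<rho>\<mu> evK) r h\<rho> f\<rho>"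
    and v: "0 < \<nu>" "\<nu> \<le> 1" "2 * r + \<nu> \<le> 1"
      "\<forall>l>0. effective_dim \<rho>\<mu> evK l \<le> c\<nu> * l powr (- \<nu>)"
    and eta0: "0 < \<eta>\<^sub>0" "\<eta>\<^sub>0 < 1 / (4 * \<kappa>\<^sup>2)"
  shows "\<exists>C. \<forall>\<delta>\<in>{0<..1}. \<exists>n\<^sub>0. \<forall>n\<ge>n\<^sub>0. \<forall>N b T \<eta> l.
           tuning R M q r \<nu> \<eta>\<^sub>0 n b \<eta> T \<longrightarrow>
           l = 1 / (\<eta> * real T) \<longrightarrow>
           real n \<ge> 32 * \<kappa>\<^sup>2 * ln (4 / \<delta>) / l *
             ln (exp 1 * effective_dim \<rho>\<mu> evK l * (1 + l / L2_op_norm \<rho>\<mu> (kernel_op \<rho>\<mu> evK))) \<longrightarrow>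
           \<eta> < 1 / (4 * \<kappa>\<^sup>2) \<longrightarrow>
           real N \<ge> scaled_size R M q n powr ((3 - 2 * r) / \<alpha>) \<longrightarrow>
           (\<forall>(\<Omega> :: 'w measure) x y s J. two_stage_sample \<Omega> Q n N (b * T) x y s J \<longrightarrow>
              measure \<Omega> {\<omega> \<in> space \<Omega>.
                real_cond_exp \<Omega> (data_algebra \<Omega> \<rho> (mean_embedding G evG) n x y)
                  (\<lambda>\<omega>. L2_norm \<rho>\<mu> (\<lambda>m.
                     evK (tail_average T
                       (sgd P K evK b \<eta> (\<lambda>j. empirical_embedding G evG N (\<lambda>i. s j i \<omega>))
                          (\<lambda>j. y j \<omega>) (\<lambda>i. J i \<omega>) h\<^sub>0)) m - f\<rho> m)) \<omega>
                \<le> C * ln (6 / \<delta>) * R * inv_scaled_size R M q n powr r} \<ge> 1 - \<delta>)"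
proof -
 \<comment> \<open>For \<kappa> = 0 the upper bound on the step size would be 1 / 0, that is
   0.\<close>
 have k0: "\<kappa> \<noteq> 0" using eta0 by auto
 have r2: "2 * r < 1" using v by linarith
 have fL2: "f\<rho> \<in> L2 \<rho>\<mu>" using iv(6) by (simp add: is_op_power_def)
 interpret E: mercer_embedding G evG using compact G by unfold_locales
 interpret D: distribution_regression G evG K evK P Y M Q \<rho> \<rho>\<mu> c f\<rho> \<kappa> \<alpha> L
  by (intro distribution_regression.intro E.mercer_embedding_axioms distribution_regression_axioms.intro) (fact assms fL2 k0)+
 obtain v B y0 where "regression_model \<rho>\<mu> v D.\<phi> evK B \<bar>\<kappa>\<bar> \<rho> f\<rho> M y0" using D.ex_regression_model by blast
 then interpret RM: regression_model \<rho>\<mu> v D.\<phi> evK B "\<bar>\<kappa>\<bar>" \<rho> f\<rho> M y0 .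
 obtain Bk where Bk: "0 <= Bk" "\<forall>s. norm (E.k s) <= Bk" using E.k_bounded by blast
 \<comment> \<open>Solves L \<zeta>^\<alpha> = 2 |\<kappa>|/5, the tolerance of
   \<open>two_stage_bound\<close>. The partition and \<beta> are then fixed independently of n, so
   the tail probability decays exponentially in N at a fixed rate.\<close>
 define \<zeta> where "\<zeta> = (2 * \<bar>\<kappa>\<bar> / (5 * L)) powr (1 / \<alpha>)"
 have z: "\<zeta> > 0" "L * \<zeta> powr \<alpha> <= 2 / 5 * \<bar>\<kappa>\<bar>" using k0 iii(1,3) by (auto simp: \<zeta>_def powr_powr)
 have "0 < \<zeta> / 4" using z by simp
 from ex_cell_partition[OF compact E.continuous_k this] obtain p t A where cells: "cell_partition E.k (\<zeta> / 4) p t A" by blast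
 have pB: "0 < real p * Bk + 1" using Bk by (intro add_nonneg_pos mult_nonneg_nonneg) auto
 define \<beta> where "\<beta> = min 2 (\<zeta> / 2 / (real p * Bk + 1))"
 have b: "0 < \<beta>" "\<beta> <= 2" using z pB by (auto simp: \<beta>_def)
 have "2 * (\<zeta> / 4) + real p * (\<beta> * Bk) <= \<zeta>"
 proof -
  have "\<beta> <= \<zeta> / 2 / (real p * Bk + 1)" unfolding \<beta>_def by (rule min.cobounded2)
  hence "\<beta> * (real p * Bk + 1) <= \<zeta> / 2" unfolding pos_le_divide_eq[OF pB] .
  moreover have "\<beta> * (real p * Bk + 1) = real p * (\<beta> * Bk) + \<beta>" by (simp add: distrib_left)
  ultimately have "real p * (\<beta> * Bk) <= \<zeta> / 2" using b by linarith
  thus ?thesis by simp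
 qed
 note cells = cells b this z
 have basis: "\<exists>I e. L2_onb \<rho>\<mu> I e" by (rule ex_L2_onb_borel[OF D.prob_rhomu D.sets_rhomu])
 define u where "u = inv_scaled_size R M q"
 define l' where "l' n = R^2 / (M^2 * ln (real n) powr q)" for n :: nat
 define c1 where "c1 = min (1 / 2) (1 / (2 * \<eta>\<^sub>0))"
 define c2 where "c2 = max 2 (2 / \<eta>\<^sub>0)"
 define c3 where "c3 = max 1 (2 * \<eta>\<^sub>0)"
 have cpos: "0 < c1" "0 < c2" "0 < c3" "0 <= max c\<nu> 0" using eta0 by (auto simp: c1_def c2_def c3_def)
 show ?thesis
 \<comment> \<open>The choice C = 1/R cancels the R of the bound; all smallness is obtained from n
   being large, where the threshold may depend on \<delta>.\<close>
 proof (intro exI[of _ "1 / R"] ballI, unfold eventually_sequentially[symmetric], goal_cases)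
  case (1 \<delta>)
  have d: "0 < \<delta>" "\<delta> <= 1" using 1 by auto
  obtain \<tau> l0 where tl: "\<tau> > 0" "l0 > 0" and bal: "eventually (%u. \<forall>\<theta> Ne E \<eta>b n T N l. regime r \<nu> \<alpha> c1 c2 c3 (max c\<nu> 0) \<tau> l0 u \<theta> Ne E \<eta>b n T N l -->
    (\<exists>\<epsilon> a. 0 < \<epsilon> \<and> 0 < a \<and> a <= 1 \<and> stage_total \<alpha> \<bar>\<kappa>\<bar> M (norm h\<^sub>0) B (\<beta>^2 / 4) (L^2 * (9 + 8 * Bk^2)) (real p) \<theta> Ne E \<eta>b n T N \<epsilon> a <= \<delta> * u powr r)) (at_right 0)"
   using balance[OF iv(1) v(1,3) iii(1,2) d(1) cpos, of M "norm h\<^sub>0" B "\<beta>^2 / 4" "L^2 * (9 + 8 * Bk^2)" "real p" "\<bar>\<kappa>\<bar>"]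
    M(1) b RM.B_nonneg by auto
  obtain \<theta>\<^sub>0 where th0: "\<theta>\<^sub>0 > 0" and source: "!!\<theta>. 0 < \<theta> ==> \<theta> < \<theta>\<^sub>0 ==>
    \<exists>w. (L2_norm \<rho>\<mu> (%m. evK w m - f\<rho> m))^2 + \<theta> * (norm w)^2 <= \<tau> * \<theta> powr (2 * r)"
   using RM.source_condition[OF iv(6,4,1) r2 tl(1)] by blast
  note lim = inv_scaled_size_tendsto[OF iv(3) M(1) q, folded u_def]
  \<comment> \<open>The last condition makes the prescribed sizes at least 2, as rounding requires.
    The third one puts \<theta>, which is at most c2 u, in the range of the source
    condition.\<close>
  have small: "eventually (%x. 0 < x \<and> x <= 1 / 2 \<and> c2 * x < \<theta>\<^sub>0 \<and> 2 <= x powr (- (2 * r + \<nu>))) (at_right 0)"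
  proof -
   define w where "w = 2 powr (- (1 / (2 * r + \<nu>)))"
   have s: "2 * r + \<nu> > 0" using iv v by simp
   hence one: "- (1 / (2 * r + \<nu>)) * (- (2 * r + \<nu>)) = 1" by (simp only: minus_mult_minus) simp
   have "2 <= x powr (- (2 * r + \<nu>))" if "0 < x" "x < w" for x
   proof -
    have "2 = w powr (- (2 * r + \<nu>))" unfolding w_def powr_powr one by simp
    also have "... <= x powr (- (2 * r + \<nu>))" using that s by (intro powr_mono2') auto
    finally show ?thesis .
   qed
   thus ?thesis using cpos th0 unfolding eventually_at_right_field
    by (intro exI[of _ "min (1 / 2) (min (\<theta>\<^sub>0 / c2) w)"]) (auto simp: w_def field_simps)
  qed
  \<comment> \<open>R^2/(M^2 log^q n) must fall below l0 for the variance and below c1/\<kappa>^2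
    for \<kappa>^2 \<le> n \<theta>.\<close>
  have lmin: "0 < min l0 (c1 / \<kappa>^2)" using tl cpos k0 by simp
  from eventually_compose_filterlim[OF eventually_conj[OF bal small] lim(1)] lim(2)
   order_tendstoD(2)[OF lim(3) lmin] eventually_ge_at_top[of 2]
  show ?case
  proof eventually_elim
   case (elim n)
   note small = conjunct2[OF elim(1)] and l' = elim(3)
   have un: "0 < u n" "u n <= 1 / 2" "2 <= u n powr (- (2 * r + \<nu>))" using small by auto
   have n: "1 <= n" "0 < real n" using elim(4) by auto
   have inv_n: "1 / real n = u n * (R^2 / (M^2 * ln (real n) powr q))"
   proof -
    have "ln (real n) > 0" using elim(4) by simp
    thus ?thesis using iv(3) M(1) n by (simp add: u_def inv_scaled_size_def)
   qed
   show ?case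
   proof (intro allI impI, goal_cases)
    case (1 N b T \<eta> l \<Omega> x y s J)
    note tun = 1(1) and \<eta> = 1(4) and NN = 1(5) and smp = 1(6)
    define \<theta> where "\<theta> = 1 / (\<eta> * real T)"
    have "b >= 1 \<and> T >= 1 \<and> \<eta> > 0 \<and> c1 * u n <= \<theta> \<and> \<theta> <= c2 * u n \<and> \<eta> / real b <= c3 * u n powr (2 * r + \<nu>) \<and> 1 / real T <= 2 * u n"
     unfolding \<theta>_def c1_def c2_def c3_def by (rule tuning_bounds[OF _ v(3) eta0(1) tun _ un]) (use iv v in \<open>auto simp: u_def\<close>)
    hence bT: "b >= 1" "T >= 1" "\<eta> > 0" and th: "c1 * u n <= \<theta>" "\<theta> <= c2 * u n"
     and \<eta>b: "\<eta> / real b <= c3 * u n powr (2 * r + \<nu>)" and Tb: "1 / real T <= 2 * u n" by auto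
    have th_pos: "0 < \<theta>" using bT by (simp add: \<theta>_def)
    have "\<kappa>^2 <= real n * \<theta>"
    proof -
     have "(R^2 / (M^2 * ln (real n) powr q)) * \<kappa>^2 < c1" using l' k0 by (simp add: pos_less_divide_eq)
     hence "u n * (R^2 / (M^2 * ln (real n) powr q)) * \<kappa>^2 <= u n * c1" using un unfolding mult.assoc by (intro mult_left_mono) auto
     hence "1 / real n * \<kappa>^2 <= \<theta>" using th unfolding inv_n[symmetric] by (simp add: mult.commute)
     thus ?thesis using n by (simp add: field_simps)
    qed
    moreover have "\<eta> * \<bar>\<kappa>\<bar>^2 <= 1 / 4" using \<eta> k0 by (simp add: field_simps)
    ultimately have sgd: "sgd_sample \<rho>\<mu> v D.\<phi> evK B \<bar>\<kappa>\<bar> \<rho> f\<rho> M y0 n b T \<eta> \<theta>" using bT n \<theta>_def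
     by (intro sgd_sample.intro regression_sample.intro RM.regression_model_axioms regression_sample_axioms.intro sgd_sample_axioms.intro) auto
    interpret S: sgd_sample \<rho>\<mu> v D.\<phi> evK B "\<bar>\<kappa>\<bar>" \<rho> f\<rho> M y0 n b T \<eta> \<theta> h\<^sub>0 by (rule sgd)
    have uN: "u n powr (- ((3 - 2 * r) / \<alpha>)) <= real N" using NN scaled_size_powr[of R M q n] un(1) by (simp add: u_def)
    moreover have "0 < u n powr (- ((3 - 2 * r) / \<alpha>))" using un by simp
    ultimately have N: "1 <= N" by linarith
    interpret TS: two_stage_sgd \<rho>\<mu> v D.\<phi> evK B "\<bar>\<kappa>\<bar>" \<rho> f\<rho> M y0 n b T \<eta> \<theta> h\<^sub>0 \<Omega>
     "vimage_algebra (space \<Omega>) (%\<omega>. \<lambda>j\<in>{1..n}. (x j \<omega>, y j \<omega>)) (Pi\<^sub>M {1..n} (%_. Q))" x y s N E.k Bk L \<alpha>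
     by (rule D.two_stage_sgd_interpretation[OF smp n(1) N sgd Bk(2)])
    note dim = RM.effective_dim_sums[OF th_pos basis]
    have Ne: "0 <= effective_dim \<rho>\<mu> evK \<theta>" by (rule S.sums_nonneg[OF dim])
    have Ne': "effective_dim \<rho>\<mu> evK \<theta> <= max c\<nu> 0 * \<theta> powr (- \<nu>)" using v(4) th_pos by (meson max.cobounded1 mult_right_mono order_trans powr_ge_zero)
    have "\<theta> < \<theta>\<^sub>0" using th small by linarith
    from source[OF th_pos this] obtain w where
     w: "(RM.excess w)^2 + \<theta> * (norm w)^2 <= \<tau> * \<theta> powr (2 * r)" unfolding RM.excess_def by blast
    have w0: "0 <= (RM.excess w)^2 + \<theta> * (norm w)^2" using th_pos by simp
    obtain \<epsilon> a where ea: "0 < \<epsilon>" "0 < a" "a <= 1"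
     and bound: "stage_total \<alpha> \<bar>\<kappa>\<bar> M (norm h\<^sub>0) B (\<beta>^2 / 4) (L^2 * (9 + 8 * Bk^2)) (real p) \<theta> (effective_dim \<rho>\<mu> evK \<theta>) ((RM.excess w)^2 + \<theta> * (norm w)^2) (\<eta> / real b) (real n) (real T) (real N) \<epsilon> a <= \<delta> * u n powr r"
     using conjunct1[OF elim(1), rule_format, of \<theta> "effective_dim \<rho>\<mu> evK \<theta>" "(RM.excess w)^2 + \<theta> * (norm w)^2" "\<eta> / real b" "real n" "real T" "real N" "R^2 / (M^2 * ln (real n) powr q)"] th Ne Ne' \<eta>b n(2) inv_n elim(2) Tb uN w0 w bT l' unfolding regime_def by auto
    have int: "(LINT \<omega>|\<Omega>. D.Z N b T y s J \<eta> h\<^sub>0 \<omega>) <= \<delta> * u n powr r" unfolding D.integral_Z[OF smp n(1) N sgd Bk(2)]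
     using order_trans[OF TS.two_stage_bound[OF dim ea(2,3,1) cells, of w]] bound by (simp add: stage_total_def Let_def S.rate_def)
    show ?case
    proof -
     define c' where "c' = 1 / R * ln (6 / \<delta>) * R * u n powr r"
     have up: "0 < u n powr r" using un by simp
     \<comment> \<open>Since \<delta> \<le> 1, the logarithmic factor of the claim is at least 1 and
       can be given away.\<close>
     have "exp 1 <= (6 / \<delta> :: real)"
     proof -
      have "exp 1 <= (3 :: real)" by (rule exp_le)
      also have "... <= 6 / \<delta>" using d by (simp add: field_simps)
      finally show ?thesis .
     qed
     hence "1 <= ln (6 / \<delta>)" using d by (simp add: ln_ge_iff)
     moreover have "c' = ln (6 / \<delta>) * u n powr r" using iv(3) by (simp add: c'_def)
     ultimately have c': "u n powr r <= c'" using mult_right_mono[of 1 "ln (6 / \<delta>)" "u n powr r"] up by simp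
     hence "\<delta> * u n powr r <= \<delta> * c'" using d by (intro mult_left_mono) auto
     with int have le: "(LINT \<omega>|\<Omega>. D.Z N b T y s J \<eta> h\<^sub>0 \<omega>) <= \<delta> * c'" by linarith
     have pos: "0 <= D.Z N b T y s J \<eta> h\<^sub>0 \<omega>" for \<omega> unfolding D.Z_def[OF smp n(1) N] by (simp add: L2_norm_def)
     have c'0: "0 < c'" using c' up by linarith
     show ?thesis using TS.Om.cond_exp_markov[OF D.sub_data[OF smp n(1) N] D.bm_Z[OF smp n(1) N sgd Bk(2)] pos c'0 le]
      unfolding D.Z_def[OF smp n(1) N, abs_def] c'_def u_def .
    qed
   qed
  qed
 qed
qed

end
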